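(* Let $H$ be a cocommutative Hopf algebra over a commutative ring $k$. Then for every $n\ge0$ $$\widetilde{HC}^{(\varepsilon,1)}_n(H)=\bigoplus_{i\ge0}H_{n-2i}(H;k).$$
   Context: $H$ has coproduct $\Delta(h)=\sum h^{(1)}\otimes h^{(2)}$, counit $\varepsilon$, antipode $S$; tensor products are over $k$. For a left $H$-module $M$, the Hopf algebra homology groups are $H_*(H;M)\cong\mathrm{Tor}^H_*(k,M)$, where $k$ is the trivial $H$-module (via $\varepsilon$); in $H_*(H;k)$ the coefficient module $k$ is also trivial. Groups in negative degree are $0$. The equality in the claim is an identification up to isomorphism. $\widetilde{HC}_*^{(\varepsilon,1)}(H)$ is the cyclic homology (homology of the total complex of the cyclic double complex) of the cyclic module $\widetilde{H}^{(\varepsilon,1)}$: $\widetilde{H}^{(\varepsilon,1)}_n=H^{\otimes n}$ ($=k$ for $n=0$), with $d_0(h_1\otimes\dots\otimes h_n)=\varepsilon(h_1)h_2\otimes\dots\otimes h_n$; $d_i$ multiplies $h_i$ and $h_{i+1}$ for $1\le i\le n-1$; $d_n(h_1\otimes\dots\otimes h_n)=\varepsilon(h_n)h_1\otimes\dots\otimes h_{n-1}$; $s_i$ ($0\le i\le n$) inserts $1$ after the $i$-th factor (in front if $i=0$); and $\tau_n(h_1\otimes\dots\otimes h_n)=\sum\varepsilon(h_n^{(2)})S(h_1^{(1)}\cdots h_n^{(1)})\otimes h_1^{(2)}\otimes\dots\otimes h_{n-1}^{(2)}$ ($\tau_0=\mathrm{id}$).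
   Formalization: For H not flat over k the claim fails with absolute Tor (k = Z, H = Z[x]/(px), x primitive, n = 3); H_*(H;k) is therefore taken as absolute Tor^H(k,k) when H is k-flat, and in general as relative Tor, from k-split resolutions by relatively projective modules. *)

theory Defs
  imports "HOL-Algebra.Module" "HOL-Algebra.AbelCoset"
begin

section \<open>Modules over a commutative ring\<close>

text \<open>Modules are records in the sense of \<^theory>\<open>HOL-Algebra.Module\<close>; the multiplicative fields
  of a record that is only used as a module are irrelevant and left undefined.\<close>

definition linear_maps ::
  "('k, 'r) ring_scheme \<Rightarrow> ('k, 'a, 'm) module_scheme \<Rightarrow> ('k, 'b, 'n) module_scheme \<Rightarrow> ('a \<Rightarrow> 'b) set"
  where "linear_maps R M N =
    {f \<in> carrier M \<rightarrow> carrier N.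
      (\<forall>x\<in>carrier M. \<forall>y\<in>carrier M. f (x \<oplus>\<^bsub>M\<^esub> y) = f x \<oplus>\<^bsub>N\<^esub> f y) \<and>
      (\<forall>r\<in>carrier R. \<forall>x\<in>carrier M. f (r \<odot>\<^bsub>M\<^esub> x) = r \<odot>\<^bsub>N\<^esub> f x)}"

definition isomorphic_modules ::
  "('k, 'r) ring_scheme \<Rightarrow> ('k, 'a, 'm) module_scheme \<Rightarrow> ('k, 'b, 'n) module_scheme \<Rightarrow> bool"
  where "isomorphic_modules R M N \<longleftrightarrow>
    (\<exists>f\<in>linear_maps R M N. bij_betw f (carrier M) (carrier N))"

definition self_module :: "('k, 'r) ring_scheme \<Rightarrow> ('k, 'k) module"
  where "self_module R =
    \<lparr>carrier = carrier R, mult = mult R, one = \<one>\<^bsub>R\<^esub>,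
     zero = \<zero>\<^bsub>R\<^esub>, add = add R, smult = mult R\<rparr>"

definition zero_module :: "('k, 'a) module"
  where "zero_module =
    \<lparr>carrier = {undefined}, mult = undefined, one = undefined, zero = undefined,
     add = (\<lambda>x y. undefined), smult = (\<lambda>r x. undefined)\<rparr>"

definition direct_sum :: "'i set \<Rightarrow> ('i \<Rightarrow> ('k, 'a, 'm) module_scheme) \<Rightarrow> ('k, 'i \<Rightarrow> 'a) module"
  where "direct_sum I M =
    \<lparr>carrier = {f \<in> (\<Pi>\<^sub>E i\<in>I. carrier (M i)). finite {i\<in>I. f i \<noteq> \<zero>\<^bsub>M i\<^esub>}},
     mult = undefined, one = undefined,
     zero = (\<lambda>i\<in>I. \<zero>\<^bsub>M i\<^esub>),
     add = (\<lambda>f g. \<lambda>i\<in>I. f i \<oplus>\<^bsub>M i\<^esub> g i),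
     smult = (\<lambda>r f. \<lambda>i\<in>I. r \<odot>\<^bsub>M i\<^esub> f i)\<rparr>"

definition quotient_module :: "('k, 'a, 'm) module_scheme \<Rightarrow> 'a set \<Rightarrow> ('k, 'a set) module"
  where "quotient_module M N =
    \<lparr>carrier = a_rcosets\<^bsub>M\<^esub> N,
     mult = undefined, one = undefined,
     zero = N,
     add = set_add M,
     smult = (\<lambda>r X. \<Union>x\<in>X. N +>\<^bsub>M\<^esub> (r \<odot>\<^bsub>M\<^esub> x))\<rparr>"

definition span_module :: "('k, 'r) ring_scheme \<Rightarrow> ('k, 'a, 'm) module_scheme \<Rightarrow> 'a set \<Rightarrow> 'a set"
  where "span_module R M B = \<Inter>{N. submodule N R M \<and> B \<subseteq> N}"

definition free_module :: "('k, 'r) ring_scheme \<Rightarrow> 'x set \<Rightarrow> ('k, 'x \<Rightarrow> 'k) module"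
  where "free_module R X = direct_sum X (\<lambda>_. self_module R)"

definition free_gen :: "('k, 'r) ring_scheme \<Rightarrow> 'x set \<Rightarrow> 'x \<Rightarrow> ('x \<Rightarrow> 'k)"
  where "free_gen R X x = (\<lambda>y\<in>X. if y = x then \<one>\<^bsub>R\<^esub> else \<zero>\<^bsub>R\<^esub>)"

definition presented_module ::
  "('k, 'r) ring_scheme \<Rightarrow> 'x set \<Rightarrow> ('x \<Rightarrow> 'k) set \<Rightarrow> ('k, ('x \<Rightarrow> 'k) set) module"
  where "presented_module R X B =
    quotient_module (free_module R X) (span_module R (free_module R X) B)"

definition presented_gen ::
  "('k, 'r) ring_scheme \<Rightarrow> 'x set \<Rightarrow> ('x \<Rightarrow> 'k) set \<Rightarrow> 'x \<Rightarrow> ('x \<Rightarrow> 'k) set"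
  where "presented_gen R X B x =
    span_module R (free_module R X) B +>\<^bsub>free_module R X\<^esub> free_gen R X x"

text \<open>The linear map \<open>M \<rightarrow> N\<close> taking the value \<open>f x\<close> at \<open>g x\<close>, where \<open>g ` X\<close> generates \<open>M\<close>. All
  maps out of tensor products are given in this way on pure tensors.\<close>

definition linear_extension ::
  "('k, 'r) ring_scheme \<Rightarrow> ('k, 'a, 'm) module_scheme \<Rightarrow> ('k, 'b, 'n) module_scheme \<Rightarrow>
   'x set \<Rightarrow> ('x \<Rightarrow> 'a) \<Rightarrow> ('x \<Rightarrow> 'b) \<Rightarrow> 'a \<Rightarrow> 'b"
  where "linear_extension R M N X g f =
    (THE \<phi>. \<phi> \<in> linear_maps R M N \<and> \<phi> \<in> extensional (carrier M) \<and> (\<forall>x\<in>X. \<phi> (g x) = f x))"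

definition list_sum :: "('a, 'm) ring_scheme \<Rightarrow> ('x \<Rightarrow> 'a) \<Rightarrow> 'x list \<Rightarrow> 'a"
  where "list_sum M f xs = (\<Oplus>\<^bsub>M\<^esub>j\<in>{..<length xs}. f (xs ! j))"

definition alternating_sum :: "('a, 'm) ring_scheme \<Rightarrow> (nat \<Rightarrow> 'a) \<Rightarrow> nat set \<Rightarrow> 'a"
  where "alternating_sum M f I = (\<Oplus>\<^bsub>M\<^esub>i\<in>I. if even i then f i else \<ominus>\<^bsub>M\<^esub> f i)"


section \<open>Tensor powers and Hopf algebras\<close>

definition tuples :: "('a, 'm) partial_object_scheme \<Rightarrow> nat \<Rightarrow> 'a list set"
  where "tuples M n = {xs. length xs = n \<and> set xs \<subseteq> carrier M}"

definition multilinear_relations ::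
  "('k, 'r) ring_scheme \<Rightarrow> ('k, 'a, 'm) module_scheme \<Rightarrow> nat \<Rightarrow> ('a list \<Rightarrow> 'k) set"
  where "multilinear_relations R M n =
    (let X = tuples M n; F = free_module R X; e = free_gen R X in
      {e (xs @ (a \<oplus>\<^bsub>M\<^esub> b) # ys) \<ominus>\<^bsub>F\<^esub> (e (xs @ a # ys) \<oplus>\<^bsub>F\<^esub> e (xs @ b # ys)) | xs a b ys.
         set xs \<union> set ys \<union> {a, b} \<subseteq> carrier M \<and> length xs + length ys + 1 = n} \<union>
      {e (xs @ (r \<odot>\<^bsub>M\<^esub> a) # ys) \<ominus>\<^bsub>F\<^esub> r \<odot>\<^bsub>F\<^esub> e (xs @ a # ys) | xs r a ys.
         r \<in> carrier R \<and> set xs \<union> set ys \<union> {a} \<subseteq> carrier M \<and> length xs + length ys + 1 = n})"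

definition tensor_power ::
  "('k, 'r) ring_scheme \<Rightarrow> ('k, 'a, 'm) module_scheme \<Rightarrow> nat \<Rightarrow> ('k, ('a list \<Rightarrow> 'k) set) module"
  where "tensor_power R M n = presented_module R (tuples M n) (multilinear_relations R M n)"

text \<open>The pure tensor of a list; for the empty list, this is the generator of the zeroth tensor
  power, which is free of rank 1.\<close>

definition pure_tensor ::
  "('k, 'r) ring_scheme \<Rightarrow> ('k, 'a, 'm) module_scheme \<Rightarrow> 'a list \<Rightarrow> ('a list \<Rightarrow> 'k) set"
  where "pure_tensor R M xs =
    presented_gen R (tuples M (length xs)) (multilinear_relations R M (length xs)) xs"

text \<open>Sweedler notation: a list of pairs \<open>(a\<^sub>j, b\<^sub>j)\<close> with \<open>\<Delta> h = \<Sum>\<^sub>j a\<^sub>j \<otimes> b\<^sub>j\<close>.\<close>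

definition sweedler ::
  "('k, 'r) ring_scheme \<Rightarrow> ('k, 'h, 'm) module_scheme \<Rightarrow> ('h \<Rightarrow> ('h list \<Rightarrow> 'k) set) \<Rightarrow> 'h \<Rightarrow>
   ('h \<times> 'h) list"
  where "sweedler R H \<Delta> h =
    (SOME ps. set ps \<subseteq> carrier H \<times> carrier H \<and>
      \<Delta> h = list_sum (tensor_power R H 2) (\<lambda>(a, b). pure_tensor R H [a, b]) ps)"

text \<open>The library's \<^locale>\<open>algebra\<close> is restricted to commutative algebras.\<close>

locale assoc_algebra = module R H + ring H
  for R :: "('k, 'r) ring_scheme" and H :: "('k, 'h, 'm) module_scheme" +
  assumes smult_mult_left:
      "\<lbrakk>r \<in> carrier R; x \<in> carrier H; y \<in> carrier H\<rbrakk> \<Longrightarrow>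
        (r \<odot>\<^bsub>H\<^esub> x) \<otimes>\<^bsub>H\<^esub> y = r \<odot>\<^bsub>H\<^esub> (x \<otimes>\<^bsub>H\<^esub> y)"
    and smult_mult_right:
      "\<lbrakk>r \<in> carrier R; x \<in> carrier H; y \<in> carrier H\<rbrakk> \<Longrightarrow>
        x \<otimes>\<^bsub>H\<^esub> (r \<odot>\<^bsub>H\<^esub> y) = r \<odot>\<^bsub>H\<^esub> (x \<otimes>\<^bsub>H\<^esub> y)"

locale hopf_algebra = assoc_algebra R H
  for R :: "('k, 'r) ring_scheme" and H :: "('k, 'h, 'm) module_scheme"
    and \<Delta> :: "'h \<Rightarrow> ('h list \<Rightarrow> 'k) set" and \<epsilon> :: "'h \<Rightarrow> 'k" and S :: "'h \<Rightarrow> 'h" +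
  assumes comult_linear: "\<Delta> \<in> linear_maps R H (tensor_power R H 2)"
    and counit_linear: "\<epsilon> \<in> linear_maps R H (self_module R)"
    and antipode_linear: "S \<in> linear_maps R H H"
    and coassoc: "h \<in> carrier H \<Longrightarrow>
      list_sum (tensor_power R H 3)
        (\<lambda>(a, b). list_sum (tensor_power R H 3)
          (\<lambda>(a1, a2). pure_tensor R H [a1, a2, b]) (sweedler R H \<Delta> a)) (sweedler R H \<Delta> h) =
      list_sum (tensor_power R H 3)
        (\<lambda>(a, b). list_sum (tensor_power R H 3)
          (\<lambda>(b1, b2). pure_tensor R H [a, b1, b2]) (sweedler R H \<Delta> b)) (sweedler R H \<Delta> h)"
    and counit_left: "h \<in> carrier H \<Longrightarrow>
      list_sum H (\<lambda>(a, b). \<epsilon> a \<odot>\<^bsub>H\<^esub> b) (sweedler R H \<Delta> h) = h"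
    and counit_right: "h \<in> carrier H \<Longrightarrow>
      list_sum H (\<lambda>(a, b). \<epsilon> b \<odot>\<^bsub>H\<^esub> a) (sweedler R H \<Delta> h) = h"
    and comult_mult: "\<lbrakk>g \<in> carrier H; h \<in> carrier H\<rbrakk> \<Longrightarrow>
      \<Delta> (g \<otimes>\<^bsub>H\<^esub> h) =
      list_sum (tensor_power R H 2)
        (\<lambda>(a, b). list_sum (tensor_power R H 2)
          (\<lambda>(c, d). pure_tensor R H [a \<otimes>\<^bsub>H\<^esub> c, b \<otimes>\<^bsub>H\<^esub> d]) (sweedler R H \<Delta> h)) (sweedler R H \<Delta> g)"
    and comult_one: "\<Delta> \<one>\<^bsub>H\<^esub> = pure_tensor R H [\<one>\<^bsub>H\<^esub>, \<one>\<^bsub>H\<^esub>]"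
    and counit_mult: "\<lbrakk>g \<in> carrier H; h \<in> carrier H\<rbrakk> \<Longrightarrow> \<epsilon> (g \<otimes>\<^bsub>H\<^esub> h) = \<epsilon> g \<otimes>\<^bsub>R\<^esub> \<epsilon> h"
    and counit_one: "\<epsilon> \<one>\<^bsub>H\<^esub> = \<one>\<^bsub>R\<^esub>"
    and antipode_left: "h \<in> carrier H \<Longrightarrow>
      list_sum H (\<lambda>(a, b). S a \<otimes>\<^bsub>H\<^esub> b) (sweedler R H \<Delta> h) = \<epsilon> h \<odot>\<^bsub>H\<^esub> \<one>\<^bsub>H\<^esub>"
    and antipode_right: "h \<in> carrier H \<Longrightarrow>
      list_sum H (\<lambda>(a, b). a \<otimes>\<^bsub>H\<^esub> S b) (sweedler R H \<Delta> h) = \<epsilon> h \<odot>\<^bsub>H\<^esub> \<one>\<^bsub>H\<^esub>"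

definition cocommutative ::
  "('k, 'r) ring_scheme \<Rightarrow> ('k, 'h, 'm) module_scheme \<Rightarrow> ('h \<Rightarrow> ('h list \<Rightarrow> 'k) set) \<Rightarrow> bool"
  where "cocommutative R H \<Delta> \<longleftrightarrow>
    (\<forall>h\<in>carrier H.
      list_sum (tensor_power R H 2) (\<lambda>(a, b). pure_tensor R H [b, a]) (sweedler R H \<Delta> h) = \<Delta> h)"


section \<open>Homology of chain complexes\<close>

text \<open>A complex is a family \<open>C n\<close> (\<open>n \<ge> 0\<close>) with \<open>d n : C (n + 1) \<rightarrow> C n\<close>.\<close>

definition cycles ::
  "(nat \<Rightarrow> ('k, 'a, 'm) module_scheme) \<Rightarrow> (nat \<Rightarrow> 'a \<Rightarrow> 'a) \<Rightarrow> nat \<Rightarrow> 'a set"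
  where "cycles C d n =
    (case n of 0 \<Rightarrow> carrier (C 0) | Suc m \<Rightarrow> a_kernel (C (Suc m)) (C m) (d m))"

definition chain_homology ::
  "(nat \<Rightarrow> ('k, 'a, 'm) module_scheme) \<Rightarrow> (nat \<Rightarrow> 'a \<Rightarrow> 'a) \<Rightarrow> int \<Rightarrow> ('k, 'a set) module"
  where "chain_homology C d i =
    (if i < 0 then zero_module
     else quotient_module ((C (nat i))\<lparr>carrier := cycles C d (nat i)\<rparr>)
            (d (nat i) ` carrier (C (Suc (nat i)))))"


section \<open>Cyclic homology\<close>

text \<open>Face and degeneracy maps \<open>face n i : X n \<rightarrow> X (n - 1)\<close>, \<open>degen n i : X n \<rightarrow> X (n + 1)\<close> and the
  cyclic operator \<open>cyc n : X n \<rightarrow> X n\<close>, without sign.\<close>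

record ('k, 'a) cyclic_object =
  obj :: "nat \<Rightarrow> ('k, 'a) module"
  face :: "nat \<Rightarrow> nat \<Rightarrow> 'a \<Rightarrow> 'a"
  degen :: "nat \<Rightarrow> nat \<Rightarrow> 'a \<Rightarrow> 'a"
  cyc :: "nat \<Rightarrow> 'a \<Rightarrow> 'a"

text \<open>\<open>b\<close> and \<open>b'\<close>, both from \<open>X (n + 1)\<close> to \<open>X n\<close>.\<close>

definition hochschild_b :: "('k, 'a) cyclic_object \<Rightarrow> nat \<Rightarrow> 'a \<Rightarrow> 'a"
  where "hochschild_b X n x = alternating_sum (obj X n) (\<lambda>i. face X (Suc n) i x) {..Suc n}"

definition hochschild_b' :: "('k, 'a) cyclic_object \<Rightarrow> nat \<Rightarrow> 'a \<Rightarrow> 'a"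
  where "hochschild_b' X n x = alternating_sum (obj X n) (\<lambda>i. face X (Suc n) i x) {..n}"

definition signed_cyc :: "('k, 'a) cyclic_object \<Rightarrow> nat \<Rightarrow> 'a \<Rightarrow> 'a"
  where "signed_cyc X n x = (if even n then cyc X n x else \<ominus>\<^bsub>obj X n\<^esub> cyc X n x)"

definition cyclic_norm :: "('k, 'a) cyclic_object \<Rightarrow> nat \<Rightarrow> 'a \<Rightarrow> 'a"
  where "cyclic_norm X n x = (\<Oplus>\<^bsub>obj X n\<^esub>i\<in>{..n}. (signed_cyc X n ^^ i) x)"

text \<open>The cyclic double complex has \<open>X q\<close> in bidegree \<open>(p, q)\<close> for \<open>p, q \<ge> 0\<close>; the vertical
  differential is \<open>b\<close> in the even and \<open>- b'\<close> in the odd columns, and the horizontal one is \<open>1 - t\<close>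
  from odd to even and \<open>N\<close> from even to odd columns. An element of degree \<open>n\<close> of the total complex
  is given by its components in the columns \<open>p \<le> n\<close>.\<close>

definition vertical :: "('k, 'a) cyclic_object \<Rightarrow> nat \<Rightarrow> nat \<Rightarrow> 'a \<Rightarrow> 'a"
  where "vertical X p q x =
    (if even p then hochschild_b X q x else \<ominus>\<^bsub>obj X q\<^esub> hochschild_b' X q x)"

text \<open>from column \<open>p + 1\<close> to column \<open>p\<close>\<close>

definition horizontal :: "('k, 'a) cyclic_object \<Rightarrow> nat \<Rightarrow> nat \<Rightarrow> 'a \<Rightarrow> 'a"
  where "horizontal X p q x =
    (if even p then x \<ominus>\<^bsub>obj X q\<^esub> signed_cyc X q x else cyclic_norm X q x)"

definition total_obj :: "('k, 'a) cyclic_object \<Rightarrow> nat \<Rightarrow> ('k, nat \<Rightarrow> 'a) module"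
  where "total_obj X n = direct_sum {..n} (\<lambda>p. obj X (n - p))"

definition total_diff :: "('k, 'a) cyclic_object \<Rightarrow> nat \<Rightarrow> (nat \<Rightarrow> 'a) \<Rightarrow> (nat \<Rightarrow> 'a)"
  where "total_diff X n f =
    (\<lambda>p\<in>{..n}. vertical X p (n - p) (f p) \<oplus>\<^bsub>obj X (n - p)\<^esub> horizontal X p (n - p) (f (Suc p)))"

definition cyclic_homology :: "('k, 'a) cyclic_object \<Rightarrow> nat \<Rightarrow> ('k, (nat \<Rightarrow> 'a) set) module"
  where "cyclic_homology X n = chain_homology (total_obj X) (total_diff X) (int n)"


section \<open>The cyclic module of a Hopf algebra\<close>

definition tensor_extension ::
  "('k, 'r) ring_scheme \<Rightarrow> ('k, 'h, 'm) module_scheme \<Rightarrow> nat \<Rightarrow> nat \<Rightarrow>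
   ('h list \<Rightarrow> ('h list \<Rightarrow> 'k) set) \<Rightarrow> ('h list \<Rightarrow> 'k) set \<Rightarrow> ('h list \<Rightarrow> 'k) set"
  where "tensor_extension R H n m =
    linear_extension R (tensor_power R H n) (tensor_power R H m) (tuples H n) (pure_tensor R H)"

definition hopf_face ::
  "('k, 'r) ring_scheme \<Rightarrow> ('k, 'h, 'm) module_scheme \<Rightarrow> ('h \<Rightarrow> 'k) \<Rightarrow> nat \<Rightarrow> nat \<Rightarrow>
   'h list \<Rightarrow> ('h list \<Rightarrow> 'k) set"
  where "hopf_face R H \<epsilon> n i hs =
    (if i = 0 then \<epsilon> (hd hs) \<odot>\<^bsub>tensor_power R H (n - 1)\<^esub> pure_tensor R H (tl hs)
     else if i < n then
       pure_tensor R H (take (i - 1) hs @ [hs ! (i - 1) \<otimes>\<^bsub>H\<^esub> hs ! i] @ drop (i + 1) hs)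
     else \<epsilon> (last hs) \<odot>\<^bsub>tensor_power R H (n - 1)\<^esub> pure_tensor R H (butlast hs))"

text \<open>An element \<open>ps\<close> of the product list is one choice, for every tensor factor \<open>h\<^sub>j\<close>, of a summand
  of \<open>\<Delta> h\<^sub>j\<close>.\<close>

definition hopf_cyc ::
  "('k, 'r) ring_scheme \<Rightarrow> ('k, 'h, 'm) module_scheme \<Rightarrow> ('h \<Rightarrow> ('h list \<Rightarrow> 'k) set) \<Rightarrow>
   ('h \<Rightarrow> 'k) \<Rightarrow> ('h \<Rightarrow> 'h) \<Rightarrow> nat \<Rightarrow> 'h list \<Rightarrow> ('h list \<Rightarrow> 'k) set"
  where "hopf_cyc R H \<Delta> \<epsilon> S n hs =
    list_sum (tensor_power R H n)
      (\<lambda>ps. \<epsilon> (snd (last ps)) \<odot>\<^bsub>tensor_power R H n\<^esub>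
        pure_tensor R H (S (foldr (mult H) (map fst ps) \<one>\<^bsub>H\<^esub>) # map snd (butlast ps)))
      (product_lists (map (sweedler R H \<Delta>) hs))"

definition hopf_cyclic_module ::
  "('k, 'r) ring_scheme \<Rightarrow> ('k, 'h, 'm) module_scheme \<Rightarrow> ('h \<Rightarrow> ('h list \<Rightarrow> 'k) set) \<Rightarrow>
   ('h \<Rightarrow> 'k) \<Rightarrow> ('h \<Rightarrow> 'h) \<Rightarrow> ('k, ('h list \<Rightarrow> 'k) set) cyclic_object"
  where "hopf_cyclic_module R H \<Delta> \<epsilon> S =
    \<lparr>obj = tensor_power R H,
     face = (\<lambda>n i. tensor_extension R H n (n - 1) (hopf_face R H \<epsilon> n i)),
     degen = (\<lambda>n i. tensor_extension R H n (n + 1)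
       (\<lambda>hs. pure_tensor R H (take i hs @ [\<one>\<^bsub>H\<^esub>] @ drop i hs))),
     cyc = (\<lambda>n. if n = 0 then (\<lambda>x. x) else tensor_extension R H n n (hopf_cyc R H \<Delta> \<epsilon> S n))\<rparr>"


section \<open>Modules over an algebra and tensor products\<close>

text \<open>A left module over the \<open>R\<close>-algebra \<open>H\<close> is an \<open>R\<close>-module with a compatible action of \<open>H\<close>.\<close>

locale left_module = module R M + assoc_algebra R H
  for R :: "('k, 'r) ring_scheme" and H :: "('k, 'h, 'm) module_scheme"
    and M :: "('k, 'a, 'n) module_scheme" and act :: "'h \<Rightarrow> 'a \<Rightarrow> 'a" +
  assumes act_linear: "h \<in> carrier H \<Longrightarrow> act h \<in> linear_maps R M M"
    and act_linear_left: "x \<in> carrier M \<Longrightarrow> (\<lambda>h. act h x) \<in> linear_maps R H M"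
    and act_mult: "\<lbrakk>g \<in> carrier H; h \<in> carrier H; x \<in> carrier M\<rbrakk> \<Longrightarrow>
      act (g \<otimes>\<^bsub>H\<^esub> h) x = act g (act h x)"
    and act_one: "x \<in> carrier M \<Longrightarrow> act \<one>\<^bsub>H\<^esub> x = x"

definition H_linear_maps ::
  "('k, 'r) ring_scheme \<Rightarrow> ('k, 'h, 'm) module_scheme \<Rightarrow>
   ('k, 'a, 'n) module_scheme \<Rightarrow> ('h \<Rightarrow> 'a \<Rightarrow> 'a) \<Rightarrow>
   ('k, 'b, 'o) module_scheme \<Rightarrow> ('h \<Rightarrow> 'b \<Rightarrow> 'b) \<Rightarrow> ('a \<Rightarrow> 'b) set"
  where "H_linear_maps R H M actM N actN =
    {f \<in> linear_maps R M N. \<forall>h\<in>carrier H. \<forall>x\<in>carrier M. f (actM h x) = actN h (f x)}"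

definition bilinear_relations ::
  "('k, 'r) ring_scheme \<Rightarrow> ('k, 'a, 'm) module_scheme \<Rightarrow> ('k, 'b, 'n) module_scheme \<Rightarrow>
   ('a \<times> 'b \<Rightarrow> 'k) set"
  where "bilinear_relations R M N =
    (let X = carrier M \<times> carrier N; F = free_module R X; e = free_gen R X in
      {e (x \<oplus>\<^bsub>M\<^esub> x', y) \<ominus>\<^bsub>F\<^esub> (e (x, y) \<oplus>\<^bsub>F\<^esub> e (x', y)) | x x' y.
         x \<in> carrier M \<and> x' \<in> carrier M \<and> y \<in> carrier N} \<union>
      {e (x, y \<oplus>\<^bsub>N\<^esub> y') \<ominus>\<^bsub>F\<^esub> (e (x, y) \<oplus>\<^bsub>F\<^esub> e (x, y')) | x y y'.
         x \<in> carrier M \<and> y \<in> carrier N \<and> y' \<in> carrier N} \<union>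
      {e (r \<odot>\<^bsub>M\<^esub> x, y) \<ominus>\<^bsub>F\<^esub> r \<odot>\<^bsub>F\<^esub> e (x, y) | r x y.
         r \<in> carrier R \<and> x \<in> carrier M \<and> y \<in> carrier N} \<union>
      {e (x, r \<odot>\<^bsub>N\<^esub> y) \<ominus>\<^bsub>F\<^esub> r \<odot>\<^bsub>F\<^esub> e (x, y) | r x y.
         r \<in> carrier R \<and> x \<in> carrier M \<and> y \<in> carrier N})"

definition balanced_relations ::
  "('k, 'r) ring_scheme \<Rightarrow> ('k, 'h, 'l) module_scheme \<Rightarrow>
   ('k, 'a, 'm) module_scheme \<Rightarrow> ('a \<Rightarrow> 'h \<Rightarrow> 'a) \<Rightarrow>
   ('k, 'b, 'n) module_scheme \<Rightarrow> ('h \<Rightarrow> 'b \<Rightarrow> 'b) \<Rightarrow> ('a \<times> 'b \<Rightarrow> 'k) set"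
  where "balanced_relations R H M ract N act =
    (let X = carrier M \<times> carrier N; F = free_module R X; e = free_gen R X in
      {e (ract x h, y) \<ominus>\<^bsub>F\<^esub> e (x, act h y) | x h y.
         x \<in> carrier M \<and> h \<in> carrier H \<and> y \<in> carrier N})"

text \<open>\<open>M \<otimes>\<^sub>k N\<close> over the ground ring\<close>

definition tensor_k ::
  "('k, 'r) ring_scheme \<Rightarrow> ('k, 'a, 'm) module_scheme \<Rightarrow> ('k, 'b, 'n) module_scheme \<Rightarrow>
   ('k, ('a \<times> 'b \<Rightarrow> 'k) set) module"
  where "tensor_k R M N = presented_module R (carrier M \<times> carrier N) (bilinear_relations R M N)"

definition tensor_k_gen ::
  "('k, 'r) ring_scheme \<Rightarrow> ('k, 'a, 'm) module_scheme \<Rightarrow> ('k, 'b, 'n) module_scheme \<Rightarrow>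
   'a \<times> 'b \<Rightarrow> ('a \<times> 'b \<Rightarrow> 'k) set"
  where "tensor_k_gen R M N = presented_gen R (carrier M \<times> carrier N) (bilinear_relations R M N)"

text \<open>\<open>M \<otimes>\<^sub>H N\<close> for a right module \<open>M\<close> and a left module \<open>N\<close>\<close>

definition tensor_H ::
  "('k, 'r) ring_scheme \<Rightarrow> ('k, 'h, 'l) module_scheme \<Rightarrow>
   ('k, 'a, 'm) module_scheme \<Rightarrow> ('a \<Rightarrow> 'h \<Rightarrow> 'a) \<Rightarrow>
   ('k, 'b, 'n) module_scheme \<Rightarrow> ('h \<Rightarrow> 'b \<Rightarrow> 'b) \<Rightarrow> ('k, ('a \<times> 'b \<Rightarrow> 'k) set) module"
  where "tensor_H R H M ract N act =
    presented_module R (carrier M \<times> carrier N)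
      (bilinear_relations R M N \<union> balanced_relations R H M ract N act)"

definition tensor_H_gen ::
  "('k, 'r) ring_scheme \<Rightarrow> ('k, 'h, 'l) module_scheme \<Rightarrow>
   ('k, 'a, 'm) module_scheme \<Rightarrow> ('a \<Rightarrow> 'h \<Rightarrow> 'a) \<Rightarrow>
   ('k, 'b, 'n) module_scheme \<Rightarrow> ('h \<Rightarrow> 'b \<Rightarrow> 'b) \<Rightarrow> 'a \<times> 'b \<Rightarrow> ('a \<times> 'b \<Rightarrow> 'k) set"
  where "tensor_H_gen R H M ract N act =
    presented_gen R (carrier M \<times> carrier N)
      (bilinear_relations R M N \<union> balanced_relations R H M ract N act)"


section \<open>Projective resolutions and Tor\<close>

locale left_resolution = left_module R H M actM
  for R :: "('k, 'r) ring_scheme" and H :: "('k, 'h, 'm) module_scheme"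
    and M :: "('k, 'a, 'n) module_scheme" and actM :: "'h \<Rightarrow> 'a \<Rightarrow> 'a"
    and Q :: "nat \<Rightarrow> ('k, 'q) module" and act :: "nat \<Rightarrow> 'h \<Rightarrow> 'q \<Rightarrow> 'q"
    and d :: "nat \<Rightarrow> 'q \<Rightarrow> 'q" and aug :: "'q \<Rightarrow> 'a" +
  assumes left_modules: "left_module R H (Q n) (act n)"
    and diff_linear: "d n \<in> H_linear_maps R H (Q (Suc n)) (act (Suc n)) (Q n) (act n)"
    and aug_linear: "aug \<in> H_linear_maps R H (Q 0) (act 0) M actM"
    and aug_surj: "aug ` carrier (Q 0) = carrier M"
    and exact_zero: "d 0 ` carrier (Q 1) = a_kernel (Q 0) M aug"
    and exact_Suc: "d (Suc n) ` carrier (Q (Suc (Suc n))) = a_kernel (Q (Suc n)) (Q n) (d n)"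

text \<open>Projective: a direct summand of a free left module \<open>H\<^sup>(\<^sup>X\<^sup>)\<close>. A basis contained in the type of
  the elements suffices, as every module is a quotient of the free module on its elements.\<close>

definition projective_left_module ::
  "('k, 'r) ring_scheme \<Rightarrow> ('k, 'h, 'm) module_scheme \<Rightarrow> ('k, 'a, 'n) module_scheme \<Rightarrow>
   ('h \<Rightarrow> 'a \<Rightarrow> 'a) \<Rightarrow> bool"
  where "projective_left_module R H M act \<longleftrightarrow>
    (\<exists>X :: 'a set.
      let F = direct_sum X (\<lambda>_. H); actF = (\<lambda>h f. \<lambda>x\<in>X. h \<otimes>\<^bsub>H\<^esub> f x) in
      \<exists>i\<in>H_linear_maps R H M act F actF. \<exists>p\<in>H_linear_maps R H F actF M act.
        \<forall>x\<in>carrier M. p (i x) = x)"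

text \<open>Relatively projective with respect to \<open>R \<rightarrow> H\<close>: the action map \<open>H \<otimes>\<^sub>k M \<rightarrow> M\<close> has an
  \<open>H\<close>-linear section.\<close>

definition relatively_projective ::
  "('k, 'r) ring_scheme \<Rightarrow> ('k, 'h, 'm) module_scheme \<Rightarrow> ('k, 'a, 'n) module_scheme \<Rightarrow>
   ('h \<Rightarrow> 'a \<Rightarrow> 'a) \<Rightarrow> bool"
  where "relatively_projective R H M act \<longleftrightarrow>
    (let T = tensor_k R H M; X = carrier H \<times> carrier M; t = tensor_k_gen R H M;
         actT = (\<lambda>h. linear_extension R T T X t (\<lambda>(g, x). t (h \<otimes>\<^bsub>H\<^esub> g, x)));
         \<mu> = linear_extension R T M X t (\<lambda>(g, x). act g x) in
      \<exists>\<sigma>\<in>H_linear_maps R H M act T actT. \<forall>x\<in>carrier M. \<mu> (\<sigma> x) = x)"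

text \<open>A linear contraction of the augmented complex \<open>\<dots> \<rightarrow> Q 1 \<rightarrow> Q 0 \<rightarrow> M \<rightarrow> 0\<close>.\<close>

definition k_split ::
  "('k, 'r) ring_scheme \<Rightarrow> ('k, 'a, 'n) module_scheme \<Rightarrow> (nat \<Rightarrow> ('k, 'q) module) \<Rightarrow>
   (nat \<Rightarrow> 'q \<Rightarrow> 'q) \<Rightarrow> ('q \<Rightarrow> 'a) \<Rightarrow> bool"
  where "k_split R M Q d aug \<longleftrightarrow>
    (\<exists>s'\<in>linear_maps R M (Q 0). \<exists>s. (\<forall>n. s n \<in> linear_maps R (Q n) (Q (Suc n))) \<and>
      (\<forall>x\<in>carrier M. aug (s' x) = x) \<and>
      (\<forall>x\<in>carrier (Q 0). d 0 (s 0 x) \<oplus>\<^bsub>Q 0\<^esub> s' (aug x) = x) \<and>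
      (\<forall>n. \<forall>x\<in>carrier (Q (Suc n)). d (Suc n) (s (Suc n) x) \<oplus>\<^bsub>Q (Suc n)\<^esub> s n (d n x) = x))"

text \<open>The equational criterion for flatness (every linear relation is trivial); it avoids the
  quantification over all modules.\<close>

definition flat_module :: "('k, 'r) ring_scheme \<Rightarrow> ('k, 'a, 'm) module_scheme \<Rightarrow> bool"
  where "flat_module R M \<longleftrightarrow>
    (\<forall>n r x. r \<in> {..<n::nat} \<rightarrow> carrier R \<and> x \<in> {..<n} \<rightarrow> carrier M \<and>
        (\<Oplus>\<^bsub>M\<^esub>i\<in>{..<n}. r i \<odot>\<^bsub>M\<^esub> x i) = \<zero>\<^bsub>M\<^esub> \<longrightarrow>
      (\<exists>l c y. (\<forall>i<n. c i \<in> {..<l::nat} \<rightarrow> carrier R) \<and> y \<in> {..<l} \<rightarrow> carrier M \<and>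
        (\<forall>i<n. x i = (\<Oplus>\<^bsub>M\<^esub>j\<in>{..<l}. c i j \<odot>\<^bsub>M\<^esub> y j)) \<and>
        (\<forall>j<l. (\<Oplus>\<^bsub>R\<^esub>i\<in>{..<n}. r i \<otimes>\<^bsub>R\<^esub> c i j) = \<zero>\<^bsub>R\<^esub>)))"

text \<open>The resolutions of \<open>M\<close> from which \<open>Tor\<^sup>H(-, M)\<close> is computed. If \<open>H\<close> is flat over the
  ground ring, any projective resolution is admitted. In general, \<open>Tor\<^sup>H\<close> has to be understood
  relative to the ground ring, as is usual in the homology of algebras over a commutative ring: one
  takes resolutions that split over the ground ring and consist of relatively projective modules,
  such as the bar resolution. If \<open>H\<close> is projective over the ground ring, every projective
  resolution of the trivial module is of this kind. The flatness cannot be dropped: for the Hopf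
  algebra \<open>\<int>[x]/(p x)\<close> over \<open>\<int>\<close>, with \<open>x\<close> primitive, the absolute \<open>Tor\<^sub>3\<close> of the trivial module is
  \<open>\<int>/p\<close>, whereas the relative one, which the bar complex computes, is 0.\<close>

definition tor_resolution ::
  "('k, 'r) ring_scheme \<Rightarrow> ('k, 'h, 'm) module_scheme \<Rightarrow> ('k, 'a, 'n) module_scheme \<Rightarrow>
   ('h \<Rightarrow> 'a \<Rightarrow> 'a) \<Rightarrow> (nat \<Rightarrow> ('k, 'q) module) \<Rightarrow> (nat \<Rightarrow> 'h \<Rightarrow> 'q \<Rightarrow> 'q) \<Rightarrow>
   (nat \<Rightarrow> 'q \<Rightarrow> 'q) \<Rightarrow> ('q \<Rightarrow> 'a) \<Rightarrow> bool"
  where "tor_resolution R H M actM Q act d aug \<longleftrightarrow>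
    left_resolution R H M actM Q act d aug \<and>
    (flat_module R H \<and> (\<forall>n. projective_left_module R H (Q n) (act n)) \<or>
     k_split R M Q d aug \<and> (\<forall>n. relatively_projective R H (Q n) (act n)))"

text \<open>\<open>Tor\<^sup>H\<^sub>i(A, M)\<close> for a right module \<open>A\<close>, computed from a resolution \<open>Q\<close> of \<open>M\<close>.\<close>

definition tor ::
  "('k, 'r) ring_scheme \<Rightarrow> ('k, 'h, 'm) module_scheme \<Rightarrow>
   ('k, 'a, 'n) module_scheme \<Rightarrow> ('a \<Rightarrow> 'h \<Rightarrow> 'a) \<Rightarrow>
   (nat \<Rightarrow> ('k, 'q) module) \<Rightarrow> (nat \<Rightarrow> 'h \<Rightarrow> 'q \<Rightarrow> 'q) \<Rightarrow> (nat \<Rightarrow> 'q \<Rightarrow> 'q) \<Rightarrow> int \<Rightarrow>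
   ('k, ('a \<times> 'q \<Rightarrow> 'k) set set) module"
  where "tor R H A ract Q act d i =
    chain_homology
      (\<lambda>n. tensor_H R H A ract (Q n) (act n))
      (\<lambda>n. linear_extension R
        (tensor_H R H A ract (Q (Suc n)) (act (Suc n))) (tensor_H R H A ract (Q n) (act n))
        (carrier A \<times> carrier (Q (Suc n))) (tensor_H_gen R H A ract (Q (Suc n)) (act (Suc n)))
        (\<lambda>(a, x). tensor_H_gen R H A ract (Q n) (act n) (a, d n x)))
      i"

definition trivial_left_action :: "('k, 'r) ring_scheme \<Rightarrow> ('h \<Rightarrow> 'k) \<Rightarrow> 'h \<Rightarrow> 'k \<Rightarrow> 'k"
  where "trivial_left_action R \<epsilon> h x = \<epsilon> h \<otimes>\<^bsub>R\<^esub> x"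

definition trivial_right_action :: "('k, 'r) ring_scheme \<Rightarrow> ('h \<Rightarrow> 'k) \<Rightarrow> 'k \<Rightarrow> 'h \<Rightarrow> 'k"
  where "trivial_right_action R \<epsilon> x h = x \<otimes>\<^bsub>R\<^esub> \<epsilon> h"

text \<open>\<open>H\<^sub>i(H; M) = Tor\<^sup>H\<^sub>i(k, M)\<close>, where \<open>Q\<close> is a resolution of \<open>M\<close>.\<close>

definition hopf_homology ::
  "('k, 'r) ring_scheme \<Rightarrow> ('k, 'h, 'm) module_scheme \<Rightarrow> ('h \<Rightarrow> 'k) \<Rightarrow>
   (nat \<Rightarrow> ('k, 'q) module) \<Rightarrow> (nat \<Rightarrow> 'h \<Rightarrow> 'q \<Rightarrow> 'q) \<Rightarrow> (nat \<Rightarrow> 'q \<Rightarrow> 'q) \<Rightarrow> int \<Rightarrow>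
   ('k, ('k \<times> 'q \<Rightarrow> 'k) set set) module"
  where "hopf_homology R H \<epsilon> Q act d i =
    tor R H (self_module R) (trivial_right_action R \<epsilon>) Q act d i"

end

theory Submission
  imports Defs
begin

text \<open>The homogeneous cyclic object with \<open>H\<^sup>\<otimes>\<^sup>n\<^sup>+\<^sup>1\<close> in degree \<open>n\<close>, whose faces apply the counit and whose cyclic operator
  rotates the factors, consists of free \<open>H\<close>-modules under the diagonal action, and by cocommutativity
  all its structure maps are \<open>H\<close>-linear; its coinvariants form the cyclic module of the theorem.
  As its Hochschild complex is contractible, the identity of column 0 extends step by step to an
  \<open>H\<close>-linear chain map from the total complex to column 0, which descends to the coinvariants.
  Together with the periodicity it splits cyclic homology into shifted copies of Hochschild homology,
  because the \<open>b'\<close>-columns are contractible. The Hochschild complex is the bar complex of the trivial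
  module; it is compared with \<open>k \<otimes>\<^sub>H Q\<close> through the double complex \<open>H\<^sup>\<otimes>\<^sup>p \<otimes> Q\<^sub>q\<close>, which is exact in the
  bar direction by (relative) projectivity and in the other one by flatness or the splitting.\<close>

text \<open>The homogeneous Hochschild complex is contracted by putting a unit in front, which is
  linear over the ground ring but not over \<open>H\<close>. A substitute suffices: for an
  equivariant map \<open>f\<close> with values in cycles, the coproduct of the leading factor
  supplies a new leading factor, and the resulting cone is an equivariant lift of \<open>f\<close>
  through the differential. Exactness fails only in degree 0, where the complex resolves the ground
  ring; the obstruction there vanishes because the cyclic operator is the identity in degree 0, so
  that \<open>1 - t\<close> is zero. Cocommutativity makes the rotation equivariant, since the
  diagonal action distributes the parts of a coproduct in a fixed order. The splitting uses no
  spectral sequence: the chain map to column 0, composed with the shifts by an even number of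
  columns, gives all components at once, and contracting the odd columns shows that they are jointly
  bijective on homology. For flat \<open>H\<close> only the equational criterion is given; turning
  it into exactness of \<open>H \<otimes> -\<close> requires bookkeeping of how a tensor
  vanishes.\<close>

abbreviation (input) module_add ("_ +[_] _" [65, 0, 66] 65) where "x +[M] y \<equiv> x \<oplus>\<^bsub>M\<^esub> y"
abbreviation (input) module_minus ("_ -[_] _" [65, 0, 66] 65) where "x -[M] y \<equiv> x \<ominus>\<^bsub>M\<^esub> y"
abbreviation (input) module_neg ("-[_] _" [0, 81] 80) where "-[M] x \<equiv> \<ominus>\<^bsub>M\<^esub> x"
abbreviation (input) module_smult ("_ *[_] _" [70, 0, 71] 70) where "r *[M] x \<equiv> r \<odot>\<^bsub>M\<^esub> x"
abbreviation (input) ring_mult ("_ **[_] _" [70, 0, 71] 70) where "x **[R] y \<equiv> x \<otimes>\<^bsub>R\<^esub> y"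
abbreviation (input) ring_zero ("\<zero>[_]") where "\<zero>[R] \<equiv> \<zero>\<^bsub>R\<^esub>"
abbreviation (input) ring_one ("\<one>[_]") where "\<one>[R] \<equiv> \<one>\<^bsub>R\<^esub>"
abbreviation (input) mem_carrier ("_ :[_]" [51, 0] 50) where "x :[M] \<equiv> x \<in> carrier M"
abbreviation (input) lin where "lin \<equiv> linear_maps"

section \<open>Linear maps between modules\<close>

lemma linear_mapsI:
 assumes "!!x. x :[M] ==> f x :[N]"
  and "!!x y. [|x :[M]; y :[M]|] ==> f (x +[M] y) = f x +[N] f y"
  and "!!r x. [|r :[R]; x :[M]|] ==> f (r *[M] x) = r *[N] f x"
 shows "f \<in> lin R M N"
 using assms by (auto simp: linear_maps_def)

lemma
 assumes "f \<in> lin R M N"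
 shows lin_closed: "x :[M] ==> f x :[N]"
  and lin_add: "[|x :[M]; y :[M]|] ==> f (x +[M] y) = f x +[N] f y"
  and lin_smult: "[|r :[R]; x :[M]|] ==> f (r *[M] x) = r *[N] f x"
 using assms by (auto simp: linear_maps_def)

lemma (in abelian_group) diff_zero_iff:
 assumes "x :[G]" "y :[G]"
 shows "x \<ominus> y = \<zero> \<longleftrightarrow> x = y"
 using assms minus_equality[of x "\<ominus> y"] by (auto simp: minus_eq r_neg)

lemma (in abelian_group) neg_zero [simp]: "\<ominus> \<zero> = \<zero>"
 by (rule minus_equality) simp_all

lemma module_minus_eq:
 assumes "module R M" "x :[M]"
 shows "-[M] x = (-[R] \<one>[R]) *[M] x"
proof -
 interpret module R M by fact
 show ?thesis using assms(2) by (simp add: smult_l_minus)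
qed

lemma
 assumes "f \<in> lin R M N" "module R M" "module R N"
 shows lin_zero: "f \<zero>[M] = \<zero>[N]"
  and lin_neg: "x :[M] ==> f (-[M] x) = -[N] f x"
  and lin_diff: "[|x :[M]; y :[M]|] ==> f (x -[M] y) = f x -[N] f y"
proof -
 interpret M: module R M by fact
 interpret N: module R N by fact
 have "f (\<zero>[R] *[M] \<zero>[M]) = \<zero>[R] *[N] f \<zero>[M]"
  using assms(1) by (intro lin_smult) auto
 then show "f \<zero>[M] = \<zero>[N]"
  using lin_closed[OF assms(1), of "\<zero>[M]"] by simp
 show neg: "f (-[M] x) = -[N] f x" if "x :[M]" for x
  using that lin_closed[OF assms(1) that] lin_smult[OF assms(1)]
  by (simp add: module_minus_eq[OF assms(2)] module_minus_eq[OF assms(3)])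
 show "f (x -[M] y) = f x -[N] f y" if "x :[M]" "y :[M]"
  using that neg lin_add[OF assms(1)] by (simp add: M.minus_eq N.minus_eq)
qed

text \<open>Holds for infinite \<open>A\<close> as well, since both sums are then zero by convention
  and \<open>f\<close> preserves zero.\<close>

lemma lin_finsum:
 assumes "f \<in> lin R M N" "module R M" "module R N" "g \<in> A \<rightarrow> carrier M"
 shows "f (\<Oplus>\<^bsub>M\<^esub>i\<in>A. g i) = (\<Oplus>\<^bsub>N\<^esub>i\<in>A. f (g i))"
 using assms(4)
proof (induction A rule: infinite_finite_induct)
 interpret M: module R M by fact
 interpret N: module R N by fact
 {
  case (infinite A)
  then show ?case
   by (simp add: M.add.finprod_infinite N.add.finprod_infinite lin_zero[OF assms(1-3)])
 next
  case empty
  then show ?case by (simp add: lin_zero[OF assms(1-3)])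
 next
  case (insert i A)
  then have "(%i. f (g i)) \<in> insert i A \<rightarrow> carrier N"
   using lin_closed[OF assms(1)] by auto
  with insert show ?case
   by (simp add: lin_add[OF assms(1)] Pi_def)
 }
qed

lemma lin_comp:
 assumes "f \<in> lin R M N" "g \<in> lin R N L"
 shows "(%x. g (f x)) \<in> lin R M L"
 using assms by (intro linear_mapsI)
  (simp_all add: lin_closed[of f] lin_closed[of g] lin_add[of f] lin_add[of g]
   lin_smult[of f] lin_smult[of g])

lemma lin_id: "(%x. x) \<in> lin R M M"
 by (auto simp: linear_maps_def)

lemma lin_cong:
 assumes "f \<in> lin R M N" "module R M" "!!x. x :[M] ==> f x = g x"
 shows "g \<in> lin R M N"
proof -
 interpret M: module R M by fact
 show ?thesis
  using assms(1,3) unfolding linear_maps_def by simp (metis M.add.m_closed M.smult_closed PiE Pi_I)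
qed

lemma lin_const_zero:
 assumes "module R N"
 shows "(%x. \<zero>[N]) \<in> lin R M N"
proof -
 interpret N: module R N by fact
 show ?thesis by (auto simp: linear_maps_def)
qed

lemma lin_map_add:
 assumes "f \<in> lin R M N" "g \<in> lin R M N" "module R N"
 shows "(%x. f x +[N] g x) \<in> lin R M N"
proof -
 interpret N: module R N by fact
 show ?thesis
  using assms by (intro linear_mapsI)
   (auto simp: lin_closed[of f] lin_closed[of g] lin_add[of f] lin_add[of g]
    lin_smult[of f] lin_smult[of g] N.smult_r_distr N.a_ac)
qed

lemma linear_map_smult:
 assumes "f \<in> lin R M N" "module R N" "r :[R]"
 shows "(%x. r *[N] f x) \<in> lin R M N"
proof -
 interpret N: module R N by fact
 show ?thesis
  using assms by (intro linear_mapsI)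
   (auto simp: lin_closed[of f] lin_add[of f] lin_smult[of f] N.smult_r_distr
    N.smult_assoc1[symmetric] N.m_comm)
qed

lemma lin_map_neg:
 assumes "f \<in> lin R M N" "module R M" "module R N"
 shows "(%x. -[N] f x) \<in> lin R M N"
proof -
 interpret N: module R N by fact
 have "(%x. (-[R] \<one>[R]) *[N] f x) \<in> lin R M N"
  by (intro linear_map_smult assms) auto
 then show ?thesis
  by (rule lin_cong) (auto simp: module_minus_eq[OF assms(3)] assms lin_closed[OF assms(1)])
qed

lemma lin_map_diff:
 assumes "f \<in> lin R M N" "g \<in> lin R M N" "module R M" "module R N"
 shows "(%x. f x -[N] g x) \<in> lin R M N"
 using lin_map_add[OF assms(1) lin_map_neg[OF assms(2-4)] assms(4)]
 by (simp add: a_minus_def)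

lemma lin_map_finsum:
 assumes "!!i. i \<in> A ==> f i \<in> lin R M N" "module R M" "module R N"
 shows "(%x. \<Oplus>\<^bsub>N\<^esub>i\<in>A. f i x) \<in> lin R M N"
proof -
 interpret N: module R N by fact
 from assms(1) show ?thesis
 proof (induction A rule: infinite_finite_induct)
  case (infinite A)
  then show ?case
   by (simp add: N.add.finprod_infinite lin_const_zero[OF assms(3)])
 next
  case empty
  then show ?case by (simp add: lin_const_zero[OF assms(3)])
 next
  case (insert i A)
  then have "(%x. f i x +[N] (\<Oplus>\<^bsub>N\<^esub>i\<in>A. f i x)) \<in> lin R M N"
   by (intro lin_map_add insert.IH insert.prems assms(3)) auto
  then show ?case
  proof (rule lin_cong[OF _ assms(2)])
   fix x assume "x :[M]"
   then have "f j x :[N]" if "j \<in> insert i A" for j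
    using lin_closed[OF insert.prems[OF that]] by simp
   then show "f i x +[N] (\<Oplus>\<^bsub>N\<^esub>i\<in>A. f i x) = (\<Oplus>\<^bsub>N\<^esub>i\<in>insert i A. f i x)"
    using insert.hyps by (simp add: Pi_def)
  qed
 qed
qed

section \<open>Submodules, generating sets and quotient modules\<close>

lemma submodule_zero:
 assumes "submodule N R M"
 shows "\<zero>[M] \<in> N"
 using subgroup.one_closed[OF submodule.axioms(1)[OF assms]] by simp

lemma linear_preimage_submodule:
 assumes "f \<in> lin R M N" "module R M" "module R N" "submodule L R N"
 shows "submodule {x \<in> carrier M. f x \<in> L} R M"
proof -
 interpret M: module R M by fact
 interpret N: module R N by fact
 note L = N.submoduleE[OF assms(4)]
 show ?thesis
  using L(3-5) submodule_zero[OF assms(4)] by (intro M.submoduleI)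
   (auto simp: lin_zero[OF assms(1-3)] lin_neg[OF assms(1-3)] lin_add[OF assms(1)]
    lin_smult[OF assms(1)])
qed

lemma zero_submodule:
 assumes "module R M"
 shows "submodule {\<zero>[M]} R M"
proof -
 interpret M: module R M by fact
 show ?thesis by (intro M.submoduleI) auto
qed

lemma linear_image_submodule:
 assumes "f \<in> lin R M N" "module R M" "module R N"
 shows "submodule (f ` carrier M) R N"
proof -
 interpret M: module R M by fact
 interpret N: module R N by fact
 show ?thesis
 proof (intro N.submoduleI)
  show "f ` carrier M \<subseteq> carrier N" using lin_closed[OF assms(1)] by auto
  show "\<zero>[N] \<in> f ` carrier M" using lin_zero[OF assms] by force
  show "-[N] a \<in> f ` carrier M" if "a \<in> f ` carrier M" for a
   using that by (auto simp: lin_neg[OF assms, symmetric])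
  show "a +[N] b \<in> f ` carrier M" if "a \<in> f ` carrier M" "b \<in> f ` carrier M" for a b
   using that by (auto simp: lin_add[OF assms(1), symmetric])
  show "r *[N] a \<in> f ` carrier M" if "r :[R]" "a \<in> f ` carrier M" for r a
   using that by (auto simp: lin_smult[OF assms(1), symmetric])
 qed
qed

lemma linear_kernel_submodule:
 assumes "f \<in> lin R M N" "module R M" "module R N"
 shows "submodule (a_kernel M N f) R M"
proof -
 have "a_kernel M N f = {x \<in> carrier M. f x \<in> {\<zero>[N]}}"
  by (auto simp: a_kernel_def')
 then show ?thesis
  using linear_preimage_submodule[OF assms zero_submodule[OF assms(3)]] by simp
qed

text \<open>Phrased through submodules rather than \<open>span_module\<close>, so that an argument
  on generators runs like an induction: the elements with the desired property only have to form a
  submodule.\<close>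

definition generates ::
 "('k, 'r) ring_scheme => ('k, 'a, 'm) module_scheme => 'a set => bool"
 where "generates R M G \<longleftrightarrow> G \<subseteq> carrier M \<and> (\<forall>N. submodule N R M \<longrightarrow> G \<subseteq> N \<longrightarrow> carrier M \<subseteq> N)"

lemma generates_linear_eq:
 assumes "generates R M G" "f \<in> lin R M N" "g \<in> lin R M N"
  "module R M" "module R N" "!!x. x \<in> G ==> f x = g x" "x :[M]"
 shows "f x = g x"
proof -
 interpret N: module R N by fact
 have l: "(%x. f x -[N] g x) \<in> lin R M N"
  by (intro lin_map_diff assms)
 have "G \<subseteq> {x \<in> carrier M. f x -[N] g x \<in> {\<zero>[N]}}"
  using assms by (auto simp: generates_def lin_closed N.r_neg N.minus_eq)
 then have "f x -[N] g x = \<zero>[N]"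
  using linear_preimage_submodule[OF l assms(4,5) zero_submodule[OF assms(5)]] assms(1,7)
  by (auto simp: generates_def)
 then show ?thesis
  using N.diff_zero_iff lin_closed[OF assms(2,7)] lin_closed[OF assms(3,7)] by blast
qed

lemma generates_subset:
 assumes "generates R M G" "submodule N R M" "!!x. x \<in> G ==> x \<in> N" "x :[M]"
 shows "x \<in> N"
 using assms by (auto simp: generates_def)

text \<open>The definite description is resolved here once and for all: generation yields uniqueness
  on the carrier, and the extensionality demanded in the definition forces the restriction.\<close>

lemma linear_extension_eq:
 assumes "module R M" "module R N" "generates R M (g ` X)"
  and "\<phi> \<in> lin R M N" "!!x. x \<in> X ==> \<phi> (g x) = f x"
 shows "linear_extension R M N X g f = restrict \<phi> (carrier M)"
 unfolding linear_extension_def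
proof (rule the_equality)
 interpret M: module R M by fact
 have X: "g x :[M]" if "x \<in> X" for x
  using assms(3) that by (auto simp: generates_def)
 have "restrict \<phi> (carrier M) \<in> lin R M N"
  by (rule lin_cong[OF assms(4,1)]) auto
 then show "restrict \<phi> (carrier M) \<in> lin R M N \<and>
   restrict \<phi> (carrier M) \<in> extensional (carrier M) \<and> (\<forall>x\<in>X. restrict \<phi> (carrier M) (g x) = f x)"
  using X assms(5) by auto
 fix \<psi> assume \<psi>: "\<psi> \<in> lin R M N \<and> \<psi> \<in> extensional (carrier M) \<and> (\<forall>x\<in>X. \<psi> (g x) = f x)"
 show "\<psi> = restrict \<phi> (carrier M)"
 proof (rule extensionalityI[of _ "carrier M"])
  show "\<psi> x = restrict \<phi> (carrier M) x" if x: "x :[M]" for x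
  proof -
   have "\<psi> x = \<phi> x"
    by (rule generates_linear_eq[OF assms(3) conjunct1[OF \<psi>] assms(4) assms(1,2) _ x])
     (use \<psi> assms(5) in auto)
   then show ?thesis using x by simp
  qed
 qed (use \<psi> in auto)
qed

text \<open>The module axioms are equations and pass along a surjection that respects the
  operations. For quotients this avoids every computation with cosets.\<close>

lemma module_image:
 assumes "module R M" "carrier Q = p ` carrier M" "p \<zero>[M] = \<zero>[Q]"
  and "!!x y. [|x :[M]; y :[M]|] ==> p (x +[M] y) = p x +[Q] p y"
  and "!!r x. [|r :[R]; x :[M]|] ==> p (r *[M] x) = r *[Q] p x"
 shows "module R Q"
proof -
 interpret M: module R M by fact
 show ?thesis
 proof (intro moduleI abelian_groupI, goal_cases)
  case 1 show ?case by (rule M.is_cring)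
 next
  case (7 x)
  then obtain x' where x': "x' :[M]" "x = p x'" by (auto simp: assms(2))
  then have "p (-[M] x') +[Q] x = \<zero>[Q]"
   by (simp add: assms(4)[symmetric] assms(3)[symmetric] M.l_neg)
  with x' show ?case by (auto simp: assms(2))
 qed (auto simp: assms(2) assms(3)[symmetric] assms(4)[symmetric] assms(5)[symmetric]
    M.a_ac M.smult_l_distr M.smult_r_distr M.smult_assoc1)
qed

lemma
 assumes "module R M" "submodule N R M"
 shows quotient_module_module: "module R (quotient_module M N)"
  and quotient_proj_linear: "(%x. N +>\<^bsub>M\<^esub> x) \<in> lin R M (quotient_module M N)"
  and quotient_carrier: "carrier (quotient_module M N) = (%x. N +>\<^bsub>M\<^esub> x) ` carrier M"
  and quotient_proj_zero: "x :[M] ==> N +>\<^bsub>M\<^esub> x = \<zero>[quotient_module M N] \<longleftrightarrow> x \<in> N"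
  and quotient_proj_eq: "[|x :[M]; y :[M]|] ==>
   N +>\<^bsub>M\<^esub> x = N +>\<^bsub>M\<^esub> y \<longleftrightarrow> x -[M] y \<in> N"
proof -
 interpret M: module R M by fact
 note NE = M.submoduleE[OF assms(2)]
 have sg: "subgroup N (add_monoid M)"
  using assms(2) by (simp add: submodule_def)
 then interpret N: abelian_subgroup N M
  using M.abelian_group_axioms by (intro abelian_subgroupI3 additive_subgroupI) auto
 let ?p = "%x. N +>\<^bsub>M\<^esub> x"
 show carr: "carrier (quotient_module M N) = ?p ` carrier M"
  by (auto simp: quotient_module_def A_RCOSETS_def')
 have add: "?p (x +[M] y) = ?p x +[quotient_module M N] ?p y"
  if "x :[M]" "y :[M]" for x y
  using that by (simp add: quotient_module_def N.a_rcos_sum)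
 show eq: "?p x = ?p y \<longleftrightarrow> x -[M] y \<in> N" if "x :[M]" "y :[M]" for x y
 proof -
  have "?p x = ?p y \<longleftrightarrow> x \<in> ?p y"
   using N.a_rcos_self[OF that(1)] M.a_repr_independence[OF _ that(2) sg, of x] by auto
  then show ?thesis
   using N.a_rcos_module[OF that(2,1)] by (simp add: M.minus_eq)
 qed
 have zero: "?p \<zero>[M] = \<zero>[quotient_module M N]"
  using NE(1) by (simp add: quotient_module_def)
 have smult: "?p (r *[M] x) = r *[quotient_module M N] ?p x"
  if r: "r :[R]" and x: "x :[M]" for r x
 proof -
  \<comment> \<open>The scalar action on the quotient is a union over all representatives; it
    collapses because its members are one and the same coset.\<close>
  have "?p (r *[M] y) = ?p (r *[M] x)" if y: "y \<in> ?p x" for y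
  proof -
   have yc: "y :[M]" using y x N.a_elemrcos_carrier by blast
   have "y -[M] x \<in> N" using y x yc N.a_rcos_module[of x y] by (simp add: M.minus_eq)
   then have "r *[M] (y -[M] x) \<in> N" using r NE(4) by auto
   moreover have "r *[M] (y -[M] x) = r *[M] y -[M] r *[M] x"
    using r x yc by (simp add: M.minus_eq M.smult_r_distr M.smult_r_minus)
   ultimately show ?thesis
    using eq[of "r *[M] y" "r *[M] x"] r x yc by simp
  qed
  then have "(\<Union>y\<in>?p x. ?p (r *[M] y)) = (\<Union>y\<in>?p x. ?p (r *[M] x))"
   by (intro SUP_cong refl)
  also have "... = ?p (r *[M] x)"
   using N.a_rcos_self[OF x] by blast
  finally show ?thesis
   by (simp add: quotient_module_def)
 qed
 show module: "module R (quotient_module M N)"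
  by (rule module_image[OF assms(1) carr zero add smult])
 show lin: "?p \<in> lin R M (quotient_module M N)"
  by (intro linear_mapsI add smult) (auto simp: carr)
 show "?p x = \<zero>[quotient_module M N] \<longleftrightarrow> x \<in> N" if "x :[M]"
  using eq[OF that M.zero_closed] that zero by (simp add: M.minus_eq)
qed

lemma quotient_lift:
 assumes "module R M" "submodule N R M" "module R L" "f \<in> lin R M L"
  "!!x. x \<in> N ==> f x = \<zero>[L]"
 obtains g where "g \<in> lin R (quotient_module M N) L"
  "!!x. x :[M] ==> g (N +>\<^bsub>M\<^esub> x) = f x"
proof -
 interpret M: module R M by fact
 interpret L: module R L by fact
 let ?Q = "quotient_module M N"
 define g where "g X = f (SOME x. x :[M] \<and> N +>\<^bsub>M\<^esub> x = X)" for X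
 have g: "g (N +>\<^bsub>M\<^esub> x) = f x" if x: "x :[M]" for x
 proof -
  define y where "y = (SOME y. y :[M] \<and> N +>\<^bsub>M\<^esub> y = N +>\<^bsub>M\<^esub> x)"
  have y: "y :[M] \<and> N +>\<^bsub>M\<^esub> y = N +>\<^bsub>M\<^esub> x"
   unfolding y_def by (rule someI[of _ x]) (use x in auto)
  then have "f (y -[M] x) = \<zero>[L]"
   using quotient_proj_eq[OF assms(1,2)] x assms(5) by auto
  then have "f y = f x"
   using y x lin_diff[OF assms(4,1,3)] L.diff_zero_iff lin_closed[OF assms(4)] by simp
  then show ?thesis by (simp add: g_def y_def)
 qed
 note q = quotient_proj_linear[OF assms(1,2)] quotient_carrier[OF assms(1,2)]
 have "g \<in> lin R ?Q L"
  using q by (intro linear_mapsI)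
   (auto simp: g lin_closed[OF assms(4)] lin_add[OF q(1), symmetric]
    lin_smult[OF q(1), symmetric] lin_add[OF assms(4)] lin_smult[OF assms(4)])
 with g that show thesis by blast
qed

lemma submodule_span:
 assumes "module R M" "B \<subseteq> carrier M"
 shows "submodule (span_module R M B) R M" and "B \<subseteq> span_module R M B"
proof -
 interpret M: module R M by fact
 let ?S = "{N. submodule N R M \<and> B \<subseteq> N}"
 have "carrier M \<in> ?S" using assms(2) M.carrier_is_submodule by auto
 then have "\<Inter>?S \<subseteq> carrier M" by (rule Inter_lower)
 then show "submodule (span_module R M B) R M"
  unfolding span_module_def
  by (intro M.submoduleI) (auto intro: submodule_zero M.submoduleE)
 show "B \<subseteq> span_module R M B"
  by (auto simp: span_module_def)
qed

lemma span_subset: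
 assumes "submodule N R M" "B \<subseteq> N" "x \<in> span_module R M B"
 shows "x \<in> N"
 using assms by (auto simp: span_module_def)

section \<open>Direct sums and free modules\<close>

lemma module_self_module:
 assumes "cring R"
 shows "module R (self_module R)"
proof -
 interpret cring R by fact
 show ?thesis
 proof (intro moduleI abelian_groupI, goal_cases)
  case (7 x)
  then have "-[R] x :[self_module R]"
    "-[R] x +[self_module R] x = \<zero>[self_module R]"
   by (auto simp: self_module_def l_neg)
  then show ?case by blast
 qed (auto simp: self_module_def a_ac l_distr r_distr m_assoc is_cring)
qed

lemma self_module_simps [simp]:
 "carrier (self_module R) = carrier R" "\<zero>[self_module R] = \<zero>[R]"
 "x +[self_module R] y = x +[R] y" "r *[self_module R] x = r **[R] x"
 by (simp_all add: self_module_def)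

lemma dsum_simps:
 "carrier (direct_sum I M) =
  {f \<in> (\<Pi>\<^sub>E i\<in>I. carrier (M i)). finite {i\<in>I. f i \<noteq> \<zero>[M i]}}"
 "\<zero>[direct_sum I M] = (\<lambda>i\<in>I. \<zero>[M i])"
 "f +[direct_sum I M] g = (\<lambda>i\<in>I. f i +[M i] g i)"
 "r *[direct_sum I M] f = (\<lambda>i\<in>I. r *[M i] f i)"
 by (simp_all add: direct_sum_def)

lemma module_direct_sum:
 assumes "cring R" "!!i. i \<in> I ==> module R (M i)"
 shows "module R (direct_sum I M)"
proof -
 have ag: "abelian_group (M i)" if "i \<in> I" for i
  using assms(2)[OF that] by (simp add: module_def)
 note am = abelian_group.axioms(1)[OF ag]
 note cl = abelian_monoid.a_closed[OF am] abelian_monoid.zero_closed[OF am]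
  abelian_group.a_inv_closed[OF ag] module.smult_closed[OF assms(2)]
 show ?thesis
 proof (intro moduleI abelian_groupI, goal_cases)
  case 1 show ?case by fact
 next
  case (2 f g)
  have "{i\<in>I. (f +[direct_sum I M] g) i \<noteq> \<zero>[M i]} \<subseteq>
    {i\<in>I. f i \<noteq> \<zero>[M i]} \<union> {i\<in>I. g i \<noteq> \<zero>[M i]}"
   using 2 by (auto simp: dsum_simps abelian_monoid.l_zero[OF am] abelian_monoid.zero_closed[OF am])
  then have fin: "finite {i\<in>I. (f +[direct_sum I M] g) i \<noteq> \<zero>[M i]}"
   by (rule finite_subset) (use 2 in "auto simp: dsum_simps")
  have "(f +[direct_sum I M] g) \<in> (\<Pi>\<^sub>E i\<in>I. carrier (M i))"
   using 2 by (auto simp: dsum_simps cl PiE_iff)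
  with fin show ?case by (simp add: dsum_simps(1))
 next
  case 3 show ?case by (auto simp: dsum_simps cl)
 next
  case (4 f g h) then show ?case
   by (auto simp: dsum_simps PiE_iff abelian_monoid.a_assoc[OF am] intro!: restrict_ext)
 next
  case (5 f g) then show ?case
   by (auto simp: dsum_simps PiE_iff abelian_monoid.a_comm[OF am] intro!: restrict_ext)
 next
  case (6 f) then show ?case
   by (auto simp: dsum_simps PiE_iff abelian_monoid.l_zero[OF am] extensional_def fun_eq_iff)
 next
  case (7 f)
  let ?g = "\<lambda>i\<in>I. -[M i] f i"
  have "{i\<in>I. ?g i \<noteq> \<zero>[M i]} \<subseteq> {i\<in>I. f i \<noteq> \<zero>[M i]}"
   by (auto simp: abelian_group.neg_zero[OF ag])
  then have "finite {i\<in>I. ?g i \<noteq> \<zero>[M i]}"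
   by (rule finite_subset) (use 7 in "auto simp: dsum_simps")
  moreover have "?g \<in> (\<Pi>\<^sub>E i\<in>I. carrier (M i))"
   using 7 by (auto simp: dsum_simps cl PiE_iff)
  ultimately have "?g :[direct_sum I M]" by (simp add: dsum_simps(1))
  moreover have "?g +[direct_sum I M] f = \<zero>[direct_sum I M]"
   using 7 by (auto simp: dsum_simps PiE_iff abelian_group.l_neg[OF ag] intro!: restrict_ext)
  ultimately show ?case by blast
 next
  case (8 r f)
  have "{i\<in>I. (r *[direct_sum I M] f) i \<noteq> \<zero>[M i]} \<subseteq> {i\<in>I. f i \<noteq> \<zero>[M i]}"
   using 8 by (auto simp: dsum_simps module.smult_r_null[OF assms(2)])
  then have fin: "finite {i\<in>I. (r *[direct_sum I M] f) i \<noteq> \<zero>[M i]}"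
   by (rule finite_subset) (use 8 in "auto simp: dsum_simps")
  have "(r *[direct_sum I M] f) \<in> (\<Pi>\<^sub>E i\<in>I. carrier (M i))"
   using 8 by (auto simp: dsum_simps cl PiE_iff)
  with fin show ?case by (simp add: dsum_simps(1))
 next
  case (9 a b x) then show ?case
   by (auto simp: dsum_simps PiE_iff module.smult_l_distr[OF assms(2)] intro!: restrict_ext)
 next
  case (10 a x y) then show ?case
   by (auto simp: dsum_simps PiE_iff module.smult_r_distr[OF assms(2)] intro!: restrict_ext)
 next
  case (11 a b x) then show ?case
   by (auto simp: dsum_simps PiE_iff module.smult_assoc1[OF assms(2)] intro!: restrict_ext)
 next
  case (12 x) then show ?case
   by (auto simp: dsum_simps PiE_iff module.smult_one[OF assms(2)] extensional_def fun_eq_iff)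
 qed
qed

lemma free_module_simps:
 "carrier (free_module R X) =
  {f \<in> (\<Pi>\<^sub>E i\<in>X. carrier R). finite {i\<in>X. f i \<noteq> \<zero>[R]}}"
 "\<zero>[free_module R X] = (\<lambda>i\<in>X. \<zero>[R])"
 "f +[free_module R X] g = (\<lambda>i\<in>X. f i +[R] g i)"
 "r *[free_module R X] f = (\<lambda>i\<in>X. r **[R] f i)"
 by (simp_all add: free_module_def dsum_simps)

context cring
begin

lemma module_free_module: "module R (free_module R X)"
 unfolding free_module_def by (intro module_direct_sum module_self_module is_cring)

lemma free_gen_closed: "x \<in> X ==> free_gen R X x :[free_module R X]"
proof -
 have "{i \<in> X. (if i = x then \<one> else \<zero>) \<noteq> \<zero>} \<subseteq> {x}" by auto
 then have "finite {i \<in> X. (if i = x then \<one> else \<zero>) \<noteq> \<zero>}"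
  by (rule finite_subset) simp
 then show "x \<in> X ==> free_gen R X x :[free_module R X]"
  by (auto simp: free_module_simps free_gen_def cong: conj_cong)
qed

text \<open>Induction on a finite set that contains the support: one coordinate is erased and
  restored as a multiple of a basis element.\<close>

lemma free_generates: "generates R (free_module R X) (free_gen R X ` X)"
 unfolding generates_def
proof (intro conjI allI impI subsetI)
 let ?F = "free_module R X"
 interpret F: module R ?F by (rule module_free_module)
 show "x :[?F]" if "x \<in> free_gen R X ` X" for x
  using that free_gen_closed by auto
 fix N w assume N: "submodule N R ?F" "free_gen R X ` X \<subseteq> N" and w: "w :[?F]"
 have "w :[?F] ==> {x \<in> X. w x \<noteq> \<zero>} \<subseteq> A ==> w \<in> N" if "finite A" for A w
  using that
 proof (induction A arbitrary: w)
  case empty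
  then have "w = \<zero>[?F]"
   by (auto simp: free_module_simps PiE_iff extensional_def fun_eq_iff)
  then show ?case using submodule_zero[OF N(1)] by simp
 next
  case (insert x A)
  show ?case
  proof (cases "x \<in> X")
   case True
   let ?v = "w(x := \<zero>)"
   have "{y \<in> X. ?v y \<noteq> \<zero>} \<subseteq> {x \<in> X. w x \<noteq> \<zero>}" by auto
   then have "finite {y \<in> X. ?v y \<noteq> \<zero>}"
    by (rule finite_subset) (use insert.prems in "auto simp: free_module_simps")
   moreover have "?v \<in> (\<Pi>\<^sub>E i\<in>X. carrier R)"
    using insert.prems True by (auto simp: free_module_simps PiE_iff extensional_def)
   ultimately have v: "?v :[?F]" by (simp add: free_module_simps(1))
   then have "?v \<in> N"
    by (intro insert.IH v) (use insert.prems in auto)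
   moreover have wx: "w x :[R]" using insert.prems True by (auto simp: free_module_simps)
   then have "w x *[?F] free_gen R X x \<in> N"
    using N True F.submoduleE(4)[OF N(1)] by auto
   ultimately have "?v +[?F] w x *[?F] free_gen R X x \<in> N"
    using F.submoduleE(5)[OF N(1)] by blast
   moreover have "?v +[?F] w x *[?F] free_gen R X x = w"
    using insert.prems(1) wx True
    by (auto simp: free_module_simps free_gen_def PiE_iff extensional_def fun_eq_iff)
   ultimately show ?thesis by simp
  next
   case False
   then show ?thesis using insert by auto
  qed
 qed
 then show "w \<in> N" using w by (auto simp: free_module_simps)
qed

end

text \<open>The sum is confined to the support because a sum over an infinite index set would be
  zero by convention. Elements with different supports are compared over a common finite
  superset.\<close>

definition free_ext ::
 "('k, 'r) ring_scheme => ('k, 'a, 'm) module_scheme => 'x set => ('x => 'a) => ('x => 'k) => 'a"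
 where "free_ext R M X f w = (\<Oplus>\<^bsub>M\<^esub>x\<in>{x\<in>X. w x \<noteq> \<zero>[R]}. w x *[M] f x)"

context module
begin

lemma free_ext_superset:
 assumes "finite A" "{x\<in>X. w x \<noteq> \<zero>} \<subseteq> A" "A \<subseteq> X" "f \<in> X \<rightarrow> carrier M" "w \<in> X \<rightarrow> carrier R"
 shows "free_ext R M X f w = (\<Oplus>\<^bsub>M\<^esub>x\<in>A. w x *[M] f x)"
 unfolding free_ext_def
proof (rule M.add.finprod_mono_neutral_cong_left[OF assms(1,2)])
 show "w i *[M] f i = \<zero>[M]" if "i \<in> A - {x \<in> X. w x \<noteq> \<zero>}" for i
 proof -
  have "w i = \<zero>" "f i :[M]" using that assms by auto
  then show ?thesis by simp
 qed
 show "(%x. w x *[M] f x) \<in> A \<rightarrow> carrier M"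
  using assms(3-5) by (auto intro!: smult_closed dest: subsetD)
qed auto

lemma free_ext_linear:
 assumes f: "f \<in> X \<rightarrow> carrier M"
 shows "free_ext R M X f \<in> lin R (free_module R X) M"
proof (intro linear_mapsI)
 let ?F = "free_module R X"
 interpret F: module R ?F by (rule module_free_module)
 let ?s = "%w. {x\<in>X. w x \<noteq> \<zero>}"
 have s: "finite (?s w)" "w \<in> X \<rightarrow> carrier R" if "w :[?F]" for w
  using that by (auto simp: free_module_simps)
 show "free_ext R M X f w :[M]" if "w :[?F]" for w
  unfolding free_ext_def using f s[OF that] by (intro M.finsum_closed) auto
 show "free_ext R M X f (v +[?F] w) = free_ext R M X f v +[M] free_ext R M X f w"
  if v: "v :[?F]" and w: "w :[?F]" for v w
 proof -
  let ?A = "?s v \<union> ?s w"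
  have fin: "finite ?A" using s v w by auto
  have "free_ext R M X f (v +[?F] w) = (\<Oplus>\<^bsub>M\<^esub>x\<in>?A. (v +[?F] w) x *[M] f x)"
   using fin s(2)[OF v] s(2)[OF w] f
   by (intro free_ext_superset) (auto simp: free_module_simps)
  also have "... = (\<Oplus>\<^bsub>M\<^esub>x\<in>?A. v x *[M] f x +[M] w x *[M] f x)"
   using s(2)[OF v] s(2)[OF w] f
   by (intro M.finsum_cong') (auto simp: free_module_simps smult_l_distr Pi_iff)
  also have "... = (\<Oplus>\<^bsub>M\<^esub>x\<in>?A. v x *[M] f x) +[M] (\<Oplus>\<^bsub>M\<^esub>x\<in>?A. w x *[M] f x)"
   using s(2)[OF v] s(2)[OF w] f by (intro M.finsum_addf) (auto simp: Pi_iff)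
  also have "(\<Oplus>\<^bsub>M\<^esub>x\<in>?A. v x *[M] f x) = free_ext R M X f v"
   using fin s(2)[OF v] f by (intro free_ext_superset[symmetric]) auto
  also have "(\<Oplus>\<^bsub>M\<^esub>x\<in>?A. w x *[M] f x) = free_ext R M X f w"
   using fin s(2)[OF w] f by (intro free_ext_superset[symmetric]) auto
  finally show ?thesis .
 qed
 show "free_ext R M X f (r *[?F] w) = r *[M] free_ext R M X f w"
  if r: "r :[R]" and w: "w :[?F]" for r w
 proof -
  have "free_ext R M X f (r *[?F] w) = (\<Oplus>\<^bsub>M\<^esub>x\<in>?s w. (r *[?F] w) x *[M] f x)"
   using s[OF w] f r by (intro free_ext_superset) (auto simp: free_module_simps)
  also have "... = (\<Oplus>\<^bsub>M\<^esub>x\<in>?s w. r *[M] (w x *[M] f x))"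
   using s(2)[OF w] f r
   by (intro M.finsum_cong') (auto simp: free_module_simps smult_assoc1 Pi_iff)
  also have "... = r *[M] free_ext R M X f w"
   unfolding free_ext_def using s[OF w] f r by (intro finsum_smult_ldistr[symmetric]) (auto simp: Pi_iff)
  finally show ?thesis .
 qed
qed

lemma free_ext_gen:
 assumes "f \<in> X \<rightarrow> carrier M" "x \<in> X"
 shows "free_ext R M X f (free_gen R X x) = f x"
proof -
 have "free_ext R M X f (free_gen R X x) = (\<Oplus>\<^bsub>M\<^esub>y\<in>{x}. free_gen R X x y *[M] f y)"
  using assms by (intro free_ext_superset) (auto simp: free_gen_def)
 moreover have "f x :[M]" using assms by auto
 ultimately show ?thesis using assms(2) by (simp add: free_gen_def)
qed

end

section \<open>Presented modules\<close>

context cring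
begin

lemma presented_lift:
 assumes "B \<subseteq> carrier (free_module R X)" "module R L" "f \<in> X \<rightarrow> carrier L"
  "!!w. w \<in> B ==> free_ext R L X f w = \<zero>[L]"
 obtains g where "g \<in> lin R (presented_module R X B) L"
  "!!x. x \<in> X ==> g (presented_gen R X B x) = f x"
proof -
 let ?F = "free_module R X"
 let ?\<phi> = "free_ext R L X f"
 have mF: "module R ?F" by (rule module_free_module)
 have \<phi>: "?\<phi> \<in> lin R ?F L" using assms by (intro module.free_ext_linear) auto
 have "?\<phi> w = \<zero>[L]" if "w \<in> span_module R ?F B" for w
  using span_subset[OF linear_preimage_submodule[OF \<phi> mF assms(2) zero_submodule[OF assms(2)]] _ that]
   assms(1,4) by auto
 from quotient_lift[OF mF submodule_span(1)[OF mF assms(1)] assms(2) \<phi> this]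
 obtain g where g: "g \<in> lin R (presented_module R X B) L"
  "!!x. x :[?F] ==> g (span_module R ?F B +>\<^bsub>?F\<^esub> x) = ?\<phi> x"
  unfolding presented_module_def by blast
 show thesis
 proof (rule that[OF g(1)])
  show "g (presented_gen R X B x) = f x" if "x \<in> X" for x
   using g(2)[OF free_gen_closed[OF that]] module.free_ext_gen[OF assms(2,3) that]
   by (simp add: presented_gen_def)
 qed
qed

lemma
 assumes "B \<subseteq> carrier (free_module R X)"
 shows module_presented: "module R (presented_module R X B)"
  and presented_gen_closed: "x \<in> X ==> presented_gen R X B x :[presented_module R X B]"
  and presented_generates: "generates R (presented_module R X B) (presented_gen R X B ` X)"
  and presented_proj_linear: "(%w. span_module R (free_module R X) B +>\<^bsub>free_module R X\<^esub> w)
   \<in> lin R (free_module R X) (presented_module R X B)"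
  and presented_proj_zero_iff: "w :[free_module R X] ==>
   span_module R (free_module R X) B +>\<^bsub>free_module R X\<^esub> w = \<zero>[presented_module R X B] \<longleftrightarrow>
   w \<in> span_module R (free_module R X) B"
  and presented_carrier: "carrier (presented_module R X B) =
   (%w. span_module R (free_module R X) B +>\<^bsub>free_module R X\<^esub> w) ` carrier (free_module R X)"
proof -
 let ?F = "free_module R X" and ?P = "presented_module R X B"
 let ?p = "%w. span_module R ?F B +>\<^bsub>?F\<^esub> w"
 have mF: "module R ?F" by (rule module_free_module)
 note q = mF submodule_span(1)[OF mF assms]
 show mP: "module R ?P"
  unfolding presented_module_def by (rule quotient_module_module[OF q])
 show p: "?p \<in> lin R ?F ?P"
  unfolding presented_module_def by (rule quotient_proj_linear[OF q])
 show carr: "carrier ?P = ?p ` carrier ?F"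
  unfolding presented_module_def by (rule quotient_carrier[OF q])
 show "w :[?F] ==> ?p w = \<zero>[?P] \<longleftrightarrow> w \<in> span_module R ?F B"
  unfolding presented_module_def by (rule quotient_proj_zero[OF q])
 show "presented_gen R X B x :[?P]" if "x \<in> X" for x
  unfolding presented_gen_def by (rule lin_closed[OF p free_gen_closed[OF that]])
 show "generates R ?P (presented_gen R X B ` X)"
  unfolding generates_def
 proof (intro conjI allI impI subsetI)
  show "y :[?P]" if "y \<in> presented_gen R X B ` X" for y
   using that by (auto simp: presented_gen_def intro!: lin_closed[OF p] free_gen_closed)
  fix N y assume N: "submodule N R ?P" "presented_gen R X B ` X \<subseteq> N" and y: "y :[?P]"
  obtain w where w: "w :[?F]" "y = ?p w" using y carr by auto
  have "w \<in> {w \<in> carrier ?F. ?p w \<in> N}"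
  proof (rule generates_subset[OF free_generates linear_preimage_submodule[OF p mF mP N(1)] _ w(1)])
   show "x \<in> {w \<in> carrier ?F. ?p w \<in> N}" if "x \<in> free_gen R X ` X" for x
    using that N(2) free_gen_closed by (auto simp: presented_gen_def)
  qed
  then show "y \<in> N" using w by simp
 qed
qed

end

context module
begin

text \<open>Additivity, homogeneity and balancing: these three shapes cover all relations that
  present tensor powers and tensor products over the ground ring and over \<open>H\<close>.\<close>

lemma free_ext_relations:
 assumes "f \<in> X \<rightarrow> carrier M" "a \<in> X" "b \<in> X"
 defines "F \<equiv> free_module R X" and "e \<equiv> free_gen R X"
 shows "c \<in> X ==> free_ext R M X f (e a -[F] (e b +[F] e c)) = f a -[M] (f b +[M] f c)"
  and "r :[R] ==> free_ext R M X f (e a -[F] r *[F] e b) = f a -[M] r *[M] f b"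
  and "free_ext R M X f (e a -[F] e b) = f a -[M] f b"
proof -
 have mF: "module R F" unfolding F_def by (rule module_free_module)
 interpret F: module R F by fact
 have l: "free_ext R M X f \<in> lin R F M"
  unfolding F_def by (rule free_ext_linear[OF assms(1)])
 have e: "e x :[F]" "free_ext R M X f (e x) = f x" if "x \<in> X" for x
  using that by (simp_all add: e_def F_def free_gen_closed free_ext_gen[OF assms(1)])
 note ll = lin_diff[OF l mF module_axioms] lin_add[OF l] lin_smult[OF l]
 show "c \<in> X ==> free_ext R M X f (e a -[F] (e b +[F] e c)) = f a -[M] (f b +[M] f c)"
  "r :[R] ==> free_ext R M X f (e a -[F] r *[F] e b) = f a -[M] r *[M] f b"
  "free_ext R M X f (e a -[F] e b) = f a -[M] f b"
  using e assms(2,3) by (auto simp: ll)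
qed

end

context cring
begin

lemma presented_relations:
 assumes "B \<subseteq> carrier (free_module R X)" "a \<in> X" "b \<in> X"
 defines "F \<equiv> free_module R X" and "e \<equiv> free_gen R X"
  and "P \<equiv> presented_module R X B" and "g \<equiv> presented_gen R X B"
 shows "[|c \<in> X; e a -[F] (e b +[F] e c) \<in> B|] ==> g a = g b +[P] g c"
  and "[|r :[R]; e a -[F] r *[F] e b \<in> B|] ==> g a = r *[P] g b"
  and "e a -[F] e b \<in> B ==> g a = g b"
proof -
 have mF: "module R F" unfolding F_def by (rule module_free_module)
 interpret F: module R F by fact
 have mP: "module R P" unfolding P_def by (rule module_presented[OF assms(1)])
 interpret P: module R P by fact
 define p where "p w = span_module R F B +>\<^bsub>F\<^esub> w" for w
 have p: "p \<in> lin R F P"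
  unfolding p_def F_def P_def by (rule presented_proj_linear[OF assms(1)])
 have e: "e x :[F]" "p (e x) = g x" "g x :[P]" if "x \<in> X" for x
  using that free_gen_closed presented_gen_closed[OF assms(1)]
  by (auto simp: e_def F_def g_def p_def presented_gen_def P_def)
 have z: "p w = \<zero>[P]" if "w \<in> B" for w
  using that submodule_span(2)[OF mF[unfolded F_def] assms(1)] assms(1) presented_proj_zero_iff[OF assms(1), of w]
  by (auto simp: p_def P_def F_def)
 note ll = lin_diff[OF p mF mP] lin_add[OF p] lin_smult[OF p]
 show "g a = g b +[P] g c" if "c \<in> X" "e a -[F] (e b +[F] e c) \<in> B"
  using z[OF that(2)] e that assms(2,3) P.diff_zero_iff by (simp add: ll)
 show "g a = r *[P] g b" if "r :[R]" "e a -[F] r *[F] e b \<in> B"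
  using z[OF that(2)] e that assms(2,3) P.diff_zero_iff by (simp add: ll)
 show "g a = g b" if "e a -[F] e b \<in> B"
  using z[OF that] e that assms(2,3) P.diff_zero_iff by (simp add: ll)
qed

end

section \<open>Bilinear maps and tensor products over the ground ring\<close>

definition bilinear ::
 "('k, 'r) ring_scheme => ('k, 'a, 'm) module_scheme => ('k, 'b, 'n) module_scheme =>
 ('k, 'c, 'o) module_scheme => ('a => 'b => 'c) => bool"
 where "bilinear R M N L \<beta> \<longleftrightarrow>
  (\<forall>x\<in>carrier M. \<beta> x \<in> lin R N L) \<and> (\<forall>y\<in>carrier N. (%x. \<beta> x y) \<in> lin R M L)"

lemma bilinearI:
 assumes "!!x. x :[M] ==> \<beta> x \<in> lin R N L"
  and "!!y. y :[N] ==> (%x. \<beta> x y) \<in> lin R M L"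
 shows "bilinear R M N L \<beta>"
 using assms by (auto simp: bilinear_def)

lemma
 assumes "bilinear R M N L \<beta>"
 shows bilinear_right: "x :[M] ==> \<beta> x \<in> lin R N L"
  and bilinear_left: "y :[N] ==> (%x. \<beta> x y) \<in> lin R M L"
  and bilinear_closed: "[|x :[M]; y :[N]|] ==> \<beta> x y :[L]"
 using assms by (auto simp: bilinear_def intro: lin_closed)

lemma bilinear_flip: "bilinear R M N L \<beta> ==> bilinear R N M L (%y x. \<beta> x y)"
 by (auto simp: bilinear_def)

lemma bilinear_linear:
 assumes "bilinear R M N L \<beta>" "f \<in> lin R L K"
 shows "bilinear R M N K (%x y. f (\<beta> x y))"
 by (intro bilinearI lin_comp[OF bilinear_right[OF assms(1)] assms(2)]
   lin_comp[OF bilinear_left[OF assms(1)] assms(2)])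

lemma bilinear_precomp:
 assumes "bilinear R M N L \<beta>" "f \<in> lin R M' M" "g \<in> lin R N' N"
 shows "bilinear R M' N' L (%x y. \<beta> (f x) (g y))"
 by (intro bilinearI lin_comp[OF assms(3) bilinear_right[OF assms(1)]]
   lin_comp[OF assms(2) bilinear_left[OF assms(1)]] lin_closed[OF assms(2)]
   lin_closed[OF assms(3)])

context cring
begin

lemma free_relation_closed:
 assumes "a \<in> X" "b \<in> X"
 defines "F \<equiv> free_module R X" and "e \<equiv> free_gen R X"
 shows "c \<in> X ==> e a -[F] (e b +[F] e c) :[F]"
  and "r :[R] ==> e a -[F] r *[F] e b :[F]"
  and "e a -[F] e b :[F]"
proof -
 interpret F: module R F unfolding F_def by (rule module_free_module)
 have e: "e x :[F]" if "x \<in> X" for x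
  using that by (simp add: F_def e_def free_gen_closed)
 show "c \<in> X ==> e a -[F] (e b +[F] e c) :[F]"
  "r :[R] ==> e a -[F] r *[F] e b :[F]"
  "e a -[F] e b :[F]"
  using e assms(1,2) by auto
qed

lemma bilinear_relations_closed:
 assumes "module R M" "module R N"
 shows "bilinear_relations R M N \<subseteq> carrier (free_module R (carrier M \<times> carrier N))"
proof -
 interpret M: module R M by fact
 interpret N: module R N by fact
 show ?thesis
  by (auto simp: bilinear_relations_def Let_def intro!: free_relation_closed)
qed

lemma bilinear_relations_zero:
 assumes "module R M" "module R N" "module R L" "bilinear R M N L \<beta>"
  "w \<in> bilinear_relations R M N"
 shows "free_ext R L (carrier M \<times> carrier N) (%(x, y). \<beta> x y) w = \<zero>[L]"
proof -
 interpret M: module R M by fact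
 interpret N: module R N by fact
 interpret L: module R L by fact
 let ?X = "carrier M \<times> carrier N"
 have c: "(%(x, y). \<beta> x y) \<in> ?X \<rightarrow> carrier L"
  using bilinear_closed[OF assms(4)] by auto
 note cl = bilinear_closed[OF assms(4)]
 note add = lin_add[OF bilinear_left[OF assms(4)]] lin_add[OF bilinear_right[OF assms(4)]]
 note smult = lin_smult[OF bilinear_left[OF assms(4)]] lin_smult[OF bilinear_right[OF assms(4)]]
 let ?F = "free_module R ?X" and ?e = "free_gen R ?X"
 from assms(5) consider
  (1) x x' y where "w = ?e (x +[M] x', y) -[?F] (?e (x, y) +[?F] ?e (x', y))"
   "x :[M]" "x' :[M]" "y :[N]"
 | (2) x y y' where "w = ?e (x, y +[N] y') -[?F] (?e (x, y) +[?F] ?e (x, y'))"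
   "x :[M]" "y :[N]" "y' :[N]"
 | (3) r x y where "w = ?e (r *[M] x, y) -[?F] r *[?F] ?e (x, y)"
   "r :[R]" "x :[M]" "y :[N]"
 | (4) r x y where "w = ?e (x, r *[N] y) -[?F] r *[?F] ?e (x, y)"
   "r :[R]" "x :[M]" "y :[N]"
  unfolding bilinear_relations_def Let_def by blast
 then show ?thesis
 proof cases
  case 1
  then show ?thesis unfolding 1(1)
   by (subst L.free_ext_relations(1)[OF c]) (simp_all add: L.diff_zero_iff cl add(1))
 next
  case 2
  then show ?thesis unfolding 2(1)
   by (subst L.free_ext_relations(1)[OF c]) (simp_all add: L.diff_zero_iff cl add(2))
 next
  case 3
  then show ?thesis unfolding 3(1)
   by (subst L.free_ext_relations(2)[OF c]) (simp_all add: L.diff_zero_iff cl smult(1))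
 next
  case 4
  then show ?thesis unfolding 4(1)
   by (subst L.free_ext_relations(2)[OF c]) (simp_all add: L.diff_zero_iff cl smult(2))
 qed
qed

text \<open>Stated for any larger set of relations, so as to cover also the tensor product over
  \<open>H\<close>, where the balancing relations are added.\<close>

lemma presented_gen_bilinear:
 assumes "module R M" "module R N" "B \<subseteq> carrier (free_module R (carrier M \<times> carrier N))"
  "bilinear_relations R M N \<subseteq> B"
 shows "bilinear R M N (presented_module R (carrier M \<times> carrier N) B)
  (%x y. presented_gen R (carrier M \<times> carrier N) B (x, y))"
proof -
 interpret M: module R M by fact
 interpret N: module R N by fact
 let ?X = "carrier M \<times> carrier N"
 note rel = presented_relations[OF assms(3)]
 show ?thesis
 proof (intro bilinearI linear_mapsI)
  fix x y y' assume "x :[M]" "y :[N]" "y' :[N]"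
  then show "presented_gen R ?X B (x, y +[N] y') =
    presented_gen R ?X B (x, y) +[presented_module R ?X B] presented_gen R ?X B (x, y')"
   by (intro rel subsetD[OF assms(4)]) (auto simp: bilinear_relations_def Let_def)
 next
  fix x r y assume "x :[M]" "r :[R]" "y :[N]"
  then show "presented_gen R ?X B (x, r *[N] y) =
    r *[presented_module R ?X B] presented_gen R ?X B (x, y)"
   by (intro rel subsetD[OF assms(4)]) (auto simp: bilinear_relations_def Let_def)
 next
  fix x x' y assume "x :[M]" "x' :[M]" "y :[N]"
  then show "presented_gen R ?X B (x +[M] x', y) =
    presented_gen R ?X B (x, y) +[presented_module R ?X B] presented_gen R ?X B (x', y)"
   by (intro rel subsetD[OF assms(4)]) (auto simp: bilinear_relations_def Let_def)
 next
  fix x r y assume "x :[M]" "r :[R]" "y :[N]"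
  then show "presented_gen R ?X B (r *[M] x, y) =
    r *[presented_module R ?X B] presented_gen R ?X B (x, y)"
   by (intro rel subsetD[OF assms(4)]) (auto simp: bilinear_relations_def Let_def)
 qed (auto intro!: presented_gen_closed[OF assms(3)])
qed

lemma
 assumes "module R M" "module R N"
 shows module_tensor_k: "module R (tensor_k R M N)"
  and tensor_k_generates:
   "generates R (tensor_k R M N) (tensor_k_gen R M N ` (carrier M \<times> carrier N))"
  and tensor_k_gen_bilinear: "bilinear R M N (tensor_k R M N) (%x y. tensor_k_gen R M N (x, y))"
proof -
 note rel = bilinear_relations_closed[OF assms]
 show "module R (tensor_k R M N)"
  unfolding tensor_k_def by (rule module_presented[OF rel])
 show "generates R (tensor_k R M N) (tensor_k_gen R M N ` (carrier M \<times> carrier N))"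
  unfolding tensor_k_def tensor_k_gen_def by (rule presented_generates[OF rel])
 show "bilinear R M N (tensor_k R M N) (%x y. tensor_k_gen R M N (x, y))"
  unfolding tensor_k_def tensor_k_gen_def by (rule presented_gen_bilinear[OF assms rel]) simp
qed

lemma tensor_k_lift:
 assumes "module R M" "module R N" "module R L" "bilinear R M N L \<beta>"
 obtains g where "g \<in> lin R (tensor_k R M N) L"
  "!!x y. [|x :[M]; y :[N]|] ==> g (tensor_k_gen R M N (x, y)) = \<beta> x y"
proof -
 have c: "(%(x, y). \<beta> x y) \<in> carrier M \<times> carrier N \<rightarrow> carrier L"
  using bilinear_closed[OF assms(4)] by auto
 from presented_lift[OF bilinear_relations_closed[OF assms(1,2)] assms(3) c
   bilinear_relations_zero[OF assms]]
 obtain g where "g \<in> lin R (tensor_k R M N) L"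
  "!!z. z \<in> carrier M \<times> carrier N ==> g (tensor_k_gen R M N z) = (%(x, y). \<beta> x y) z"
  unfolding tensor_k_def tensor_k_gen_def by blast
 then show thesis using that by force
qed

end

text \<open>\<open>T\<close> is a tensor product of \<open>H\<close> and \<open>A\<close> via \<open>c\<close>; comparing with \<^const>\<open>tensor_k\<close> avoids
 quantifying over the targets in the universal property.\<close>

definition is_tensor ::
 "('k, 'r) ring_scheme => ('k, 'h, 'm) module_scheme => ('k, 'a, 'n) module_scheme =>
 ('k, 'b, 'o) module_scheme => ('h => 'a => 'b) => bool"
 where "is_tensor R H A T c \<longleftrightarrow>
  module R H \<and> module R A \<and> module R T \<and> bilinear R H A T c \<and>
  generates R T ((%(h, a). c h a) ` (carrier H \<times> carrier A)) \<and>
  (\<exists>u\<in>lin R T (tensor_k R H A). \<forall>h\<in>carrier H. \<forall>a\<in>carrier A.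
   u (c h a) = tensor_k_gen R H A (h, a))"

text \<open>The comparison map has a fixed target, \<open>tensor_k\<close>; composing it with the
  maps out of \<open>tensor_k\<close> gives the universal property for targets of every
  type.\<close>

lemma is_tensor_lift:
 assumes "is_tensor R H A T c" "module R L" "bilinear R H A L \<beta>"
 obtains g where "g \<in> lin R T L"
  "!!h a. [|h :[H]; a :[A]|] ==> g (c h a) = \<beta> h a"
proof -
 obtain u where u: "u \<in> lin R T (tensor_k R H A)"
  "!!h a. [|h :[H]; a :[A]|] ==> u (c h a) = tensor_k_gen R H A (h, a)"
  using assms(1) by (auto simp: is_tensor_def)
 interpret L: module R L by fact
 obtain g where g: "g \<in> lin R (tensor_k R H A) L"
  "!!x y. [|x :[H]; y :[A]|] ==> g (tensor_k_gen R H A (x, y)) = \<beta> x y"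
  using L.tensor_k_lift[OF _ _ assms(2,3)] assms(1) by (auto simp: is_tensor_def)
 show thesis
  by (rule that[OF lin_comp[OF u(1) g(1)]]) (simp add: u(2) g(2))
qed

lemma is_tensor_eq:
 assumes "is_tensor R H A T c" "module R L" "f \<in> lin R T L" "g \<in> lin R T L"
  "!!h a. [|h :[H]; a :[A]|] ==> f (c h a) = g (c h a)" "x :[T]"
 shows "f x = g x"
 by (rule generates_linear_eq[of R T "(%(h, a). c h a) ` (carrier H \<times> carrier A)", OF _ assms(3,4)])
  (use assms in "auto simp: is_tensor_def")

text \<open>A choice among all solutions instead of \<open>linear_extension\<close>: the values on
  the carrier are determined anyway, and no extensionality has to be maintained when such maps are
  composed.\<close>

definition tensor_lift ::
 "('k, 'r) ring_scheme => ('k, 'h, 'm) module_scheme => ('k, 'a, 'n) module_scheme =>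
 ('k, 'b, 'o) module_scheme => ('h => 'a => 'b) => ('k, 'c, 'p) module_scheme =>
 ('h => 'a => 'c) => 'b => 'c"
 where "tensor_lift R H A T c L \<beta> = (SOME g. g \<in> lin R T L \<and>
  (\<forall>h\<in>carrier H. \<forall>a\<in>carrier A. g (c h a) = \<beta> h a))"

lemma
 assumes "is_tensor R H A T c" "module R L" "bilinear R H A L \<beta>"
 shows tensor_lift_linear: "tensor_lift R H A T c L \<beta> \<in> lin R T L"
  and tensor_lift_cons: "[|h :[H]; a :[A]|] ==> tensor_lift R H A T c L \<beta> (c h a) = \<beta> h a"
proof -
 have "\<exists>g. g \<in> lin R T L \<and> (\<forall>h\<in>carrier H. \<forall>a\<in>carrier A. g (c h a) = \<beta> h a)"
  using is_tensor_lift[OF assms] by metis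
 from someI_ex[OF this] show "tensor_lift R H A T c L \<beta> \<in> lin R T L"
  "[|h :[H]; a :[A]|] ==> tensor_lift R H A T c L \<beta> (c h a) = \<beta> h a"
  unfolding tensor_lift_def by blast+
qed

section \<open>Multilinear maps and tensor powers\<close>

definition multilinear ::
 "('k, 'r) ring_scheme => ('k, 'h, 'm) module_scheme => nat => ('k, 'c, 'o) module_scheme =>
 ('h list => 'c) => bool"
 where "multilinear R M n L f \<longleftrightarrow> f \<in> tuples M n \<rightarrow> carrier L \<and>
  (\<forall>xs ys. set xs \<union> set ys \<subseteq> carrier M \<longrightarrow> length xs + length ys + 1 = n \<longrightarrow>
   (%a. f (xs @ a # ys)) \<in> lin R M L)"

lemma Nil_in_tuples [simp]: "xs \<in> tuples M 0 \<longleftrightarrow> xs = []"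
 by (auto simp: tuples_def)

lemma Cons_in_tuples [simp]: "h # hs \<in> tuples M (Suc n) \<longleftrightarrow> h :[M] \<and> hs \<in> tuples M n"
 by (auto simp: tuples_def)

lemma tuples_SucE:
 assumes "xs \<in> tuples M (Suc n)"
 obtains h hs where "xs = h # hs" "h :[M]" "hs \<in> tuples M n"
 using assms by (cases xs) (auto simp: tuples_def)

lemma multilinear_0: "multilinear R M 0 L f \<longleftrightarrow> f [] :[L]"
 by (auto simp: multilinear_def)

text \<open>Maps out of tensor powers are constructed below by recursion on the first factor; this
  brings linearity in every slot into the same recursive form.\<close>

lemma multilinear_Suc:
 "multilinear R M (Suc n) L f \<longleftrightarrow> (\<forall>h\<in>carrier M. multilinear R M n L (%hs. f (h # hs))) \<and>
  (\<forall>hs\<in>tuples M n. (%h. f (h # hs)) \<in> lin R M L)" (is "?l = ?r")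
proof
 assume l: ?l
 then have 1: "(%a. f (xs @ a # ys)) \<in> lin R M L"
  if "set xs \<union> set ys \<subseteq> carrier M" "length xs + length ys + 1 = Suc n" for xs ys
  using that by (auto simp: multilinear_def)
 have "multilinear R M n L (%hs. f (h # hs))" if "h :[M]" for h
  using l that 1[of "h # xs" ys for xs ys] by (auto simp: multilinear_def)
 moreover have "(%h. f (h # hs)) \<in> lin R M L" if "hs \<in> tuples M n" for hs
  using 1[of "[]" hs] that by (auto simp: tuples_def)
 ultimately show ?r by blast
next
 assume r: ?r
 have "(%a. f (xs @ a # ys)) \<in> lin R M L"
  if "set xs \<union> set ys \<subseteq> carrier M" "length xs + length ys + 1 = Suc n" for xs ys
 proof (cases xs)
  case Nil
  then show ?thesis using r that by (auto simp: tuples_def)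
 next
  case (Cons x zs)
  then have "multilinear R M n L (%hs. f (x # hs))" using r that by auto
  then show ?thesis using Cons that by (auto simp: multilinear_def)
 qed
 moreover have "f \<in> tuples M (Suc n) \<rightarrow> carrier L"
 proof
  fix hs assume "hs \<in> tuples M (Suc n)"
  then show "f hs :[L]"
   by (rule tuples_SucE) (use r in "auto dest: lin_closed")
 qed
 ultimately show ?l by (auto simp: multilinear_def)
qed

lemma multilinear_closed: "[|multilinear R M n L f; hs \<in> tuples M n|] ==> f hs :[L]"
 by (auto simp: multilinear_def)

lemma multilinear_linear:
 assumes "multilinear R M n L f" "g \<in> lin R L K"
 shows "multilinear R M n K (%hs. g (f hs))"
 using assms(1) unfolding multilinear_def
 by (auto intro: lin_closed[OF assms(2)] lin_comp[OF _ assms(2)])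

context cring
begin

lemma multilinear_relations_closed:
 assumes "module R M"
 shows "multilinear_relations R M n \<subseteq> carrier (free_module R (tuples M n))"
proof -
 interpret M: module R M by fact
 show ?thesis
  by (auto simp: multilinear_relations_def Let_def tuples_def intro!: free_relation_closed)
qed

lemma multilinear_relations_zero:
 assumes "module R M" "module R L" "multilinear R M n L f" "w \<in> multilinear_relations R M n"
 shows "free_ext R L (tuples M n) f w = \<zero>[L]"
proof -
 interpret M: module R M by fact
 interpret L: module R L by fact
 have c: "f \<in> tuples M n \<rightarrow> carrier L"
  using assms(3) by (auto simp: multilinear_def)
 have t: "xs @ a # ys \<in> tuples M n"
  if "set xs \<subseteq> carrier M" "set ys \<subseteq> carrier M" "a :[M]" "length xs + length ys + 1 = n" for xs ys a
  using that by (auto simp: tuples_def)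
 have l: "(%a. f (xs @ a # ys)) \<in> lin R M L"
  if "set xs \<subseteq> carrier M" "set ys \<subseteq> carrier M" "length xs + length ys + 1 = n" for xs ys
  using that assms(3) by (auto simp: multilinear_def)
 from assms(4) consider
  (add) xs a b ys where "w = free_gen R (tuples M n) (xs @ (a +[M] b) # ys) -[free_module R (tuples M n)]
    (free_gen R (tuples M n) (xs @ a # ys) +[free_module R (tuples M n)] free_gen R (tuples M n) (xs @ b # ys))"
   "set xs \<subseteq> carrier M" "set ys \<subseteq> carrier M" "a :[M]" "b :[M]" "length xs + length ys + 1 = n"
 | (smult) xs r a ys where "w = free_gen R (tuples M n) (xs @ (r *[M] a) # ys) -[free_module R (tuples M n)]
    r *[free_module R (tuples M n)] free_gen R (tuples M n) (xs @ a # ys)"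
   "set xs \<subseteq> carrier M" "set ys \<subseteq> carrier M" "r :[R]" "a :[M]" "length xs + length ys + 1 = n"
  unfolding multilinear_relations_def Let_def by blast
 then show ?thesis
 proof cases
  case add
  have "f (xs @ (a +[M] b) # ys) = f (xs @ a # ys) +[L] f (xs @ b # ys)"
   by (rule lin_add[OF l]) (use add in auto)
  moreover have "f (xs @ a # ys) :[L]" "f (xs @ b # ys) :[L]"
   using c t add by auto
  ultimately show ?thesis
   unfolding add(1) using add t
   by (subst L.free_ext_relations(1)[OF c]) (auto simp: L.diff_zero_iff)
 next
  case smult
  have "f (xs @ (r *[M] a) # ys) = r *[L] f (xs @ a # ys)"
   by (rule lin_smult[OF l]) (use smult in auto)
  moreover have "f (xs @ a # ys) :[L]"
   using c t smult by auto
  ultimately show ?thesis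
   unfolding smult(1) using smult t
   by (subst L.free_ext_relations(2)[OF c]) (auto simp: L.diff_zero_iff)
 qed
qed

lemma
 assumes "module R M"
 shows module_tensor_power: "module R (tensor_power R M n)"
  and tensor_power_generates: "generates R (tensor_power R M n) (pure_tensor R M ` tuples M n)"
  and pure_tensor_multilinear: "multilinear R M n (tensor_power R M n) (pure_tensor R M)"
proof -
 interpret M: module R M by fact
 note rel = multilinear_relations_closed[OF assms, of n]
 show "module R (tensor_power R M n)"
  unfolding tensor_power_def by (rule module_presented[OF rel])
 have len: "length xs = n" if "xs \<in> tuples M n" for xs using that by (simp add: tuples_def)
 then have p: "pure_tensor R M xs = presented_gen R (tuples M n) (multilinear_relations R M n) xs"
  if "xs \<in> tuples M n" for xs
  using that by (simp add: pure_tensor_def)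
 then have im: "pure_tensor R M ` tuples M n =
   presented_gen R (tuples M n) (multilinear_relations R M n) ` tuples M n"
  by (intro image_cong) auto
 show "generates R (tensor_power R M n) (pure_tensor R M ` tuples M n)"
  unfolding tensor_power_def im by (rule presented_generates[OF rel])
 show "multilinear R M n (tensor_power R M n) (pure_tensor R M)"
  unfolding multilinear_def
 proof (intro conjI allI impI)
  show cl: "pure_tensor R M \<in> tuples M n \<rightarrow> carrier (tensor_power R M n)"
   unfolding tensor_power_def using presented_gen_closed[OF rel] by (auto simp: p)
  fix xs ys assume xy: "set xs \<union> set ys \<subseteq> carrier M" "length xs + length ys + 1 = n"
  then have t: "xs @ a # ys \<in> tuples M n" if "a :[M]" for a
   using that by (auto simp: tuples_def)
  show "(%a. pure_tensor R M (xs @ a # ys)) \<in> lin R M (tensor_power R M n)"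
  proof (intro linear_mapsI)
   show "pure_tensor R M (xs @ a # ys) :[tensor_power R M n]" if "a :[M]" for a
    using cl t[OF that] by auto
   show "pure_tensor R M (xs @ (a +[M] b) # ys) =
     pure_tensor R M (xs @ a # ys) +[tensor_power R M n] pure_tensor R M (xs @ b # ys)"
    if "a :[M]" "b :[M]" for a b
    unfolding p[OF t[OF that(1)]] p[OF t[OF that(2)]] p[OF t[OF M.a_closed[OF that]]] tensor_power_def
   proof (rule presented_relations(1)[OF rel])
    show "free_gen R (tuples M n) (xs @ (a +[M] b) # ys) -[free_module R (tuples M n)]
     (free_gen R (tuples M n) (xs @ a # ys) +[free_module R (tuples M n)] free_gen R (tuples M n) (xs @ b # ys))
     \<in> multilinear_relations R M n"
     using that xy unfolding multilinear_relations_def Let_def by blast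
   qed (use that t in auto)
   show "pure_tensor R M (xs @ (r *[M] a) # ys) =
     r *[tensor_power R M n] pure_tensor R M (xs @ a # ys)"
    if "r :[R]" "a :[M]" for r a
    unfolding p[OF t[OF that(2)]] p[OF t[OF M.smult_closed[OF that]]] tensor_power_def
   proof (rule presented_relations(2)[OF rel])
    show "free_gen R (tuples M n) (xs @ (r *[M] a) # ys) -[free_module R (tuples M n)]
     r *[free_module R (tuples M n)] free_gen R (tuples M n) (xs @ a # ys)
     \<in> multilinear_relations R M n"
     using that xy unfolding multilinear_relations_def Let_def by blast
   qed (use that t in auto)
  qed
 qed
qed

lemma pure_tensor_closed:
 "[|module R M; hs \<in> tuples M n|] ==> pure_tensor R M hs :[tensor_power R M n]"
 by (rule multilinear_closed[OF pure_tensor_multilinear])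

lemma tensor_power_lift:
 assumes "module R M" "module R L" "multilinear R M n L f"
 obtains g where "g \<in> lin R (tensor_power R M n) L"
  "!!hs. hs \<in> tuples M n ==> g (pure_tensor R M hs) = f hs"
proof -
 have c: "f \<in> tuples M n \<rightarrow> carrier L"
  using assms(3) by (auto simp: multilinear_def)
 have p: "pure_tensor R M xs = presented_gen R (tuples M n) (multilinear_relations R M n) xs"
  if "xs \<in> tuples M n" for xs
  using that by (auto simp: pure_tensor_def tuples_def)
 from presented_lift[OF multilinear_relations_closed[OF assms(1)] assms(2) c
   multilinear_relations_zero[OF assms]]
 obtain g where "g \<in> lin R (tensor_power R M n) L"
  "!!z. z \<in> tuples M n ==> g (presented_gen R (tuples M n) (multilinear_relations R M n) z) = f z"
  unfolding tensor_power_def by blast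
 then show thesis using that by (simp add: p)
qed

lemma tensor_power_eq:
 assumes "module R M" "module R L" "f \<in> lin R (tensor_power R M n) L"
  "g \<in> lin R (tensor_power R M n) L"
  "!!hs. hs \<in> tuples M n ==> f (pure_tensor R M hs) = g (pure_tensor R M hs)"
  "x :[tensor_power R M n]"
 shows "f x = g x"
 by (rule generates_linear_eq[OF tensor_power_generates[OF assms(1)] assms(3,4)
    module_tensor_power[OF assms(1)] assms(2) _ assms(6)]) (use assms(5) in auto)

lemma linear_extension_tensor_power:
 assumes "module R M" "module R L" "g \<in> lin R (tensor_power R M n) L"
  "!!hs. hs \<in> tuples M n ==> g (pure_tensor R M hs) = f hs" "x :[tensor_power R M n]"
 shows "linear_extension R (tensor_power R M n) L (tuples M n) (pure_tensor R M) f x = g x"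
 using linear_extension_eq[OF module_tensor_power[OF assms(1)] assms(2)
   tensor_power_generates[OF assms(1)] assms(3,4)] assms(5) by simp

end

text \<open>Prepending a factor. Via this map a tensor power is the tensor product of
  \<open>H\<close> with the previous one, which is the basis of all recursive definitions and
  inductions on tensor powers.\<close>

definition tcons ::
 "('k, 'r) ring_scheme => ('k, 'h, 'm) module_scheme => nat => 'h =>
 ('h list => 'k) set => ('h list => 'k) set"
 where "tcons R H n h = tensor_extension R H n (Suc n) (%hs. pure_tensor R H (h # hs))"

context cring
begin

text \<open>The comparison map to \<open>tensor_k\<close> exists because sending a list to the
  tensor of its head with the pure tensor of its tail is multilinear. The bracketing of a tensor
  power is thereby fixed to the right.\<close>

lemma
 assumes "module R H"
 shows tcons_pure: "[|h :[H]; hs \<in> tuples H n|] ==>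
   tcons R H n h (pure_tensor R H hs) = pure_tensor R H (h # hs)"
  and is_tensor_tcons: "is_tensor R H (tensor_power R H n) (tensor_power R H (Suc n)) (tcons R H n)"
proof -
 interpret H: module R H by fact
 let ?T = "tensor_power R H"
 note mT = module_tensor_power[OF assms]
 note ml = pure_tensor_multilinear[OF assms, of "Suc n", unfolded multilinear_Suc]
 have tc: "tcons R H n h \<in> lin R (?T n) (?T (Suc n)) \<and>
   (\<forall>hs\<in>tuples H n. tcons R H n h (pure_tensor R H hs) = pure_tensor R H (h # hs))"
  if h: "h :[H]" for h
 proof -
  have "multilinear R H n (?T (Suc n)) (%hs. pure_tensor R H (h # hs))" using ml h by blast
  then obtain g where g: "g \<in> lin R (?T n) (?T (Suc n))"
   "!!hs. hs \<in> tuples H n ==> g (pure_tensor R H hs) = pure_tensor R H (h # hs)"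
   using tensor_power_lift[OF assms mT] by metis
  have e: "tcons R H n h x = g x" if "x :[?T n]" for x
   unfolding tcons_def tensor_extension_def
   by (rule linear_extension_tensor_power[OF assms mT g that])
  have "tcons R H n h \<in> lin R (?T n) (?T (Suc n))"
   by (rule lin_cong[OF g(1) mT]) (simp add: e)
  then show ?thesis using e g(2) pure_tensor_closed[OF assms] by auto
 qed
 then show p: "[|h :[H]; hs \<in> tuples H n|] ==>
   tcons R H n h (pure_tensor R H hs) = pure_tensor R H (h # hs)" for h hs by blast
 have bil: "bilinear R H (?T n) (?T (Suc n)) (tcons R H n)"
 proof (intro bilinearI linear_mapsI)
  note lin = conjunct1[OF tc]
  have ml2: "(%h. pure_tensor R H (h # hs)) \<in> lin R H (?T (Suc n))" if "hs \<in> tuples H n" for hs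
   using ml that by blast
  interpret T: module R "?T (Suc n)" by (rule mT)
  show "tcons R H n h x :[?T (Suc n)]" if "x :[?T n]" "h :[H]" for x h
   using lin_closed[OF lin] that by auto
  show "tcons R H n h x :[?T (Suc n)]" if "h :[H]" "x :[?T n]" for x h
   using lin_closed[OF lin] that by auto
  \<comment> \<open>Linearity in the head, for a fixed tensor \<open>x\<close>, is an equality of
    linear maps in \<open>x\<close> and hence may be tested on pure tensors. The same holds for
    scalars.\<close>
  show "tcons R H n (g +[H] h) x = tcons R H n g x +[?T (Suc n)] tcons R H n h x"
   if x: "x :[?T n]" and gh: "g :[H]" "h :[H]" for x g h
  proof (rule tensor_power_eq[OF assms mT lin lin_map_add[OF lin lin mT] _ x])
   show "tcons R H n (g +[H] h) (pure_tensor R H hs) =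
    tcons R H n g (pure_tensor R H hs) +[?T (Suc n)] tcons R H n h (pure_tensor R H hs)"
    if "hs \<in> tuples H n" for hs
    using that gh lin_add[OF ml2[OF that] gh] by (simp add: p)
  qed (use gh in auto)
  show "tcons R H n (r *[H] h) x = r *[?T (Suc n)] tcons R H n h x"
   if x: "x :[?T n]" and rh: "r :[R]" "h :[H]" for x r h
  proof (rule tensor_power_eq[OF assms mT lin linear_map_smult[OF lin mT] _ x])
   show "tcons R H n (r *[H] h) (pure_tensor R H hs) =
    r *[?T (Suc n)] tcons R H n h (pure_tensor R H hs)" if "hs \<in> tuples H n" for hs
    using that rh lin_smult[OF ml2[OF that] rh] by (simp add: p)
  qed (use rh in auto)
  show "tcons R H n h (x +[?T n] y) = tcons R H n h x +[?T (Suc n)] tcons R H n h y"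
   if "h :[H]" "x :[?T n]" "y :[?T n]" for h x y
   by (rule lin_add[OF lin]) (use that in auto)
  show "tcons R H n h (r *[?T n] x) = r *[?T (Suc n)] tcons R H n h x"
   if "h :[H]" "r :[R]" "x :[?T n]" for h r x
   by (rule lin_smult[OF lin]) (use that in auto)
 qed
 have gen: "generates R (?T (Suc n)) ((%(h, a). tcons R H n h a) ` (carrier H \<times> carrier (?T n)))"
  unfolding generates_def
 proof (intro conjI allI impI subsetI)
  show "y :[?T (Suc n)]" if "y \<in> (%(h, a). tcons R H n h a) ` (carrier H \<times> carrier (?T n))" for y
   using that bilinear_closed[OF bil] by auto
  fix N y assume N: "submodule N R (?T (Suc n))"
   "(%(h, a). tcons R H n h a) ` (carrier H \<times> carrier (?T n)) \<subseteq> N" and y: "y :[?T (Suc n)]"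
  show "y \<in> N"
  proof (rule generates_subset[OF tensor_power_generates[OF assms] N(1) _ y])
   fix x assume "x \<in> pure_tensor R H ` tuples H (Suc n)"
   then obtain h hs where "x = tcons R H n h (pure_tensor R H hs)" "h :[H]" "hs \<in> tuples H n"
    by (auto elim!: tuples_SucE simp: p)
   then show "x \<in> N" using N(2) pure_tensor_closed[OF assms] by auto
  qed
 qed
 let ?K = "tensor_k R H (?T n)"
 let ?g = "tensor_k_gen R H (?T n)"
 note kb = tensor_k_gen_bilinear[OF assms mT[of n]]
 have "multilinear R H (Suc n) ?K (%hs. ?g (hd hs, pure_tensor R H (tl hs)))"
  unfolding multilinear_Suc
  using multilinear_linear[OF pure_tensor_multilinear[OF assms] bilinear_right[OF kb]]
   bilinear_left[OF kb pure_tensor_closed[OF assms]] by simp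
 from tensor_power_lift[OF assms module_tensor_k[OF assms mT] this]
 obtain u where u: "u \<in> lin R (?T (Suc n)) ?K"
  "!!hs. hs \<in> tuples H (Suc n) ==> u (pure_tensor R H hs) = ?g (hd hs, pure_tensor R H (tl hs))"
  by metis
 have "u (tcons R H n h a) = ?g (h, a)" if h: "h :[H]" and a: "a :[?T n]" for h a
  by (rule tensor_power_eq[OF assms module_tensor_k[OF assms mT]
     lin_comp[OF bilinear_right[OF bil h] u(1)] bilinear_right[OF kb h] _ a])
   (use h in "simp add: p u(2)")
 then show "is_tensor R H (?T n) (?T (Suc n)) (tcons R H n)"
  using assms mT bil gen u(1) by (auto simp: is_tensor_def)
qed

end

section \<open>Sums over lists\<close>

context module
begin

lemma list_sum_Nil [simp]: "list_sum M f [] = \<zero>[M]"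
 by (simp add: list_sum_def)

lemma list_sum_Cons:
 assumes "f x :[M]" "!!y. y \<in> set xs ==> f y :[M]"
 shows "list_sum M f (x # xs) = f x +[M] list_sum M f xs"
proof -
 have *: "{..<length (x # xs)} = insert 0 (Suc ` {..<length xs})"
  by (simp add: lessThan_Suc_eq_insert_0)
 have c: "(%j. f ((x # xs) ! j)) \<in> Suc ` {..<length xs} \<rightarrow> carrier M"
  using assms by auto
 have "list_sum M f (x # xs) = f x +[M] (\<Oplus>\<^bsub>M\<^esub>j\<in>Suc ` {..<length xs}. f ((x # xs) ! j))"
  unfolding list_sum_def * using c assms by (subst M.finsum_insert) auto
 also have "(\<Oplus>\<^bsub>M\<^esub>j\<in>Suc ` {..<length xs}. f ((x # xs) ! j)) = list_sum M f xs"
  unfolding list_sum_def using c by (subst M.finsum_reindex) auto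
 finally show ?thesis .
qed

lemma list_sum_closed:
 "(!!y. y \<in> set xs ==> f y :[M]) ==> list_sum M f xs :[M]"
 by (induction xs) (simp_all add: list_sum_Cons)

lemma list_sum_cong:
 assumes "!!y. y \<in> set xs ==> f y :[M]" "!!y. y \<in> set xs ==> f y = g y"
 shows "list_sum M f xs = list_sum M g xs"
 using assms by (induction xs) (simp_all add: list_sum_Cons)

lemma list_sum_append:
 assumes "!!y. y \<in> set xs ==> f y :[M]" "!!y. y \<in> set ys ==> f y :[M]"
 shows "list_sum M f (xs @ ys) = list_sum M f xs +[M] list_sum M f ys"
 using assms(1)
proof (induction xs)
 case Nil
 then show ?case using list_sum_closed[of ys f] assms(2) by simp
next
 case (Cons x xs)
 have "list_sum M f (x # (xs @ ys)) = f x +[M] list_sum M f (xs @ ys)"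
  using Cons.prems assms(2) by (intro list_sum_Cons) auto
 moreover have "list_sum M f (x # xs) = f x +[M] list_sum M f xs"
  using Cons.prems by (intro list_sum_Cons) auto
 moreover have "f x :[M]" "list_sum M f xs :[M]" "list_sum M f ys :[M]"
  using Cons.prems assms(2) by (auto intro: list_sum_closed)
 ultimately show ?case
  using Cons by (simp add: M.a_assoc)
qed

lemma list_sum_map:
 assumes "!!y. y \<in> set xs ==> f (g y) :[M]"
 shows "list_sum M f (map g xs) = list_sum M (%x. f (g x)) xs"
 using assms
proof (induction xs)
 case (Cons x xs)
 have "list_sum M f (g x # map g xs) = f (g x) +[M] list_sum M f (map g xs)"
  using Cons.prems by (intro list_sum_Cons) auto
 moreover have "list_sum M (%x. f (g x)) (x # xs) = f (g x) +[M] list_sum M (%x. f (g x)) xs"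
  using Cons.prems by (intro list_sum_Cons) auto
 ultimately show ?case using Cons by simp
qed simp

lemma list_sum_concat_map:
 assumes "!!x y. [|x \<in> set xs; y \<in> set (g x)|] ==> f y :[M]"
 shows "list_sum M f (concat (map g xs)) = list_sum M (%x. list_sum M f (g x)) xs"
 using assms
proof (induction xs)
 case (Cons x xs)
 have IH: "list_sum M f (concat (map g xs)) = list_sum M (%x. list_sum M f (g x)) xs"
  by (rule Cons.IH) (rule Cons.prems, auto)
 have "list_sum M f (concat (map g (x # xs))) = list_sum M f (g x) +[M] list_sum M f (concat (map g xs))"
  using Cons.prems by (simp, subst list_sum_append) auto
 also have "... = list_sum M (%x. list_sum M f (g x)) (x # xs)"
  unfolding IH using Cons.prems by (subst list_sum_Cons) (auto intro!: list_sum_closed)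
 finally show ?case .
qed simp

lemma list_sum_linear_map:
 assumes "module R N" "\<phi> \<in> lin R M N" "!!y. y \<in> set xs ==> f y :[M]"
 shows "\<phi> (list_sum M f xs) = list_sum N (%x. \<phi> (f x)) xs"
proof -
 interpret N: module R N by fact
 show ?thesis
  using assms(3) lin_zero[OF assms(2) module_axioms assms(1)]
  by (induction xs)
   (simp_all add: list_sum_Cons N.list_sum_Cons lin_closed[OF assms(2)]
    lin_add[OF assms(2)] list_sum_closed)
qed

lemma list_sum_addf:
 assumes "!!y. y \<in> set xs ==> f y :[M]" "!!y. y \<in> set xs ==> g y :[M]"
 shows "list_sum M (%x. f x +[M] g x) xs = list_sum M f xs +[M] list_sum M g xs"
 using assms
proof (induction xs)
 case (Cons x xs)
 then have "list_sum M f xs :[M]" "list_sum M g xs :[M]"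
  by (auto intro: list_sum_closed)
 with Cons show ?case by (simp add: list_sum_Cons M.a_ac)
qed simp

lemma list_sum_zero: "list_sum M (%x. \<zero>[M]) xs = \<zero>[M]"
 by (induction xs) (simp_all add: list_sum_Cons)

text \<open>Its use is the interchange of the Sweedler expansions of two independent
  elements.\<close>

lemma list_sum_commute:
 assumes "!!x y. [|x \<in> set xs; y \<in> set ys|] ==> f x y :[M]"
 shows "list_sum M (%x. list_sum M (f x) ys) xs = list_sum M (%y. list_sum M (%x. f x y) xs) ys"
 using assms
proof (induction xs)
 case Nil
 then show ?case by (simp add: list_sum_zero)
next
 case (Cons x xs)
 have "list_sum M (%y. list_sum M (%x. f x y) (x # xs)) ys =
   list_sum M (%y. f x y +[M] list_sum M (%x. f x y) xs) ys"
  using Cons.prems by (intro list_sum_cong list_sum_closed list_sum_Cons) auto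
 also have "... = list_sum M (f x) ys +[M] list_sum M (%y. list_sum M (%x. f x y) xs) ys"
  using Cons.prems by (intro list_sum_addf list_sum_closed) auto
 also have "... = list_sum M (%x. list_sum M (f x) ys) (x # xs)"
  using Cons by (subst list_sum_Cons) (auto intro: list_sum_closed)
 finally show ?case ..
qed

lemma list_sum_param_linear:
 assumes "module R L" "!!x. x \<in> set xs ==> (%z. f z x) \<in> lin R L M"
 shows "(%z. list_sum M (f z) xs) \<in> lin R L M"
 using assms(2)
proof (induction xs)
 case Nil
 then show ?case by (simp add: lin_const_zero[OF module_axioms])
next
 case (Cons x xs)
 then have "(%z. f z x +[M] list_sum M (f z) xs) \<in> lin R L M"
  by (intro lin_map_add Cons.IH module_axioms) auto
 then show ?case
 proof (rule lin_cong[OF _ assms(1)])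
  fix z assume z: "z :[L]"
  have "f z y :[M]" if "y \<in> set (x # xs)" for y
   using lin_closed[OF Cons.prems[OF that] z] .
  then show "f z x +[M] list_sum M (f z) xs = list_sum M (f z) (x # xs)"
   by (intro list_sum_Cons[symmetric]) auto
 qed
qed

end

section \<open>Sweedler calculus\<close>

lemma (in hopf_algebra) module_H: "module R H"
 by (rule module_axioms)

lemma (in hopf_algebra) module_T: "module R (tensor_power R H n)"
 by (rule module_tensor_power[OF module_H])

text \<open>Scalars can be absorbed in the left factor, so the sums of pure tensors without
  coefficients already form a submodule. This is what makes the choice in \<open>sweedler\<close>
  meaningful.\<close>

lemma (in hopf_algebra) tensor2_list_sum:
 assumes "x :[tensor_power R H 2]"
 obtains ps where "set ps \<subseteq> carrier H \<times> carrier H"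
  "x = list_sum (tensor_power R H 2) (%(a, b). pure_tensor R H [a, b]) ps"
proof -
 let ?T = "tensor_power R H 2"
 interpret T: module R ?T by (rule module_T)
 define N where "N = {x \<in> carrier ?T. \<exists>ps. set ps \<subseteq> carrier H \<times> carrier H \<and>
  x = list_sum ?T (%(a, b). pure_tensor R H [a, b]) ps}"
 have pc: "pure_tensor R H [a, b] :[?T]" if "a :[H]" "b :[H]" for a b
  by (rule pure_tensor_closed[OF module_H]) (use that in "simp add: tuples_def")
 have sm: "r *[?T] y \<in> N" if r: "r :[R]" and y: "y \<in> N" for r y
 proof -
  obtain ps where ps: "set ps \<subseteq> carrier H \<times> carrier H"
   "y = list_sum ?T (%(a, b). pure_tensor R H [a, b]) ps" "y :[?T]"
   using y by (auto simp: N_def)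
  have lb: "(%a. pure_tensor R H ([] @ a # [b])) \<in> lin R H ?T" if "b :[H]" for b
   using pure_tensor_multilinear[OF module_H, of 2, unfolded multilinear_def, THEN conjunct2,
     rule_format, of "[]" "[b]"] that by simp
  have l: "r *[?T] pure_tensor R H [a, b] = pure_tensor R H [r *[H] a, b]"
   if "a :[H]" "b :[H]" for a b
   using lin_smult[OF lb[OF that(2)] r that(1)] by simp
  have "r *[?T] y = list_sum ?T (%z. r *[?T] (%(a, b). pure_tensor R H [a, b]) z) ps"
   unfolding ps(2) using ps(1) pc
   by (intro T.list_sum_linear_map[OF module_T linear_map_smult[OF lin_id module_T r]]) auto
  also have "... = list_sum ?T (%z. (%(a, b). pure_tensor R H [a, b]) ((%(a, b). (r *[H] a, b)) z)) ps"
   using ps(1) pc l r by (intro T.list_sum_cong) auto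
  also have "... = list_sum ?T (%(a, b). pure_tensor R H [a, b]) (map (%(a, b). (r *[H] a, b)) ps)"
   using ps(1) pc r by (intro T.list_sum_map[symmetric]) auto
  finally have "r *[?T] y = list_sum ?T (%(a, b). pure_tensor R H [a, b]) (map (%(a, b). (r *[H] a, b)) ps)" .
  moreover have "set (map (%(a, b). (r *[H] a, b)) ps) \<subseteq> carrier H \<times> carrier H"
   using ps(1) r by auto
  ultimately show ?thesis using ps(3) r unfolding N_def by blast
 qed
 have "submodule N R ?T"
 proof (rule T.submoduleI)
  show "\<zero>[?T] \<in> N"
   unfolding N_def by (auto intro: exI[of _ "[]"])
  show "-[?T] y \<in> N" if y: "y \<in> N" for y
  proof -
   have "y :[?T]" using y by (simp add: N_def)
   then show ?thesis
    unfolding module_minus_eq[OF module_T \<open>y :[?T]\<close>] by (intro sm y) simp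
  qed
  show "y +[?T] z \<in> N" if "y \<in> N" "z \<in> N" for y z
  proof -
   obtain ps where ps: "set ps \<subseteq> carrier H \<times> carrier H" "y :[?T]"
    "y = list_sum ?T (%(a, b). pure_tensor R H [a, b]) ps"
    using \<open>y \<in> N\<close> unfolding N_def by blast
   obtain qs where qs: "set qs \<subseteq> carrier H \<times> carrier H" "z :[?T]"
    "z = list_sum ?T (%(a, b). pure_tensor R H [a, b]) qs"
    using \<open>z \<in> N\<close> unfolding N_def by blast
   have "list_sum ?T (%(a, b). pure_tensor R H [a, b]) (ps @ qs) = y +[?T] z"
    unfolding ps(3) qs(3) using pc ps(1) qs(1) by (intro T.list_sum_append) auto
   moreover have "set (ps @ qs) \<subseteq> carrier H \<times> carrier H" "y +[?T] z :[?T]"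
    using ps(1,2) qs(1,2) by auto
   ultimately show ?thesis
    unfolding N_def by (metis (mono_tags, lifting) mem_Collect_eq)
  qed
 qed (use sm in "auto simp: N_def")
 moreover have "y \<in> N" if "y \<in> pure_tensor R H ` tuples H 2" for y
 proof -
  from that obtain a b where ab: "a :[H]" "b :[H]" "y = pure_tensor R H [a, b]"
   by (auto simp: numeral_2_eq_2 elim!: tuples_SucE)
  have "list_sum ?T (%(a, b). pure_tensor R H [a, b]) [(a, b)] = y"
   using ab pc by (subst T.list_sum_Cons) auto
  with ab show ?thesis
   unfolding N_def using pc by (auto intro!: exI[of _ "[(a, b)]"])
 qed
 ultimately have "x \<in> N"
  using generates_subset[OF tensor_power_generates[OF module_H]] assms by blast
 with that show thesis by (auto simp: N_def)
qed

context hopf_algebra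
begin

lemma
 assumes "h :[H]"
 shows sweedler_closed: "set (sweedler R H \<Delta> h) \<subseteq> carrier H \<times> carrier H"
  and sweedler_sum: "\<Delta> h =
   list_sum (tensor_power R H 2) (%(a, b). pure_tensor R H [a, b]) (sweedler R H \<Delta> h)"
proof -
 have "\<Delta> h :[tensor_power R H 2]"
  by (rule lin_closed[OF comult_linear assms])
 then have "\<exists>ps. set ps \<subseteq> carrier H \<times> carrier H \<and>
   \<Delta> h = list_sum (tensor_power R H 2) (%(a, b). pure_tensor R H [a, b]) ps"
  using tensor2_list_sum by metis
 from someI_ex[OF this] show "set (sweedler R H \<Delta> h) \<subseteq> carrier H \<times> carrier H"
  "\<Delta> h = list_sum (tensor_power R H 2) (%(a, b). pure_tensor R H [a, b]) (sweedler R H \<Delta> h)"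
  unfolding sweedler_def by blast+
qed

text \<open>Iterated coproducts are written by nesting such sums. The expansion of the coproduct is
  an arbitrary choice; only for bilinear \<open>\<beta>\<close> does the value depend on nothing but
  \<open>\<Delta> h\<close>.\<close>

definition sw :: "('k, 'x, 'n) module_scheme => ('h => 'h => 'x) => 'h => 'x"
 where "sw M \<beta> h = list_sum M (%(a, b). \<beta> a b) (sweedler R H \<Delta> h)"

abbreviation T where "T \<equiv> tensor_power R H"

definition trilinear :: "('k, 'x, 'n) module_scheme => ('h => 'h => 'h => 'x) => bool"
 where "trilinear M \<gamma> \<longleftrightarrow> (\<forall>a\<in>carrier H. bilinear R H H M (\<gamma> a)) \<and>
  (\<forall>b\<in>carrier H. \<forall>c\<in>carrier H. (%a. \<gamma> a b c) \<in> lin R H M)"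

lemma trilinearI:
 assumes "!!b c. [|b :[H]; c :[H]|] ==> (%a. \<gamma> a b c) \<in> lin R H M"
  and "!!a c. [|a :[H]; c :[H]|] ==> (%b. \<gamma> a b c) \<in> lin R H M"
  and "!!a b. [|a :[H]; b :[H]|] ==> (%c. \<gamma> a b c) \<in> lin R H M"
 shows "trilinear M \<gamma>"
 using assms by (auto simp: trilinear_def bilinear_def)

lemma eps_closed: "h :[H] ==> \<epsilon> h :[R]"
 using lin_closed[OF counit_linear] by simp

lemma S_closed: "h :[H] ==> S h :[H]"
 by (rule lin_closed[OF antipode_linear])

lemma smult_eps_linear:
 assumes "module R M" "f \<in> lin R L H" "c :[M]"
 shows "(%z. \<epsilon> (f z) *[M] c) \<in> lin R L M"
proof -
 interpret M: module R M by fact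
 have "(%r. r *[M] c) \<in> lin R (self_module R) M"
  using assms(3) by (intro linear_mapsI) (auto simp: M.smult_l_distr M.smult_assoc1)
 from lin_comp[OF lin_comp[OF assms(2) counit_linear] this] show ?thesis .
qed

lemma mult_linear_right: "[|g :[H]; f \<in> lin R L H|] ==> (%z. g **[H] f z) \<in> lin R L H"
 by (intro linear_mapsI)
  (auto simp: lin_add[of f] lin_smult[of f] lin_closed[of f] r_distr smult_mult_right)

lemma mult_linear_left: "[|g :[H]; f \<in> lin R L H|] ==> (%z. f z **[H] g) \<in> lin R L H"
 by (intro linear_mapsI)
  (auto simp: lin_add[of f] lin_smult[of f] lin_closed[of f] l_distr smult_mult_left)

context
 fixes M :: "('k, 'x, 'n) module_scheme"
 assumes M: "module R M"
begin

interpretation M: module R M by (rule M)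

lemma sw_closed:
 assumes "h :[H]" "!!a b. [|a :[H]; b :[H]|] ==> \<beta> a b :[M]"
 shows "sw M \<beta> h :[M]"
 unfolding sw_def using assms sweedler_closed[OF assms(1)] by (intro M.list_sum_closed) auto

lemma sw_cong:
 assumes "h :[H]" "!!a b. [|a :[H]; b :[H]|] ==> \<beta> a b :[M]"
  "!!a b. [|a :[H]; b :[H]|] ==> \<beta> a b = \<gamma> a b"
 shows "sw M \<beta> h = sw M \<gamma> h"
 unfolding sw_def using assms sweedler_closed[OF assms(1)] by (intro M.list_sum_cong) auto

lemma sw_map:
 assumes "h :[H]" "module R N" "\<phi> \<in> lin R M N"
  "!!a b. [|a :[H]; b :[H]|] ==> \<beta> a b :[M]"
 shows "\<phi> (sw M \<beta> h) = sw N (%a b. \<phi> (\<beta> a b)) h"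
 unfolding sw_def using assms sweedler_closed[OF assms(1)]
 by (subst M.list_sum_linear_map[OF assms(2,3)]) (auto simp: case_prod_unfold)

lemma sw_commute:
 assumes "h :[H]" "g :[H]"
  "!!a b c d. [|a :[H]; b :[H]; c :[H]; d :[H]|] ==> \<gamma> a b c d :[M]"
 shows "sw M (%a b. sw M (%c d. \<gamma> a b c d) g) h = sw M (%c d. sw M (%a b. \<gamma> a b c d) h) g"
proof -
 have "list_sum M (%p. list_sum M (%q. \<gamma> (fst p) (snd p) (fst q) (snd q)) (sweedler R H \<Delta> g)) (sweedler R H \<Delta> h) =
   list_sum M (%q. list_sum M (%p. \<gamma> (fst p) (snd p) (fst q) (snd q)) (sweedler R H \<Delta> h)) (sweedler R H \<Delta> g)"
  using sweedler_closed[OF assms(1)] sweedler_closed[OF assms(2)]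
  by (intro M.list_sum_commute assms(3)) auto
 then show ?thesis
  unfolding sw_def case_prod_unfold .
qed

lemma sw_param_linear:
 assumes "module R L" "h :[H]"
  "!!a b. [|a :[H]; b :[H]|] ==> (%z. \<beta> z a b) \<in> lin R L M"
 shows "(%z. sw M (\<beta> z) h) \<in> lin R L M"
 unfolding sw_def using assms(3) sweedler_closed[OF assms(2)]
 by (intro M.list_sum_param_linear[OF assms(1)]) auto

text \<open>The reason why Sweedler notation is sound: a bilinear expression factors through
  \<open>T 2\<close>, so that its sum is a linear function of \<open>\<Delta> h\<close>. Identities
  between coproducts are transported to sums along this factorisation.\<close>

lemma sw_lift:
 assumes "bilinear R H H M \<beta>"
 obtains g where "g \<in> lin R (T 2) M"
  "!!a b. [|a :[H]; b :[H]|] ==> g (pure_tensor R H [a, b]) = \<beta> a b"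
  "!!h. h :[H] ==> sw M \<beta> h = g (\<Delta> h)"
proof -
 have "multilinear R H 2 M (%hs. \<beta> (hs ! 0) (hs ! 1))"
  using assms by (auto simp: numeral_2_eq_2 multilinear_Suc multilinear_0 bilinear_def
    elim!: tuples_SucE intro: lin_closed)
 from tensor_power_lift[OF module_H M this]
 obtain g where g: "g \<in> lin R (T 2) M" "!!hs. hs \<in> tuples H 2 ==> g (pure_tensor R H hs) = \<beta> (hs ! 0) (hs ! 1)"
  by metis
 have p: "g (pure_tensor R H [a, b]) = \<beta> a b" "pure_tensor R H [a, b] :[T 2]"
  if "a :[H]" "b :[H]" for a b
  using g(2)[of "[a, b]"] pure_tensor_closed[OF module_H, of "[a, b]" 2] that by (simp_all add: tuples_def)
 have "sw M \<beta> h = g (\<Delta> h)" if "h :[H]" for h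
 proof -
  interpret T: module R "T 2" by (rule module_T)
  have "g (\<Delta> h) = list_sum M (%z. g ((%(a, b). pure_tensor R H [a, b]) z)) (sweedler R H \<Delta> h)"
   unfolding sweedler_sum[OF that] using sweedler_closed[OF that] p(2)
   by (intro T.list_sum_linear_map[OF M g(1)]) auto
  also have "... = sw M \<beta> h"
   unfolding sw_def using sweedler_closed[OF that] p bilinear_closed[OF assms]
   by (intro M.list_sum_cong) auto
  finally show ?thesis ..
 qed
 with that g(1) p(1) show thesis by blast
qed

lemma sw_linear:
 assumes "bilinear R H H M \<beta>"
 shows "sw M \<beta> \<in> lin R H M"
proof -
 from sw_lift[OF assms] obtain g where g: "g \<in> lin R (T 2) M"
  "!!h. h :[H] ==> sw M \<beta> h = g (\<Delta> h)" by metis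
 show ?thesis
  by (rule lin_cong[OF lin_comp[OF comult_linear g(1)] module_H]) (simp add: g(2))
qed

lemma sw_linear':
 assumes "bilinear R H H M \<beta>" "f \<in> lin R L H"
 shows "(%z. sw M \<beta> (f z)) \<in> lin R L M"
 by (rule lin_comp[OF assms(2) sw_linear[OF assms(1)]])

text \<open>The counit and antipode axioms are restated under an arbitrary linear map
  \<open>f\<close>, because in the calculations they are applied to a part that sits deep inside a
  tensor.\<close>

lemma sw_counit_left:
 assumes "h :[H]" "f \<in> lin R H M"
 shows "sw M (%a b. \<epsilon> a *[M] f b) h = f h"
proof -
 have "f h = f (sw H (%a b. \<epsilon> a *[H] b) h)"
  using counit_left[OF assms(1)] by (simp add: sw_def)
 also have "... = list_sum M (%z. f ((%(a, b). \<epsilon> a *[H] b) z)) (sweedler R H \<Delta> h)"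
  unfolding sw_def using sweedler_closed[OF assms(1)] eps_closed
  by (intro list_sum_linear_map[OF M assms(2)]) auto
 also have "... = sw M (%a b. \<epsilon> a *[M] f b) h"
  unfolding sw_def using sweedler_closed[OF assms(1)] eps_closed
  by (intro M.list_sum_cong) (auto simp: lin_smult[OF assms(2)] intro!: lin_closed[OF assms(2)])
 finally show ?thesis ..
qed

lemma sw_counit_right:
 assumes "h :[H]" "f \<in> lin R H M"
 shows "sw M (%a b. \<epsilon> b *[M] f a) h = f h"
proof -
 have "f h = f (sw H (%a b. \<epsilon> b *[H] a) h)"
  using counit_right[OF assms(1)] by (simp add: sw_def)
 also have "... = list_sum M (%z. f ((%(a, b). \<epsilon> b *[H] a) z)) (sweedler R H \<Delta> h)"
  unfolding sw_def using sweedler_closed[OF assms(1)] eps_closed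
  by (intro list_sum_linear_map[OF M assms(2)]) auto
 also have "... = sw M (%a b. \<epsilon> b *[M] f a) h"
  unfolding sw_def using sweedler_closed[OF assms(1)] eps_closed
  by (intro M.list_sum_cong) (auto simp: lin_smult[OF assms(2)] intro!: lin_closed[OF assms(2)])
 finally show ?thesis ..
qed

lemma sw_antipode_left:
 assumes "h :[H]" "f \<in> lin R H M"
 shows "sw M (%a b. f (S a **[H] b)) h = \<epsilon> h *[M] f \<one>[H]"
proof -
 have "sw M (%a b. f (S a **[H] b)) h =
   list_sum M (%z. f ((%(a, b). S a **[H] b) z)) (sweedler R H \<Delta> h)"
  by (simp add: sw_def case_prod_unfold)
 also have "... = f (list_sum H (%(a, b). S a **[H] b) (sweedler R H \<Delta> h))"
  using sweedler_closed[OF assms(1)] S_closed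
  by (intro list_sum_linear_map[OF M assms(2), symmetric]) auto
 finally show ?thesis
  using antipode_left[OF assms(1)] lin_smult[OF assms(2) eps_closed[OF assms(1)]] by simp
qed

lemma sw_antipode_right:
 assumes "h :[H]" "f \<in> lin R H M"
 shows "sw M (%a b. f (a **[H] S b)) h = \<epsilon> h *[M] f \<one>[H]"
proof -
 have "sw M (%a b. f (a **[H] S b)) h =
   list_sum M (%z. f ((%(a, b). a **[H] S b) z)) (sweedler R H \<Delta> h)"
  by (simp add: sw_def case_prod_unfold)
 also have "... = f (list_sum H (%(a, b). a **[H] S b) (sweedler R H \<Delta> h))"
  using sweedler_closed[OF assms(1)] S_closed
  by (intro list_sum_linear_map[OF M assms(2), symmetric]) auto
 finally show ?thesis
  using antipode_right[OF assms(1)] lin_smult[OF assms(2) eps_closed[OF assms(1)]] by simp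
qed

lemma sw_one:
 assumes "bilinear R H H M \<beta>"
 shows "sw M \<beta> \<one>[H] = \<beta> \<one>[H] \<one>[H]"
proof -
 from sw_lift[OF assms] obtain g where
  "!!a b. [|a :[H]; b :[H]|] ==> g (pure_tensor R H [a, b]) = \<beta> a b"
  "!!h. h :[H] ==> sw M \<beta> h = g (\<Delta> h)" by metis
 then show ?thesis by (simp add: comult_one)
qed

end

lemma pure2_closed: "[|a :[H]; b :[H]|] ==> pure_tensor R H [a, b] :[T 2]"
 by (rule pure_tensor_closed[OF module_H]) (simp add: tuples_def)

lemma pure3_closed:
 "[|a :[H]; b :[H]; c :[H]|] ==> pure_tensor R H [a, b, c] :[T 3]"
 by (rule pure_tensor_closed[OF module_H]) (simp add: tuples_def)

lemma sw_mult:
 assumes M: "module R M" and "g :[H]" "h :[H]" "bilinear R H H M \<beta>"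
 shows "sw M \<beta> (g **[H] h) = sw M (%a b. sw M (%c d. \<beta> (a **[H] c) (b **[H] d)) h) g"
proof -
 from sw_lift[OF M assms(4)] obtain \<phi> where \<phi>: "\<phi> \<in> lin R (T 2) M"
  "!!a b. [|a :[H]; b :[H]|] ==> \<phi> (pure_tensor R H [a, b]) = \<beta> a b"
  "!!h. h :[H] ==> sw M \<beta> h = \<phi> (\<Delta> h)" by metis
 have "sw M \<beta> (g **[H] h) =
   \<phi> (sw (T 2) (%a b. sw (T 2) (%c d. pure_tensor R H [a **[H] c, b **[H] d]) h) g)"
  using comult_mult[OF assms(2,3)] \<phi>(3) assms(2,3) by (simp add: sw_def)
 also have "... = sw M (%a b. \<phi> (sw (T 2) (%c d. pure_tensor R H [a **[H] c, b **[H] d]) h)) g"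
  using assms(2,3) by (intro sw_map[OF module_T _ M \<phi>(1)] sw_closed[OF module_T] pure2_closed) auto
 also have "... = sw M (%a b. sw M (%c d. \<beta> (a **[H] c) (b **[H] d)) h) g"
 proof (rule sw_cong[OF M assms(2)])
  fix a b assume ab: "a :[H]" "b :[H]"
  show "\<phi> (sw (T 2) (%c d. pure_tensor R H [a **[H] c, b **[H] d]) h) :[M]"
   using ab assms(3) by (intro lin_closed[OF \<phi>(1)] sw_closed[OF module_T] pure2_closed) auto
  have "\<phi> (sw (T 2) (%c d. pure_tensor R H [a **[H] c, b **[H] d]) h) =
    sw M (%c d. \<phi> (pure_tensor R H [a **[H] c, b **[H] d])) h"
   using ab assms(3) by (intro sw_map[OF module_T _ M \<phi>(1)] pure2_closed) auto
  also have "... = sw M (%c d. \<beta> (a **[H] c) (b **[H] d)) h"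
   using ab assms(3) \<phi>(2) by (intro sw_cong[OF M] lin_closed[OF \<phi>(1)] pure2_closed) auto
  finally show "\<phi> (sw (T 2) (%c d. pure_tensor R H [a **[H] c, b **[H] d]) h) =
    sw M (%c d. \<beta> (a **[H] c) (b **[H] d)) h" .
 qed
 finally show ?thesis .
qed

text \<open>The axiom lives in \<open>T 3\<close>. A trilinear expression factors through
  \<open>T 3\<close>, and the factorising map is moved out of one pair of nested sums and into the
  other.\<close>

lemma sw_coassoc:
 assumes M: "module R M" and h: "h :[H]" and tri: "trilinear M \<gamma>"
 shows "sw M (%a b. sw M (%c d. \<gamma> c d b) a) h = sw M (%a b. sw M (%c d. \<gamma> a c d) b) h"
proof -
 have "multilinear R H 3 M (%hs. \<gamma> (hs ! 0) (hs ! 1) (hs ! 2))"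
  using tri by (auto simp: numeral_2_eq_2 numeral_3_eq_3 multilinear_Suc multilinear_0 bilinear_def trilinear_def
    elim!: tuples_SucE intro: lin_closed)
 from tensor_power_lift[OF module_H M this]
 obtain \<phi> where \<phi>: "\<phi> \<in> lin R (T 3) M"
  "!!hs. hs \<in> tuples H 3 ==> \<phi> (pure_tensor R H hs) = \<gamma> (hs ! 0) (hs ! 1) (hs ! 2)" by metis
 have p: "\<phi> (pure_tensor R H [a, b, c]) = \<gamma> a b c"
  if "a :[H]" "b :[H]" "c :[H]" for a b c
  using \<phi>(2)[of "[a, b, c]"] that by (simp add: tuples_def)
 have cl: "\<gamma> a b c :[M]" if "a :[H]" "b :[H]" "c :[H]" for a b c
  using tri that by (auto simp: trilinear_def bilinear_def intro: lin_closed)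
 have "sw M (%a b. sw M (%c d. \<gamma> c d b) a) h = sw M (%a b. \<phi> (sw (T 3) (%c d. pure_tensor R H [c, d, b]) a)) h"
 proof (rule sw_cong[OF M h])
  fix a b assume ab: "a :[H]" "b :[H]"
  show "sw M (%c d. \<gamma> c d b) a :[M]"
   using ab cl by (intro sw_closed[OF M]) auto
  have "\<phi> (sw (T 3) (%c d. pure_tensor R H [c, d, b]) a) = sw M (%c d. \<phi> (pure_tensor R H [c, d, b])) a"
   using ab by (intro sw_map[OF module_T _ M \<phi>(1)] pure3_closed) auto
  also have "... = sw M (%c d. \<gamma> c d b) a"
   using ab p by (intro sw_cong[OF M] lin_closed[OF \<phi>(1)] pure3_closed) auto
  finally show "sw M (%c d. \<gamma> c d b) a = \<phi> (sw (T 3) (%c d. pure_tensor R H [c, d, b]) a)" ..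
 qed
 also have "... = \<phi> (sw (T 3) (%a b. sw (T 3) (%c d. pure_tensor R H [c, d, b]) a) h)"
  using h by (intro sw_map[OF module_T _ M \<phi>(1), symmetric] sw_closed[OF module_T] pure3_closed) auto
 also have "sw (T 3) (%a b. sw (T 3) (%c d. pure_tensor R H [c, d, b]) a) h =
   sw (T 3) (%a b. sw (T 3) (%c d. pure_tensor R H [a, c, d]) b) h"
  using coassoc[OF h] by (simp add: sw_def)
 also have "\<phi> ... = sw M (%a b. \<phi> (sw (T 3) (%c d. pure_tensor R H [a, c, d]) b)) h"
  using h by (intro sw_map[OF module_T _ M \<phi>(1)] sw_closed[OF module_T] pure3_closed) auto
 also have "... = sw M (%a b. sw M (%c d. \<gamma> a c d) b) h"
 proof (rule sw_cong[OF M h])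
  fix a b assume ab: "a :[H]" "b :[H]"
  show "\<phi> (sw (T 3) (%c d. pure_tensor R H [a, c, d]) b) :[M]"
   using ab by (intro lin_closed[OF \<phi>(1)] sw_closed[OF module_T] pure3_closed) auto
  have "\<phi> (sw (T 3) (%c d. pure_tensor R H [a, c, d]) b) = sw M (%c d. \<phi> (pure_tensor R H [a, c, d])) b"
   using ab by (intro sw_map[OF module_T _ M \<phi>(1)] pure3_closed) auto
  also have "... = sw M (%c d. \<gamma> a c d) b"
   using ab p by (intro sw_cong[OF M] lin_closed[OF \<phi>(1)] pure3_closed) auto
  finally show "\<phi> (sw (T 3) (%c d. pure_tensor R H [a, c, d]) b) = sw M (%c d. \<gamma> a c d) b" .
 qed
 finally show ?thesis .
qed

end

section \<open>Cocommutativity\<close>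

locale cocommutative_hopf_algebra = hopf_algebra R H \<Delta> \<epsilon> S
 for R :: "('k, 'r) ring_scheme" and H :: "('k, 'h, 'm) module_scheme"
  and \<Delta> :: "'h => ('h list => 'k) set" and \<epsilon> :: "'h => 'k" and S :: "'h => 'h" +
 assumes cocommutative: "cocommutative R H \<Delta>"
begin

lemma sw_cocomm:
 assumes M: "module R M" and h: "h :[H]" and bil: "bilinear R H H M \<beta>"
 shows "sw M \<beta> h = sw M (%a b. \<beta> b a) h"
proof -
 from sw_lift[OF M bil] obtain \<phi> where \<phi>: "\<phi> \<in> lin R (T 2) M"
  "!!a b. [|a :[H]; b :[H]|] ==> \<phi> (pure_tensor R H [a, b]) = \<beta> a b"
  "!!h. h :[H] ==> sw M \<beta> h = \<phi> (\<Delta> h)" by metis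
 have "sw M \<beta> h = \<phi> (sw (T 2) (%a b. pure_tensor R H [b, a]) h)"
  using cocommutative h \<phi>(3)[OF h] by (simp add: cocommutative_def sw_def)
 also have "... = sw M (%a b. \<phi> (pure_tensor R H [b, a])) h"
  using h by (intro sw_map[OF module_T _ M \<phi>(1)] pure2_closed) auto
 also have "... = sw M (%a b. \<beta> b a) h"
  using h \<phi>(2) by (intro sw_cong[OF M] lin_closed[OF \<phi>(1)] pure2_closed) auto
 finally show ?thesis .
qed

text \<open>Coassociativity regroups the three parts so that the first two come from one coproduct;
  there they are exchanged, and the regrouping is undone.\<close>

lemma sw_cocomm3:
 assumes M: "module R M" and h: "h :[H]" and tri: "trilinear M \<gamma>"
 shows "sw M (%a b. sw M (%c d. \<gamma> a c d) b) h = sw M (%a b. sw M (%c d. \<gamma> c a d) b) h"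
proof -
 have cl: "\<gamma> a b c :[M]" if "a :[H]" "b :[H]" "c :[H]" for a b c
  using tri that by (auto simp: trilinear_def bilinear_def intro: lin_closed)
 have tri': "trilinear M (%a b c. \<gamma> b a c)"
  using tri by (intro trilinearI) (auto simp: trilinear_def bilinear_def)
 have "sw M (%a b. sw M (%c d. \<gamma> a c d) b) h = sw M (%a b. sw M (%c d. \<gamma> c d b) a) h"
  by (rule sw_coassoc[OF M h tri, symmetric])
 also have "... = sw M (%a b. sw M (%c d. \<gamma> d c b) a) h"
 proof (rule sw_cong[OF M h])
  fix a b assume ab: "a :[H]" "b :[H]"
  show "sw M (%c d. \<gamma> c d b) a :[M]"
   using ab cl by (intro sw_closed[OF M]) auto
  show "sw M (%c d. \<gamma> c d b) a = sw M (%c d. \<gamma> d c b) a"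
   using tri ab by (intro sw_cocomm[OF M]) (auto simp: trilinear_def bilinear_def)
 qed
 also have "... = sw M (%a b. sw M (%c d. \<gamma> c a d) b) h"
  by (rule sw_coassoc[OF M h tri'])
 finally show ?thesis .
qed

end

lemma foldSetD_cong:
 "(A, y) \<in> foldSetD D f e ==> (!!x. x \<in> A ==> f x = g x) ==> (A, y) \<in> foldSetD D g e"
proof (induction rule: foldSetD.induct)
 case emptyI
 from emptyI(1) show ?case by (rule foldSetD.emptyI)
next
 case (insertI x A y)
 have "(insert x A, g x y) \<in> foldSetD D g e"
  using insertI by (intro foldSetD.insertI) auto
 then show ?case using insertI.prems[of x] by simp
qed

text \<open>No closedness of the values enters, since the graph of the fold depends only on the
  values on \<open>A\<close>. Summands can therefore be rewritten before they are known to lie in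
  the carrier.\<close>

lemma finsum_strong_cong:
 assumes "!!i. i \<in> A ==> f i = g i"
 shows "finsum M f A = finsum M g A"
proof -
 have "(A, y) \<in> foldSetD (carrier M) (add M \<circ> f) \<zero>[M] \<longleftrightarrow> (A, y) \<in> foldSetD (carrier M) (add M \<circ> g) \<zero>[M]" for y
  by (intro iffI; erule foldSetD_cong) (simp_all add: assms)
 then show ?thesis
  by (simp add: finsum_def finprod_def foldD_def)
qed

lemma list_sum_strong_cong:
 "(!!x. x \<in> set xs ==> f x = g x) ==> list_sum M f xs = list_sum M g xs"
 unfolding list_sum_def by (intro finsum_strong_cong) simp

text \<open>Linear maps that agree on generators are equal, so a lift inherits linear dependence on
  a parameter from the bilinear maps that define it. This provides bilinearity of all maps that are
  defined by recursion with an accumulating parameter.\<close>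

lemma tensor_lift_bilinear:
 assumes t: "is_tensor R H A V c" and L: "module R L" and K: "module R K"
  and bil: "!!a. a :[K] ==> bilinear R H A L (\<Gamma> a)"
  and lin: "!!h t. [|h :[H]; t :[A]|] ==> (%a. \<Gamma> a h t) \<in> lin R K L"
 shows "bilinear R K V L (%a. tensor_lift R H A V c L (\<Gamma> a))"
proof (intro bilinearI)
 interpret K: module R K by fact
 interpret L: module R L by fact
 let ?l = "tensor_lift R H A V c L"
 show l: "?l (\<Gamma> a) \<in> lin R V L" if "a :[K]" for a
  by (rule tensor_lift_linear[OF t L bil[OF that]])
 note lc = tensor_lift_cons[OF t L bil]
 fix x assume x: "x :[V]"
 show "(%a. ?l (\<Gamma> a) x) \<in> lin R K L"
 proof (intro linear_mapsI)
  show "?l (\<Gamma> a) x :[L]" if "a :[K]" for a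
   using lin_closed[OF l[OF that] x] .
  show "?l (\<Gamma> (a +[K] b)) x = ?l (\<Gamma> a) x +[L] ?l (\<Gamma> b) x"
   if ab: "a :[K]" "b :[K]" for a b
   by (rule is_tensor_eq[OF t L l lin_map_add[OF l l L] _ x])
    (use ab in "simp_all add: lc lin_add[OF lin]")
  show "?l (\<Gamma> (r *[K] a)) x = r *[L] ?l (\<Gamma> a) x"
   if ra: "r :[R]" "a :[K]" for r a
   by (rule is_tensor_eq[OF t L l linear_map_smult[OF l L] _ x])
    (use ra in "simp_all add: lc lin_smult[OF lin]")
 qed
qed

section \<open>Maps on tensor powers by recursion on the first factor\<close>

context hopf_algebra
begin

text \<open>As a congruence rule it lets the simplifier work under Sweedler sums. Closedness of the
  two parts is offered under the guard that \<open>h'\<close> lies in \<open>H\<close>, so the rule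
  itself has no side condition.\<close>

lemma sw_strong_cong [cong]:
 assumes "h = h'" "!!a b. [|h' :[H] ==> a :[H]; h' :[H] ==> b :[H]|] ==> \<beta> a b = \<gamma> a b"
 shows "sw M \<beta> h = sw M \<gamma> h'"
 unfolding sw_def assms(1) using sweedler_closed[of h'] assms(2)
 by (intro list_sum_strong_cong) fastforce

lemmas hopf_closed [simp] = eps_closed S_closed module_T module_H

abbreviation tc where "tc \<equiv> tcons R H"

lemma T_tensor: "is_tensor R H (T n) (T (Suc n)) (tc n)"
 by (rule is_tensor_tcons[OF module_H])

lemma tc_bilinear: "bilinear R H (T n) (T (Suc n)) (tc n)"
 using T_tensor by (simp add: is_tensor_def)

lemma tc_closed [simp]: "[|h :[H]; t :[T n]|] ==> tc n h t :[T (Suc n)]"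
 by (rule bilinear_closed[OF tc_bilinear])

lemma pure_Nil_closed [simp]: "pure_tensor R H [] :[T 0]"
 by (rule pure_tensor_closed[OF module_H]) simp

lemma
 assumes "bilinear R H K L B"
 shows bilinear_comp_right: "[|h :[H]; f \<in> lin R N K|] ==> (%z. B h (f z)) \<in> lin R N L"
  and bilinear_comp_left: "[|t :[K]; f' \<in> lin R N H|] ==> (%z. B (f' z) t) \<in> lin R N L"
  and bilinear_sw: "[|module R K; module R L; h :[H]; g :[H];
    !!a b. [|a :[H]; b :[H]|] ==> \<beta> a b :[K]|] ==>
   B h (sw K \<beta> g) = sw L (%a b. B h (\<beta> a b)) g"
  and bilinear_eps: "[|r :[R]; h :[H]; t :[K]|] ==> B h (r *[K] t) = r *[L] B h t"
  and bilinear_eps': "[|r :[R]; h :[H]; t :[K]|] ==> B (r *[H] h) t = r *[L] B h t"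
proof -
 show "[|h :[H]; f \<in> lin R N K|] ==> (%z. B h (f z)) \<in> lin R N L"
  by (rule lin_comp[OF _ bilinear_right[OF assms]])
 show "[|t :[K]; f' \<in> lin R N H|] ==> (%z. B (f' z) t) \<in> lin R N L"
  by (rule lin_comp[OF _ bilinear_left[OF assms]])
 show "B h (sw K \<beta> g) = sw L (%a b. B h (\<beta> a b)) g"
  if "module R K" "module R L" "h :[H]" "g :[H]"
   "!!a b. [|a :[H]; b :[H]|] ==> \<beta> a b :[K]"
  by (rule sw_map[OF that(1,4,2) bilinear_right[OF assms that(3)] that(5)])
 show "[|r :[R]; h :[H]; t :[K]|] ==> B h (r *[K] t) = r *[L] B h t"
  by (rule lin_smult[OF bilinear_right[OF assms]])
 show "[|r :[R]; h :[H]; t :[K]|] ==> B (r *[H] h) t = r *[L] B h t"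
  by (rule lin_smult[OF bilinear_left[OF assms]])
qed

lemmas tc_linear = bilinear_comp_right[OF tc_bilinear] bilinear_comp_left[OF tc_bilinear]
lemmas tc_sw = bilinear_sw[OF tc_bilinear module_T module_T]
lemmas tc_smult = bilinear_eps[OF tc_bilinear] bilinear_eps'[OF tc_bilinear]

lemma S_linear: "f \<in> lin R L H ==> (%z. S (f z)) \<in> lin R L H"
 by (rule lin_comp[OF _ antipode_linear])

lemmas smult_T_linear = linear_map_smult[OF _ module_T]
lemmas smult_eps_T_linear = smult_eps_linear[OF module_T]
lemmas sw_T_linear = sw_param_linear[OF module_T] sw_linear'[OF module_T] sw_linear[OF module_T]
lemmas sw_T_closed = sw_closed[OF module_T]

text \<open>The linear map with prescribed values on head and tail. Inside this locale the name
  hides the tail of a list.\<close>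

definition tl :: "nat => ('k, 'x, 'n) module_scheme => ('h => ('h list => 'k) set => 'x) =>
  ('h list => 'k) set => 'x"
 where "tl n L \<beta> = tensor_lift R H (T n) (T (Suc n)) (tc n) L \<beta>"

lemma
 assumes "module R L" "bilinear R H (T n) L \<beta>"
 shows tl_linear: "tl n L \<beta> \<in> lin R (T (Suc n)) L"
  and tl_tc: "[|h :[H]; t :[T n]|] ==> tl n L \<beta> (tc n h t) = \<beta> h t"
 unfolding tl_def using tensor_lift_linear[OF T_tensor assms] tensor_lift_cons[OF T_tensor assms] by auto

lemma T_eqI:
 assumes "x :[T (Suc n)]" "module R L" "f \<in> lin R (T (Suc n)) L"
  "g \<in> lin R (T (Suc n)) L"
  "!!h t. [|h :[H]; t :[T n]|] ==> f (tc n h t) = g (tc n h t)"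
 shows "f x = g x"
 by (rule is_tensor_eq[OF T_tensor assms(2-5,1)])

lemma T0_eqI:
 assumes "x :[T 0]" "module R L" "f \<in> lin R (T 0) L" "g \<in> lin R (T 0) L"
  "f (pure_tensor R H []) = g (pure_tensor R H [])"
 shows "f x = g x"
 by (rule tensor_power_eq[OF module_H assms(2-4) _ assms(1)]) (use assms(5) in auto)

lemma tl_bilinear:
 assumes "module R L" "module R K" "!!a. a :[K] ==> bilinear R H (T n) L (\<Gamma> a)"
  "!!h t. [|h :[H]; t :[T n]|] ==> (%a. \<Gamma> a h t) \<in> lin R K L"
 shows "bilinear R K (T (Suc n)) L (%a. tl n L (\<Gamma> a))"
 unfolding tl_def by (rule tensor_lift_bilinear[OF T_tensor assms])

lemmas lin_intros = bilinearI lin_id tc_linear mult_linear_left mult_linear_right S_linear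
 smult_eps_T_linear smult_T_linear sw_T_linear sw_T_closed

text \<open>The diagonal action of \<open>H\<close> on its tensor powers.\<close>

primrec act :: "nat => 'h => ('h list => 'k) set => ('h list => 'k) set"
 where "act 0 = (%a t. \<epsilon> a *[T 0] t)"
 | "act (Suc n) = (%a. tl n (T (Suc n)) (%h t. sw (T (Suc n)) (%x y. tc n (x **[H] h) (act n y t)) a))"

text \<open>Bilinearity has to come before the computation rule: a lift takes the prescribed values
  only if the data are bilinear, and these contain the map of the previous stage. The same order
  recurs for the other recursively defined operations.\<close>

lemma act_bilinear: "bilinear R H (T n) (T n) (act n)"
proof (induction n)
 case 0
 show ?case by (simp, intro lin_intros) simp_all
next
 case (Suc n)
 note [simp] = bilinear_closed[OF Suc]
 note lin = bilinear_comp_left[OF Suc] bilinear_comp_right[OF Suc]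
 show ?case
  unfolding act.simps by (intro tl_bilinear lin_intros lin) simp_all
qed

lemmas act_linear = bilinear_comp_right[OF act_bilinear] bilinear_comp_left[OF act_bilinear]
lemmas act_sw = bilinear_sw[OF act_bilinear module_T module_T]

lemma act_closed [simp]: "[|h :[H]; t :[T n]|] ==> act n h t :[T n]"
 by (rule bilinear_closed[OF act_bilinear])

lemma act_tc [simp]:
 assumes "a :[H]" "h :[H]" "t :[T n]"
 shows "act (Suc n) a (tc n h t) = sw (T (Suc n)) (%x y. tc n (x **[H] h) (act n y t)) a"
 unfolding act.simps using assms by (subst tl_tc) (intro lin_intros act_linear | simp)+

text \<open>\<open>F n a (h\<^sub>1 \<otimes> ... \<otimes> h\<^sub>n) = a \<otimes> a h\<^sub>1 \<otimes> a h\<^sub>1 h\<^sub>2 \<otimes> ...\<close> passes from the bar construction to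
 homogeneous coordinates.\<close>

primrec F :: "nat => 'h => ('h list => 'k) set => ('h list => 'k) set"
 where "F 0 = tc 0"
 | "F (Suc n) = (%a. tl n (T (Suc (Suc n)))
   (%h t. sw (T (Suc (Suc n))) (%x y. tc (Suc n) x (F n (y **[H] h) t)) a))"

lemma F_bilinear: "bilinear R H (T n) (T (Suc n)) (F n)"
proof (induction n)
 case 0
 show ?case by (simp add: tc_bilinear)
next
 case (Suc n)
 note [simp] = bilinear_closed[OF Suc]
 note lin = bilinear_comp_left[OF Suc] bilinear_comp_right[OF Suc]
 show ?case
  unfolding F.simps by (intro tl_bilinear lin_intros lin) simp_all
qed

lemmas F_linear = bilinear_comp_right[OF F_bilinear] bilinear_comp_left[OF F_bilinear]
lemmas F_sw = bilinear_sw[OF F_bilinear module_T module_T]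

lemma F_closed [simp]: "[|h :[H]; t :[T n]|] ==> F n h t :[T (Suc n)]"
 by (rule bilinear_closed[OF F_bilinear])

lemma F_tc [simp]:
 assumes "a :[H]" "h :[H]" "t :[T n]"
 shows "F (Suc n) a (tc n h t) = sw (T (Suc (Suc n))) (%x y. tc (Suc n) x (F n (y **[H] h) t)) a"
 unfolding F.simps using assms by (subst tl_tc) (intro lin_intros F_linear | simp)+

text \<open>The parameter \<open>z\<close> is the factor that stands before the tensor: the value on
  \<open>g\<^sub>1 \<otimes> ... \<otimes> g\<^sub>n\<close> is the sum of \<open>S(z)
  g\<^sub>1\<^sup>(\<^sup>1\<^sup>) \<otimes> S(g\<^sub>1\<^sup>(\<^sup>2\<^sup>))
  g\<^sub>2\<^sup>(\<^sup>1\<^sup>) \<otimes> ...\<close>. The second part of the last factor is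
  left over and removed by the counit.\<close>

primrec P :: "nat => 'h => ('h list => 'k) set => ('h list => 'k) set"
 where "P 0 = (%z t. \<epsilon> z *[T 0] t)"
 | "P (Suc n) = (%z. tl n (T (Suc n)) (%g t. sw (T (Suc n)) (%x y. tc n (S z **[H] x) (P n y t)) g))"

lemma P_bilinear: "bilinear R H (T n) (T n) (P n)"
proof (induction n)
 case 0
 show ?case by (simp, intro lin_intros) simp_all
next
 case (Suc n)
 note [simp] = bilinear_closed[OF Suc]
 note lin = bilinear_comp_left[OF Suc] bilinear_comp_right[OF Suc]
 show ?case
  unfolding P.simps by (intro tl_bilinear lin_intros lin) simp_all
qed

lemmas P_linear = bilinear_comp_right[OF P_bilinear] bilinear_comp_left[OF P_bilinear]
lemmas P_sw = bilinear_sw[OF P_bilinear module_T module_T]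

lemma P_closed [simp]: "[|h :[H]; t :[T n]|] ==> P n h t :[T n]"
 by (rule bilinear_closed[OF P_bilinear])

lemma P_tc [simp]:
 assumes "z :[H]" "g :[H]" "t :[T n]"
 shows "P (Suc n) z (tc n g t) = sw (T (Suc n)) (%x y. tc n (S z **[H] x) (P n y t)) g"
 unfolding P.simps using assms by (subst tl_tc) (intro lin_intros P_linear | simp)+

text \<open>The projection from homogeneous coordinates to the bar complex, the coinvariants of the
 diagonal action: \<open>g\<^sub>0 \<otimes> ... \<otimes> g\<^sub>n \<mapsto> S(g\<^sub>0) g\<^sub>1 \<otimes> S(g\<^sub>1) g\<^sub>2 \<otimes> ...\<close>\<close>

definition \<pi> :: "nat => ('h list => 'k) set => ('h list => 'k) set"
 where "\<pi> n = tl n (T n) (P n)"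

lemma \<pi>_linear: "\<pi> n \<in> lin R (T (Suc n)) (T n)"
 unfolding \<pi>_def by (intro tl_linear P_bilinear) simp

lemma \<pi>_closed [simp]: "t :[T (Suc n)] ==> \<pi> n t :[T n]"
 by (rule lin_closed[OF \<pi>_linear])

lemma \<pi>_tc [simp]: "[|g :[H]; t :[T n]|] ==> \<pi> n (tc n g t) = P n g t"
 unfolding \<pi>_def by (subst tl_tc) (simp_all add: P_bilinear)

lemmas \<pi>_comp = lin_comp[OF _ \<pi>_linear]

text \<open>This is face 0 both of the homogeneous object and of the bar complex.\<close>

definition e0 :: "nat => ('h list => 'k) set => ('h list => 'k) set"
 where "e0 n = tl n (T n) (%h t. \<epsilon> h *[T n] t)"

lemma smult_eps_bilinear: "bilinear R H (T n) (T n) (%h t. \<epsilon> h *[T n] t)"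
 by (intro lin_intros) simp_all

lemma e0_linear: "e0 n \<in> lin R (T (Suc n)) (T n)"
 unfolding e0_def by (intro tl_linear smult_eps_bilinear) simp

lemma e0_tc [simp]: "[|g :[H]; t :[T n]|] ==> e0 n (tc n g t) = \<epsilon> g *[T n] t"
 unfolding e0_def by (subst tl_tc) (simp_all add: smult_eps_bilinear)

text \<open>The faces of the homogeneous object: the counit is applied to factor \<open>i\<close>,
  counted from 0. An index beyond the last factor counts as the last one, so linearity and
  equivariance hold for every \<open>i\<close>.\<close>

primrec del :: "nat => nat => ('h list => 'k) set => ('h list => 'k) set"
 where "del 0 = (%i. e0 0)"
 | "del (Suc n) = (%i. case i of 0 => e0 (Suc n) | Suc j => tl (Suc n) (T (Suc n)) (%h t. tc n h (del n j t)))"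

lemma del_linear: "del n i \<in> lin R (T (Suc n)) (T n)"
proof (induction n arbitrary: i)
 case 0
 show ?case by (simp add: e0_linear)
next
 case (Suc n)
 note [simp] = lin_closed[OF Suc]
 have "tl (Suc n) (T (Suc n)) (%h t. tc n h (del n j t)) \<in> lin R (T (Suc (Suc n))) (T (Suc n))" for j
  by (intro tl_linear lin_intros Suc) simp_all
 then show ?case by (auto simp: e0_linear split: nat.split)
qed

lemma del_closed [simp]: "t :[T (Suc n)] ==> del n i t :[T n]"
 by (rule lin_closed[OF del_linear])

lemmas del_comp = lin_comp[OF _ del_linear]

lemma del_zero [simp]: "del n 0 = e0 n"
 by (cases n) simp_all

lemma del_Suc_tc [simp]:
 "[|h :[H]; t :[T (Suc n)]|] ==> del (Suc n) (Suc j) (tc (Suc n) h t) = tc n h (del n j t)"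
 by (simp, subst tl_tc) (intro lin_intros del_linear | simp)+

definition lm :: "nat => 'h => ('h list => 'k) set => ('h list => 'k) set"
 where "lm n h = tl n (T (Suc n)) (%g t. tc n (h **[H] g) t)"

lemma lm_bilinear: "bilinear R H (T (Suc n)) (T (Suc n)) (lm n)"
 unfolding lm_def by (intro tl_bilinear lin_intros) simp_all

lemma lm_tc [simp]:
 "[|h :[H]; g :[H]; t :[T n]|] ==> lm n h (tc n g t) = tc n (h **[H] g) t"
 unfolding lm_def by (subst tl_tc) (intro lin_intros | simp)+

text \<open>The inner faces of the bar complex and its last face: \<open>dd n j\<close> is \<open>d\<^sub>j\<^sub>+\<^sub>1\<close> on
 \<open>H\<^sup>n\<^sup>+\<^sup>1\<close>.\<close>

primrec dd :: "nat => nat => ('h list => 'k) set => ('h list => 'k) set"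
 where "dd 0 = (%j. e0 0)"
 | "dd (Suc n) = (%j. case j of 0 => tl (Suc n) (T (Suc n)) (lm n)
   | Suc j => tl (Suc n) (T (Suc n)) (%h t. tc n h (dd n j t)))"

lemma dd_linear: "dd n j \<in> lin R (T (Suc n)) (T n)"
proof (induction n arbitrary: j)
 case 0
 show ?case by (simp add: e0_linear)
next
 case (Suc n)
 note [simp] = lin_closed[OF Suc]
 have "tl (Suc n) (T (Suc n)) (%h t. tc n h (dd n j t)) \<in> lin R (T (Suc (Suc n))) (T (Suc n))" for j
  by (intro tl_linear lin_intros Suc) simp_all
 moreover have "tl (Suc n) (T (Suc n)) (lm n) \<in> lin R (T (Suc (Suc n))) (T (Suc n))"
  by (intro tl_linear lm_bilinear) simp
 ultimately show ?case by (auto split: nat.split)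
qed

lemma dd_closed [simp]: "t :[T (Suc n)] ==> dd n i t :[T n]"
 by (rule lin_closed[OF dd_linear])

lemmas dd_comp = lin_comp[OF _ dd_linear]

lemma dd_zero_tc [simp]: "[|h :[H]; t :[T 0]|] ==> dd 0 j (tc 0 h t) = \<epsilon> h *[T 0] t"
 by simp

lemma dd_Suc_0_tc [simp]:
 "[|h :[H]; t :[T (Suc n)]|] ==> dd (Suc n) 0 (tc (Suc n) h t) = lm n h t"
 by (simp, subst tl_tc) (intro lm_bilinear | simp)+

lemma dd_Suc_Suc_tc [simp]:
 "[|h :[H]; t :[T (Suc n)]|] ==> dd (Suc n) (Suc j) (tc (Suc n) h t) = tc n h (dd n j t)"
 by (simp, subst tl_tc) (intro lin_intros dd_linear | simp)+

definition swap :: "nat => ('h list => 'k) set => ('h list => 'k) set"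
 where "swap n = tl (Suc n) (T (Suc (Suc n)))
  (%h. tl n (T (Suc (Suc n))) (%g t. tc (Suc n) g (tc n h t)))"

lemma swap_inner: "bilinear R H (T (Suc n)) (T (Suc (Suc n)))
  (%h. tl n (T (Suc (Suc n))) (%g t. tc (Suc n) g (tc n h t)))"
 by (intro tl_bilinear lin_intros) simp_all

lemma swap_linear: "swap n \<in> lin R (T (Suc (Suc n))) (T (Suc (Suc n)))"
 unfolding swap_def by (intro tl_linear swap_inner) simp

lemma swap_closed [simp]: "t :[T (Suc (Suc n))] ==> swap n t :[T (Suc (Suc n))]"
 by (rule lin_closed[OF swap_linear])

lemma swap_tc [simp]:
 assumes "h :[H]" "g :[H]" "t :[T n]"
 shows "swap n (tc (Suc n) h (tc n g t)) = tc (Suc n) g (tc n h t)"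
proof -
 have "bilinear R H (T n) (T (Suc (Suc n))) (%g t. tc (Suc n) g (tc n h t))"
  using assms by (intro lin_intros) simp_all
 then show ?thesis
  unfolding swap_def using assms by (simp add: tl_tc swap_inner)
qed

lemmas swap_comp = lin_comp[OF _ swap_linear]

text \<open>The last factor travels to the front by adjacent exchanges. Equivariance and the
  relations with the faces thus reduce to statements about \<open>swap\<close>.\<close>

primrec rot :: "nat => ('h list => 'k) set => ('h list => 'k) set"
 where "rot 0 = (%t. t)"
 | "rot (Suc n) = tl (Suc n) (T (Suc (Suc n))) (%h t. swap n (tc (Suc n) h (rot n t)))"

lemma rot_linear: "rot n \<in> lin R (T (Suc n)) (T (Suc n))"
proof (induction n)
 case 0
 show ?case by (simp add: lin_id)
next
 case (Suc n)
 note [simp] = lin_closed[OF Suc]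
 show ?case unfolding rot.simps
  by (intro tl_linear lin_intros swap_comp Suc) simp_all
qed

lemma rot_closed [simp]: "t :[T (Suc n)] ==> rot n t :[T (Suc n)]"
 by (rule lin_closed[OF rot_linear])

lemmas rot_comp = lin_comp[OF _ rot_linear]

lemma rot_tc [simp]:
 "[|h :[H]; t :[T (Suc n)]|] ==>
  rot (Suc n) (tc (Suc n) h t) = swap n (tc (Suc n) h (rot n t))"
 by (simp, subst tl_tc) (intro lin_intros swap_comp rot_linear | simp)+

declare act.simps(2) [simp del] F.simps(2) [simp del] P.simps(2) [simp del] del.simps(2) [simp del]
 dd.simps(2) [simp del] rot.simps(2) [simp del]

lemmas linear_sw = sw_map[OF module_T _ module_T]

end

section \<open>Bar coordinates and homogeneous coordinates\<close>

context hopf_algebra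
begin

lemmas all_lin = lin_intros act_linear F_linear P_linear

lemma sw_diff:
 assumes "module R M" "h :[H]"
  "!!a b. [|a :[H]; b :[H]|] ==> \<beta> a b :[M]"
  "!!a b. [|a :[H]; b :[H]|] ==> \<gamma> a b :[M]"
 shows "sw M (%a b. \<beta> a b -[M] \<gamma> a b) h = sw M \<beta> h -[M] sw M \<gamma> h"
proof -
 interpret M: module R M by fact
 have neg: "(%x. -[M] x) \<in> lin R M M"
  using lin_map_neg[OF lin_id assms(1,1)] .
 have "sw M (%a b. \<beta> a b -[M] \<gamma> a b) h = sw M \<beta> h +[M] sw M (%a b. -[M] \<gamma> a b) h"
  unfolding sw_def case_prod_unfold M.minus_eq
  using sweedler_closed[OF assms(2)] assms(3,4) by (intro M.list_sum_addf) auto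
 also have "sw M (%a b. -[M] \<gamma> a b) h = -[M] sw M \<gamma> h"
  by (rule sw_map[OF assms(1,2,1) neg assms(4), symmetric])
 finally show ?thesis by (simp add: M.minus_eq)
qed

text \<open>In the form \<open>F n a t\<close> the diagonal action becomes left multiplication on
  \<open>a\<close> alone. Together with \<open>F_P\<close> and \<open>\<pi>_F\<close> this expresses
  that the homogeneous modules are free over \<open>H\<close> on the tensor powers.\<close>

lemma act_F:
 assumes "a :[H]" "b :[H]" "t :[T n]"
 shows "act (Suc n) a (F n b t) = F n (a **[H] b) t"
 using assms
proof (induction n arbitrary: a b t)
 case 0
 then have "act (Suc 0) a (F 0 b t) = sw (T (Suc 0)) (%x y. \<epsilon> y *[T (Suc 0)] tc 0 (x **[H] b) t) a"
  by (simp add: tc_smult)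
 also have "... = tc 0 (a **[H] b) t"
  using 0 by (intro sw_counit_right[where f = "%x. tc 0 (x **[H] b) t"] all_lin) simp_all
 finally show ?case by simp
next
 case (Suc n)
 let ?T = "T (Suc (Suc n))"
 show ?case
 proof (rule T_eqI[OF \<open>t \<in> _\<close>, where f = "%t. act (Suc (Suc n)) a (F (Suc n) b t)" and L = ?T])
  fix h t assume ht: "h :[H]" "t :[T n]"
  have "act (Suc (Suc n)) a (F (Suc n) b (tc n h t)) =
    sw ?T (%x y. sw ?T (%u v. tc (Suc n) (u **[H] x) (F n (v **[H] (y **[H] h)) t)) a) b"
   using ht Suc.prems by (simp add: act_sw Suc.IH)
  also have "... = sw ?T (%u v. sw ?T (%x y. tc (Suc n) (u **[H] x) (F n (v **[H] (y **[H] h)) t)) b) a"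
   using ht Suc.prems by (intro sw_commute) simp_all
  also have "... = sw ?T (%u v. sw ?T (%x y. tc (Suc n) (u **[H] x) (F n ((v **[H] y) **[H] h) t)) b) a"
   using ht Suc.prems by (simp add: m_assoc)
  also have "... = sw ?T (%x y. tc (Suc n) x (F n (y **[H] h) t)) (a **[H] b)"
   using ht Suc.prems by (intro sw_mult[symmetric] all_lin) simp_all
  also have "... = F (Suc n) (a **[H] b) (tc n h t)"
   using ht Suc.prems by simp
  finally show "act (Suc (Suc n)) a (F (Suc n) b (tc n h t)) = F (Suc n) (a **[H] b) (tc n h t)" .
 qed (use Suc.prems in "(intro all_lin | simp)+")
qed

text \<open>Telescoping: the part \<open>v\<close> of \<open>a\<close> that \<open>P\<close> hands
  on meets the part \<open>y\<close> with which the rest of \<open>F\<close> begins, and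
  \<open>S v\<close> times \<open>y\<close> collapses by the antipode axiom after
  regrouping.\<close>

lemma P_F:
 assumes "z :[H]" "a :[H]" "t :[T n]"
 shows "P (Suc n) z (F n a t) = tc n (S z **[H] a) t"
 using assms
proof (induction n arbitrary: z a t)
 case 0
 then have "P (Suc 0) z (F 0 a t) = sw (T (Suc 0)) (%x y. \<epsilon> y *[T (Suc 0)] tc 0 (S z **[H] x) t) a"
  by (simp add: tc_smult)
 also have "... = tc 0 (S z **[H] a) t"
  using 0 by (intro sw_counit_right[where f = "%x. tc 0 (S z **[H] x) t"] all_lin) simp_all
 finally show ?case .
next
 case (Suc n)
 let ?T = "T (Suc (Suc n))"
 show ?case
 proof (rule T_eqI[OF \<open>t \<in> _\<close>, where f = "%t. P (Suc (Suc n)) z (F (Suc n) a t)" and L = ?T])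
  fix h t assume ht: "h :[H]" "t :[T n]"
  have "P (Suc (Suc n)) z (F (Suc n) a (tc n h t)) =
    sw ?T (%x y. sw ?T (%u v. tc (Suc n) (S z **[H] u) (tc n (S v **[H] (y **[H] h)) t)) x) a"
   using ht Suc.prems by (simp add: P_sw Suc.IH)
  also have "... = sw ?T (%u w. sw ?T (%v y. tc (Suc n) (S z **[H] u) (tc n (S v **[H] (y **[H] h)) t)) w) a"
   using ht Suc.prems
   by (intro sw_coassoc[where \<gamma> = "%u v y. tc (Suc n) (S z **[H] u) (tc n (S v **[H] (y **[H] h)) t)"]
     trilinearI all_lin) simp_all
  also have "... = sw ?T (%u w. \<epsilon> w *[?T] tc (Suc n) (S z **[H] u) (tc n h t)) a"
  proof (rule sw_strong_cong[OF refl])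
   fix u w assume "a :[H] ==> u :[H]" "a :[H] ==> w :[H]"
   then have uw: "u :[H]" "w :[H]" using Suc.prems by auto
   have "sw ?T (%v y. tc (Suc n) (S z **[H] u) (tc n ((S v **[H] y) **[H] h) t)) w =
     \<epsilon> w *[?T] tc (Suc n) (S z **[H] u) (tc n (\<one>[H] **[H] h) t)"
    using ht Suc.prems uw
    by (intro sw_antipode_left[where f = "%g. tc (Suc n) (S z **[H] u) (tc n (g **[H] h) t)"] all_lin) simp_all
   then show "sw ?T (%v y. tc (Suc n) (S z **[H] u) (tc n (S v **[H] (y **[H] h)) t)) w =
     \<epsilon> w *[?T] tc (Suc n) (S z **[H] u) (tc n h t)"
    using ht Suc.prems uw by (simp add: m_assoc)
  qed
  also have "... = tc (Suc n) (S z **[H] a) (tc n h t)"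
   using ht Suc.prems
   by (intro sw_counit_right[where f = "%u. tc (Suc n) (S z **[H] u) (tc n h t)"] all_lin) simp_all
  finally show "P (Suc (Suc n)) z (F (Suc n) a (tc n h t)) = tc (Suc n) (S z **[H] a) (tc n h t)" .
 qed (use Suc.prems in "(intro all_lin | simp)+")
qed

lemma \<pi>_F:
 assumes "a :[H]" "t :[T n]"
 shows "\<pi> n (F n a t) = \<epsilon> a *[T n] t"
proof (cases n)
 case 0
 then show ?thesis using assms by simp
next
 case (Suc m)
 show ?thesis
  unfolding Suc
 proof (rule T_eqI[where f = "%t. \<pi> (Suc m) (F (Suc m) a t)" and L = "T (Suc m)"])
  fix h t assume ht: "h :[H]" "t :[T m]"
  have "\<pi> (Suc m) (F (Suc m) a (tc m h t)) = sw (T (Suc m)) (%x y. tc m ((S x **[H] y) **[H] h) t) a"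
   using ht assms(1) by (simp add: linear_sw[OF _ \<pi>_linear] P_F m_assoc)
  also have "... = \<epsilon> a *[T (Suc m)] tc m (\<one>[H] **[H] h) t"
   using ht assms(1) by (intro sw_antipode_left[where f = "%g. tc m (g **[H] h) t"] all_lin) simp_all
  finally show "\<pi> (Suc m) (F (Suc m) a (tc m h t)) = \<epsilon> a *[T (Suc m)] tc m h t"
   using ht by simp
 qed (use assms Suc in "(intro all_lin \<pi>_comp | simp)+")
qed

text \<open>Homogeneous tensors are combinations of values of \<open>F\<close>. Here the telescoping
  pair is \<open>q\<close> times \<open>S y\<close>, where \<open>q\<close> comes from
  \<open>F\<close> and \<open>y\<close> from \<open>P\<close>.\<close>

lemma F_P:
 assumes "g :[H]" "t :[T n]"
 shows "sw (T (Suc n)) (%x y. F n x (P n y t)) g = tc n g t"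
 using assms
proof (induction n arbitrary: g t)
 case 0
 then have "sw (T (Suc 0)) (%x y. F 0 x (P 0 y t)) g = sw (T (Suc 0)) (%x y. \<epsilon> y *[T (Suc 0)] tc 0 x t) g"
  by (simp add: tc_smult)
 also have "... = tc 0 g t"
  using 0 by (intro sw_counit_right[where f = "%x. tc 0 x t"] all_lin) simp_all
 finally show ?case .
next
 case (Suc n)
 let ?T = "T (Suc (Suc n))"
 show ?case
 proof (rule T_eqI[OF \<open>t \<in> _\<close>, where f = "%t. sw ?T (%x y. F (Suc n) x (P (Suc n) y t)) g" and L = ?T])
  fix h t assume ht: "h :[H]" "t :[T n]"
  have "sw ?T (%x y. F (Suc n) x (P (Suc n) y (tc n h t))) g =
    sw ?T (%x y. sw ?T (%u v. sw ?T (%p q. tc (Suc n) p (F n (q **[H] (S y **[H] u)) (P n v t))) x) h) g"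
   using ht Suc.prems by (simp add: F_sw)
  also have "... = sw ?T (%u v. sw ?T (%x y. sw ?T (%p q. tc (Suc n) p (F n (q **[H] (S y **[H] u)) (P n v t))) x) g) h"
   using ht Suc.prems by (intro sw_commute sw_T_closed) simp_all
  also have "... = sw ?T (%u v. tc (Suc n) g (F n u (P n v t))) h"
  proof (rule sw_strong_cong[OF refl])
   fix u v assume "h :[H] ==> u :[H]" "h :[H] ==> v :[H]"
   then have uv: "u :[H]" "v :[H]" using ht by auto
   have "sw ?T (%x y. sw ?T (%p q. tc (Suc n) p (F n (q **[H] (S y **[H] u)) (P n v t))) x) g =
     sw ?T (%p w. sw ?T (%q y. tc (Suc n) p (F n (q **[H] (S y **[H] u)) (P n v t))) w) g"
    using ht Suc.prems uv
    by (intro sw_coassoc[where \<gamma> = "%p q y. tc (Suc n) p (F n (q **[H] (S y **[H] u)) (P n v t))"]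
      trilinearI all_lin) simp_all
   also have "... = sw ?T (%p w. \<epsilon> w *[?T] tc (Suc n) p (F n u (P n v t))) g"
   proof (rule sw_strong_cong[OF refl])
    fix p w assume "g :[H] ==> p :[H]" "g :[H] ==> w :[H]"
    then have pw: "p :[H]" "w :[H]" using Suc.prems by auto
    have "sw ?T (%q y. tc (Suc n) p (F n ((q **[H] S y) **[H] u) (P n v t))) w =
      \<epsilon> w *[?T] tc (Suc n) p (F n (\<one>[H] **[H] u) (P n v t))"
     using ht pw uv
     by (intro sw_antipode_right[where f = "%g. tc (Suc n) p (F n (g **[H] u) (P n v t))"] all_lin) simp_all
    then show "sw ?T (%q y. tc (Suc n) p (F n (q **[H] (S y **[H] u)) (P n v t))) w =
      \<epsilon> w *[?T] tc (Suc n) p (F n u (P n v t))"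
     using ht pw uv by (simp add: m_assoc)
   qed
   also have "... = tc (Suc n) g (F n u (P n v t))"
    using ht uv Suc.prems
    by (intro sw_counit_right[where f = "%p. tc (Suc n) p (F n u (P n v t))"] all_lin) simp_all
   finally show "sw ?T (%x y. sw ?T (%p q. tc (Suc n) p (F n (q **[H] (S y **[H] u)) (P n v t))) x) g =
     tc (Suc n) g (F n u (P n v t))" .
  qed
  also have "... = tc (Suc n) g (sw (T (Suc n)) (%u v. F n u (P n v t)) h)"
   using ht Suc.prems by (simp add: tc_sw)
  also have "... = tc (Suc n) g (tc n h t)"
   using ht by (simp add: Suc.IH)
  finally show "sw ?T (%x y. F (Suc n) x (P (Suc n) y (tc n h t))) g = tc (Suc n) g (tc n h t)" .
 qed (use Suc.prems in "(intro all_lin | simp)+")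
qed

text \<open>Equality of linear maps may be tested on the values of \<open>F\<close>, where the
  action, the faces and the projection take their simplest form.\<close>

lemma F_eqI:
 assumes "x :[T (Suc n)]" "module R L" "f \<in> lin R (T (Suc n)) L"
  "g \<in> lin R (T (Suc n)) L"
  "!!a t. [|a :[H]; t :[T n]|] ==> f (F n a t) = g (F n a t)"
 shows "f x = g x"
proof (rule T_eqI[OF assms(1-4)])
 fix h t assume ht: "h :[H]" "t :[T n]"
 have "f (tc n h t) = sw L (%x y. f (F n x (P n y t))) h"
  unfolding F_P[OF ht, symmetric] using ht by (intro sw_map[OF module_T _ assms(2,3)]) simp_all
 also have "... = sw L (%x y. g (F n x (P n y t))) h"
  using ht assms(5) by simp
 also have "... = g (tc n h t)"
  unfolding F_P[OF ht, symmetric] using ht by (intro sw_map[OF module_T _ assms(2,4), symmetric]) simp_all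
 finally show "f (tc n h t) = g (tc n h t)" .
qed

text \<open>The action becomes trivial after \<open>\<pi>\<close>, that is, \<open>\<pi>\<close>
  factors through the coinvariants.\<close>

lemma \<pi>_act:
 assumes "a :[H]" "x :[T (Suc n)]"
 shows "\<pi> n (act (Suc n) a x) = \<epsilon> a *[T n] \<pi> n x"
proof (rule F_eqI[OF assms(2), where f = "%x. \<pi> n (act (Suc n) a x)" and L = "T n"])
 interpret Tn: module R "T n" by simp
 fix b t assume "b :[H]" "t :[T n]"
 then show "\<pi> n (act (Suc n) a (F n b t)) = \<epsilon> a *[T n] \<pi> n (F n b t)"
  using assms(1) by (simp add: act_F \<pi>_F counit_mult Tn.smult_assoc1)
qed (use assms in "(intro all_lin \<pi>_comp \<pi>_linear | simp)+")

definition Hlin :: "nat => nat => (('h list => 'k) set => ('h list => 'k) set) => bool"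
 where "Hlin q m f \<longleftrightarrow> f \<in> lin R (T q) (T m) \<and>
  (\<forall>a\<in>carrier H. \<forall>t\<in>carrier (T q). f (act q a t) = act m a (f t))"

lemma Hlin_linear: "Hlin q m f ==> f \<in> lin R (T q) (T m)"
 and Hlin_act: "[|Hlin q m f; a :[H]; t :[T q]|] ==> f (act q a t) = act m a (f t)"
 and Hlin_closed: "[|Hlin q m f; t :[T q]|] ==> f t :[T m]"
 by (auto simp: Hlin_def intro: lin_closed)

text \<open>\<open>H\<close>-linear maps descend to coinvariants.\<close>

lemma Hlin_descend:
 assumes "Hlin (Suc q) (Suc m) f" "x :[T (Suc q)]"
 shows "\<pi> m (f x) = \<pi> m (f (F q \<one>[H] (\<pi> q x)))"
proof (rule F_eqI[OF assms(2), where f = "%x. \<pi> m (f x)" and L = "T m"])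
 note [simp] = Hlin_closed[OF assms(1)]
 interpret Tm: module R "T m" by simp
 interpret Tq: module R "T q" by simp
 fix a t assume at: "a :[H]" "t :[T q]"
 have "\<pi> m (f (F q a t)) = \<pi> m (f (act (Suc q) a (F q \<one>[H] t)))"
  using at by (simp add: act_F)
 also have "... = \<epsilon> a *[T m] \<pi> m (f (F q \<one>[H] t))"
  using at by (simp add: Hlin_act[OF assms(1)] \<pi>_act)
 also have "... = \<pi> m (f (F q \<one>[H] (\<epsilon> a *[T q] t)))"
  using at by (simp add: lin_smult[OF lin_comp[OF lin_comp[OF bilinear_right[OF F_bilinear]
   Hlin_linear[OF assms(1)]] \<pi>_linear]])
 also have "... = \<pi> m (f (F q \<one>[H] (\<pi> q (F q a t))))"
  using at by (simp add: \<pi>_F)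
 finally show "\<pi> m (f (F q a t)) = \<pi> m (f (F q \<one>[H] (\<pi> q (F q a t))))" .
qed (intro lin_comp[OF Hlin_linear[OF assms(1)] \<pi>_linear] \<pi>_comp lin_comp[OF _ Hlin_linear[OF assms(1)]]
  F_linear \<pi>_linear | simp)+

lemma \<pi>_F_one: "t :[T n] ==> \<pi> n (F n \<one>[H] t) = t"
proof -
 interpret Tn: module R "T n" by simp
 show "t :[T n] ==> \<pi> n (F n \<one>[H] t) = t"
  by (simp add: \<pi>_F counit_one)
qed

lemma e0_Hlin: "Hlin (Suc n) n (e0 n)"
 unfolding Hlin_def
proof (intro conjI ballI e0_linear)
 interpret Tn: module R "T n" by simp
 fix a x assume a: "a :[H]" and x: "x :[T (Suc n)]"
 show "e0 n (act (Suc n) a x) = act n a (e0 n x)"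
 proof (rule T_eqI[OF x, where f = "%x. e0 n (act (Suc n) a x)" and L = "T n"])
  fix h t assume ht: "h :[H]" "t :[T n]"
  have "e0 n (act (Suc n) a (tc n h t)) = sw (T n) (%x y. \<epsilon> x *[T n] (\<epsilon> h *[T n] act n y t)) a"
   using ht a by (simp add: linear_sw[OF _ e0_linear] counit_mult Tn.smult_assoc1)
  also have "... = \<epsilon> h *[T n] act n a t"
   using ht a by (intro sw_counit_left[where f = "%y. \<epsilon> h *[T n] act n y t"] all_lin) simp_all
  finally show "e0 n (act (Suc n) a (tc n h t)) = act n a (e0 n (tc n h t))"
   using ht a by (simp add: bilinear_eps[OF act_bilinear])
 qed (use a in "(intro all_lin lin_comp[OF _ e0_linear] e0_linear | simp)+")
qed

lemma del_Hlin: "Hlin (Suc n) n (del n i)"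
proof (induction n arbitrary: i)
 case 0
 show ?case by (simp add: e0_Hlin)
next
 case (Suc n)
 show ?case
 proof (cases i)
  case 0
  then show ?thesis using e0_Hlin[of "Suc n"] del_zero[of "Suc n"] by metis
 next
  case (Suc j)
  show ?thesis
   unfolding Hlin_def Suc
  proof (intro conjI ballI del_linear)
   fix a x assume a: "a :[H]" and x: "x :[T (Suc (Suc n))]"
   show "del (Suc n) (Suc j) (act (Suc (Suc n)) a x) = act (Suc n) a (del (Suc n) (Suc j) x)"
   proof (rule T_eqI[OF x, where f = "%x. del (Suc n) (Suc j) (act (Suc (Suc n)) a x)" and L = "T (Suc n)"])
    fix h t assume ht: "h :[H]" "t :[T (Suc n)]"
    then show "del (Suc n) (Suc j) (act (Suc (Suc n)) a (tc (Suc n) h t)) =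
      act (Suc n) a (del (Suc n) (Suc j) (tc (Suc n) h t))"
     using a by (simp add: linear_sw[OF _ del_linear] Hlin_act[OF Suc.IH])
   qed (use a in "(intro all_lin del_comp del_linear | simp)+")
  qed
 qed
qed

lemma e0_F:
 assumes "a :[H]" "h :[H]" "t :[T n]"
 shows "e0 (Suc n) (F (Suc n) a (tc n h t)) = F n (a **[H] h) t"
proof -
 have "e0 (Suc n) (F (Suc n) a (tc n h t)) = sw (T (Suc n)) (%x y. \<epsilon> x *[T (Suc n)] F n (y **[H] h) t) a"
  using assms by (simp add: linear_sw[OF _ e0_linear])
 also have "... = F n (a **[H] h) t"
  using assms by (intro sw_counit_left[where f = "%y. F n (y **[H] h) t"] all_lin) simp_all
 finally show ?thesis .
qed

text \<open>Homogeneous coordinates are partial products of the bar coordinates. Deleting a partial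
  product merges the two increments next to it; deleting the last one discards the last increment by
  the counit.\<close>

lemma del_F:
 assumes "a :[H]" "t :[T (Suc n)]"
 shows "del (Suc n) (Suc j) (F (Suc n) a t) = F n a (dd n j t)"
 using assms
proof (induction n arbitrary: a t j)
 case 0
 interpret T0: module R "T 0" by simp
 interpret T1: module R "T (Suc 0)" by simp
 show ?case
 proof (rule T_eqI[OF 0(2), where f = "%t. del (Suc 0) (Suc j) (F (Suc 0) a t)" and L = "T (Suc 0)"])
  fix h t assume ht: "h :[H]" "t :[T 0]"
  have "del (Suc 0) (Suc j) (F (Suc 0) a (tc 0 h t)) =
    sw (T (Suc 0)) (%x y. \<epsilon> y *[T (Suc 0)] (\<epsilon> h *[T (Suc 0)] tc 0 x t)) a"
   using ht 0 by (simp add: linear_sw[OF _ del_linear] counit_mult tc_smult T1.smult_assoc1)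
  also have "... = \<epsilon> h *[T (Suc 0)] tc 0 a t"
   using ht 0 by (intro sw_counit_right[where f = "%x. \<epsilon> h *[T (Suc 0)] tc 0 x t"] all_lin) simp_all
  finally show "del (Suc 0) (Suc j) (F (Suc 0) a (tc 0 h t)) = F 0 a (dd 0 j (tc 0 h t))"
   using ht 0 by (simp add: tc_smult)
 qed (use 0 in "(intro all_lin del_comp dd_linear | simp)+")
next
 case (Suc n)
 show ?case
 proof (rule T_eqI[OF Suc.prems(2), where f = "%t. del (Suc (Suc n)) (Suc j) (F (Suc (Suc n)) a t)" and L = "T (Suc (Suc n))"])
  fix h t assume ht: "h :[H]" "t :[T (Suc n)]"
  show "del (Suc (Suc n)) (Suc j) (F (Suc (Suc n)) a (tc (Suc n) h t)) = F (Suc n) a (dd (Suc n) j (tc (Suc n) h t))"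
  proof (cases j)
   case 0
   \<comment> \<open>The face that multiplies two bar factors needs the second one explicitly, so
     the tail is split once more.\<close>
   show ?thesis
   proof (rule T_eqI[OF ht(2), where L = "T (Suc (Suc n))" and
      f = "%t. del (Suc (Suc n)) (Suc j) (F (Suc (Suc n)) a (tc (Suc n) h t))"])
    fix g s assume gs: "g :[H]" "s :[T n]"
    have "del (Suc (Suc n)) (Suc 0) (F (Suc (Suc n)) a (tc (Suc n) h (tc n g s))) =
      sw (T (Suc (Suc n))) (%x y. tc (Suc n) x (F n (y **[H] h **[H] g) s)) a"
     using ht Suc.prems gs by (subst F_tc) (simp_all add: linear_sw[OF _ del_linear] e0_F del: F_tc)
    then show "del (Suc (Suc n)) (Suc j) (F (Suc (Suc n)) a (tc (Suc n) h (tc n g s))) =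
      F (Suc n) a (dd (Suc n) j (tc (Suc n) h (tc n g s)))"
     using ht Suc.prems gs 0 by (simp add: m_assoc)
   qed (use ht Suc.prems in "(intro all_lin del_comp dd_comp | simp)+")
  next
   case (Suc i)
   then show ?thesis
    using ht Suc.prems by (simp add: linear_sw[OF _ del_linear] Suc.IH)
  qed
 qed (use Suc.prems in "(intro all_lin del_comp dd_linear | simp)+")
qed

lemma \<pi>_e0:
 assumes "x :[T (Suc (Suc n))]"
 shows "\<pi> n (e0 (Suc n) x) = e0 n (\<pi> (Suc n) x)"
proof (rule F_eqI[OF assms, where f = "%x. \<pi> n (e0 (Suc n) x)" and L = "T n"])
 interpret Tn: module R "T n" by simp
 fix a t assume a: "a :[H]" and t: "t :[T (Suc n)]"
 show "\<pi> n (e0 (Suc n) (F (Suc n) a t)) = e0 n (\<pi> (Suc n) (F (Suc n) a t))"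
 proof (rule T_eqI[OF t, where f = "%t. \<pi> n (e0 (Suc n) (F (Suc n) a t))" and L = "T n"])
  fix h s assume "h :[H]" "s :[T n]"
  then show "\<pi> n (e0 (Suc n) (F (Suc n) a (tc n h s))) = e0 n (\<pi> (Suc n) (F (Suc n) a (tc n h s)))"
   using a by (simp add: e0_F \<pi>_F counit_mult Tn.smult_assoc1 lin_smult[OF e0_linear] del: F_tc)
 qed (use a in "(intro all_lin \<pi>_comp lin_comp[OF _ e0_linear] | simp)+")
qed (intro \<pi>_comp lin_comp[OF _ e0_linear] e0_linear \<pi>_linear | simp)+

lemma \<pi>_del_Suc:
 assumes "x :[T (Suc (Suc n))]"
 shows "\<pi> n (del (Suc n) (Suc j) x) = dd n j (\<pi> (Suc n) x)"
proof (rule F_eqI[OF assms, where f = "%x. \<pi> n (del (Suc n) (Suc j) x)" and L = "T n"])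
 fix a t assume "a :[H]" "t :[T (Suc n)]"
 then show "\<pi> n (del (Suc n) (Suc j) (F (Suc n) a t)) = dd n j (\<pi> (Suc n) (F (Suc n) a t))"
  by (simp add: del_F \<pi>_F lin_smult[OF dd_linear])
qed (intro \<pi>_comp del_linear dd_comp \<pi>_linear | simp)+

text \<open>The cyclic operator of the bar complex before the antipode is applied to the first factor:
 \<open>K n (h\<^sub>0 \<otimes> ... \<otimes> h\<^sub>n) = \<Sum> h\<^sub>0\<^sup>(\<^sup>1\<^sup>) \<cdots> h\<^sub>n\<^sub>-\<^sub>1\<^sup>(\<^sup>1\<^sup>) h\<^sub>n \<otimes> h\<^sub>0\<^sup>(\<^sup>2\<^sup>) \<otimes> ... \<otimes> h\<^sub>n\<^sub>-\<^sub>1\<^sup>(\<^sup>2\<^sup>)\<close>\<close>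

definition M2 :: "nat => 'h => 'h => ('h list => 'k) set => ('h list => 'k) set"
 where "M2 n x y = tl n (T (Suc (Suc n))) (%g s. tc (Suc n) (x **[H] g) (tc n y s))"

lemma
 shows M2_bilinear1: "y :[H] ==> bilinear R H (T (Suc n)) (T (Suc (Suc n))) (%x. M2 n x y)"
  and M2_bilinear2: "x :[H] ==> bilinear R H (T (Suc n)) (T (Suc (Suc n))) (%y. M2 n x y)"
 unfolding M2_def by (intro tl_bilinear all_lin; simp)+

lemmas M2_linear = bilinear_comp_right[OF M2_bilinear1] bilinear_comp_left[OF M2_bilinear1]
 bilinear_comp_left[OF M2_bilinear2]

lemma M2_closed [simp]:
 "[|x :[H]; y :[H]; t :[T (Suc n)]|] ==> M2 n x y t :[T (Suc (Suc n))]"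
 by (rule bilinear_closed[OF M2_bilinear1])

lemma M2_tc [simp]:
 "[|x :[H]; y :[H]; g :[H]; s :[T n]|] ==>
  M2 n x y (tc n g s) = tc (Suc n) (x **[H] g) (tc n y s)"
 unfolding M2_def by (subst tl_tc) (intro all_lin | simp)+

primrec K :: "nat => ('h list => 'k) set => ('h list => 'k) set"
 where "K 0 = (%t. t)"
 | "K (Suc n) = tl (Suc n) (T (Suc (Suc n))) (%h t. sw (T (Suc (Suc n))) (%x y. M2 n x y (K n t)) h)"

lemma K_linear: "K n \<in> lin R (T (Suc n)) (T (Suc n))"
proof (induction n)
 case 0
 show ?case by (simp add: lin_id)
next
 case (Suc n)
 note [simp] = lin_closed[OF Suc]
 show ?case unfolding K.simps
  by (intro tl_linear all_lin M2_linear Suc) simp_all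
qed

lemma K_closed [simp]: "t :[T (Suc n)] ==> K n t :[T (Suc n)]"
 by (rule lin_closed[OF K_linear])

lemma K_tc [simp]:
 "[|h :[H]; t :[T (Suc n)]|] ==>
  K (Suc n) (tc (Suc n) h t) = sw (T (Suc (Suc n))) (%x y. M2 n x y (K n t)) h"
 by (simp, subst tl_tc) (intro all_lin M2_linear K_linear | simp)+

declare K.simps(2) [simp del]

text \<open>The shape of a rotated tensor: if \<open>g\<close> is the product of all increments, the
  last coordinate \<open>a g\<close> now comes first, and the remaining coordinates start from
  \<open>a\<close> again as in \<open>F\<close>.\<close>

definition Z :: "nat => 'h => ('h list => 'k) set => ('h list => 'k) set"
 where "Z n a = tl n (T (Suc (Suc n)))
  (%g s. sw (T (Suc (Suc n))) (%x y. tc (Suc n) (x **[H] g) (F n y s)) a)"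

lemma Z_bilinear: "bilinear R H (T (Suc n)) (T (Suc (Suc n))) (Z n)"
 unfolding Z_def by (intro tl_bilinear all_lin) simp_all

lemmas Z_linear = bilinear_comp_right[OF Z_bilinear] bilinear_comp_left[OF Z_bilinear]
lemmas Z_sw = bilinear_sw[OF Z_bilinear module_T module_T]

lemma Z_closed [simp]: "[|a :[H]; t :[T (Suc n)]|] ==> Z n a t :[T (Suc (Suc n))]"
 by (rule bilinear_closed[OF Z_bilinear])

lemma Z_tc [simp]:
 "[|a :[H]; g :[H]; s :[T n]|] ==>
  Z n a (tc n g s) = sw (T (Suc (Suc n))) (%x y. tc (Suc n) (x **[H] g) (F n y s)) a"
 unfolding Z_def by (subst tl_tc) (intro all_lin | simp)+

definition sf :: "nat => ('h list => 'k) set => ('h list => 'k) set"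
 where "sf n = tl n (T (Suc n)) (%g s. tc n (S g) s)"

lemma sf_linear: "sf n \<in> lin R (T (Suc n)) (T (Suc n))"
 unfolding sf_def by (intro tl_linear all_lin) simp_all

lemma sf_tc [simp]: "[|g :[H]; s :[T n]|] ==> sf n (tc n g s) = tc n (S g) s"
 unfolding sf_def by (subst tl_tc) (intro all_lin | simp)+

text \<open>The cone \<open>g\<^sub>0 \<otimes> g' \<mapsto> \<Sum> g\<^sub>0\<^sup>(\<^sup>1\<^sup>) \<otimes> f(g\<^sub>0\<^sup>(\<^sup>2\<^sup>) \<otimes> g')\<close>, an \<open>H\<close>-linear
 substitute for the extra degeneracy.\<close>

definition kap :: "nat => nat => (('h list => 'k) set => ('h list => 'k) set) =>
  ('h list => 'k) set => ('h list => 'k) set"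
 where "kap q m f = tl q (T (Suc m)) (%g t. sw (T (Suc m)) (%x y. tc m x (f (tc q y t))) g)"

context
 fixes q m f
 assumes f: "f \<in> lin R (T (Suc q)) (T m)"
begin

lemmas f_comp = lin_comp[OF _ f]
lemma f_cl: "t :[T (Suc q)] ==> f t :[T m]" by (rule lin_closed[OF f])

lemma kap_linear: "kap q m f \<in> lin R (T (Suc q)) (T (Suc m))"
 unfolding kap_def by (intro tl_linear all_lin f_comp) (simp_all add: f_cl)

lemma kap_tc:
 "[|g :[H]; t :[T q]|] ==>
  kap q m f (tc q g t) = sw (T (Suc m)) (%x y. tc m x (f (tc q y t))) g"
 unfolding kap_def by (subst tl_tc) (intro all_lin f_comp | simp add: f_cl)+

end

text \<open>The action on the source and the cone both split the leading factor. After expansion,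
  coassociativity brings together the two parts of \<open>a\<close> that have ended up inside
  \<open>f\<close>; equivariance of \<open>f\<close> takes them out as an action on the
  value.\<close>

lemma kap_Hlin:
 assumes "Hlin (Suc q) m f"
 shows "Hlin (Suc q) (Suc m) (kap q m f)"
 unfolding Hlin_def
proof (intro conjI ballI)
 note f = Hlin_linear[OF assms]
 note [simp] = Hlin_closed[OF assms]
 let ?T = "T (Suc m)"
 show lin: "kap q m f \<in> lin R (T (Suc q)) (T (Suc m))" by (rule kap_linear[OF f])
 note [simp] = lin_closed[OF lin]
 fix a x assume a: "a :[H]" and x: "x :[T (Suc q)]"
 show "kap q m f (act (Suc q) a x) = act (Suc m) a (kap q m f x)"
 proof (rule T_eqI[OF x, where f = "%x. kap q m f (act (Suc q) a x)" and L = ?T])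
  fix g t assume gt: "g :[H]" "t :[T q]"
  have "kap q m f (act (Suc q) a (tc q g t)) =
    sw ?T (%x y. sw ?T (%p r. tc m p (f (tc q r (act q y t)))) (x **[H] g)) a"
   using gt a by (simp add: linear_sw[OF _ lin] kap_tc[OF f])
  also have "... = sw ?T (%x y. sw ?T (%u v. sw ?T (%p r. tc m (u **[H] p) (f (tc q (v **[H] r) (act q y t)))) g) x) a"
  proof (rule sw_strong_cong[OF refl])
   fix x y assume "a :[H] ==> x :[H]" "a :[H] ==> y :[H]"
   then show "sw ?T (%p r. tc m p (f (tc q r (act q y t)))) (x **[H] g) =
     sw ?T (%u v. sw ?T (%p r. tc m (u **[H] p) (f (tc q (v **[H] r) (act q y t)))) g) x"
    using gt a by (intro sw_mult all_lin lin_comp[OF _ f]) simp_all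
  qed
  also have "... = sw ?T (%u w. sw ?T (%v y. sw ?T (%p r. tc m (u **[H] p) (f (tc q (v **[H] r) (act q y t)))) g) w) a"
   using gt a
   by (intro sw_coassoc[where \<gamma> = "%u v y. sw ?T (%p r. tc m (u **[H] p) (f (tc q (v **[H] r) (act q y t)))) g"]
     trilinearI all_lin lin_comp[OF _ f]) simp_all
  also have "... = sw ?T (%u w. sw ?T (%p r. sw ?T (%v y. tc m (u **[H] p) (f (tc q (v **[H] r) (act q y t)))) w) g) a"
  proof (rule sw_strong_cong[OF refl])
   fix u w assume "a :[H] ==> u :[H]" "a :[H] ==> w :[H]"
   then show "sw ?T (%v y. sw ?T (%p r. tc m (u **[H] p) (f (tc q (v **[H] r) (act q y t)))) g) w =
     sw ?T (%p r. sw ?T (%v y. tc m (u **[H] p) (f (tc q (v **[H] r) (act q y t)))) w) g"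
    using gt a by (intro sw_commute) simp_all
  qed
  also have "... = sw ?T (%u w. sw ?T (%p r. tc m (u **[H] p) (act m w (f (tc q r t)))) g) a"
   using gt a by (simp add: Hlin_act[OF assms, symmetric] linear_sw[OF _ f] tc_sw)
  also have "... = sw ?T (%p r. sw ?T (%u w. tc m (u **[H] p) (act m w (f (tc q r t)))) a) g"
   using gt a by (intro sw_commute) simp_all
  also have "... = act (Suc m) a (kap q m f (tc q g t))"
   using gt a by (simp add: kap_tc[OF f] act_sw)
  finally show "kap q m f (act (Suc q) a (tc q g t)) = act (Suc m) a (kap q m f (tc q g t))" .
 qed (use a in "(intro all_lin lin_comp[OF _ lin] lin | simp)+")
qed

end

section \<open>Equivariance and descent of the rotation\<close>

context cocommutative_hopf_algebra
begin

text \<open>The action hands out the parts of \<open>a\<close> from left to right. Exchanging two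
  factors therefore exchanges the first two parts as well, and cocommutativity puts them back into
  order.\<close>

lemma swap_Hlin: "Hlin (Suc (Suc n)) (Suc (Suc n)) (swap n)"
 unfolding Hlin_def
proof (intro conjI ballI swap_linear)
 let ?T = "T (Suc (Suc n))"
 fix a x assume a: "a :[H]" and x: "x :[?T]"
 show "swap n (act (Suc (Suc n)) a x) = act (Suc (Suc n)) a (swap n x)"
 proof (rule T_eqI[OF x, where f = "%x. swap n (act (Suc (Suc n)) a x)" and L = ?T])
  fix h y assume h: "h :[H]" and y: "y :[T (Suc n)]"
  show "swap n (act (Suc (Suc n)) a (tc (Suc n) h y)) = act (Suc (Suc n)) a (swap n (tc (Suc n) h y))"
  proof (rule T_eqI[OF y, where f = "%y. swap n (act (Suc (Suc n)) a (tc (Suc n) h y))" and L = ?T])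
   fix g t assume gt: "g :[H]" "t :[T n]"
   have "swap n (act (Suc (Suc n)) a (tc (Suc n) h (tc n g t))) =
     sw ?T (%x y. sw ?T (%u v. tc (Suc n) (u **[H] g) (tc n (x **[H] h) (act n v t))) y) a"
    using a h gt by (simp add: tc_sw linear_sw[OF _ swap_linear] sw_T_closed)
   also have "... = sw ?T (%x y. sw ?T (%u v. tc (Suc n) (x **[H] g) (tc n (u **[H] h) (act n v t))) y) a"
    using a h gt
    by (intro sw_cocomm3[where \<gamma> = "%x u v. tc (Suc n) (u **[H] g) (tc n (x **[H] h) (act n v t))"]
      trilinearI all_lin) simp_all
   also have "... = act (Suc (Suc n)) a (swap n (tc (Suc n) h (tc n g t)))"
    using a h gt by (simp add: tc_sw)
   finally show "swap n (act (Suc (Suc n)) a (tc (Suc n) h (tc n g t))) =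
     act (Suc (Suc n)) a (swap n (tc (Suc n) h (tc n g t)))" .
  qed (use a h in "(intro all_lin swap_comp | simp)+")
 qed (use a in "(intro all_lin swap_comp swap_linear | simp)+")
qed

lemma rot_Hlin: "Hlin (Suc n) (Suc n) (rot n)"
proof (induction n)
 case 0
 show ?case by (simp add: Hlin_def lin_id)
next
 case (Suc n)
 let ?T = "T (Suc (Suc n))"
 show ?case
  unfolding Hlin_def
 proof (intro conjI ballI rot_linear)
  fix a x assume a: "a :[H]" and x: "x :[?T]"
  show "rot (Suc n) (act (Suc (Suc n)) a x) = act (Suc (Suc n)) a (rot (Suc n) x)"
  proof (rule T_eqI[OF x, where f = "%x. rot (Suc n) (act (Suc (Suc n)) a x)" and L = ?T])
   fix h t assume ht: "h :[H]" "t :[T (Suc n)]"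
   have "rot (Suc n) (act (Suc (Suc n)) a (tc (Suc n) h t)) =
     swap n (act (Suc (Suc n)) a (tc (Suc n) h (rot n t)))"
    using a ht by (simp add: linear_sw[OF _ rot_linear] linear_sw[OF _ swap_linear] Hlin_act[OF Suc.IH])
   also have "... = act (Suc (Suc n)) a (rot (Suc n) (tc (Suc n) h t))"
    using a ht by (simp add: Hlin_act[OF swap_Hlin] del: act_tc)
   finally show "rot (Suc n) (act (Suc (Suc n)) a (tc (Suc n) h t)) =
     act (Suc (Suc n)) a (rot (Suc n) (tc (Suc n) h t))" .
  qed (use a in "(intro all_lin rot_comp rot_linear | simp)+")
 qed
qed

text \<open>The inductive step of \<open>rot_F\<close>: the last coordinate is already in front of
  the shorter tensor and has to pass one more factor.\<close>

lemma swap_Z: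
 assumes "a :[H]" "h :[H]" "k :[T (Suc n)]"
 shows "sw (T (Suc (Suc (Suc n)))) (%x y. swap (Suc n) (tc (Suc (Suc n)) x (Z n (y **[H] h) k))) a =
  sw (T (Suc (Suc (Suc n)))) (%u v. Z (Suc n) a (M2 n u v k)) h"
proof -
 let ?T = "T (Suc (Suc (Suc n)))"
 show ?thesis
 proof (rule T_eqI[OF assms(3), where L = ?T and
    f = "%k. sw ?T (%x y. swap (Suc n) (tc (Suc (Suc n)) x (Z n (y **[H] h) k))) a"])
  fix g s assume gs: "g :[H]" "s :[T n]"
  \<comment> \<open>A normal form for both sides: \<open>u\<close>, \<open>v\<close> are the parts
    of \<open>h\<close> and \<open>x\<close>, \<open>p\<close>, \<open>q\<close> those of
    \<open>a\<close>. The two sides then differ only by the order of \<open>x\<close> and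
    \<open>p\<close>.\<close>
  define \<gamma> where "\<gamma> u v x p q = tc (Suc (Suc n)) (p **[H] u **[H] g) (tc (Suc n) x (F n (q **[H] v) s))"
   for u v x p q
  have \<gamma>c [simp]: "\<gamma> u v x p q :[?T]"
   if "u :[H]" "v :[H]" "x :[H]" "p :[H]" "q :[H]" for u v x p q
   using that gs by (simp add: \<gamma>_def)
  have \<gamma>t: "trilinear ?T (\<gamma> u v)" if "u :[H]" "v :[H]" for u v
   unfolding \<gamma>_def using that gs by (intro trilinearI all_lin) simp_all
  have 1: "swap (Suc n) (tc (Suc (Suc n)) x (Z n (y **[H] h) (tc n g s))) =
    sw ?T (%u v. sw ?T (%p q. \<gamma> u v x p q) y) h"
   if xy: "x :[H]" "y :[H]" for x y
  proof -
   have "swap (Suc n) (tc (Suc (Suc n)) x (Z n (y **[H] h) (tc n g s))) =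
     sw ?T (%p q. tc (Suc (Suc n)) (p **[H] g) (tc (Suc n) x (F n q s))) (y **[H] h)"
    using assms gs xy by (simp add: tc_sw linear_sw[OF _ swap_linear])
   also have "... = sw ?T (%p q. sw ?T (%u v. \<gamma> u v x p q) h) y"
    unfolding \<gamma>_def using assms gs xy by (intro sw_mult all_lin) simp_all
   also have "... = sw ?T (%u v. sw ?T (%p q. \<gamma> u v x p q) y) h"
    using assms xy by (intro sw_commute) simp_all
   finally show ?thesis .
  qed
  have "sw ?T (%x y. swap (Suc n) (tc (Suc (Suc n)) x (Z n (y **[H] h) (tc n g s)))) a =
    sw ?T (%x y. sw ?T (%u v. sw ?T (%p q. \<gamma> u v x p q) y) h) a"
   using assms(1) 1 by simp
  also have "... = sw ?T (%u v. sw ?T (%x y. sw ?T (%p q. \<gamma> u v x p q) y) a) h"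
   using assms by (intro sw_commute sw_T_closed) simp_all
  also have "... = sw ?T (%u v. sw ?T (%x y. sw ?T (%p q. \<gamma> u v p x q) y) a) h"
  proof (rule sw_strong_cong[OF refl])
   fix u v assume "h :[H] ==> u :[H]" "h :[H] ==> v :[H]"
   then show "sw ?T (%x y. sw ?T (%p q. \<gamma> u v x p q) y) a = sw ?T (%x y. sw ?T (%p q. \<gamma> u v p x q) y) a"
    using assms by (intro sw_cocomm3 \<gamma>t) simp_all
  qed
  also have "... = sw ?T (%u v. Z (Suc n) a (M2 n u v (tc n g s))) h"
   unfolding \<gamma>_def using assms gs by (simp add: tc_sw m_assoc)
  finally show "sw ?T (%x y. swap (Suc n) (tc (Suc (Suc n)) x (Z n (y **[H] h) (tc n g s)))) a =
    sw ?T (%u v. Z (Suc n) a (M2 n u v (tc n g s))) h" .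
 qed (use assms in "(intro all_lin swap_comp Z_linear M2_linear | simp)+")
qed

text \<open>In bar coordinates rotation means computing the product of all increments, which is what
  \<open>K\<close> does, and putting it first. The length-one case already uses
  cocommutativity.\<close>

lemma rot_F:
 assumes "a :[H]" "t :[T (Suc n)]"
 shows "rot (Suc n) (F (Suc n) a t) = Z n a (K n t)"
 using assms
proof (induction n arbitrary: a t)
 case 0
 let ?T = "T (Suc (Suc 0))"
 show ?case
 proof (rule T_eqI[OF 0(2), where f = "%t. rot (Suc 0) (F (Suc 0) a t)" and L = ?T])
  fix h t assume ht: "h :[H]" "t :[T 0]"
  have "rot (Suc 0) (F (Suc 0) a (tc 0 h t)) = sw ?T (%x y. tc (Suc 0) (y **[H] h) (tc 0 x t)) a"
   using 0 ht by (simp add: linear_sw[OF _ rot_linear])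
  also have "... = sw ?T (%x y. tc (Suc 0) (x **[H] h) (tc 0 y t)) a"
   using 0 ht
   by (intro sw_cocomm[where \<beta> = "%x y. tc (Suc 0) (y **[H] h) (tc 0 x t)"] all_lin) simp_all
  finally show "rot (Suc 0) (F (Suc 0) a (tc 0 h t)) = Z 0 a (K 0 (tc 0 h t))"
   using 0 ht by simp
 qed (use 0 in "(intro all_lin rot_comp Z_linear K_linear | simp del: K.simps)+")
next
 case (Suc n)
 let ?T = "T (Suc (Suc (Suc n)))"
 show ?case
 proof (rule T_eqI[OF Suc.prems(2), where f = "%t. rot (Suc (Suc n)) (F (Suc (Suc n)) a t)" and L = ?T])
  fix h t assume ht: "h :[H]" "t :[T (Suc n)]"
  have "rot (Suc (Suc n)) (F (Suc (Suc n)) a (tc (Suc n) h t)) =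
    sw ?T (%x y. swap (Suc n) (tc (Suc (Suc n)) x (Z n (y **[H] h) (K n t)))) a"
   using Suc.prems ht by (simp add: linear_sw[OF _ rot_linear] Suc.IH)
  also have "... = sw ?T (%u v. Z (Suc n) a (M2 n u v (K n t))) h"
   using Suc.prems ht by (intro swap_Z) simp_all
  also have "... = Z (Suc n) a (K (Suc n) (tc (Suc n) h t))"
   using Suc.prems ht by (simp add: Z_sw)
  finally show "rot (Suc (Suc n)) (F (Suc (Suc n)) a (tc (Suc n) h t)) = Z (Suc n) a (K (Suc n) (tc (Suc n) h t))" .
 qed (use Suc.prems in "(intro all_lin rot_comp Z_linear K_linear | simp)+")
qed

text \<open>On coinvariants the base point may be taken to be \<open>1\<close>. The rotated tensor
  then begins with the product of all increments, and the new first increment leads from there back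
  to \<open>1\<close>: this is the origin of the antipode in the cyclic operator.\<close>

lemma \<pi>_rot:
 assumes "x :[T (Suc (Suc n))]"
 shows "\<pi> (Suc n) (rot (Suc n) x) = sf n (K n (\<pi> (Suc n) x))"
proof -
 have "\<pi> (Suc n) (Z n \<one>[H] k) = sf n k" if "k :[T (Suc n)]" for k
 proof (rule T_eqI[OF that, where f = "%k. \<pi> (Suc n) (Z n \<one>[H] k)" and L = "T (Suc n)"])
  fix g s assume gs: "g :[H]" "s :[T n]"
  have "Z n \<one>[H] (tc n g s) = tc (Suc n) (\<one>[H] **[H] g) (F n \<one>[H] s)"
   using gs by (simp del: l_one) (intro sw_one[where \<beta> = "%x y. tc (Suc n) (x **[H] g) (F n y s)"] all_lin; simp)
  then show "\<pi> (Suc n) (Z n \<one>[H] (tc n g s)) = sf n (tc n g s)"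
   using gs by (simp add: P_F del: Z_tc)
 qed (intro \<pi>_comp Z_linear all_lin sf_linear | simp)+
 then show ?thesis
  using assms by (subst Hlin_descend[OF rot_Hlin assms]) (simp_all add: rot_F)
qed

end

section \<open>Alternating sums\<close>

context module
begin

lemma alternating_sum_closed:
 "(!!i. i \<in> I ==> f i :[M]) ==> alternating_sum M f I :[M]"
 unfolding alternating_sum_def by (intro M.finsum_closed) auto

lemma alternating_sum_cong:
 "(!!i. i \<in> I ==> f i = g i) ==> alternating_sum M f I = alternating_sum M g I"
 unfolding alternating_sum_def by (intro finsum_strong_cong) auto

lemma alternating_sum_0: "f 0 :[M] ==> alternating_sum M f {0} = f 0"
 by (simp add: alternating_sum_def)

lemma alternating_sum_linear:
 assumes "module R N" "\<phi> \<in> lin R M N" "!!i. i \<in> I ==> f i :[M]"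
 shows "\<phi> (alternating_sum M f I) = alternating_sum N (%i. \<phi> (f i)) I"
 unfolding alternating_sum_def using assms(3)
 by (subst lin_finsum[OF assms(2) module_axioms assms(1)])
  (auto intro!: finsum_strong_cong simp: lin_neg[OF assms(2) module_axioms assms(1)])

lemma alternating_sum_linear_map:
 assumes "module R L" "!!i. i \<in> I ==> f i \<in> lin R L M"
 shows "(%x. alternating_sum M (%i. f i x) I) \<in> lin R L M"
proof -
 have "(%x. \<Oplus>\<^bsub>M\<^esub>i\<in>I. (if even i then f i else (%x. -[M] f i x)) x) \<in> lin R L M"
  using assms(2) lin_map_neg[OF assms(2) assms(1) module_axioms]
  by (intro lin_map_finsum[OF _ assms(1) module_axioms]) auto
 then show ?thesis
  unfolding alternating_sum_def by (simp add: if_distrib[of "%f. f _"] cong: if_cong)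
qed

lemma alternating_sum_Suc:
 assumes "!!i. i \<le> Suc n ==> f i :[M]"
 shows "alternating_sum M f {..Suc n} = f 0 -[M] alternating_sum M (%i. f (Suc i)) {..n}"
proof -
 let ?g = "%i. if even i then f i else -[M] f i"
 have g: "?g \<in> {..Suc n} \<rightarrow> carrier M" using assms by auto
 have "alternating_sum M f {..Suc n} = (\<Oplus>\<^bsub>M\<^esub>i\<in>{..n}. ?g (Suc i)) +[M] ?g 0"
  unfolding alternating_sum_def by (rule M.finsum_Suc2[OF g])
 also have "(\<Oplus>\<^bsub>M\<^esub>i\<in>{..n}. ?g (Suc i)) = -[M] alternating_sum M (%i. f (Suc i)) {..n}"
  unfolding alternating_sum_def
  using assms by (subst lin_finsum[OF lin_map_neg[OF lin_id module_axioms module_axioms]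
    module_axioms module_axioms]) (auto intro!: finsum_strong_cong)
 moreover have "alternating_sum M (%i. f (Suc i)) {..n} :[M]" "f 0 :[M]"
  using assms by (auto intro: alternating_sum_closed)
 ultimately show ?thesis
  by (simp add: M.minus_eq M.a_comm)
qed

lemma alternating_sum_last:
 assumes "!!i. i \<le> Suc n ==> f i :[M]"
 shows "alternating_sum M f {..Suc n} =
  alternating_sum M f {..n} +[M] (if odd n then f (Suc n) else -[M] f (Suc n))"
 unfolding alternating_sum_def using assms
 by (subst M.finsum_Suc) (auto simp: M.a_comm intro!: M.a_comm M.finsum_closed)

text \<open>The cancellation behind \<open>b b = 0\<close>, by induction on the size: the column
  \<open>j = 0\<close> and the row \<open>i = 0\<close> are split off and cancel each other by the
  hypothesis, and a smaller array of the same kind remains.\<close>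

lemma alternating_double_sum_zero:
 assumes "!!i j. [|i \<le> N; j \<le> Suc N|] ==> g i j :[M]"
  and "!!i k. [|i \<le> k; k \<le> N|] ==> g i (Suc k) = g k i"
 shows "alternating_sum M (%i. alternating_sum M (g i) {..Suc N}) {..N} = \<zero>[M]"
 using assms
proof (induction N arbitrary: g)
 case 0
 have "alternating_sum M (g 0) {..Suc 0} = g 0 0 -[M] g 0 (Suc 0)"
  using 0(1)[of 0] by (subst alternating_sum_Suc) (simp_all add: alternating_sum_0)
 moreover have "g 0 (Suc 0) = g 0 0" using 0(2)[of 0 0] by simp
 ultimately have "alternating_sum M (g 0) {..Suc 0} = \<zero>[M]"
  using 0(1)[of 0 0] by (simp add: M.diff_zero_iff)
 then show ?case by (simp add: alternating_sum_0)
next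
 case (Suc N)
 let ?A = "alternating_sum M"
 have cl: "?A (%j. g i (Suc j)) {..Suc N} :[M]" if "i \<le> Suc N" for i
  using that Suc.prems(1) by (intro alternating_sum_closed) auto
 have c0: "?A (%i. g i 0) {..Suc N} :[M]"
  using Suc.prems(1) by (intro alternating_sum_closed) auto
 have lin2: "?A (%i. f i -[M] h i) {..n} = ?A f {..n} -[M] ?A h {..n}"
  if "!!i. i \<le> n ==> f i :[M]" "!!i. i \<le> n ==> h i :[M]" for f h n
  using that
 proof (induction n)
  case 0
  then show ?case by (simp add: alternating_sum_0)
 next
  case (Suc n)
  have c: "?A f {..n} :[M]" "?A h {..n} :[M]" "f (Suc n) :[M]" "h (Suc n) :[M]"
   using Suc.prems by (auto intro: alternating_sum_closed)
  have e: "?A (%i. f i -[M] h i) {..n} = ?A f {..n} -[M] ?A h {..n}"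
   using Suc by simp
  show ?case
   using c Suc.prems
   by (subst (1 2 3) alternating_sum_last) (auto simp: e[unfolded M.minus_eq] M.minus_eq M.minus_add M.a_ac)
 qed
 have "?A (%i. ?A (g i) {..Suc (Suc N)}) {..Suc N} =
   ?A (%i. g i 0 -[M] ?A (%j. g i (Suc j)) {..Suc N}) {..Suc N}"
  using Suc.prems(1) by (intro alternating_sum_cong alternating_sum_Suc) auto
 also have "... = ?A (%i. g i 0) {..Suc N} -[M] ?A (%i. ?A (%j. g i (Suc j)) {..Suc N}) {..Suc N}"
  using Suc.prems(1) cl by (intro lin2) auto
 also have "?A (%i. ?A (%j. g i (Suc j)) {..Suc N}) {..Suc N} =
   ?A (%j. g 0 (Suc j)) {..Suc N} -[M] ?A (%i. ?A (%j. g (Suc i) (Suc j)) {..Suc N}) {..N}"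
  using cl by (intro alternating_sum_Suc) auto
 also have "?A (%i. ?A (%j. g (Suc i) (Suc j)) {..Suc N}) {..N} = \<zero>[M]"
  using Suc.prems by (intro Suc.IH) auto
 also have "?A (%j. g 0 (Suc j)) {..Suc N} = ?A (%i. g i 0) {..Suc N}"
  using Suc.prems(2) by (intro alternating_sum_cong) auto
 finally show ?case using c0 by (simp add: M.minus_eq M.r_neg)
qed

end

section \<open>The cyclic double complex of a precyclic module\<close>

lemma linear_funpow:
 assumes "f \<in> lin R M M"
 shows "(f ^^ k) \<in> lin R M M"
proof (induction k)
 case 0
 show ?case using lin_id by (simp add: id_def)
next
 case (Suc k)
 show ?case using lin_comp[OF Suc assms] by (simp add: o_def)
qed

text \<open>The operator \<open>cyc\<close> carries no sign; signs enter with
  \<open>signed_cyc\<close>. The face relation is indexed by \<open>i \<le> k\<close> and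
  \<open>Suc k\<close>, the form in which double sums cancel without subtraction of indices.\<close>

locale precyclic =
 fixes R :: "('k, 'r) ring_scheme" and X :: "('k, 'a) cyclic_object"
 assumes module_obj: "module R (obj X n)"
  and face_linear: "i \<le> Suc n ==> face X (Suc n) i \<in> lin R (obj X (Suc n)) (obj X n)"
  and cyc_linear: "cyc X n \<in> lin R (obj X n) (obj X n)"
  and face_face: "[|i \<le> k; k \<le> Suc n; x :[obj X (Suc (Suc n))]|] ==>
   face X (Suc n) i (face X (Suc (Suc n)) (Suc k) x) = face X (Suc n) k (face X (Suc (Suc n)) i x)"
  and face_cyc_0: "x :[obj X (Suc n)] ==>
   face X (Suc n) 0 (cyc X (Suc n) x) = face X (Suc n) (Suc n) x"
  and face_cyc_Suc: "[|i \<le> n; x :[obj X (Suc n)]|] ==>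
   face X (Suc n) (Suc i) (cyc X (Suc n) x) = cyc X n (face X (Suc n) i x)"
  and cyc_pow: "x :[obj X n] ==> (cyc X n ^^ Suc n) x = x"
begin

abbreviation C where "C \<equiv> obj X"
abbreviation b where "b \<equiv> hochschild_b X"
abbreviation b' where "b' \<equiv> hochschild_b' X"
abbreviation t where "t \<equiv> signed_cyc X"
abbreviation N where "N \<equiv> cyclic_norm X"

lemma face_closed [simp]: "[|i \<le> Suc n; x :[C (Suc n)]|] ==> face X (Suc n) i x :[C n]"
 by (rule lin_closed[OF face_linear])

lemma cyc_closed [simp]: "x :[C n] ==> cyc X n x :[C n]"
 by (rule lin_closed[OF cyc_linear])

lemma b_linear: "b n \<in> lin R (C (Suc n)) (C n)"
proof -
 interpret C: module R "C n" by (rule module_obj)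
 have "(%x. alternating_sum (C n) (%i. face X (Suc n) i x) {..Suc n}) \<in> lin R (C (Suc n)) (C n)"
  by (intro C.alternating_sum_linear_map module_obj face_linear) simp
 then show ?thesis by (simp add: hochschild_b_def[abs_def])
qed

lemma b'_linear: "b' n \<in> lin R (C (Suc n)) (C n)"
proof -
 interpret C: module R "C n" by (rule module_obj)
 have "(%x. alternating_sum (C n) (%i. face X (Suc n) i x) {..n}) \<in> lin R (C (Suc n)) (C n)"
  by (intro C.alternating_sum_linear_map module_obj face_linear) simp
 then show ?thesis by (simp add: hochschild_b'_def[abs_def])
qed

lemma t_linear: "t n \<in> lin R (C n) (C n)"
 using cyc_linear[of n] lin_map_neg[OF cyc_linear module_obj module_obj, of n]
 by (cases "even n") (simp_all add: signed_cyc_def[abs_def])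

lemma N_linear: "N n \<in> lin R (C n) (C n)"
 unfolding cyclic_norm_def[abs_def]
 by (intro lin_map_finsum linear_funpow t_linear module_obj)

lemma bc [simp]: "x :[C (Suc n)] ==> b n x :[C n]"
 and b'c [simp]: "x :[C (Suc n)] ==> b' n x :[C n]"
 and tc [simp]: "x :[C n] ==> t n x :[C n]"
 and tpc [simp]: "x :[C n] ==> (t n ^^ k) x :[C n]"
 and Nc [simp]: "x :[C n] ==> N n x :[C n]"
 using lin_closed[OF b_linear] lin_closed[OF b'_linear] lin_closed[OF t_linear]
  lin_closed[OF N_linear] lin_closed[OF linear_funpow[OF t_linear]] by auto

lemma b_b: "x :[C (Suc (Suc n))] ==> b n (b (Suc n) x) = \<zero>[C n]"
proof -
 assume x: "x :[C (Suc (Suc n))]"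
 interpret C: module R "C n" by (rule module_obj)
 interpret C1: module R "C (Suc n)" by (rule module_obj)
 have "b n (b (Suc n) x) = alternating_sum (C n) (%i. alternating_sum (C n)
   (%j. face X (Suc n) i (face X (Suc (Suc n)) j x)) {..Suc (Suc n)}) {..Suc n}"
  unfolding hochschild_b_def using x
  by (intro C.alternating_sum_cong C1.alternating_sum_linear[OF module_obj face_linear]) auto
 also have "... = \<zero>[C n]"
  using x by (intro C.alternating_double_sum_zero) (auto intro: face_face)
 finally show ?thesis .
qed

lemma b'_b': "x :[C (Suc (Suc n))] ==> b' n (b' (Suc n) x) = \<zero>[C n]"
proof -
 assume x: "x :[C (Suc (Suc n))]"
 interpret C: module R "C n" by (rule module_obj)
 interpret C1: module R "C (Suc n)" by (rule module_obj)
 have "b' n (b' (Suc n) x) = alternating_sum (C n) (%i. alternating_sum (C n)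
   (%j. face X (Suc n) i (face X (Suc (Suc n)) j x)) {..Suc n}) {..n}"
  unfolding hochschild_b'_def using x
  by (intro C.alternating_sum_cong C1.alternating_sum_linear[OF module_obj face_linear]) auto
 also have "... = \<zero>[C n]"
  using x by (intro C.alternating_double_sum_zero) (auto intro: face_face)
 finally show ?thesis .
qed

text \<open>Signed faces \<open>(-1)\<^sup>i d\<^sub>i\<close>, for which the relations with \<open>t\<close> carry no signs.\<close>

definition sface :: "nat => nat => 'a => 'a"
 where "sface n i x = (if even i then face X (Suc n) i x else -[C n] face X (Suc n) i x)"

lemma sface_closed [simp]: "[|i \<le> Suc n; x :[C (Suc n)]|] ==> sface n i x :[C n]"
proof -
 interpret C: module R "C n" by (rule module_obj)
 show "[|i \<le> Suc n; x :[C (Suc n)]|] ==> sface n i x :[C n]" by (simp add: sface_def)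
qed

lemma sface_linear: "i \<le> Suc n ==> sface n i \<in> lin R (C (Suc n)) (C n)"
 using face_linear[of i n] lin_map_neg[OF face_linear module_obj module_obj, of i n]
 by (cases "even i") (simp_all add: sface_def[abs_def])

lemma b_sface: "b n x = (\<Oplus>\<^bsub>C n\<^esub>i\<in>{..Suc n}. sface n i x)"
 and b'_sface: "b' n x = (\<Oplus>\<^bsub>C n\<^esub>i\<in>{..n}. sface n i x)"
 by (simp_all add: hochschild_b_def hochschild_b'_def alternating_sum_def sface_def cong: if_cong)

lemma sface_t_0: "x :[C (Suc n)] ==> sface n 0 (t (Suc n) x) = sface n (Suc n) x"
proof -
 interpret C: module R "C n" by (rule module_obj)
 show "x :[C (Suc n)] ==> sface n 0 (t (Suc n) x) = sface n (Suc n) x"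
  by (simp add: sface_def signed_cyc_def face_cyc_0 lin_neg[OF face_linear module_obj module_obj])
qed

lemma sface_t_Suc:
 "[|i \<le> n; x :[C (Suc n)]|] ==> sface n (Suc i) (t (Suc n) x) = t n (sface n i x)"
proof -
 interpret C: module R "C n" by (rule module_obj)
 show "[|i \<le> n; x :[C (Suc n)]|] ==> sface n (Suc i) (t (Suc n) x) = t n (sface n i x)"
  by (simp add: sface_def signed_cyc_def face_cyc_Suc lin_neg[OF face_linear module_obj module_obj]
    lin_neg[OF cyc_linear module_obj module_obj])
qed

lemma b_t: "x :[C (Suc n)] ==> b n (t (Suc n) x) = sface n (Suc n) x +[C n] t n (b' n x)"
proof -
 assume x: "x :[C (Suc n)]"
 interpret C: module R "C n" by (rule module_obj)
 have "b n (t (Suc n) x) = (\<Oplus>\<^bsub>C n\<^esub>i\<in>{..n}. sface n (Suc i) (t (Suc n) x)) +[C n] sface n 0 (t (Suc n) x)"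
  unfolding b_sface using x by (intro C.finsum_Suc2) auto
 also have "(\<Oplus>\<^bsub>C n\<^esub>i\<in>{..n}. sface n (Suc i) (t (Suc n) x)) = (\<Oplus>\<^bsub>C n\<^esub>i\<in>{..n}. t n (sface n i x))"
  using x by (intro finsum_strong_cong) (simp add: sface_t_Suc)
 also have "... = t n (b' n x)"
  unfolding b'_sface using x by (intro lin_finsum[OF t_linear module_obj module_obj, symmetric]) auto
 finally show ?thesis
  using x by (simp add: sface_t_0 C.a_comm)
qed

lemma b_one_minus_t:
 assumes x: "x :[C (Suc n)]"
 shows "b n (x -[C (Suc n)] t (Suc n) x) = b' n x -[C n] t n (b' n x)"
proof -
 interpret C: module R "C n" by (rule module_obj)
 have "b n x = sface n (Suc n) x +[C n] b' n x"
  unfolding b_sface b'_sface using x by (intro C.finsum_Suc) auto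
 then have "b n (x -[C (Suc n)] t (Suc n) x) =
   (sface n (Suc n) x +[C n] b' n x) -[C n] (sface n (Suc n) x +[C n] t n (b' n x))"
  using x by (simp add: lin_diff[OF b_linear module_obj module_obj] b_t)
 also have "... = b' n x -[C n] t n (b' n x)"
  using x by (simp add: C.minus_eq C.minus_add C.a_ac C.r_neg2)
 finally show ?thesis .
qed

lemma t_pow_cyc:
 "x :[C n] ==> (t n ^^ k) x = (if even (n * k) then (cyc X n ^^ k) x else -[C n] (cyc X n ^^ k) x)"
proof (induction k)
 case (Suc k)
 interpret C: module R "C n" by (rule module_obj)
 have "(cyc X n ^^ k) x :[C n]"
  using lin_closed[OF linear_funpow[OF cyc_linear] Suc.prems] .
 then show ?case
  using Suc by (auto simp: signed_cyc_def lin_neg[OF cyc_linear module_obj module_obj])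
qed simp

lemma t_pow: "x :[C n] ==> (t n ^^ Suc n) x = x"
proof -
 have "even (n * Suc n)" by simp
 then show "x :[C n] ==> (t n ^^ Suc n) x = x"
  by (subst t_pow_cyc) (simp_all only: if_True cyc_pow)
qed

lemma t_N: "x :[C n] ==> t n (N n x) = N n x"
 and N_t: "x :[C n] ==> N n (t n x) = N n x"
proof -
 assume x: "x :[C n]"
 interpret C: module R "C n" by (rule module_obj)
 have 1: "(\<Oplus>\<^bsub>C n\<^esub>i\<in>{..n}. (t n ^^ Suc i) x) = N n x"
 proof (cases n)
  case 0
  interpret C0: module R "C 0" by (rule module_obj)
  show ?thesis using t_pow[OF x] x 0 by (simp add: cyclic_norm_def)
 next
  case (Suc m)
  have "(\<Oplus>\<^bsub>C n\<^esub>i\<in>{..Suc m}. (t n ^^ Suc i) x) =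
    (t n ^^ Suc (Suc m)) x +[C n] (\<Oplus>\<^bsub>C n\<^esub>i\<in>{..m}. (t n ^^ Suc i) x)"
   using x by (intro C.finsum_Suc) (auto simp del: funpow.simps)
  also have "(t n ^^ Suc (Suc m)) x = (t n ^^ 0) x"
   using t_pow[OF x] Suc by simp
  also have "(t n ^^ 0) x +[C n] (\<Oplus>\<^bsub>C n\<^esub>i\<in>{..m}. (t n ^^ Suc i) x) =
    (\<Oplus>\<^bsub>C n\<^esub>i\<in>{..m}. (t n ^^ Suc i) x) +[C n] (t n ^^ 0) x"
   using x by (intro C.a_comm C.finsum_closed) (auto simp del: funpow.simps)
  also have "... = (\<Oplus>\<^bsub>C n\<^esub>i\<in>{..Suc m}. (t n ^^ i) x)"
   using x by (intro C.finsum_Suc2[symmetric]) auto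
  finally show ?thesis by (simp add: cyclic_norm_def Suc)
 qed
 have "t n (N n x) = (\<Oplus>\<^bsub>C n\<^esub>i\<in>{..n}. t n ((t n ^^ i) x))"
  unfolding cyclic_norm_def using x by (intro lin_finsum[OF t_linear module_obj module_obj]) auto
 then show "t n (N n x) = N n x" using 1 by simp
 have "N n (t n x) = (\<Oplus>\<^bsub>C n\<^esub>i\<in>{..n}. (t n ^^ Suc i) x)"
  unfolding cyclic_norm_def by (simp only: funpow_Suc_right o_apply)
 then show "N n (t n x) = N n x" using 1 by simp
qed

lemma one_minus_t_N: "x :[C n] ==> N n x -[C n] t n (N n x) = \<zero>[C n]"
 and N_one_minus_t: "x :[C n] ==> N n (x -[C n] t n x) = \<zero>[C n]"
proof -
 assume x: "x :[C n]"
 interpret C: module R "C n" by (rule module_obj)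
 show "N n x -[C n] t n (N n x) = \<zero>[C n]" "N n (x -[C n] t n x) = \<zero>[C n]"
  using x by (simp_all add: t_N N_t lin_diff[OF N_linear module_obj module_obj] C.diff_zero_iff)
qed

lemma t_pow_N: "x :[C n] ==> (t n ^^ k) (N n x) = N n x"
 by (induction k) (simp_all add: t_N)

lemma N_t_pow: "x :[C n] ==> N n ((t n ^^ k) x) = N n x"
 by (induction k) (simp_all add: N_t)

lemma sface_t_pow:
 "[|i \<le> n; x :[C (Suc n)]|] ==> sface n i ((t (Suc n) ^^ i) x) = (t n ^^ i) (sface n 0 x)"
 by (induction i) (simp_all add: sface_t_Suc)

lemma sface_t_pow':
 "[|i \<le> Suc n; x :[C (Suc n)]|] ==> sface n i ((t (Suc n) ^^ i) x) = (t n ^^ i) (sface n 0 x)"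
 by (cases i) (simp_all add: sface_t_Suc sface_t_pow)

text \<open>Both sides are \<open>N d\<^sub>0 N\<close>.\<close>

lemma b'_N:
 assumes x: "x :[C (Suc n)]"
 shows "b' n (N (Suc n) x) = N n (b n x)"
proof -
 interpret C: module R "C n" by (rule module_obj)
 interpret C1: module R "C (Suc n)" by (rule module_obj)
 have 1: "sface n i (N (Suc n) x) = (t n ^^ i) (sface n 0 (N (Suc n) x))" if "i \<le> n" for i
  using sface_t_pow[OF that, of "N (Suc n) x"] x by (simp add: t_pow_N)
 have "b' n (N (Suc n) x) = N n (sface n 0 (N (Suc n) x))"
  unfolding b'_sface cyclic_norm_def[of X n] by (intro finsum_strong_cong 1) simp
 also have "... = N n (b n x)"
 proof -
  let ?f = "%y. N n (sface n 0 y)"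
  have lf: "?f \<in> lin R (C (Suc n)) (C n)"
   by (intro lin_comp[OF sface_linear N_linear]) simp
  \<comment> \<open>A signed face is face 0 conjugated by powers of \<open>t\<close>. To use this,
    \<open>x\<close> is written as the \<open>i\<close>-th power of \<open>t\<close> applied to an
    element, which is possible since the power \<open>n + 2\<close> of \<open>t\<close> is the
    identity in degree \<open>n + 1\<close>. The outer powers of \<open>t\<close> are absorbed by
    \<open>N\<close>.\<close>
  have i: "N n (sface n i x) = ?f ((t (Suc n) ^^ (Suc (Suc n) - i)) x)" if i: "i \<le> Suc n" for i
  proof -
   have "x = (t (Suc n) ^^ i) ((t (Suc n) ^^ (Suc (Suc n) - i)) x)"
    using t_pow[OF x] i by (simp only: funpow_add[symmetric, THEN fun_cong, unfolded o_apply]) simp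
   then have "sface n i x = (t n ^^ i) (sface n 0 ((t (Suc n) ^^ (Suc (Suc n) - i)) x))"
    using sface_t_pow'[OF i, of "(t (Suc n) ^^ (Suc (Suc n) - i)) x"] x by simp
   then show ?thesis using x by (simp add: N_t_pow)
  qed
  have "N n (b n x) = (\<Oplus>\<^bsub>C n\<^esub>i\<in>{..Suc n}. N n (sface n i x))"
   unfolding b_sface using x by (intro lin_finsum[OF N_linear module_obj module_obj]) auto
  also have "... = (\<Oplus>\<^bsub>C n\<^esub>i\<in>{..Suc n}. ?f (t (Suc n) ((t (Suc n) ^^ (Suc n - i)) x)))"
   using i by (intro finsum_strong_cong) (simp add: Suc_diff_le)
  also have "... = ?f (t (Suc n) (\<Oplus>\<^bsub>C (Suc n)\<^esub>i\<in>{..Suc n}. (t (Suc n) ^^ (Suc n - i)) x))"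
   using x by (intro lin_finsum[OF lin_comp[OF t_linear lf] module_obj module_obj, symmetric]) auto
  also have "(\<Oplus>\<^bsub>C (Suc n)\<^esub>i\<in>{..Suc n}. (t (Suc n) ^^ (Suc n - i)) x) = N (Suc n) x"
  proof -
   have "bij_betw (%i. Suc n - i) {..Suc n} {..Suc n}"
    by (rule bij_betwI[of _ _ _ "%i. Suc n - i"]) auto
   then have "inj_on (%i. Suc n - i) {..Suc n}" "(%i. Suc n - i) ` {..Suc n} = {..Suc n}"
    by (auto simp: bij_betw_def)
   then show ?thesis
    unfolding cyclic_norm_def
    using C1.finsum_reindex[of "%i. (t (Suc n) ^^ i) x" "%i. Suc n - i" "{..Suc n}"] x by (simp del: funpow.simps)
  qed
  finally show ?thesis using x by (simp add: t_N)
 qed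
 finally show ?thesis .
qed

lemma vertical_linear: "vertical X p q \<in> lin R (C (Suc q)) (C q)"
 using b_linear[of q] lin_map_neg[OF b'_linear module_obj module_obj, of q]
 by (cases "even p") (simp_all add: vertical_def[abs_def])

lemma horizontal_linear: "horizontal X p q \<in> lin R (C q) (C q)"
 using N_linear[of q] lin_map_diff[OF lin_id t_linear module_obj module_obj, of q]
 by (cases "even p") (simp_all add: horizontal_def[abs_def])

lemma vertical_closed [simp]: "x :[C (Suc q)] ==> vertical X p q x :[C q]"
 and horizontal_closed [simp]: "x :[C q] ==> horizontal X p q x :[C q]"
 using lin_closed[OF vertical_linear] lin_closed[OF horizontal_linear] by auto

lemma vertical_vertical:
 "x :[C (Suc (Suc q))] ==> vertical X p q (vertical X p (Suc q) x) = \<zero>[C q]"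
proof -
 interpret C: module R "C q" by (rule module_obj)
 show "x :[C (Suc (Suc q))] ==> vertical X p q (vertical X p (Suc q) x) = \<zero>[C q]"
  by (simp add: vertical_def b_b b'_b' lin_neg[OF b'_linear module_obj module_obj])
qed

lemma horizontal_horizontal:
 "x :[C q] ==> horizontal X p q (horizontal X (Suc p) q x) = \<zero>[C q]"
 by (simp add: horizontal_def one_minus_t_N N_one_minus_t)

lemma vertical_horizontal:
 assumes x: "x :[C (Suc q)]"
 shows "vertical X p q (horizontal X p (Suc q) x) +[C q] horizontal X p q (vertical X (Suc p) q x) = \<zero>[C q]"
proof -
 interpret C: module R "C q" by (rule module_obj)
 show ?thesis
 proof (cases "even p")
  case True
  have "-[C q] b' q x -[C q] t q (-[C q] b' q x) = -[C q] (b' q x -[C q] t q (b' q x))"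
   using x by (simp add: lin_neg[OF t_linear module_obj module_obj] C.minus_eq C.minus_add)
  with True x show ?thesis
   by (simp add: vertical_def horizontal_def b_one_minus_t C.r_neg)
 next
  case False
  with x show ?thesis by (simp add: vertical_def horizontal_def b'_N C.l_neg)
 qed
qed

end

lemma precyclic_morphism:
 assumes X: "precyclic R X" and Y: "precyclic R Y"
  and g: "!!n. g n \<in> lin R (obj X n) (obj Y n)"
  and face: "!!n i x. [|i \<le> Suc n; x :[obj X (Suc n)]|] ==> g n (face X (Suc n) i x) = face Y (Suc n) i (g (Suc n) x)"
  and cyc: "!!n x. x :[obj X n] ==> g n (cyc X n x) = cyc Y n (g n x)"
 shows "x :[obj X (Suc n)] ==> g n (hochschild_b X n x) = hochschild_b Y n (g (Suc n) x)"
  and "x :[obj X (Suc n)] ==> g n (vertical X p n x) = vertical Y p n (g (Suc n) x)"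
  and "x :[obj X n] ==> g n (horizontal X p n x) = horizontal Y p n (g n x)"
proof -
 interpret X: precyclic R X by fact
 interpret Y: precyclic R Y by fact
 note mX = X.module_obj and mY = Y.module_obj
 show b: "g n (hochschild_b X n x) = hochschild_b Y n (g (Suc n) x)"
  if "x :[obj X (Suc n)]" for n x
  unfolding hochschild_b_def using that face
  by (subst module.alternating_sum_linear[OF mX mY g]) (auto intro!: module.alternating_sum_cong[OF mY])
 have b': "g n (hochschild_b' X n x) = hochschild_b' Y n (g (Suc n) x)"
  if "x :[obj X (Suc n)]" for n x
  unfolding hochschild_b'_def using that face
  by (subst module.alternating_sum_linear[OF mX mY g]) (auto intro!: module.alternating_sum_cong[OF mY])
 have t: "g n (signed_cyc X n x) = signed_cyc Y n (g n x)" if "x :[obj X n]" for n x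
  using that cyc by (simp add: signed_cyc_def lin_neg[OF g mX mY])
 have tp: "g n ((signed_cyc X n ^^ k) x) = (signed_cyc Y n ^^ k) (g n x)" if "x :[obj X n]" for n x k
  using that by (induction k) (simp_all add: t)
 have N: "g n (cyclic_norm X n x) = cyclic_norm Y n (g n x)" if "x :[obj X n]" for n x
  unfolding cyclic_norm_def using that
  by (subst lin_finsum[OF g mX mY]) (auto intro!: finsum_strong_cong simp: tp)
 show "x :[obj X (Suc n)] ==> g n (vertical X p n x) = vertical Y p n (g (Suc n) x)"
  by (simp add: vertical_def b b' lin_neg[OF g mX mY])
 show "x :[obj X n] ==> g n (horizontal X p n x) = horizontal Y p n (g n x)"
  by (simp add: horizontal_def t N lin_diff[OF g mX mY])
qed

lemma Nil_notin_tuples_Suc [simp]: "[] \<notin> tuples M (Suc n)"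
 by (simp add: tuples_def)

section \<open>The homogeneous cyclic object\<close>

context hopf_algebra
begin

lemma e0_closed [simp]: "t :[T (Suc n)] ==> e0 n t :[T n]"
 by (rule lin_closed[OF e0_linear])

lemma del_del:
 assumes "i \<le> k" "k \<le> n" "x :[T (Suc (Suc n))]"
 shows "del n i (del (Suc n) (Suc k) x) = del n k (del (Suc n) i x)"
 using assms
proof (induction n arbitrary: i k x)
 case 0
 then have "i = 0" "k = 0" by auto
 have "del 0 0 (del (Suc 0) (Suc 0) x) = del 0 0 (del (Suc 0) 0 x)"
 proof (rule T_eqI[OF 0(3) module_T[of 0], where f = "%x. del 0 0 (del (Suc 0) (Suc 0) x)"
    and g = "%x. del 0 0 (del (Suc 0) 0 x)"])
  fix h t assume "h :[H]" "t :[T (Suc 0)]"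
  then show "del 0 0 (del (Suc 0) (Suc 0) (tc (Suc 0) h t)) = del 0 0 (del (Suc 0) 0 (tc (Suc 0) h t))"
   by (simp add: lin_smult[OF e0_linear])
 qed (rule lin_comp[OF del_linear del_linear])+
 then show ?case by (simp only: \<open>i = 0\<close> \<open>k = 0\<close>)
next
 case (Suc n)
 show ?case
 proof (rule T_eqI[OF Suc.prems(3) module_T[of "Suc n"], where f = "%x. del (Suc n) i (del (Suc (Suc n)) (Suc k) x)"
    and g = "%x. del (Suc n) k (del (Suc (Suc n)) i x)"])
  fix h t assume ht: "h :[H]" "t :[T (Suc (Suc n))]"
  show "del (Suc n) i (del (Suc (Suc n)) (Suc k) (tc (Suc (Suc n)) h t)) =
    del (Suc n) k (del (Suc (Suc n)) i (tc (Suc (Suc n)) h t))"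
  proof (cases i)
   case 0
   then show ?thesis using ht by (simp add: lin_smult[OF del_linear])
  next
   case (Suc i')
   then obtain k' where "k = Suc k'" using Suc.prems by (cases k) auto
   then show ?thesis using ht Suc Suc.prems by (simp add: Suc.IH)
  qed
 qed (rule lin_comp[OF del_linear del_linear])+
qed

text \<open>Faces 0 and 1 change places under an exchange of the first two factors, and the later
  faces commute with it. These three rules carry the inductions for \<open>rot\<close>.\<close>

lemma e0_swap:
 assumes "h :[H]" "y :[T (Suc n)]"
 shows "e0 (Suc n) (swap n (tc (Suc n) h y)) = tc n h (e0 n y)"
 by (rule T_eqI[OF assms(2), where L = "T (Suc n)" and f = "%y. e0 (Suc n) (swap n (tc (Suc n) h y))"])
  (use assms(1) in "(intro lin_comp[OF _ e0_linear] swap_comp all_lin e0_linear | simp add: tc_smult)+")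

lemma del_1_swap:
 assumes "h :[H]" "y :[T (Suc n)]"
 shows "del (Suc n) (Suc 0) (swap n (tc (Suc n) h y)) = \<epsilon> h *[T (Suc n)] y"
 by (rule T_eqI[OF assms(2), where L = "T (Suc n)" and f = "%y. del (Suc n) (Suc 0) (swap n (tc (Suc n) h y))"])
  (use assms(1) in "(intro del_comp swap_comp all_lin | simp add: tc_smult)+")

lemma del_Suc_Suc_swap:
 assumes "h :[H]" "y :[T (Suc (Suc n))]"
 shows "del (Suc (Suc n)) (Suc (Suc i)) (swap (Suc n) (tc (Suc (Suc n)) h y)) =
  swap n (tc (Suc n) h (del (Suc n) (Suc i) y))"
 by (rule T_eqI[OF assms(2), where L = "T (Suc (Suc n))" and
    f = "%y. del (Suc (Suc n)) (Suc (Suc i)) (swap (Suc n) (tc (Suc (Suc n)) h y))"])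
  (use assms(1) in "(intro del_comp swap_comp all_lin del_linear | simp)+")

lemma e0_rot:
 assumes "x :[T (Suc (Suc n))]"
 shows "e0 (Suc n) (rot (Suc n) x) = del (Suc n) (Suc n) x"
 using assms
proof (induction n arbitrary: x)
 case 0
 show ?case
  by (rule T_eqI[OF 0, where L = "T (Suc 0)" and f = "%x. e0 (Suc 0) (rot (Suc 0) x)"])
   (intro lin_comp[OF _ e0_linear] rot_linear del_linear | simp add: e0_swap)+
next
 case (Suc n)
 show ?case
  by (rule T_eqI[OF Suc.prems, where L = "T (Suc (Suc n))" and f = "%x. e0 (Suc (Suc n)) (rot (Suc (Suc n)) x)"])
   (intro lin_comp[OF _ e0_linear] rot_linear del_linear | simp add: e0_swap Suc.IH)+
qed

lemma del_Suc_rot: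
 assumes "x :[T (Suc (Suc n))]" "i \<le> n"
 shows "del (Suc n) (Suc i) (rot (Suc n) x) = rot n (del (Suc n) i x)"
 using assms
proof (induction n arbitrary: x i)
 case 0
 have "del (Suc 0) (Suc 0) (rot (Suc 0) x) = e0 (Suc 0) x"
  by (rule T_eqI[OF 0(1) module_T[of "Suc 0"], where g = "e0 (Suc 0)" and f = "%x. del (Suc 0) (Suc 0) (rot (Suc 0) x)"])
   (rule lin_comp[OF rot_linear del_linear] e0_linear | simp add: del_1_swap)+
 then show ?case using 0 by simp
next
 case (Suc n)
 show ?case
 proof (rule T_eqI[OF Suc.prems(1) module_T[of "Suc (Suc n)"], where f = "%x. del (Suc (Suc n)) (Suc i) (rot (Suc (Suc n)) x)"
    and g = "%x. rot (Suc n) (del (Suc (Suc n)) i x)"])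
  fix h t assume ht: "h :[H]" "t :[T (Suc (Suc n))]"
  show "del (Suc (Suc n)) (Suc i) (rot (Suc (Suc n)) (tc (Suc (Suc n)) h t)) =
    rot (Suc n) (del (Suc (Suc n)) i (tc (Suc (Suc n)) h t))"
  proof (cases i)
   case 0
   then show ?thesis using ht by (simp add: del_1_swap lin_smult[OF rot_linear])
  next
   case (Suc j)
   then show ?thesis using ht Suc.prems by (simp add: del_Suc_Suc_swap Suc.IH)
  qed
 qed (rule lin_comp[OF rot_linear del_linear] lin_comp[OF del_linear rot_linear])+
qed

lemma rot_pure:
 assumes "hs \<in> tuples H (Suc n)"
 shows "rot n (pure_tensor R H hs) = pure_tensor R H (last hs # butlast hs)"
 using assms
proof (induction n arbitrary: hs)
 case 0
 then show ?case by (auto elim!: tuples_SucE)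
next
 case (Suc n)
 from Suc.prems obtain h hs' where hs: "hs = h # hs'" "h :[H]" "hs' \<in> tuples H (Suc n)"
  by (rule tuples_SucE)
 from hs(3) have ne: "hs' \<noteq> []" by auto
 have lb: "last hs' :[H]" "butlast hs' \<in> tuples H n"
  using hs(3) ne by (auto simp: tuples_def dest: in_set_butlastD)
 have pc: "pure_tensor R H hs' :[T (Suc n)]" "pure_tensor R H (butlast hs') :[T n]"
  using pure_tensor_closed[OF module_H] hs lb by auto
 have "rot (Suc n) (pure_tensor R H hs) = rot (Suc n) (tc (Suc n) h (pure_tensor R H hs'))"
  using hs by (simp add: tcons_pure[OF module_H])
 also have "... = swap n (tc (Suc n) h (tc n (last hs') (pure_tensor R H (butlast hs'))))"
  using hs pc tcons_pure[OF module_H lb] by (simp add: Suc.IH)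
 also have "... = tc (Suc n) (last hs') (tc n h (pure_tensor R H (butlast hs')))"
  using hs lb pc by simp
 also have "... = pure_tensor R H (last hs' # h # butlast hs')"
  using hs lb pc by (simp add: tcons_pure[OF module_H])
 finally show ?case using hs ne by simp
qed

text \<open>The step \<open>last xs # butlast xs\<close> is inverse to \<open>rotate1\<close>, and
  rotating by the full length is the identity.\<close>

lemma rotate_back: "((%xs. last xs # butlast xs) ^^ length xs) xs = xs"
proof (cases "xs = []")
 case False
 let ?f = "%xs. last xs # butlast xs"
 have len: "length ((?f ^^ k) xs) = length xs" for k
  using False by (induction k) auto
 have "rotate k ((?f ^^ k) xs) = xs" for k
 proof (induction k)
  case (Suc k)
  have "(?f ^^ k) xs \<noteq> []" using len[of k] False by auto
  then have "rotate1 (?f ((?f ^^ k) xs)) = (?f ^^ k) xs" by simp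
  then show ?case
   using Suc by (simp add: rotate1_rotate_swap del: rotate1.simps)
 qed simp
 from this[of "length xs"] show ?thesis using len[of "length xs"] by (simp add: rotate_id)
qed simp

lemma rot_pow:
 assumes "x :[T (Suc n)]"
 shows "(rot n ^^ Suc n) x = x"
proof (rule tensor_power_eq[OF module_H module_T linear_funpow[OF rot_linear] lin_id _ assms])
 fix hs assume hs: "hs \<in> tuples H (Suc n)"
 let ?r = "%xs :: 'h list. last xs # butlast xs"
 have r: "?r xs \<in> tuples H (Suc n)" if "xs \<in> tuples H (Suc n)" for xs
  using that by (cases "xs = []") (auto simp: tuples_def dest: in_set_butlastD)
 have rt: "(?r ^^ k) hs \<in> tuples H (Suc n)" for k
  using hs r by (induction k) simp_all
 have "(rot n ^^ k) (pure_tensor R H hs) = pure_tensor R H ((?r ^^ k) hs)" for k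
  using rt by (induction k) (simp_all add: rot_pure)
 from this[of "Suc n"] rotate_back[of hs] hs
 show "(rot n ^^ Suc n) (pure_tensor R H hs) = pure_tensor R H hs"
  by (simp add: tuples_def del: funpow.simps)
qed

definition HX :: "('k, ('h list => 'k) set) cyclic_object"
 where "HX = \<lparr>obj = (%n. T (Suc n)), face = del, degen = (%n i x. x), cyc = rot\<rparr>"

lemma HX_simps [simp]: "obj HX n = T (Suc n)" "face HX = del" "cyc HX = rot"
 by (simp_all add: HX_def)

lemma precyclic_HX: "precyclic R HX"
proof (rule precyclic.intro)
 fix n i k and x :: "('h list => 'k) set"
 show "[|i \<le> k; k \<le> Suc n; x :[obj HX (Suc (Suc n))]|] ==>
   face HX (Suc n) i (face HX (Suc (Suc n)) (Suc k) x) = face HX (Suc n) k (face HX (Suc (Suc n)) i x)"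
  by (simp add: del_del)
 show "x :[obj HX n] ==> (cyc HX n ^^ Suc n) x = x"
  using rot_pow by (simp del: funpow.simps)
qed (simp_all add: del_linear rot_linear e0_rot del_Suc_rot)

section \<open>The cyclic module of the Hopf algebra in recursive form\<close>

abbreviation CX where "CX \<equiv> hopf_cyclic_module R H \<Delta> \<epsilon> S"

lemma CX_obj [simp]: "obj CX = T"
 by (simp add: hopf_cyclic_module_def)

lemma CX_face_0:
 assumes "x :[T (Suc n)]"
 shows "face CX (Suc n) 0 x = e0 n x"
 unfolding hopf_cyclic_module_def tensor_extension_def cyclic_object.simps diff_Suc_1
proof (rule linear_extension_tensor_power[OF module_H module_T e0_linear _ assms])
 fix hs assume "hs \<in> tuples H (Suc n)"
 then obtain h hs' where "hs = h # hs'" "h :[H]" "hs' \<in> tuples H n" by (rule tuples_SucE)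
 then show "e0 n (pure_tensor R H hs) = hopf_face R H \<epsilon> (Suc n) 0 hs"
  using pure_tensor_closed[OF module_H]
  by (simp add: hopf_face_def tcons_pure[OF module_H, symmetric])
qed

lemma dd_pure:
 assumes "hs \<in> tuples H (Suc n)" "j \<le> n"
 shows "dd n j (pure_tensor R H hs) = (if j < n
  then pure_tensor R H (take j hs @ [hs ! j **[H] hs ! Suc j] @ drop (Suc (Suc j)) hs)
  else \<epsilon> (last hs) *[T n] pure_tensor R H (butlast hs))"
 using assms
proof (induction n arbitrary: hs j)
 case 0
 then obtain h where h: "hs = [h]" "h :[H]" by (auto elim!: tuples_SucE)
 have "dd 0 j (tc 0 h (pure_tensor R H [])) = \<epsilon> h *[T 0] pure_tensor R H []"
  using h by simp
 then show ?case
  using h 0 by (simp add: tcons_pure[OF module_H])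
next
 case (Suc n)
 from Suc.prems(1) obtain h hs' where hs: "hs = h # hs'" "h :[H]" "hs' \<in> tuples H (Suc n)"
  by (rule tuples_SucE)
 then have ne: "hs' \<noteq> []" by auto
 note pc = pure_tensor_closed[OF module_H]
 have eq: "dd (Suc n) j (pure_tensor R H hs) = dd (Suc n) j (tc (Suc n) h (pure_tensor R H hs'))"
  using hs by (simp add: tcons_pure[OF module_H])
 show ?case
 proof (cases j)
  case 0
  from hs(3) obtain g gs where g: "hs' = g # gs" "g :[H]" "gs \<in> tuples H n"
   by (rule tuples_SucE)
  then have p: "pure_tensor R H hs' = tc n g (pure_tensor R H gs)"
   by (simp add: tcons_pure[OF module_H])
  have "dd (Suc n) j (pure_tensor R H hs) = lm n h (tc n g (pure_tensor R H gs))"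
   unfolding eq p[symmetric] using 0 hs pc by simp
  also have "... = pure_tensor R H ((h **[H] g) # gs)"
   using g hs pc by (simp add: tcons_pure[OF module_H, of "h **[H] g" gs n, symmetric])
  finally show ?thesis using 0 hs g by simp
 next
  case (Suc i)
  have "dd (Suc n) j (pure_tensor R H hs) = tc n h (dd n i (pure_tensor R H hs'))"
   unfolding eq using Suc hs pc by simp
  also have "... = tc n h (if i < n
    then pure_tensor R H (take i hs' @ [hs' ! i **[H] hs' ! Suc i] @ drop (Suc (Suc i)) hs')
    else \<epsilon> (last hs') *[T n] pure_tensor R H (butlast hs'))"
   using Suc Suc.prems hs Suc.IH[of hs' i] by simp
  also have "... = (if i < n
    then pure_tensor R H (h # take i hs' @ [hs' ! i **[H] hs' ! Suc i] @ drop (Suc (Suc i)) hs')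
    else \<epsilon> (last hs') *[T (Suc n)] pure_tensor R H (h # butlast hs'))"
  proof (cases "i < n")
   case True
   have "hs' ! i :[H]" "hs' ! Suc i :[H]"
    using hs(3) True by (auto simp: tuples_def)
   then have "take i hs' @ [hs' ! i **[H] hs' ! Suc i] @ drop (Suc (Suc i)) hs' \<in> tuples H n"
    using hs(3) True by (auto simp: tuples_def dest: in_set_takeD in_set_dropD)
   then show ?thesis using True hs by (simp add: tcons_pure[OF module_H])
  next
   case False
   have lb: "last hs' :[H]" "butlast hs' \<in> tuples H n"
    using hs(3) ne by (auto simp: tuples_def dest: in_set_butlastD)
   then show ?thesis using False hs pc by (simp add: tcons_pure[OF module_H] tc_smult)
  qed
  finally show ?thesis using Suc hs ne by simp
 qed
qed

lemma CX_face_Suc: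
 assumes "x :[T (Suc n)]" "j \<le> n"
 shows "face CX (Suc n) (Suc j) x = dd n j x"
 unfolding hopf_cyclic_module_def tensor_extension_def cyclic_object.simps diff_Suc_1
proof (rule linear_extension_tensor_power[OF module_H module_T dd_linear _ assms(1)])
 fix hs assume hs: "hs \<in> tuples H (Suc n)"
 show "dd n j (pure_tensor R H hs) = hopf_face R H \<epsilon> (Suc n) (Suc j) hs"
  using dd_pure[OF hs assms(2)] by (auto simp: hopf_face_def)
qed

lemma product_sweedler:
 assumes "hs \<in> tuples H n" "ps \<in> set (product_lists (map (sweedler R H \<Delta>) hs))"
 shows "length ps = n" and "set ps \<subseteq> carrier H \<times> carrier H"
proof -
 have l: "list_all2 (%x ys. x \<in> set ys) ps (map (sweedler R H \<Delta>) hs)"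
  using assms(2) by (simp add: product_lists_set)
 then show "length ps = n" using assms(1) by (auto simp: tuples_def dest: list_all2_lengthD)
 have "p \<in> carrier H \<times> carrier H" if p: "p \<in> set ps" for p
 proof -
  from p obtain i where i: "i < length ps" "p = ps ! i" by (auto simp: in_set_conv_nth)
  then have "p \<in> set (sweedler R H \<Delta> (hs ! i))" "i < length hs"
   using list_all2_nthD[OF l i(1)] list_all2_lengthD[OF l] by auto
  moreover from this(2) have "hs ! i :[H]"
   using assms(1) nth_mem[of i hs] by (auto simp: tuples_def)
  ultimately show ?thesis using sweedler_closed[of "hs ! i"] by auto
 qed
 then show "set ps \<subseteq> carrier H \<times> carrier H" by auto
qed

lemma foldr_mult_closed: "set ps \<subseteq> carrier H \<times> carrier H ==> foldr (mult H) (map fst ps) \<one>[H] :[H]"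
 by (induction ps) auto

lemma product_sweedler_closed:
 assumes "length ps = Suc n" "set ps \<subseteq> carrier H \<times> carrier H"
 shows "\<epsilon> (snd (last ps)) :[R]" "foldr (mult H) (map fst ps) \<one>[H] :[H]"
  "map snd (butlast ps) \<in> tuples H n" "pure_tensor R H (map snd (butlast ps)) :[T n]"
proof -
 have "ps \<noteq> []" using assms by auto
 then have "last ps \<in> carrier H \<times> carrier H" using assms(2) last_in_set by blast
 then show "\<epsilon> (snd (last ps)) :[R]" by auto
 show "foldr (mult H) (map fst ps) \<one>[H] :[H]" by (rule foldr_mult_closed[OF assms(2)])
 show "map snd (butlast ps) \<in> tuples H n"
  using assms by (auto simp: tuples_def dest!: in_set_butlastD)
 then show "pure_tensor R H (map snd (butlast ps)) :[T n]"
  by (rule pure_tensor_closed[OF module_H])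
qed

text \<open>\<open>K\<close> contains one Sweedler sum per factor except the last;
  \<open>product_lists\<close> runs through all choices at once. For the last factor the counit of
  its second part restores the factor itself, which is why \<open>K\<close> leaves it unsplit while
  \<open>hopf_cyc\<close> splits it.\<close>

lemma K_pure:
 assumes "hs \<in> tuples H (Suc n)"
 shows "K n (pure_tensor R H hs) = list_sum (T (Suc n))
  (%ps. \<epsilon> (snd (last ps)) *[T (Suc n)]
   tc n (foldr (mult H) (map fst ps) \<one>[H]) (pure_tensor R H (map snd (butlast ps))))
  (product_lists (map (sweedler R H \<Delta>) hs))"
 using assms
proof (induction n arbitrary: hs)
 case 0
 interpret T1: module R "T (Suc 0)" by simp
 from 0 obtain h where h: "hs = [h]" "h :[H]" by (auto elim!: tuples_SucE)
 let ?G = "%ps. \<epsilon> (snd (last ps)) *[T (Suc 0)]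
   tc 0 (foldr (mult H) (map fst ps) \<one>[H]) (pure_tensor R H (map snd (butlast ps)))"
 have "product_lists (map (sweedler R H \<Delta>) hs) = map (%p. [p]) (sweedler R H \<Delta> h)"
  by (simp add: h)
 then have "list_sum (T (Suc 0)) ?G (product_lists (map (sweedler R H \<Delta>) hs)) =
   list_sum (T (Suc 0)) (%p. ?G [p]) (sweedler R H \<Delta> h)"
  using sweedler_closed[OF h(2)] by (simp only:) (intro T1.list_sum_map, auto)
 also have "... = sw (T (Suc 0)) (%x y. \<epsilon> y *[T (Suc 0)] tc 0 x (pure_tensor R H [])) h"
  unfolding sw_def using sweedler_closed[OF h(2)] by (intro list_sum_strong_cong) auto
 also have "... = tc 0 h (pure_tensor R H [])"
  using h by (intro sw_counit_right[where f = "%x. tc 0 x (pure_tensor R H [])"] all_lin) simp_all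
 finally show ?case
  using h by (simp add: tcons_pure[OF module_H])
next
 case (Suc n)
 let ?T = "T (Suc (Suc n))"
 interpret T1: module R "T (Suc n)" by simp
 interpret T2: module R ?T by simp
 from Suc.prems obtain h hs' where hs: "hs = h # hs'" "h :[H]" "hs' \<in> tuples H (Suc n)"
  by (rule tuples_SucE)
 let ?L = "product_lists (map (sweedler R H \<Delta>) hs')"
 let ?G = "%n ps. \<epsilon> (snd (last ps)) *[T (Suc n)]
   tc n (foldr (mult H) (map fst ps) \<one>[H]) (pure_tensor R H (map snd (butlast ps)))"
 note L = product_sweedler[OF hs(3)]
 have Lc: "?G n ps :[T (Suc n)]" if "ps \<in> set ?L" for ps
  using product_sweedler_closed[OF L[OF that]] by simp
 have st: "M2 n x y (?G n ps) = ?G (Suc n) ((x, y) # ps)"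
  if "x :[H]" "y :[H]" "ps \<in> set ?L" for x y ps
 proof -
  have ne: "ps \<noteq> []" using L(1)[OF that(3)] by auto
  note c = product_sweedler_closed[OF L[OF that(3)]]
  have "M2 n x y (?G n ps) = \<epsilon> (snd (last ps)) *[?T] M2 n x y
    (tc n (foldr (mult H) (map fst ps) \<one>[H]) (pure_tensor R H (map snd (butlast ps))))"
   using that c by (intro lin_smult[OF bilinear_right[OF M2_bilinear1]]) simp_all
  then show ?thesis
   using that c ne by (simp add: tcons_pure[OF module_H that(2) c(3), symmetric])
 qed
 have Lc2: "?G (Suc n) (p # ps) :[?T]" if "p \<in> set (sweedler R H \<Delta> h)" "ps \<in> set ?L" for p ps
 proof -
  obtain x y where p: "p = (x, y)" by force
  have xy: "x :[H]" "y :[H]" using that(1) sweedler_closed[OF hs(2)] p by auto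
  show ?thesis
   unfolding p st[OF xy that(2), symmetric] using xy Lc[OF that(2)] by simp
 qed
 have "K (Suc n) (pure_tensor R H hs) = K (Suc n) (tc (Suc n) h (pure_tensor R H hs'))"
  using hs by (simp add: tcons_pure[OF module_H])
 also have "... = sw ?T (%x y. M2 n x y (list_sum (T (Suc n)) (?G n) ?L)) h"
  using hs pure_tensor_closed[OF module_H hs(3)] by (simp add: Suc.IH)
 also have "... = sw ?T (%x y. list_sum ?T (%ps. ?G (Suc n) ((x, y) # ps)) ?L) h"
 proof (rule sw_strong_cong[OF refl])
  fix x y assume "h :[H] ==> x :[H]" "h :[H] ==> y :[H]"
  then have xy: "x :[H]" "y :[H]" using hs by auto
  have "M2 n x y (list_sum (T (Suc n)) (?G n) ?L) = list_sum ?T (%ps. M2 n x y (?G n ps)) ?L"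
   using xy Lc by (intro T1.list_sum_linear_map[OF module_T bilinear_right[OF M2_bilinear1]]) auto
  also have "... = list_sum ?T (%ps. ?G (Suc n) ((x, y) # ps)) ?L"
   using st[OF xy] by (intro list_sum_strong_cong) auto
  finally show "M2 n x y (list_sum (T (Suc n)) (?G n) ?L) = list_sum ?T (%ps. ?G (Suc n) ((x, y) # ps)) ?L" .
 qed
 also have "... = list_sum ?T (%p. list_sum ?T (?G (Suc n)) (map ((#) p) ?L)) (sweedler R H \<Delta> h)"
  unfolding sw_def using Lc2
  by (intro list_sum_strong_cong) (auto intro!: T2.list_sum_map[symmetric] simp del: last.simps butlast.simps foldr.simps list.map)
 also have "... = list_sum ?T (?G (Suc n)) (product_lists (map (sweedler R H \<Delta>) hs))"
 proof -
  have "list_sum ?T (?G (Suc n)) (concat (map (%p. map ((#) p) ?L) (sweedler R H \<Delta> h))) =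
    list_sum ?T (%p. list_sum ?T (?G (Suc n)) (map ((#) p) ?L)) (sweedler R H \<Delta> h)"
  proof (rule T2.list_sum_concat_map)
   fix p qs assume "p \<in> set (sweedler R H \<Delta> h)" "qs \<in> set (map ((#) p) ?L)"
   then show "?G (Suc n) qs :[?T]" using Lc2 by force
  qed
  then show ?thesis by (simp add: hs)
 qed
 finally show ?case .
qed

lemma CX_cyc_0: "cyc CX 0 x = x"
 by (simp add: hopf_cyclic_module_def)

lemma CX_cyc_Suc:
 assumes "x :[T (Suc n)]"
 shows "cyc CX (Suc n) x = sf n (K n x)"
 unfolding hopf_cyclic_module_def tensor_extension_def cyclic_object.simps if_not_P[OF nat.distinct(2)]
proof (rule linear_extension_tensor_power[OF module_H module_T lin_comp[OF K_linear sf_linear] _ assms])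
 fix hs assume hs: "hs \<in> tuples H (Suc n)"
 interpret T1: module R "T (Suc n)" by simp
 note L = product_sweedler_closed[OF product_sweedler[OF hs]]
 let ?L = "product_lists (map (sweedler R H \<Delta>) hs)"
 have "sf n (K n (pure_tensor R H hs)) = list_sum (T (Suc n))
   (%ps. sf n (\<epsilon> (snd (last ps)) *[T (Suc n)]
    tc n (foldr (mult H) (map fst ps) \<one>[H]) (pure_tensor R H (map snd (butlast ps))))) ?L"
  unfolding K_pure[OF hs] using L by (intro T1.list_sum_linear_map[OF module_T sf_linear]) simp_all
 also have "... = hopf_cyc R H \<Delta> \<epsilon> S (Suc n) hs"
  unfolding hopf_cyc_def using L
  by (intro list_sum_strong_cong) (simp add: lin_smult[OF sf_linear], simp add: tcons_pure[OF module_H])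
 finally show "sf n (K n (pure_tensor R H hs)) = hopf_cyc R H \<Delta> \<epsilon> S (Suc n) hs" .
qed

text \<open>Appending \<open>1\<close> contracts the complex with differential \<open>b'\<close>, up to a sign.\<close>

primrec sn :: "nat => ('h list => 'k) set => ('h list => 'k) set"
 where "sn 0 = tc 0 \<one>[H]"
 | "sn (Suc n) = tl n (T (Suc (Suc n))) (%h t. tc (Suc n) h (sn n t))"

lemma sn_linear: "sn n \<in> lin R (T n) (T (Suc n))"
proof (induction n)
 case 0
 show ?case by (simp add: bilinear_right[OF tc_bilinear])
next
 case (Suc n)
 note [simp] = lin_closed[OF Suc]
 show ?case unfolding sn.simps by (intro tl_linear all_lin Suc) simp_all
qed

lemma sn_closed [simp]: "t :[T n] ==> sn n t :[T (Suc n)]"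
 by (rule lin_closed[OF sn_linear])

lemma sn_tc [simp]:
 "[|h :[H]; t :[T n]|] ==> sn (Suc n) (tc n h t) = tc (Suc n) h (sn n t)"
 by (simp, subst tl_tc) (intro all_lin sn_linear | simp)+

declare sn.simps(2) [simp del]

lemma e0_sn:
 assumes "x :[T (Suc n)]"
 shows "e0 (Suc n) (sn (Suc n) x) = sn n (e0 n x)"
proof (rule T_eqI[OF assms module_T[of "Suc n"], where f = "%x. e0 (Suc n) (sn (Suc n) x)" and g = "%x. sn n (e0 n x)"])
 show "(%x. e0 (Suc n) (sn (Suc n) x)) \<in> lin R (T (Suc n)) (T (Suc n))"
  by (rule lin_comp[OF sn_linear e0_linear])
 show "(%x. sn n (e0 n x)) \<in> lin R (T (Suc n)) (T (Suc n))"
  by (rule lin_comp[OF e0_linear sn_linear])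
qed (simp add: lin_smult[OF sn_linear])

lemma dd_sn_last:
 assumes "x :[T (Suc n)]"
 shows "dd (Suc n) n (sn (Suc n) x) = x"
 using assms
proof (induction n arbitrary: x)
 case 0
 show ?case
 proof (rule T_eqI[OF 0 module_T[of "Suc 0"], where f = "%x. dd (Suc 0) 0 (sn (Suc 0) x)" and g = "%x. x"])
  show "(%x. dd (Suc 0) 0 (sn (Suc 0) x)) \<in> lin R (T (Suc 0)) (T (Suc 0))"
   by (rule lin_comp[OF sn_linear dd_linear])
 qed (simp_all add: lin_id)
next
 case (Suc n)
 show ?case
 proof (rule T_eqI[OF Suc.prems module_T[of "Suc (Suc n)"], where f = "%x. dd (Suc (Suc n)) (Suc n) (sn (Suc (Suc n)) x)" and g = "%x. x"])
  show "(%x. dd (Suc (Suc n)) (Suc n) (sn (Suc (Suc n)) x)) \<in> lin R (T (Suc (Suc n))) (T (Suc (Suc n)))"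
   by (rule lin_comp[OF sn_linear dd_linear])
 qed (simp_all add: lin_id Suc.IH)
qed

lemma lm_sn:
 assumes "h :[H]" "x :[T (Suc n)]"
 shows "lm (Suc n) h (sn (Suc n) x) = sn (Suc n) (lm n h x)"
proof (rule T_eqI[OF assms(2) module_T[of "Suc (Suc n)"], where f = "%x. lm (Suc n) h (sn (Suc n) x)" and g = "%x. sn (Suc n) (lm n h x)"])
 show "(%x. lm (Suc n) h (sn (Suc n) x)) \<in> lin R (T (Suc n)) (T (Suc (Suc n)))"
  by (rule lin_comp[OF sn_linear bilinear_right[OF lm_bilinear assms(1)]])
 show "(%x. sn (Suc n) (lm n h x)) \<in> lin R (T (Suc n)) (T (Suc (Suc n)))"
  by (rule lin_comp[OF bilinear_right[OF lm_bilinear assms(1)] sn_linear])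
qed (use assms in simp)

lemma dd_sn:
 assumes "x :[T (Suc n)]" "j < n"
 shows "dd (Suc n) j (sn (Suc n) x) = sn n (dd n j x)"
 using assms
proof (induction n arbitrary: x j)
 case (Suc n)
 show ?case
 proof (rule T_eqI[OF Suc.prems(1) module_T[of "Suc (Suc n)"], where f = "%x. dd (Suc (Suc n)) j (sn (Suc (Suc n)) x)"
    and g = "%x. sn (Suc n) (dd (Suc n) j x)"])
  fix h t assume "h :[H]" "t :[T (Suc n)]"
  then show "dd (Suc (Suc n)) j (sn (Suc (Suc n)) (tc (Suc n) h t)) = sn (Suc n) (dd (Suc n) j (tc (Suc n) h t))"
   using Suc.prems by (cases j) (simp_all add: lm_sn Suc.IH)
 next
  show "(%x. dd (Suc (Suc n)) j (sn (Suc (Suc n)) x)) \<in> lin R (T (Suc (Suc n))) (T (Suc (Suc n)))"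
   by (rule lin_comp[OF sn_linear dd_linear])
  show "(%x. sn (Suc n) (dd (Suc n) j x)) \<in> lin R (T (Suc (Suc n))) (T (Suc (Suc n)))"
   by (rule lin_comp[OF dd_linear sn_linear])
 qed
qed simp

text \<open>The face that multiplies the appended unit into the last factor, or for
  \<open>n = 0\<close> takes its counit, is face \<open>n\<close> and enters \<open>b'\<close> with
  the sign of \<open>n\<close>; the sign chosen here compensates it.\<close>

definition sg :: "nat => ('h list => 'k) set => ('h list => 'k) set"
 where "sg n x = (if even n then sn n x else -[T (Suc n)] sn n x)"

lemma sg_linear: "sg n \<in> lin R (T n) (T (Suc n))"
 using sn_linear[of n] lin_map_neg[OF sn_linear module_T module_T, of n]
 by (cases "even n") (simp_all add: sg_def[abs_def])

lemma b'_sg_0: "x :[T 0] ==> hochschild_b' CX 0 (sg 0 x) = x"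
proof -
 interpret T0: module R "T 0" by simp
 show "x :[T 0] ==> hochschild_b' CX 0 (sg 0 x) = x"
  by (simp add: hochschild_b'_def sg_def T0.alternating_sum_0 CX_face_0 counit_one)
qed

lemma b'_sg_Suc:
 assumes x: "x :[T (Suc n)]"
 shows "hochschild_b' CX (Suc n) (sg (Suc n) x) +[T (Suc n)] sg n (hochschild_b' CX n x) = x"
proof -
 interpret T0: module R "T n" by simp
 interpret T1: module R "T (Suc n)" by simp
 interpret T2: module R "T (Suc (Suc n))" by simp
 let ?f = "%i. face CX (Suc (Suc n)) i (sn (Suc n) x)"
 have f: "?f i = sn n (face CX (Suc n) i x)" if "i \<le> n" for i
  using that x by (cases i) (simp_all add: CX_face_0 CX_face_Suc e0_sn dd_sn)
 have fl: "?f (Suc n) = x"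
  using x by (simp add: CX_face_Suc dd_sn_last)
 have fc: "face CX (Suc n) i x :[T n]" if "i \<le> n" for i
  using that x by (cases i) (simp_all add: CX_face_0 CX_face_Suc)
 have B: "hochschild_b' CX n x :[T n]"
  unfolding hochschild_b'_def using fc by (auto intro: T0.alternating_sum_closed)
 have cl: "?f i :[T (Suc n)]" if "i \<le> Suc n" for i
  using that f fc fl x by (cases "i = Suc n") auto
 have "alternating_sum (T (Suc n)) ?f {..Suc n} =
   alternating_sum (T (Suc n)) ?f {..n} +[T (Suc n)] (if odd n then ?f (Suc n) else -[T (Suc n)] ?f (Suc n))"
  using cl by (intro T1.alternating_sum_last) auto
 also have "alternating_sum (T (Suc n)) ?f {..n} = sn n (hochschild_b' CX n x)"
  unfolding hochschild_b'_def CX_obj using f fc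
  by (subst T0.alternating_sum_linear[OF module_T sn_linear]) (auto intro!: T1.alternating_sum_cong)
 finally have e: "hochschild_b' CX (Suc n) (sn (Suc n) x) =
   sn n (hochschild_b' CX n x) +[T (Suc n)] (if odd n then x else -[T (Suc n)] x)"
  by (simp add: hochschild_b'_def fl)
 have bl: "hochschild_b' CX (Suc n) (-[T (Suc (Suc n))] sn (Suc n) x) = -[T (Suc n)] hochschild_b' CX (Suc n) (sn (Suc n) x)"
 proof -
  have fl: "face CX (Suc (Suc n)) i (-[T (Suc (Suc n))] sn (Suc n) x) = -[T (Suc n)] ?f i" if "i \<le> Suc n" for i
   using that x by (cases i) (simp_all add: CX_face_0 CX_face_Suc lin_neg[OF e0_linear module_T module_T]
    lin_neg[OF dd_linear module_T module_T])
  have neg: "(%y. -[T (Suc n)] y) \<in> lin R (T (Suc n)) (T (Suc n))"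
   by (rule lin_map_neg[OF lin_id module_T module_T])
  show ?thesis
   unfolding hochschild_b'_def CX_obj
   using cl by (subst T1.alternating_sum_linear[OF module_T neg]) (auto intro!: T1.alternating_sum_cong simp: fl)
 qed
 have snB: "sn n (hochschild_b' CX n x) :[T (Suc n)]" using B by simp
 show ?thesis
  using x snB
  by (cases "even n") (simp_all add: sg_def bl e T1.minus_add T1.a_ac T1.r_neg1 T1.r_neg2 T1.l_neg T1.r_neg)
qed

end

section \<open>The cyclic identities in bar coordinates\<close>

context cocommutative_hopf_algebra
begin

lemma \<pi>_face:
 assumes "i \<le> Suc n" "x :[T (Suc (Suc n))]"
 shows "\<pi> n (del (Suc n) i x) = face CX (Suc n) i (\<pi> (Suc n) x)"
 using assms by (cases i) (simp_all add: CX_face_0 CX_face_Suc \<pi>_e0 \<pi>_del_Suc)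

lemma \<pi>_cyc:
 assumes "x :[T (Suc n)]"
 shows "\<pi> n (rot n x) = cyc CX n (\<pi> n x)"
 using assms by (cases n) (simp_all add: CX_cyc_0 CX_cyc_Suc \<pi>_rot)

lemma \<pi>_surj:
 assumes "y :[T n]"
 obtains x where "x :[T (Suc n)]" "\<pi> n x = y"
 using assms that[of "F n \<one>[H] y"] \<pi>_F_one by simp

text \<open>The identities are not computed with coproducts and antipodes: an element is lifted
  along the surjection \<open>\<pi>\<close>, which intertwines faces and cyclic operators, and the
  identity is read off in the homogeneous object.\<close>

lemma precyclic_CX: "precyclic R CX"
proof (rule precyclic.intro; unfold CX_obj)
 interpret E: precyclic R HX by (rule precyclic_HX)
 note pf = \<pi>_face[symmetric]
 fix n i k x
 show "module R (T n)" by simp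
 show "face CX (Suc n) i \<in> lin R (T (Suc n)) (T n)" if "i \<le> Suc n"
  using lin_cong[OF e0_linear[of n] module_T] lin_cong[OF dd_linear[of n "i - 1"] module_T] that
  by (cases i) (auto simp: CX_face_0 CX_face_Suc)
 show "cyc CX n \<in> lin R (T n) (T n)"
 proof (cases n)
  case 0
  then show ?thesis using lin_cong[OF lin_id module_T] by (auto simp: CX_cyc_0)
 next
  case (Suc m)
  then show ?thesis using lin_cong[OF lin_comp[OF K_linear sf_linear] module_T, of m] by (auto simp: CX_cyc_Suc)
 qed
 show "face CX (Suc n) i (face CX (Suc (Suc n)) (Suc k) x) = face CX (Suc n) k (face CX (Suc (Suc n)) i x)"
  if A: "i \<le> k" "k \<le> Suc n" "x :[T (Suc (Suc n))]"
 proof -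
  obtain y where y: "y :[T (Suc (Suc (Suc n)))]" "\<pi> (Suc (Suc n)) y = x" using \<pi>_surj[OF A(3)] .
  show ?thesis unfolding y(2)[symmetric] using A y(1) E.face_face[of i k n y] by (simp add: pf)
 qed
 show "face CX (Suc n) 0 (cyc CX (Suc n) x) = face CX (Suc n) (Suc n) x" if A: "x :[T (Suc n)]"
 proof -
  obtain y where y: "y :[T (Suc (Suc n))]" "\<pi> (Suc n) y = x" using \<pi>_surj[OF A] .
  show ?thesis unfolding y(2)[symmetric] using A y(1) E.face_cyc_0[of y n] by (simp add: pf \<pi>_cyc[symmetric])
 qed
 show "face CX (Suc n) (Suc i) (cyc CX (Suc n) x) = cyc CX n (face CX (Suc n) i x)"
  if A: "i \<le> n" "x :[T (Suc n)]"
 proof -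
  obtain y where y: "y :[T (Suc (Suc n))]" "\<pi> (Suc n) y = x" using \<pi>_surj[OF A(2)] .
  show ?thesis unfolding y(2)[symmetric] using A y(1) E.face_cyc_Suc[of i n y] by (simp add: pf \<pi>_cyc[symmetric])
 qed
 show "(cyc CX n ^^ Suc n) x = x" if A: "x :[T n]"
 proof -
  obtain y where y: "y :[T (Suc n)]" "\<pi> n y = x" using \<pi>_surj[OF A] .
  have c: "(rot n ^^ k) y :[T (Suc n)]" for k
   using lin_closed[OF linear_funpow[OF rot_linear] y(1)] .
  have "\<pi> n ((rot n ^^ k) y) = (cyc CX n ^^ k) (\<pi> n y)" for k
   using y(1) c by (induction k) (simp_all add: \<pi>_cyc)
  from this[of "Suc n"] show ?thesis unfolding rot_pow[OF y(1)] y(2) by simp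
 qed
qed

end

section \<open>The equivariant chain map to column 0\<close>

context hopf_algebra
begin

lemma HlinI:
 assumes "f \<in> lin R (T q) (T m)"
  "!!a t. [|a :[H]; t :[T q]|] ==> f (act q a t) = act m a (f t)"
 shows "Hlin q m f"
 using assms by (auto simp: Hlin_def)

lemma Hlin_id: "Hlin q q (%x. x)"
 by (rule HlinI[OF lin_id]) simp

lemma Hlin_comp:
 assumes "Hlin q m f" "Hlin m l g"
 shows "Hlin q l (%x. g (f x))"
 by (rule HlinI[OF lin_comp[OF Hlin_linear[OF assms(1)] Hlin_linear[OF assms(2)]]])
  (simp add: Hlin_act[OF assms(1)] Hlin_act[OF assms(2)] Hlin_closed[OF assms(1)])

lemma Hlin_add:
 assumes "Hlin q m f" "Hlin q m g"
 shows "Hlin q m (%x. f x +[T m] g x)"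
 by (rule HlinI[OF lin_map_add[OF Hlin_linear[OF assms(1)] Hlin_linear[OF assms(2)] module_T]])
  (simp add: Hlin_act[OF assms(1)] Hlin_act[OF assms(2)] Hlin_closed[OF assms(1)] Hlin_closed[OF assms(2)]
   lin_add[OF bilinear_right[OF act_bilinear]])

lemma Hlin_neg:
 assumes "Hlin q m f"
 shows "Hlin q m (%x. -[T m] f x)"
 by (rule HlinI[OF lin_map_neg[OF Hlin_linear[OF assms] module_T module_T]])
  (simp add: Hlin_act[OF assms] Hlin_closed[OF assms] lin_neg[OF bilinear_right[OF act_bilinear] module_T module_T])

lemma Hlin_zero: "Hlin q m (%x. \<zero>[T m])"
 by (rule HlinI[OF lin_const_zero[OF module_T]])
  (simp add: lin_zero[OF bilinear_right[OF act_bilinear] module_T module_T])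

lemma Hlin_finsum:
 assumes "!!i. i \<in> A ==> Hlin q m (f i)"
 shows "Hlin q m (%x. \<Oplus>\<^bsub>T m\<^esub>i\<in>A. f i x)"
proof (rule HlinI[OF lin_map_finsum[OF Hlin_linear[OF assms] module_T module_T]])
 fix a t assume at: "a :[H]" "t :[T q]"
 have "(\<Oplus>\<^bsub>T m\<^esub>i\<in>A. f i (act q a t)) = (\<Oplus>\<^bsub>T m\<^esub>i\<in>A. act m a (f i t))"
  using at assms by (intro finsum_strong_cong) (simp add: Hlin_act)
 also have "... = act m a (\<Oplus>\<^bsub>T m\<^esub>i\<in>A. f i t)"
  using at assms by (intro lin_finsum[OF bilinear_right[OF act_bilinear] module_T module_T, symmetric])
   (auto intro: Hlin_closed)
 finally show "(\<Oplus>\<^bsub>T m\<^esub>i\<in>A. f i (act q a t)) = act m a (\<Oplus>\<^bsub>T m\<^esub>i\<in>A. f i t)" .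
qed

lemma Hlin_alternating_sum:
 assumes "!!i. i \<in> A ==> Hlin q m (f i)"
 shows "Hlin q m (%x. alternating_sum (T m) (%i. f i x) A)"
proof -
 have "Hlin q m (%x. \<Oplus>\<^bsub>T m\<^esub>i\<in>A. (if even i then f i else (%x. -[T m] f i x)) x)"
  using assms Hlin_neg[OF assms] by (intro Hlin_finsum) auto
 then show ?thesis
  unfolding alternating_sum_def by (simp add: if_distrib[of "%f. f _"] cong: if_cong)
qed

lemma Hlin_funpow: "Hlin q q f ==> Hlin q q (f ^^ k)"
proof (induction k)
 case 0
 show ?case using Hlin_id by (simp add: id_def)
next
 case (Suc k)
 show ?case using Hlin_comp[OF Suc.IH[OF Suc.prems] Suc.prems] by (simp add: o_def)
qed

text \<open>The differential in homogeneous coordinates on \<open>h \<otimes> z\<close>.\<close>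

lemma b_HX_tc:
 assumes "h :[H]" "z :[T (Suc (Suc m))]"
 shows "hochschild_b HX (Suc m) (tc (Suc (Suc m)) h z) =
  \<epsilon> h *[T (Suc (Suc m))] z -[T (Suc (Suc m))] tc (Suc m) h (hochschild_b HX m z)"
proof -
 interpret T1: module R "T (Suc m)" by simp
 interpret T2: module R "T (Suc (Suc m))" by simp
 have "alternating_sum (T (Suc (Suc m))) (%i. del (Suc (Suc m)) i (tc (Suc (Suc m)) h z)) {..Suc (Suc m)} =
   del (Suc (Suc m)) 0 (tc (Suc (Suc m)) h z) -[T (Suc (Suc m))]
   alternating_sum (T (Suc (Suc m))) (%i. del (Suc (Suc m)) (Suc i) (tc (Suc (Suc m)) h z)) {..Suc m}"
  using assms by (intro T2.alternating_sum_Suc) simp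
 also have "alternating_sum (T (Suc (Suc m))) (%i. del (Suc (Suc m)) (Suc i) (tc (Suc (Suc m)) h z)) {..Suc m} =
   tc (Suc m) h (alternating_sum (T (Suc m)) (%i. del (Suc m) i z) {..Suc m})"
  using assms by (subst T1.alternating_sum_linear[OF module_T bilinear_right[OF tc_bilinear]])
   (auto intro!: T2.alternating_sum_cong)
 finally show ?thesis using assms by (simp add: hochschild_b_def)
qed

lemma kap_zero:
 assumes "f \<in> lin R (T (Suc q)) (T m)" "!!x. x :[T (Suc q)] ==> f x = \<zero>[T m]"
  "x :[T (Suc q)]"
 shows "kap q m f x = \<zero>[T (Suc m)]"
proof (rule T_eqI[OF assms(3) module_T[of "Suc m"] kap_linear[OF assms(1)], where g = "%x. \<zero>[T (Suc m)]"])
 show "(%x. \<zero>[T (Suc m)]) \<in> lin R (T (Suc q)) (T (Suc m))"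
  by (intro lin_const_zero module_T)
 interpret Tm: module R "T (Suc m)" by simp
 fix g t assume gt: "g :[H]" "t :[T q]"
 have "kap q m f (tc q g t) = sw (T (Suc m)) (%x y. \<zero>[T (Suc m)]) g"
  using gt assms(2) by (simp add: kap_tc[OF assms(1)]
   lin_zero[OF bilinear_right[OF tc_bilinear] module_T module_T])
 also have "... = \<zero>[T (Suc m)]"
  by (simp add: sw_def case_prod_unfold Tm.list_sum_zero)
 finally show "kap q m f (tc q g t) = \<zero>[T (Suc m)]" .
qed

text \<open>In the boundary of the cone, face 0 removes the new leading factor by the counit and
  returns \<open>f\<close>; the other faces assemble to the boundary of a value of \<open>f\<close>,
  which is zero.\<close>

lemma b_kap:
 assumes f: "f \<in> lin R (T (Suc q)) (T (Suc (Suc m)))" and x: "x :[T (Suc q)]"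
  and bf: "!!x. x :[T (Suc q)] ==> hochschild_b HX m (f x) = \<zero>[T (Suc m)]"
 shows "hochschild_b HX (Suc m) (kap q (Suc (Suc m)) f x) = f x"
proof -
 interpret E: precyclic R HX by (rule precyclic_HX)
 let ?T = "T (Suc (Suc m))"
 interpret T2: module R ?T by simp
 have bl: "hochschild_b HX (Suc m) \<in> lin R (T (Suc (Suc (Suc m)))) ?T"
  using E.b_linear[of "Suc m"] by simp
 note fc = lin_closed[OF f]
 show ?thesis
 proof (rule T_eqI[OF x module_T[of "Suc (Suc m)"] lin_comp[OF kap_linear[OF f] bl] f])
  fix g t assume gt: "g :[H]" "t :[T q]"
  have "hochschild_b HX (Suc m) (kap q (Suc (Suc m)) f (tc q g t)) =
    sw ?T (%x y. hochschild_b HX (Suc m) (tc (Suc (Suc m)) x (f (tc q y t)))) g"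
   using gt fc by (simp add: kap_tc[OF f] linear_sw[OF _ bl])
  also have "... = sw ?T (%x y. \<epsilon> x *[?T] f (tc q y t)) g"
   using gt fc bf by (simp add: b_HX_tc lin_zero[OF bilinear_right[OF tc_bilinear] module_T module_T] T2.minus_eq)
  also have "... = f (tc q g t)"
   using gt by (intro sw_counit_left[where f = "%y. f (tc q y t)"] lin_comp[OF _ f] all_lin) simp_all
  finally show "hochschild_b HX (Suc m) (kap q (Suc (Suc m)) f (tc q g t)) = f (tc q g t)" .
 qed
qed

text \<open>\<open>phi p q\<close> maps degree \<open>q\<close> of column \<open>p\<close> to degree \<open>q + p\<close> of column 0. Together these maps
 are an \<open>H\<close>-linear extension of the identity of column 0 to a chain map on the total complex; it
 is constructed recursively by acyclicity.\<close>

fun phi :: "nat => nat => ('h list => 'k) set => ('h list => 'k) set"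
 where "phi 0 q = (%x. x)"
 | "phi (Suc p) 0 = kap 0 (Suc p) (%x. phi p 0 (horizontal HX p 0 x))"
 | "phi (Suc p) (Suc q) = kap (Suc q) (Suc (Suc (q + p)))
   (%x. phi (Suc p) q (vertical HX (Suc p) q x) +[T (Suc (Suc (q + p)))]
    phi p (Suc q) (horizontal HX p (Suc q) x))"

end

context cocommutative_hopf_algebra
begin

lemma vertical_Hlin: "Hlin (Suc (Suc q)) (Suc q) (vertical HX p q)"
proof -
 have "Hlin (Suc (Suc q)) (Suc q) (%x. hochschild_b HX q x)"
  unfolding hochschild_b_def HX_simps by (intro Hlin_alternating_sum del_Hlin)
 moreover have "Hlin (Suc (Suc q)) (Suc q) (%x. -[T (Suc q)] hochschild_b' HX q x)"
  unfolding hochschild_b'_def HX_simps by (intro Hlin_neg Hlin_alternating_sum del_Hlin)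
 ultimately show ?thesis by (cases "even p") (simp_all add: vertical_def[abs_def])
qed

lemma horizontal_Hlin: "Hlin (Suc q) (Suc q) (horizontal HX p q)"
proof -
 have t: "Hlin (Suc q) (Suc q) (signed_cyc HX q)"
  using rot_Hlin[of q] Hlin_neg[OF rot_Hlin[of q]] by (cases "even q") (simp_all add: signed_cyc_def[abs_def])
 have "Hlin (Suc q) (Suc q) (%x. x -[T (Suc q)] signed_cyc HX q x)"
  unfolding a_minus_def by (intro Hlin_add Hlin_id Hlin_neg t)
 moreover have "Hlin (Suc q) (Suc q) (cyclic_norm HX q)"
  unfolding cyclic_norm_def[abs_def] HX_simps by (intro Hlin_finsum Hlin_funpow t)
 ultimately show ?thesis by (cases "even p") (simp_all add: horizontal_def[abs_def])
qed

lemma phi_Hlin: "Hlin (Suc q) (Suc (q + p)) (phi p q)"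
proof (induction p q rule: phi.induct)
 case (1 q)
 show ?case by (simp add: Hlin_id)
next
 case (2 p)
 have "Hlin (Suc 0) (Suc p) (%x. phi p 0 (horizontal HX p 0 x))"
  using Hlin_comp[OF horizontal_Hlin 2] by simp
 then show ?case using kap_Hlin by simp
next
 case (3 p q)
 have "Hlin (Suc (Suc q)) (Suc (Suc (q + p))) (%x. phi (Suc p) q (vertical HX (Suc p) q x))"
  using Hlin_comp[OF vertical_Hlin 3(1)] by simp
 moreover have "Hlin (Suc (Suc q)) (Suc (Suc (q + p))) (%x. phi p (Suc q) (horizontal HX p (Suc q) x))"
  using Hlin_comp[OF horizontal_Hlin 3(2)] by simp
 ultimately show ?case using kap_Hlin[OF Hlin_add] by simp
qed

lemma phi_closed: "x :[T (Suc q)] ==> phi p q x :[T (Suc (q + p))]"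
 by (rule Hlin_closed[OF phi_Hlin])

text \<open>The prescribed boundary of \<open>phi (Suc p) q\<close>: the value of the chain map, as
  far as it is already constructed, on the total differential of an element of column
  \<open>p + 1\<close>.\<close>

definition phi_d :: "nat => nat => ('h list => 'k) set => ('h list => 'k) set"
 where "phi_d p q x = (case q of 0 => phi p 0 (horizontal HX p 0 x)
  | Suc q => phi (Suc p) q (vertical HX (Suc p) q x) +[T (Suc (Suc (q + p)))] phi p (Suc q) (horizontal HX p (Suc q) x))"

lemma phi_Suc: "phi (Suc p) q = kap q (Suc (q + p)) (phi_d p q)"
 by (cases q) (simp_all add: phi_d_def[abs_def])

lemma phi_d_linear: "phi_d p q \<in> lin R (T (Suc q)) (T (Suc (q + p)))"
proof (cases q)
 case 0
 then show ?thesis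
  using Hlin_linear[OF Hlin_comp[OF horizontal_Hlin[of 0 p] phi_Hlin[of 0 p]]] by (simp add: phi_d_def[abs_def])
next
 case (Suc r)
 show ?thesis
  using lin_map_add[OF Hlin_linear[OF Hlin_comp[OF vertical_Hlin phi_Hlin, of r "Suc p" "Suc p"]]
    _ module_T] Hlin_linear[OF Hlin_comp[OF horizontal_Hlin[of "Suc r" p] phi_Hlin[of "Suc r" p]]]
  by (simp add: phi_d_def[abs_def] Suc)
qed

lemma phi_linear: "phi p q \<in> lin R (T (Suc q)) (T (Suc (q + p)))"
 by (rule Hlin_linear[OF phi_Hlin])

text \<open>Induction on the column and, inside it, on the degree; \<open>step\<close> isolates the
  use of the cone. The prescribed boundary is a cycle because rows and columns of the double complex
  are complexes and its squares anticommute.\<close>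

lemma b_phi:
 assumes "x :[T (Suc q)]"
 shows "hochschild_b HX (q + p) (phi (Suc p) q x) = phi_d p q x"
proof -
 interpret E: precyclic R HX by (rule precyclic_HX)
 note mT = module_T
 note vc = E.vertical_closed[unfolded HX_simps] and hc = E.horizontal_closed[unfolded HX_simps]
 note vv = E.vertical_vertical[unfolded HX_simps] and hh = E.horizontal_horizontal[unfolded HX_simps]
  and vh = E.vertical_horizontal[unfolded HX_simps]
 have step: "hochschild_b HX (q + p) (phi (Suc p) q x) = phi_d p q x"
  if x: "x :[T (Suc q)]"
   and b0: "!!m x. [|q + p = Suc m; x :[T (Suc q)]|] ==> hochschild_b HX m (phi_d p q x) = \<zero>[T (Suc m)]"
  for p q x
 proof (cases "q + p")
  case 0
  then have pq: "q = 0" "p = 0" by auto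
  interpret T1: module R "T (Suc 0)" by simp
  \<comment> \<open>In total degree 0 there is no cycle condition that could make the cone a lift.
    But the prescribed boundary is zero, since the cyclic operator of degree 0 is the
    identity.\<close>
  have z: "phi_d 0 0 x = \<zero>[T (Suc 0)]" if "x :[T (Suc 0)]" for x
   using that by (simp add: phi_d_def horizontal_def signed_cyc_def T1.diff_zero_iff)
  have l: "phi_d 0 0 \<in> lin R (T (Suc 0)) (T (Suc 0))"
   using phi_d_linear[of 0 0] by simp
  have "hochschild_b HX 0 (phi (Suc 0) 0 x) = hochschild_b HX 0 \<zero>[T (Suc (Suc 0))]"
   unfolding phi_Suc using kap_zero[OF l z] x pq by simp
  also have "... = \<zero>[T (Suc 0)]"
   using lin_zero[OF E.b_linear[of 0]] by simp
  finally show ?thesis using z x pq by simp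
 next
  case (Suc m)
  have l: "phi_d p q \<in> lin R (T (Suc q)) (T (Suc (Suc m)))"
   using phi_d_linear[of p q] by (simp add: Suc)
  show ?thesis
   unfolding phi_Suc Suc using b_kap[OF l x b0[OF Suc]] by simp
 qed
 \<comment> \<open>On a vertical boundary only the horizontal part of the prescription
   survives.\<close>
 have dv: "phi_d p q (vertical HX (Suc p) q y) = phi p q (horizontal HX p q (vertical HX (Suc p) q y))"
  if y: "y :[T (Suc (Suc q))]" for p q y
 proof (cases q)
  case 0
  then show ?thesis by (simp add: phi_d_def)
 next
  case (Suc r)
  interpret Tm: module R "T (Suc (Suc (r + p)))" by simp
  have "phi (Suc p) r (vertical HX (Suc p) r (vertical HX (Suc p) (Suc r) y)) = \<zero>[T (Suc (Suc (r + p)))]"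
   using y vv[of y r "Suc p"] lin_zero[OF phi_linear[of "Suc p" r] mT mT] by (simp add: Suc)
  moreover have "phi p (Suc r) (horizontal HX p (Suc r) (vertical HX (Suc p) (Suc r) y)) :[T (Suc (Suc (r + p)))]"
   using phi_closed[of "horizontal HX p (Suc r) (vertical HX (Suc p) (Suc r) y)" "Suc r" p] y vc hc Suc by simp
  ultimately show ?thesis by (simp add: phi_d_def Suc)
 qed
 show ?thesis
  using assms
 proof (induction p arbitrary: q x)
  case 0
  note p0 = 0
  show ?case
   using 0
  proof (induction q arbitrary: x)
   case 0
   show ?case by (rule step[OF 0]) simp
  next
   case (Suc q)
   show ?case
   proof (rule step[OF Suc.prems])
    fix m x assume m: "Suc q + 0 = Suc m" and x: "x :[T (Suc (Suc q))]"
    then have mq: "m = q" by simp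
    interpret Tm: module R "T (Suc q)" by simp
    have v: "vertical HX (Suc 0) q x :[T (Suc q)]" using vc x by simp
    have "hochschild_b HX q (phi_d 0 (Suc q) x) =
      hochschild_b HX q (phi (Suc 0) q (vertical HX (Suc 0) q x)) +[T (Suc q)]
      hochschild_b HX q (horizontal HX 0 (Suc q) x)"
     unfolding phi_d_def
     using lin_add[OF E.b_linear[of q, unfolded HX_simps]] phi_closed[OF v, of "Suc 0"] hc x by simp
    also have "hochschild_b HX q (phi (Suc 0) q (vertical HX (Suc 0) q x)) = horizontal HX 0 q (vertical HX (Suc 0) q x)"
     using Suc.IH[OF v] dv[OF x, of 0] by simp
    also have "hochschild_b HX q (horizontal HX 0 (Suc q) x) = vertical HX 0 q (horizontal HX 0 (Suc q) x)"
     by (simp add: vertical_def)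
    finally show "hochschild_b HX m (phi_d 0 (Suc q) x) = \<zero>[T (Suc m)]"
     unfolding mq using vh[OF x, of 0] vc hc x by (simp add: Tm.a_comm)
   qed
  qed
 next
  case (Suc p)
  note IHp = Suc.IH
  show ?case
   using Suc.prems
  proof (induction q arbitrary: x)
   case 0
   show ?case
   proof (rule step[OF 0])
    fix m x assume m: "0 + Suc p = Suc m" and x: "x :[T (Suc 0)]"
    have h: "horizontal HX (Suc p) 0 x :[T (Suc 0)]" using hc x by simp
    have "hochschild_b HX p (phi_d (Suc p) 0 x) = phi p 0 (horizontal HX p 0 (horizontal HX (Suc p) 0 x))"
     using IHp[OF h] by (simp add: phi_d_def)
    also have "... = \<zero>[T (Suc p)]"
     using hh[OF x] lin_zero[OF phi_linear[of p 0] mT mT] by simp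
    finally show "hochschild_b HX m (phi_d (Suc p) 0 x) = \<zero>[T (Suc m)]" using m by simp
   qed
  next
   case (Suc q)
   show ?case
   proof (rule step[OF Suc.prems])
    fix m x assume m: "Suc q + Suc p = Suc m" and x: "x :[T (Suc (Suc q))]"
    then have mq: "m = Suc (q + p)" by simp
    let ?T = "T (Suc (Suc (q + p)))"
    interpret Tm: module R ?T by simp
    have v: "vertical HX (Suc (Suc p)) q x :[T (Suc q)]" using vc x by simp
    have h: "horizontal HX (Suc p) (Suc q) x :[T (Suc (Suc q))]" using hc x by simp
    have "hochschild_b HX (Suc (q + p)) (phi_d (Suc p) (Suc q) x) =
      hochschild_b HX (Suc (q + p)) (phi (Suc (Suc p)) q (vertical HX (Suc (Suc p)) q x)) +[?T]
      hochschild_b HX (Suc (q + p)) (phi (Suc p) (Suc q) (horizontal HX (Suc p) (Suc q) x))"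
     unfolding phi_d_def
     using lin_add[OF E.b_linear[of "Suc (q + p)", unfolded HX_simps]] phi_closed[OF v, of "Suc (Suc p)"]
      phi_closed[OF h, of "Suc p"] by simp
    also have "hochschild_b HX (Suc (q + p)) (phi (Suc (Suc p)) q (vertical HX (Suc (Suc p)) q x)) =
      phi (Suc p) q (horizontal HX (Suc p) q (vertical HX (Suc (Suc p)) q x))"
     using Suc.IH[OF v] dv[OF x, of "Suc p"] by simp
    also have "hochschild_b HX (Suc (q + p)) (phi (Suc p) (Suc q) (horizontal HX (Suc p) (Suc q) x)) =
      phi (Suc p) q (vertical HX (Suc p) q (horizontal HX (Suc p) (Suc q) x))"
    proof -
     have "phi p (Suc q) (horizontal HX p (Suc q) (horizontal HX (Suc p) (Suc q) x)) = \<zero>[?T]"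
      using hh[OF x] lin_zero[OF phi_linear[of p "Suc q"] mT mT] by simp
     moreover have "phi (Suc p) q (vertical HX (Suc p) q (horizontal HX (Suc p) (Suc q) x)) :[?T]"
      using phi_closed[of "vertical HX (Suc p) q (horizontal HX (Suc p) (Suc q) x)" q "Suc p"] vc h by simp
     ultimately show ?thesis
      using IHp[OF h] by (simp add: phi_d_def)
    qed
    also have "phi (Suc p) q (horizontal HX (Suc p) q (vertical HX (Suc (Suc p)) q x)) +[?T]
      phi (Suc p) q (vertical HX (Suc p) q (horizontal HX (Suc p) (Suc q) x)) =
      phi (Suc p) q (horizontal HX (Suc p) q (vertical HX (Suc (Suc p)) q x) +[T (Suc q)]
       vertical HX (Suc p) q (horizontal HX (Suc p) (Suc q) x))"
     using lin_add[OF phi_linear[of "Suc p" q]] vc hc x by simp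
    also have "horizontal HX (Suc p) q (vertical HX (Suc (Suc p)) q x) +[T (Suc q)]
       vertical HX (Suc p) q (horizontal HX (Suc p) (Suc q) x) = \<zero>[T (Suc q)]"
    proof -
     interpret Tq: module R "T (Suc q)" by simp
     show ?thesis using vh[OF x, of "Suc p"] vc hc x by (simp add: Tq.a_comm)
    qed
    also have "phi (Suc p) q \<zero>[T (Suc q)] = \<zero>[?T]"
     using lin_zero[OF phi_linear[of "Suc p" q] mT mT] by simp
    finally show "hochschild_b HX m (phi_d (Suc p) (Suc q) x) = \<zero>[T (Suc m)]" unfolding mq .
   qed
  qed
 qed
qed

text \<open>The descent of \<open>phi\<close> to coinvariants, computed on the particular lift
  \<open>F q \<one>[H] y\<close> of \<open>y\<close>; by equivariance every other lift gives the
  same value.\<close>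

definition phibar :: "nat => nat => ('h list => 'k) set => ('h list => 'k) set"
 where "phibar p q y = \<pi> (q + p) (phi p q (F q \<one>[H] y))"

lemma phibar_linear: "phibar p q \<in> lin R (T q) (T (q + p))"
 unfolding phibar_def[abs_def]
 by (intro lin_comp[OF lin_comp[OF bilinear_right[OF F_bilinear] phi_linear] \<pi>_linear]) simp

lemma phibar_\<pi>: "x :[T (Suc q)] ==> phibar p q (\<pi> q x) = \<pi> (q + p) (phi p q x)"
 unfolding phibar_def by (rule Hlin_descend[OF phi_Hlin, symmetric])

lemma phibar_0: "y :[T q] ==> phibar 0 q y = y"
 by (simp add: phibar_def \<pi>_F_one)

lemma
 shows \<pi>_b: "x :[T (Suc (Suc n))] ==> \<pi> n (hochschild_b HX n x) = hochschild_b CX n (\<pi> (Suc n) x)"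
  and \<pi>_vertical: "x :[T (Suc (Suc n))] ==> \<pi> n (vertical HX p n x) = vertical CX p n (\<pi> (Suc n) x)"
  and \<pi>_horizontal: "x :[T (Suc n)] ==> \<pi> n (horizontal HX p n x) = horizontal CX p n (\<pi> n x)"
 using precyclic_morphism[OF precyclic_HX precyclic_CX, of \<pi>] \<pi>_linear \<pi>_face \<pi>_cyc by simp_all

lemma b_phibar_0:
 assumes "y :[T 0]"
 shows "hochschild_b CX p (phibar (Suc p) 0 y) = phibar p 0 (horizontal CX p 0 y)"
proof -
 interpret E: precyclic R HX by (rule precyclic_HX)
 obtain x where x: "x :[T (Suc 0)]" "\<pi> 0 x = y" using \<pi>_surj[OF assms] .
 have h: "horizontal HX p 0 x :[T (Suc 0)]" using E.horizontal_closed[of x 0 p] x by simp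
 have "hochschild_b CX p (phibar (Suc p) 0 y) = \<pi> p (hochschild_b HX p (phi (Suc p) 0 x))"
  using x phi_closed[OF x(1), of "Suc p"] phibar_\<pi>[OF x(1), of "Suc p"] by (simp add: \<pi>_b del: phi.simps)
 also have "... = \<pi> p (phi p 0 (horizontal HX p 0 x))"
  using b_phi[OF x(1), of p] by (simp add: phi_d_def del: phi.simps)
 also have "... = phibar p 0 (horizontal CX p 0 y)"
  using phibar_\<pi>[OF h, of p] x by (simp add: \<pi>_horizontal)
 finally show ?thesis .
qed

lemma b_phibar_Suc:
 assumes "y :[T (Suc q)]"
 shows "hochschild_b CX (Suc (q + p)) (phibar (Suc p) (Suc q) y) =
  phibar (Suc p) q (vertical CX (Suc p) q y) +[T (Suc (q + p))] phibar p (Suc q) (horizontal CX p (Suc q) y)"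
proof -
 interpret E: precyclic R HX by (rule precyclic_HX)
 obtain x where x: "x :[T (Suc (Suc q))]" "\<pi> (Suc q) x = y" using \<pi>_surj[OF assms] .
 have h: "horizontal HX p (Suc q) x :[T (Suc (Suc q))]" using E.horizontal_closed[of x "Suc q" p] x by simp
 have v: "vertical HX (Suc p) q x :[T (Suc q)]" using E.vertical_closed[of x q "Suc p"] x by simp
 have "hochschild_b CX (Suc (q + p)) (phibar (Suc p) (Suc q) y) = \<pi> (Suc (q + p)) (hochschild_b HX (Suc (q + p)) (phi (Suc p) (Suc q) x))"
  using x phi_closed[OF x(1), of "Suc p"] phibar_\<pi>[OF x(1), of "Suc p"] by (simp add: \<pi>_b del: phi.simps)
 also have "... = \<pi> (Suc (q + p)) (phi (Suc p) q (vertical HX (Suc p) q x) +[T (Suc (Suc (q + p)))]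
   phi p (Suc q) (horizontal HX p (Suc q) x))"
  using b_phi[OF x(1), of p] by (simp add: phi_d_def del: phi.simps)
 also have "... = \<pi> (Suc (q + p)) (phi (Suc p) q (vertical HX (Suc p) q x)) +[T (Suc (q + p))]
   \<pi> (Suc (q + p)) (phi p (Suc q) (horizontal HX p (Suc q) x))"
  using phi_closed[OF v, of "Suc p"] phi_closed[OF h, of p] by (intro lin_add[OF \<pi>_linear]) simp_all
 also have "... = phibar (Suc p) q (vertical CX (Suc p) q y) +[T (Suc (q + p))] phibar p (Suc q) (horizontal CX p (Suc q) y)"
  using phibar_\<pi>[OF h, of p] phibar_\<pi>[OF v, of "Suc p"] x by (simp add: \<pi>_horizontal \<pi>_vertical del: phi.simps)
 finally show ?thesis .
qed

end

section \<open>Isomorphisms of modules\<close>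

lemma isomorphic_modules_sym:
 assumes "isomorphic_modules R M N" "module R M"
 shows "isomorphic_modules R N M"
proof -
 interpret M: module R M by fact
 obtain f where f: "f \<in> lin R M N" "bij_betw f (carrier M) (carrier N)"
  using assms(1) by (auto simp: isomorphic_modules_def)
 define g where "g = inv_into (carrier M) f"
 have gc: "g y :[M]" "f (g y) = y" if "y :[N]" for y
  using that f(2) by (auto simp: g_def bij_betw_def inv_into_into f_inv_into_f)
 have gf: "g (f x) = x" if "x :[M]" for x
  using that f(2) by (simp add: g_def bij_betw_def inv_into_f_f)
 have "g \<in> lin R N M"
 proof (intro linear_mapsI)
  show "g (x +[N] y) = g x +[M] g y" if "x :[N]" "y :[N]" for x y
   using gf[of "g x +[M] g y"] gc that lin_add[OF f(1), of "g x" "g y"] by simp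
  show "g (r *[N] x) = r *[M] g x" if "r :[R]" "x :[N]" for r x
   using gf[of "r *[M] g x"] gc that lin_smult[OF f(1), of r "g x"] by simp
 qed (use gc in simp)
 moreover have "bij_betw g (carrier N) (carrier M)"
  unfolding g_def by (rule bij_betw_inv_into[OF f(2)])
 ultimately show ?thesis by (auto simp: isomorphic_modules_def)
qed

lemma isomorphic_modules_trans:
 assumes "isomorphic_modules R M N" "isomorphic_modules R N L"
 shows "isomorphic_modules R M L"
proof -
 obtain f g where "f \<in> lin R M N" "bij_betw f (carrier M) (carrier N)"
  "g \<in> lin R N L" "bij_betw g (carrier N) (carrier L)"
  using assms by (auto simp: isomorphic_modules_def)
 then have "(%x. g (f x)) \<in> lin R M L" "bij_betw (%x. g (f x)) (carrier M) (carrier L)"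
  using lin_comp bij_betw_trans by (auto simp: o_def dest: bij_betw_trans)
 then show ?thesis by (auto simp: isomorphic_modules_def)
qed

lemma direct_sum_isomorphic:
 assumes "!!i. i \<in> I ==> isomorphic_modules R (M i) (N i)"
  and "!!i. i \<in> I ==> module R (M i)" "!!i. i \<in> I ==> module R (N i)"
 shows "isomorphic_modules R (direct_sum I M) (direct_sum I N)"
proof -
 have "\<forall>i\<in>I. \<exists>f. f \<in> lin R (M i) (N i) \<and> bij_betw f (carrier (M i)) (carrier (N i))"
  using assms(1) by (auto simp: isomorphic_modules_def)
 then obtain f where f: "!!i. i \<in> I ==> f i \<in> lin R (M i) (N i)"
  "!!i. i \<in> I ==> bij_betw (f i) (carrier (M i)) (carrier (N i))"
  by metis
 note fz = lin_zero[OF f(1) assms(2,3)]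
 have f0: "f i x = \<zero>[N i] \<longleftrightarrow> x = \<zero>[M i]" if "i \<in> I" "x :[M i]" for i x
 proof -
  interpret Mi: module R "M i" using assms(2) that by simp
  have "inj_on (f i) (carrier (M i))" using f(2)[OF that(1)] by (simp add: bij_betw_def)
  from inj_onD[OF this, of x "\<zero>[M i]"] show ?thesis
   using that fz[OF that(1) that(1) that(1)] by auto
 qed
 let ?g = "%x. \<lambda>i\<in>I. f i (x i)"
 have supp: "{i \<in> I. f i (x i) \<noteq> \<zero>[N i]} = {i \<in> I. x i \<noteq> \<zero>[M i]}"
  if "x \<in> (\<Pi>\<^sub>E i\<in>I. carrier (M i))" for x
  using that f0 by auto
 have gI: "?g x :[direct_sum I N]" if x: "x :[direct_sum I M]" for x
 proof -
  have "{i \<in> I. ?g x i \<noteq> \<zero>[N i]} = {i \<in> I. f i (x i) \<noteq> \<zero>[N i]}" by auto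
  then have "finite {i \<in> I. ?g x i \<noteq> \<zero>[N i]}"
   using x supp[of x] by (simp add: dsum_simps(1))
  moreover have "?g x \<in> (\<Pi>\<^sub>E i\<in>I. carrier (N i))"
   using x lin_closed[OF f(1)] by (auto simp: dsum_simps(1))
  ultimately show ?thesis by (simp add: dsum_simps(1))
 qed
 have "?g \<in> lin R (direct_sum I M) (direct_sum I N)"
  using gI by (intro linear_mapsI)
   (auto simp: dsum_simps PiE_iff lin_add[OF f(1)] lin_smult[OF f(1)] intro!: restrict_ext)
 moreover have "inj_on ?g (carrier (direct_sum I M))"
 proof (rule inj_onI)
  fix x y assume xy: "x :[direct_sum I M]" "y :[direct_sum I M]" "?g x = ?g y"
  show "x = y"
  proof (rule PiE_ext[of x I "%i. carrier (M i)"])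
   show "x i = y i" if "i \<in> I" for i
   proof -
    have "f i (x i) = f i (y i)" using fun_cong[OF xy(3), of i] that by simp
    moreover have "x i :[M i]" "y i :[M i]"
     using xy that by (auto simp: dsum_simps(1))
    ultimately show ?thesis using f(2)[OF that] by (auto simp: bij_betw_def dest: inj_onD)
   qed
  qed (use xy in "auto simp: dsum_simps(1)")
 qed
 moreover have "carrier (direct_sum I N) \<subseteq> ?g ` carrier (direct_sum I M)"
 proof
  fix y assume y: "y :[direct_sum I N]"
  let ?x = "\<lambda>i\<in>I. inv_into (carrier (M i)) (f i) (y i)"
  have yi: "y i \<in> f i ` carrier (M i)" if "i \<in> I" for i
   using y f(2)[OF that] that by (auto simp: dsum_simps(1) bij_betw_def)
  then have xP: "?x \<in> (\<Pi>\<^sub>E i\<in>I. carrier (M i))" by (auto intro: inv_into_into)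
  have fx: "?g ?x = y"
  proof
   show "?g ?x i = y i" for i
    using y yi[of i] by (cases "i \<in> I") (auto simp: dsum_simps(1) PiE_iff extensional_def f_inv_into_f)
  qed
  have fi: "f i (?x i) = y i" if "i \<in> I" for i
   using yi[OF that] that by (simp add: f_inv_into_f)
  have "{i \<in> I. ?x i \<noteq> \<zero>[M i]} = {i \<in> I. f i (?x i) \<noteq> \<zero>[N i]}" using supp[OF xP] by simp
  also have "... = {i \<in> I. y i \<noteq> \<zero>[N i]}"
   using fi by (intro Collect_cong conj_cong refl) simp
  finally have "finite {i \<in> I. ?x i \<noteq> \<zero>[M i]}" using y by (simp add: dsum_simps(1))
  then have xc: "?x :[direct_sum I M]" using xP by (simp only: dsum_simps(1) mem_Collect_eq)
  show "y \<in> ?g ` carrier (direct_sum I M)"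
  proof (rule image_eqI[where x = ?x])
   show "y = ?g ?x" by (rule fx[symmetric])
   show "?x :[direct_sum I M]" by (fact xc)
  qed
 qed
 moreover have "?g ` carrier (direct_sum I M) \<subseteq> carrier (direct_sum I N)"
  using gI by (rule image_subsetI)
 ultimately have "bij_betw ?g (carrier (direct_sum I M)) (carrier (direct_sum I N))"
  unfolding bij_betw_def by blast
 then show ?thesis
  unfolding isomorphic_modules_def using \<open>?g \<in> lin R (direct_sum I M) (direct_sum I N)\<close> by blast
qed

text \<open>Zigzags in a double complex define a correspondence rather than a map. As
  \<open>G\<close> is closed under linear operations, two related pairs can be subtracted, and the
  matching of kernels then makes the induced correspondence of the images single-valued and
  injective.\<close>

lemma isomorphic_by_relation:
 assumes mod: "module R M" "module R N" "module R L1" "module R L2"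
  and p: "p \<in> lin R M L1" "p ` carrier M = carrier L1"
  and q: "q \<in> lin R N L2" "q ` carrier N = carrier L2"
  and closed: "!!x y. G x y ==> x :[M] \<and> y :[N]"
  and total: "!!x. x :[M] ==> \<exists>y. G x y" and onto: "!!y. y :[N] ==> \<exists>x. G x y"
  and add: "!!x y x' y'. [|G x y; G x' y'|] ==> G (x +[M] x') (y +[N] y')"
  and smult: "!!r x y. [|r :[R]; G x y|] ==> G (r *[M] x) (r *[N] y)"
  and zero: "!!x y. G x y ==> p x = \<zero>[L1] \<longleftrightarrow> q y = \<zero>[L2]"
 shows "isomorphic_modules R L1 L2"
proof -
 interpret M: module R M by fact
 interpret N: module R N by fact
 interpret L1: module R L1 by fact
 interpret L2: module R L2 by fact
 have eq: "p x = p x' \<longleftrightarrow> q y = q y'" if "G x y" "G x' y'" for x y x' y'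
 proof -
  have "G ((-[R] \<one>[R]) *[M] x') ((-[R] \<one>[R]) *[N] y')" using that by (intro smult) auto
  then have "G (-[M] x') (-[N] y')"
   using closed[OF that(2)] by (simp add: module_minus_eq[OF mod(1)] module_minus_eq[OF mod(2)])
  from zero[OF add[OF that(1) this]]
  have "p (x -[M] x') = \<zero>[L1] \<longleftrightarrow> q (y -[N] y') = \<zero>[L2]"
   by (simp add: a_minus_def)
  then show ?thesis
   using closed[OF that(1)] closed[OF that(2)] lin_closed[OF p(1)] lin_closed[OF q(1)]
   by (simp add: lin_diff[OF p(1) mod(1,3)] lin_diff[OF q(1) mod(2,4)] L1.diff_zero_iff L2.diff_zero_iff)
 qed
 define f where "f a = (SOME b. \<exists>x y. G x y \<and> a = p x \<and> b = q y)" for a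
 have f: "f (p x) = q y" if "G x y" for x y
 proof -
  have "\<exists>b. \<exists>x' y'. G x' y' \<and> p x = p x' \<and> b = q y'" using that by blast
  from someI_ex[OF this] obtain x' y' where "G x' y'" "p x = p x'" "f (p x) = q y'"
   unfolding f_def by blast
  then show ?thesis using eq[OF that, of x' y'] by simp
 qed
 have rep: "\<exists>x y. G x y \<and> a = p x \<and> f a = q y" if a: "a :[L1]" for a
 proof -
  obtain x where x: "x :[M]" "a = p x" using a p(2) by auto
  then obtain y where "G x y" using total by blast
  then show ?thesis using x f by blast
 qed
 have "f \<in> lin R L1 L2"
 proof (intro linear_mapsI)
  show "f a :[L2]" if "a :[L1]" for a
   using rep[OF that] closed lin_closed[OF q(1)] by auto
  show "f (a +[L1] a') = f a +[L2] f a'" if a: "a :[L1]" "a' :[L1]" for a a'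
  proof -
   obtain x y where r1: "G x y" "a = p x" "f a = q y" using rep[OF a(1)] by blast
   obtain x' y' where r2: "G x' y'" "a' = p x'" "f a' = q y'" using rep[OF a(2)] by blast
   note r = r1 r2
   then have "a +[L1] a' = p (x +[M] x')" "f a +[L2] f a' = q (y +[N] y')"
    using closed[OF r(1)] closed[OF r(4)] lin_add[OF p(1)] lin_add[OF q(1)] by auto
   then show ?thesis using f[OF add[OF r(1,4)]] by simp
  qed
  show "f (r *[L1] a) = r *[L2] f a" if a: "r :[R]" "a :[L1]" for r a
  proof -
   obtain x y where r: "G x y" "a = p x" "f a = q y" using rep[OF a(2)] by blast
   then have "r *[L1] a = p (r *[M] x)" "r *[L2] f a = q (r *[N] y)"
    using closed[OF r(1)] a lin_smult[OF p(1)] lin_smult[OF q(1)] by auto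
   then show ?thesis using f[OF smult[OF a(1) r(1)]] by simp
  qed
 qed
 moreover have "inj_on f (carrier L1)"
 proof (rule inj_onI)
  fix a a' assume a: "a :[L1]" "a' :[L1]" "f a = f a'"
  obtain x y where r1: "G x y" "a = p x" "f a = q y" using rep[OF a(1)] by blast
  obtain x' y' where r2: "G x' y'" "a' = p x'" "f a' = q y'" using rep[OF a(2)] by blast
  show "a = a'" using eq[OF r1(1) r2(1)] r1 r2 a(3) by simp
 qed
 moreover have "f ` carrier L1 = carrier L2"
 proof
  show "f ` carrier L1 \<subseteq> carrier L2" using lin_closed[OF \<open>f \<in> _\<close>] by auto
  show "carrier L2 \<subseteq> f ` carrier L1"
  proof
   fix b assume "b :[L2]"
   then obtain y where y: "y :[N]" "b = q y" using q(2) by auto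
   then obtain x where xy: "G x y" using onto by blast
   then have "f (p x) = b" "p x :[L1]" using f y closed[OF xy] lin_closed[OF p(1)] by auto
   then show "b \<in> f ` carrier L1" by auto
  qed
 qed
 ultimately show ?thesis by (auto simp: isomorphic_modules_def bij_betw_def)
qed

section \<open>Homology of chain complexes\<close>

locale chain_complex =
 fixes R :: "('k, 'r) ring_scheme" and C :: "nat => ('k, 'a, 'm) module_scheme" and d :: "nat => 'a => 'a"
 assumes module_C: "module R (C n)"
  and d_linear: "d n \<in> lin R (C (Suc n)) (C n)"
  and d_d: "x :[C (Suc (Suc n))] ==> d n (d (Suc n) x) = \<zero>[C n]"
begin

lemma cycles_iff: "x \<in> cycles C d n \<longleftrightarrow> x :[C n] \<and> (\<forall>m. n = Suc m \<longrightarrow> d m x = \<zero>[C m])"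
 by (cases n) (auto simp: cycles_def a_kernel_def')

lemma cycles_submodule: "submodule (cycles C d n) R (C n)"
proof (cases n)
 case 0
 then show ?thesis by (simp add: cycles_def module.carrier_is_submodule[OF module_C])
next
 case (Suc m)
 then show ?thesis
  by (simp add: cycles_def linear_kernel_submodule[OF d_linear module_C module_C])
qed

abbreviation Z where "Z n \<equiv> (C n)\<lparr>carrier := cycles C d n\<rparr>"

lemma module_Z: "module R (Z n)"
 by (rule submodule.submodule_is_module[OF cycles_submodule module_C])

lemma boundary_cycle: "x :[C (Suc n)] ==> d n x \<in> cycles C d n"
 using d_d lin_closed[OF d_linear] by (auto simp: cycles_iff)

lemma boundaries_submodule: "submodule (d n ` carrier (C (Suc n))) R (Z n)"
proof -
 have "d n \<in> lin R (C (Suc n)) (Z n)"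
  using boundary_cycle by (auto intro!: linear_mapsI simp: lin_add[OF d_linear] lin_smult[OF d_linear])
 from linear_image_submodule[OF this module_C module_Z] show ?thesis .
qed

definition cls :: "nat => 'a => 'a set" where "cls n x = d n ` carrier (C (Suc n)) +>\<^bsub>Z n\<^esub> x"

lemma chain_homology_eq: "chain_homology C d (int n) = quotient_module (Z n) (d n ` carrier (C (Suc n)))"
 by (simp add: chain_homology_def)

lemma
 shows module_homology: "module R (chain_homology C d (int n))"
  and cls_linear: "cls n \<in> lin R (Z n) (chain_homology C d (int n))"
  and cls_surj: "cls n ` carrier (Z n) = carrier (chain_homology C d (int n))"
  and cls_zero_iff: "x \<in> cycles C d n ==>
   cls n x = \<zero>[chain_homology C d (int n)] \<longleftrightarrow> x \<in> d n ` carrier (C (Suc n))"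
 unfolding chain_homology_eq cls_def[abs_def]
 using quotient_module_module[OF module_Z boundaries_submodule] quotient_proj_linear[OF module_Z boundaries_submodule]
  quotient_carrier[OF module_Z boundaries_submodule] quotient_proj_zero[OF module_Z boundaries_submodule]
 by auto

end

lemma module_zero_module:
 assumes "cring R"
 shows "module R zero_module"
 by (intro moduleI abelian_groupI assms) (auto simp: zero_module_def)

lemma module_chain_homology:
 assumes "chain_complex R C d" "cring R"
 shows "module R (chain_homology C d i)"
proof (cases "i < 0")
 case True
 then show ?thesis using module_zero_module[OF assms(2)] by (simp add: chain_homology_def)
next
 case False
 then show ?thesis using chain_complex.module_homology[OF assms(1), of "nat i"] by simp
qed

text \<open>In negative degrees both sides are copies of the zero module, whose only element is
  \<open>undefined\<close>.\<close>

lemma isomorphic_chain_homology_negative: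
 "i < 0 ==> isomorphic_modules R (chain_homology C d i) (chain_homology C' d' i)"
 by (auto simp: isomorphic_modules_def chain_homology_def zero_module_def linear_maps_def bij_betw_def
   intro!: bexI[of _ "%x. undefined"])

lemma direct_sum_neg:
 assumes "cring R" "!!i. i \<in> I ==> module R (M i)" "f :[direct_sum I M]" "i \<in> I"
 shows "(-[direct_sum I M] f) i = -[M i] f i"
proof -
 interpret cring R by fact
 have "f i :[M i]" using assms(3,4) by (auto simp: dsum_simps(1))
 then show ?thesis
  using module_minus_eq[OF module_direct_sum[OF assms(1,2)] assms(3)] module_minus_eq[OF assms(2)[OF assms(4)]]
   assms(4) by (simp add: dsum_simps)
qed

lemma direct_sum_diff:
 assumes "cring R" "!!i. i \<in> I ==> module R (M i)" "f :[direct_sum I M]" "g :[direct_sum I M]" "i \<in> I"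
 shows "(f -[direct_sum I M] g) i = f i -[M i] g i"
 using direct_sum_neg[OF assms(1,2,4,5)] assms(5) by (simp add: a_minus_def dsum_simps)

section \<open>The total complex\<close>

context precyclic
begin

abbreviation Tot where "Tot \<equiv> total_obj X"
abbreviation D where "D \<equiv> total_diff X"

lemma cring_R: "cring R"
 using module_obj[of 0] by (simp add: module_def)


lemma Tot_iff: "f :[Tot n] \<longleftrightarrow> (\<forall>p\<le>n. f p :[C (n - p)]) \<and> f \<in> extensional {..n}"
 by (auto simp: total_obj_def dsum_simps(1) PiE_iff)

lemma module_Tot: "module R (Tot n)"
 unfolding total_obj_def by (intro module_direct_sum cring_R module_obj)

lemma Tot_ops:
 "p \<le> n ==> (f +[Tot n] g) p = f p +[C (n - p)] g p"
 "p \<le> n ==> (r *[Tot n] f) p = r *[C (n - p)] f p"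
 "p \<le> n ==> \<zero>[Tot n] p = \<zero>[C (n - p)]"
 "[|p \<le> n; f :[Tot n]; g :[Tot n]|] ==> (f -[Tot n] g) p = f p -[C (n - p)] g p"
 unfolding total_obj_def
 by (simp_all add: dsum_simps direct_sum_diff[OF cring_R module_obj])

lemma Tot_eqI:
 assumes "f :[Tot n]" "g :[Tot n]" "!!p. p \<le> n ==> f p = g p"
 shows "f = g"
 by (rule extensionalityI[of _ "{..n}"]) (use assms in "auto simp: Tot_iff")

lemma Tot_comp: "[|f :[Tot n]; p \<le> n|] ==> f p :[C (n - p)]"
 by (simp add: Tot_iff)

lemma Tot_comp': "[|f :[Tot (Suc n)]; p \<le> n|] ==> f p :[C (Suc (n - p))]"
 "[|f :[Tot (Suc n)]; p \<le> n|] ==> f (Suc p) :[C (n - p)]"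
 using Tot_comp[of f "Suc n" p] Tot_comp[of f "Suc n" "Suc p"] by (simp_all add: Suc_diff_le)

lemma D_apply: "p \<le> n ==> D n f p = vertical X p (n - p) (f p) +[C (n - p)] horizontal X p (n - p) (f (Suc p))"
 by (simp add: total_diff_def)

lemma D_linear: "D n \<in> lin R (Tot (Suc n)) (Tot n)"
proof (intro linear_mapsI)
 fix f assume f: "f :[Tot (Suc n)]"
 show "D n f :[Tot n]"
  unfolding Tot_iff
 proof (intro conjI allI impI)
  fix p assume p: "p \<le> n"
  interpret Cp: module R "C (n - p)" by (rule module_obj)
  show "D n f p :[C (n - p)]"
   using p Tot_comp'[OF f p] by (simp add: D_apply)
 qed (simp add: total_diff_def)
next
 fix f g assume fg: "f :[Tot (Suc n)]" "g :[Tot (Suc n)]"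
 have "D n (f +[Tot (Suc n)] g) p = (D n f +[Tot n] D n g) p" if p: "p \<le> n" for p
 proof -
  interpret Cp: module R "C (n - p)" by (rule module_obj)
  show ?thesis
   using p Tot_comp'[OF fg(1) p] Tot_comp'[OF fg(2) p]
   by (simp add: D_apply Tot_ops Suc_diff_le lin_add[OF vertical_linear] lin_add[OF horizontal_linear] Cp.a_ac)
 qed
 then show "D n (f +[Tot (Suc n)] g) = D n f +[Tot n] D n g"
  by (intro extensionalityI[of _ "{..n}"]) (auto simp: total_diff_def total_obj_def dsum_simps)
next
 fix r f assume rf: "r :[R]" "f :[Tot (Suc n)]"
 have "D n (r *[Tot (Suc n)] f) p = (r *[Tot n] D n f) p" if p: "p \<le> n" for p
 proof -
  interpret Cp: module R "C (n - p)" by (rule module_obj)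
  show ?thesis
   using p Tot_comp'[OF rf(2) p] rf(1)
   by (simp add: D_apply Tot_ops Suc_diff_le lin_smult[OF vertical_linear] lin_smult[OF horizontal_linear] Cp.smult_r_distr)
 qed
 then show "D n (r *[Tot (Suc n)] f) = r *[Tot n] D n f"
  by (intro extensionalityI[of _ "{..n}"]) (auto simp: total_diff_def total_obj_def dsum_simps)
qed

lemma D_D:
 assumes f: "f :[Tot (Suc (Suc n))]"
 shows "D n (D (Suc n) f) = \<zero>[Tot n]"
proof (rule Tot_eqI)
 show "D n (D (Suc n) f) :[Tot n]"
  using lin_closed[OF D_linear] f by blast
 interpret T: module R "Tot n" by (rule module_Tot)
 show "\<zero>[Tot n] :[Tot n]" by simp
 fix p assume p: "p \<le> n"
 let ?q = "n - p"
 interpret Cp: module R "C ?q" by (rule module_obj)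
 interpret Cq: module R "C (Suc ?q)" by (rule module_obj)
 have x: "f p :[C (Suc (Suc ?q))]" "f (Suc p) :[C (Suc ?q)]" "f (Suc (Suc p)) :[C ?q]"
  using Tot_comp[OF f, of p] Tot_comp[OF f, of "Suc p"] Tot_comp[OF f, of "Suc (Suc p)"] p
  by (simp_all add: Suc_diff_le)
 have "D n (D (Suc n) f) p =
   vertical X p ?q (vertical X p (Suc ?q) (f p) +[C (Suc ?q)] horizontal X p (Suc ?q) (f (Suc p))) +[C ?q]
   horizontal X p ?q (vertical X (Suc p) ?q (f (Suc p)) +[C ?q] horizontal X (Suc p) ?q (f (Suc (Suc p))))"
  using p by (simp add: D_apply Suc_diff_le)
 also have "... = vertical X p ?q (horizontal X p (Suc ?q) (f (Suc p))) +[C ?q]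
   horizontal X p ?q (vertical X (Suc p) ?q (f (Suc p)))"
  using x by (simp add: lin_add[OF vertical_linear] lin_add[OF horizontal_linear] vertical_vertical horizontal_horizontal)
 also have "... = \<zero>[C ?q]"
  using x by (rule_tac vertical_horizontal)
 finally show "D n (D (Suc n) f) p = \<zero>[Tot n] p" using p by (simp add: Tot_ops)
qed

end

sublocale precyclic \<subseteq> tot: chain_complex R "total_obj X" "total_diff X"
 by (intro chain_complex.intro module_Tot D_linear D_D)

sublocale precyclic \<subseteq> hoch: chain_complex R "obj X" "hochschild_b X"
 by (intro chain_complex.intro module_obj b_linear b_b)

text \<open>A cyclic module for which the identity of column 0 of the cyclic double complex extends to a
 chain map from the total complex, and whose \<open>b'\<close>-complex is contractible.\<close>

locale split_precyclic = precyclic R X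
 for R :: "('k, 'r) ring_scheme" and X :: "('k, 'a) cyclic_object" +
 fixes \<phi> :: "nat => nat => 'a => 'a" and \<sigma> :: "nat => 'a => 'a"
 assumes \<phi>_linear: "\<phi> p q \<in> lin R (obj X q) (obj X (q + p))"
  and \<phi>_0: "x :[obj X q] ==> \<phi> 0 q x = x"
  and b_\<phi>_0: "x :[obj X 0] ==> hochschild_b X p (\<phi> (Suc p) 0 x) = \<phi> p 0 (horizontal X p 0 x)"
  and b_\<phi>_Suc: "x :[obj X (Suc q)] ==> hochschild_b X (Suc (q + p)) (\<phi> (Suc p) (Suc q) x) =
   \<phi> (Suc p) q (vertical X (Suc p) q x) +[obj X (Suc (q + p))] \<phi> p (Suc q) (horizontal X p (Suc q) x)"
  and \<sigma>_linear: "\<sigma> n \<in> lin R (obj X n) (obj X (Suc n))"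
  and b'_\<sigma>_0: "x :[obj X 0] ==> hochschild_b' X 0 (\<sigma> 0 x) = x"
  and b'_\<sigma>_Suc: "x :[obj X (Suc n)] ==>
   hochschild_b' X (Suc n) (\<sigma> (Suc n) x) +[obj X (Suc n)] \<sigma> n (hochschild_b' X n x) = x"
begin

section \<open>Splitting the homology of the total complex\<close>

definition \<Psi> :: "nat => (nat => 'a) => 'a"
 where "\<Psi> n f = (\<Oplus>\<^bsub>C n\<^esub>p\<in>{..n}. \<phi> p (n - p) (f p))"

lemma \<phi>_closed: "[|p \<le> n; x :[C (n - p)]|] ==> \<phi> p (n - p) x :[C n]"
 using lin_closed[OF \<phi>_linear, of x "n - p" p] by simp

lemma \<Psi>_linear: "\<Psi> n \<in> lin R (Tot n) (C n)"
 unfolding \<Psi>_def[abs_def]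
proof (intro lin_map_finsum module_obj module_Tot)
 fix p assume p: "p \<in> {..n}"
 have "(%f. f p) \<in> lin R (Tot n) (C (n - p))"
  using p by (intro linear_mapsI) (auto simp: Tot_ops Tot_iff)
 from lin_comp[OF this \<phi>_linear[of p "n - p"]] p
 show "(%f. \<phi> p (n - p) (f p)) \<in> lin R (Tot n) (C n)" by simp
qed

lemma \<Psi>_closed [simp]: "f :[Tot n] ==> \<Psi> n f :[C n]"
 by (rule lin_closed[OF \<Psi>_linear])

text \<open>The component in column \<open>p + 1\<close> contributes a vertical term that belongs to
  column \<open>p + 1\<close> of the differential and a horizontal one that belongs to column
  \<open>p\<close>. Shifting the index of the vertical terms collects the components of
  \<open>D n f\<close>.\<close>

lemma b_\<Psi>:
 assumes f: "f :[Tot (Suc n)]"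
 shows "b n (\<Psi> (Suc n) f) = \<Psi> n (D n f)"
proof -
 interpret Cn: module R "C n" by (rule module_obj)
 \<comment> \<open>The component in column \<open>n + 1\<close> has degree 0 and no vertical
   boundary, hence the zero beyond \<open>n\<close>.\<close>
 define V where "V p = (if p \<le> n then \<phi> p (n - p) (vertical X p (n - p) (f p)) else \<zero>[C n])" for p
 define W where "W p = \<phi> p (n - p) (horizontal X p (n - p) (f (Suc p)))" for p
 have Vc: "V p :[C n]" for p
  using Tot_comp'(1)[OF f] by (auto simp: V_def intro!: \<phi>_closed)
 have Wc: "W p :[C n]" if "p \<le> n" for p
  using Tot_comp'(2)[OF f that] that by (auto simp: W_def intro!: \<phi>_closed)
 have t0: "b n (\<phi> 0 (Suc n) (f 0)) = V 0"
  using Tot_comp'(1)[OF f, of 0] by (simp add: V_def \<phi>_0 vertical_def)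
 have tS: "b n (\<phi> (Suc p) (Suc n - Suc p) (f (Suc p))) = V (Suc p) +[C n] W p" if p: "p \<le> n" for p
 proof (cases "n - p")
  case 0
  then have "p = n" using p by simp
  then show ?thesis
   using Tot_comp'(2)[OF f p] Wc[OF p] b_\<phi>_0[of "f (Suc p)" p] by (simp add: V_def W_def)
 next
  case (Suc q)
  then have n: "n = Suc (q + p)" "n - Suc p = q" "Suc p \<le> n" by auto
  show ?thesis
   using Tot_comp'(2)[OF f p] b_\<phi>_Suc[of "f (Suc p)" q p] n by (simp add: V_def W_def Suc)
 qed
 have "b n (\<Psi> (Suc n) f) = (\<Oplus>\<^bsub>C n\<^esub>p\<in>{..Suc n}. b n (\<phi> p (Suc n - p) (f p)))"
  unfolding \<Psi>_def using Tot_comp[OF f] \<phi>_closed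
  by (intro lin_finsum[OF b_linear module_obj module_obj]) auto
 also have "... = (\<Oplus>\<^bsub>C n\<^esub>p\<in>{..n}. b n (\<phi> (Suc p) (Suc n - Suc p) (f (Suc p)))) +[C n] b n (\<phi> 0 (Suc n - 0) (f 0))"
  using Tot_comp[OF f] \<phi>_closed[of _ "Suc n"] by (intro Cn.finsum_Suc2) auto
 also have "(\<Oplus>\<^bsub>C n\<^esub>p\<in>{..n}. b n (\<phi> (Suc p) (Suc n - Suc p) (f (Suc p)))) = (\<Oplus>\<^bsub>C n\<^esub>p\<in>{..n}. V (Suc p) +[C n] W p)"
  using tS by (intro finsum_strong_cong) simp
 also have "... = (\<Oplus>\<^bsub>C n\<^esub>p\<in>{..n}. V (Suc p)) +[C n] (\<Oplus>\<^bsub>C n\<^esub>p\<in>{..n}. W p)"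
  using Vc Wc by (intro Cn.finsum_addf) auto
 also have "... +[C n] b n (\<phi> 0 (Suc n - 0) (f 0)) =
   ((\<Oplus>\<^bsub>C n\<^esub>p\<in>{..n}. V (Suc p)) +[C n] V 0) +[C n] (\<Oplus>\<^bsub>C n\<^esub>p\<in>{..n}. W p)"
 proof -
  have "(\<Oplus>\<^bsub>C n\<^esub>p\<in>{..n}. V (Suc p)) :[C n]" "(\<Oplus>\<^bsub>C n\<^esub>p\<in>{..n}. W p) :[C n]"
   using Vc Wc by (auto intro!: Cn.finsum_closed)
  then show ?thesis using t0 Vc[of 0] by (simp add: Cn.a_ac)
 qed
 also have "(\<Oplus>\<^bsub>C n\<^esub>p\<in>{..n}. V (Suc p)) +[C n] V 0 = (\<Oplus>\<^bsub>C n\<^esub>p\<in>{..Suc n}. V p)"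
  using Vc by (intro Cn.finsum_Suc2[symmetric]) auto
 also have "... = (\<Oplus>\<^bsub>C n\<^esub>p\<in>{..n}. V p)"
 proof -
  have "(\<Oplus>\<^bsub>C n\<^esub>p\<in>{..n}. V p) :[C n]" using Vc by (auto intro!: Cn.finsum_closed)
  moreover have "V (Suc n) = \<zero>[C n]" by (simp add: V_def)
  ultimately show ?thesis using Vc by (subst Cn.finsum_Suc) auto
 qed
 also have "... +[C n] (\<Oplus>\<^bsub>C n\<^esub>p\<in>{..n}. W p) = (\<Oplus>\<^bsub>C n\<^esub>p\<in>{..n}. V p +[C n] W p)"
  using Vc Wc by (intro Cn.finsum_addf[symmetric]) auto
 also have "... = \<Psi> n (D n f)"
  unfolding \<Psi>_def
 proof (intro finsum_strong_cong)
  fix p assume "p \<in> {..n}"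
  then have p: "p \<le> n" by simp
  have "\<phi> p (n - p) (vertical X p (n - p) (f p) +[C (n - p)] horizontal X p (n - p) (f (Suc p))) =
    \<phi> p (n - p) (vertical X p (n - p) (f p)) +[C (n - p + p)] \<phi> p (n - p) (horizontal X p (n - p) (f (Suc p)))"
   using Tot_comp'[OF f p] by (intro lin_add[OF \<phi>_linear]) auto
  then show "V p +[C n] W p = \<phi> p (n - p) (D n f p)"
   using p by (simp add: V_def W_def D_apply)
 qed
 finally show ?thesis .
qed

definition inc :: "nat => nat => 'a => nat => 'a"
 where "inc n p v = (\<lambda>i\<in>{..n}. if i = p then v else \<zero>[C (n - i)])"

lemma zero_closed_C [simp]: "\<zero>[C n] :[C n]"
proof -
 interpret module R "C n" by (rule module_obj)
 show ?thesis by simp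
qed

lemma inc_closed: "v :[C (n - p)] ==> inc n p v :[Tot n]"
 by (auto simp: Tot_iff inc_def)

lemmas maps_zero [simp] = lin_zero[OF vertical_linear module_obj module_obj]
 lin_zero[OF horizontal_linear module_obj module_obj]

lemma \<Psi>_zero_tail:
 assumes "f :[Tot n]" "!!p. [|0 < p; p \<le> n|] ==> f p = \<zero>[C (n - p)]"
 shows "\<Psi> n f = f 0"
proof -
 interpret Cn: module R "C n" by (rule module_obj)
 have z: "\<phi> p (n - p) (f p) = (if p = 0 then f 0 else \<zero>[C n])" if "p \<le> n" for p
  using that assms Tot_comp[OF assms(1), of 0] lin_zero[OF \<phi>_linear[of p "n - p"] module_obj module_obj]
  by (auto simp: \<phi>_0)
 have "\<Psi> n f = (\<Oplus>\<^bsub>C n\<^esub>p\<in>{..n}. if 0 = p then f 0 else \<zero>[C n])"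
  unfolding \<Psi>_def using z by (intro finsum_strong_cong) auto
 also have "... = f 0"
  using Tot_comp[OF assms(1), of 0] by (intro Cn.finsum_singleton[where f = "%_. f 0"]) auto
 finally show ?thesis .
qed

lemma D_inc_0:
 assumes "v :[C (Suc n)]"
 shows "D n (inc (Suc n) 0 v) = inc n 0 (b n v)"
proof (rule Tot_eqI)
 show "D n (inc (Suc n) 0 v) :[Tot n]"
  using inc_closed[of v "Suc n" 0] assms lin_closed[OF D_linear] by simp
 show "inc n 0 (b n v) :[Tot n]" using inc_closed[of "b n v" n 0] assms by simp
 fix p assume p: "p \<le> n"
 interpret Cp: module R "C (n - p)" by (rule module_obj)
 show "D n (inc (Suc n) 0 v) p = inc n 0 (b n v) p"
  using p assms by (auto simp: D_apply inc_def vertical_def[of _ 0] Suc_diff_le)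
qed

text \<open>The component in column 1 is removed by the contraction of \<open>b'\<close>. What
  remains lives in column 0, where \<open>\<Psi>\<close> is the identity, so that the hypothesis on
  \<open>\<Psi> n x\<close> says that it is a boundary.\<close>

lemma two_columns_boundary:
 assumes x: "x \<in> cycles Tot D n" and tail: "!!p. [|2 \<le> p; p \<le> n|] ==> x p = \<zero>[C (n - p)]"
  and bd: "\<Psi> n x \<in> b n ` carrier (C (Suc n))"
 shows "x \<in> D n ` carrier (Tot (Suc n))"
proof -
 interpret Tn: module R "Tot n" by (rule module_Tot)
 interpret TS: module R "Tot (Suc n)" by (rule module_Tot)
 interpret Cn: module R "C n" by (rule module_obj)
 have xT: "x :[Tot n]" using x by (simp add: tot.cycles_iff)
 have one: "\<exists>u\<in>carrier (Tot (Suc n)). \<forall>p. 0 < p \<longrightarrow> p \<le> n \<longrightarrow> D n u p = x p"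
 proof (cases n)
  case 0
  then show ?thesis using TS.zero_closed by (intro bexI[of _ "\<zero>[Tot (Suc n)]"]) auto
 next
  case (Suc m)
  have x1: "x (Suc 0) :[C m]" using Tot_comp[OF xT, of "Suc 0"] Suc by simp
  interpret Cm: module R "C m" by (rule module_obj)
  interpret CSm: module R "C (Suc m)" by (rule module_obj)
  have \<sigma>c: "\<sigma> m (x (Suc 0)) :[C (Suc m)]" using lin_closed[OF \<sigma>_linear x1] .
  \<comment> \<open>The vertical differential of an odd column is \<open>- b'\<close>, hence the
    sign.\<close>
  let ?v = "-[C (Suc m)] \<sigma> m (x (Suc 0))"
  let ?u = "inc (Suc n) (Suc 0) ?v"
  have u: "?u :[Tot (Suc n)]" using \<sigma>c Suc by (intro inc_closed) simp
  \<comment> \<open>As column 2 is empty, the cycle condition in column 1 says that this component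
    is a cycle for \<open>b'\<close>.\<close>
  have bs: "b' m (\<sigma> m (x (Suc 0))) = x (Suc 0)"
  proof (cases m)
   case 0
   then show ?thesis using x1 b'_\<sigma>_0 by simp
  next
   case (Suc l)
   interpret Cl: module R "C l" by (rule module_obj)
   interpret CSl: module R "C (Suc l)" by (rule module_obj)
   have "D m x (Suc 0) = \<zero>[Tot m] (Suc 0)" using x \<open>n = Suc m\<close> by (simp add: tot.cycles_iff)
   moreover have "x (Suc (Suc 0)) = \<zero>[C l]" using tail[of 2] \<open>n = Suc m\<close> Suc by (simp add: numeral_2_eq_2)
   ultimately have "-[C l] b' l (x (Suc 0)) = \<zero>[C l]"
    using Suc x1 by (simp add: D_apply Tot_ops vertical_def)
   then have "b' l (x (Suc 0)) = \<zero>[C l]"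
    using x1 Suc by (metis Cl.minus_minus Cl.neg_zero b'c)
   then show ?thesis
    using b'_\<sigma>_Suc[of "x (Suc 0)" l] x1 Suc lin_zero[OF \<sigma>_linear module_obj module_obj, of l]
     b'c[OF \<sigma>c] by simp
  qed
  have "D n ?u p = x p" if p: "0 < p" "p \<le> n" for p
  proof (cases "p = Suc 0")
   case True
   have "D n ?u p = -[C m] b' m ?v +[C m] horizontal X (Suc 0) m \<zero>[C m]"
    using p True Suc by (simp add: D_apply inc_def vertical_def)
   also have "... = b' m (\<sigma> m (x (Suc 0)))"
    using \<sigma>c by (simp add: lin_neg[OF b'_linear module_obj module_obj])
   finally show ?thesis using bs True by simp
  next
   case False
   interpret Cp: module R "C (n - p)" by (rule module_obj)
   show ?thesis using p False tail[of p] by (simp add: D_apply inc_def Suc_diff_le)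
  qed
  then show ?thesis using u by blast
 qed
 then obtain u where u: "u :[Tot (Suc n)]" "!!p. [|0 < p; p \<le> n|] ==> D n u p = x p" by blast
 define y where "y = x -[Tot n] D n u"
 have Du: "D n u :[Tot n]" using lin_closed[OF D_linear u(1)] .
 have y: "y :[Tot n]" using xT Du by (simp add: y_def)
 have y0: "y p = \<zero>[C (n - p)]" if "0 < p" "p \<le> n" for p
 proof -
  interpret Cp: module R "C (n - p)" by (rule module_obj)
  show ?thesis using that u(2)[OF that] Tot_comp[OF xT that(2)] xT Du
   by (simp add: y_def Tot_ops Cp.diff_zero_iff)
 qed
 have "\<Psi> n y = y 0" by (rule \<Psi>_zero_tail[OF y y0])
 moreover have "\<Psi> n y = \<Psi> n x -[C n] b n (\<Psi> (Suc n) u)"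
  using lin_diff[OF \<Psi>_linear module_Tot module_obj xT Du] b_\<Psi>[OF u(1)] by (simp add: y_def)
 moreover obtain c where c: "c :[C (Suc n)]" "\<Psi> n x = b n c" using bd by auto
 interpret CS: module R "C (Suc n)" by (rule module_obj)
 \<comment> \<open>Subtracting \<open>D n u\<close> has changed the value of \<open>\<Psi>\<close>
   by the boundary of \<open>\<Psi> (Suc n) u\<close>; the bounding element is corrected
   accordingly.\<close>
 define e where "e = c -[C (Suc n)] \<Psi> (Suc n) u"
 have e: "e :[C (Suc n)]" using c u(1) by (simp add: e_def)
 have "b n e = b n c -[C n] b n (\<Psi> (Suc n) u)"
  unfolding e_def using c u(1) by (intro lin_diff[OF b_linear module_obj module_obj]) auto
 ultimately have be: "b n e = y 0" using c by simp
 have "y = D n (inc (Suc n) 0 e)"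
  unfolding D_inc_0[OF e] by (rule Tot_eqI[OF y inc_closed]) (use e be y0 Tot_comp[OF y, of 0] in "auto simp: inc_def")
 then have "x = D n (inc (Suc n) 0 e +[Tot (Suc n)] u)"
  using lin_add[OF D_linear inc_closed[of e "Suc n" 0] u(1)] e xT Du
  by (simp add: y_def) (metis Tn.a_assoc Tn.l_neg Tn.minus_eq Tn.r_zero Tn.a_inv_closed)
 then show ?thesis using inc_closed[of e "Suc n" 0] e u(1) by auto
qed

text \<open>The \<open>i\<close>-th power of the periodicity operator, which forgets the first
  \<open>2 * i\<close> columns. It is indexed by the degree \<open>m\<close> of its target, so that
  no subtraction of degrees occurs.\<close>

definition sh :: "nat => nat => (nat => 'a) => nat => 'a"
 where "sh i m f = (\<lambda>p\<in>{..m}. f (p + 2 * i))"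

lemma sh_closed:
 assumes "f :[Tot (m + 2 * i)]"
 shows "sh i m f :[Tot m]"
proof -
 have "f (p + 2 * i) :[C (m - p)]" if "p \<le> m" for p
  using Tot_comp[OF assms, of "p + 2 * i"] that by simp
 then show ?thesis by (simp add: Tot_iff sh_def)
qed

lemma sh_linear: "sh i m \<in> lin R (Tot (m + 2 * i)) (Tot m)"
proof (intro linear_mapsI sh_closed)
 fix f g assume fg: "f :[Tot (m + 2 * i)]" "g :[Tot (m + 2 * i)]"
 have "(f +[Tot (m + 2 * i)] g) (p + 2 * i) = f (p + 2 * i) +[C (m - p)] g (p + 2 * i)" if "p \<le> m" for p
  using Tot_ops(1)[of "p + 2 * i" "m + 2 * i" f g] that by simp
 then show "sh i m (f +[Tot (m + 2 * i)] g) = sh i m f +[Tot m] sh i m g"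
  by (auto simp: sh_def total_obj_def dsum_simps(3) intro!: restrict_ext)
next
 fix r f assume rf: "r :[R]" "f :[Tot (m + 2 * i)]"
 have "(r *[Tot (m + 2 * i)] f) (p + 2 * i) = r *[C (m - p)] f (p + 2 * i)" if "p \<le> m" for p
  using Tot_ops(2)[of "p + 2 * i" "m + 2 * i" r f] that by simp
 then show "sh i m (r *[Tot (m + 2 * i)] f) = r *[Tot m] sh i m f"
  by (auto simp: sh_def total_obj_def dsum_simps(4) intro!: restrict_ext)
qed

lemma vertical_shift: "vertical X (p + 2 * i) = vertical X p"
 and horizontal_shift: "horizontal X (p + 2 * i) = horizontal X p"
 by (auto simp: vertical_def[abs_def] horizontal_def[abs_def])

lemma D_sh: "D m (sh i (Suc m) f) = sh i m (D (m + 2 * i) f)"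
proof (rule extensionalityI[of _ "{..m}"])
 fix p assume "p \<in> {..m}"
 then have p: "p \<le> m" by simp
 have "D m (sh i (Suc m) f) p = vertical X p (m - p) (f (p + 2 * i)) +[C (m - p)] horizontal X p (m - p) (f (Suc p + 2 * i))"
  using p by (simp add: D_apply sh_def)
 moreover have "D (m + 2 * i) f (p + 2 * i) =
   vertical X p (m - p) (f (p + 2 * i)) +[C (m - p)] horizontal X p (m - p) (f (Suc p + 2 * i))"
  using p D_apply[of "p + 2 * i" "m + 2 * i" f] by (simp add: vertical_shift horizontal_shift)
 ultimately show "D m (sh i (Suc m) f) p = sh i m (D (m + 2 * i) f) p"
  using p by (simp add: sh_def)
qed (auto simp: total_diff_def sh_def)

lemma sh_zero: "sh i m \<zero>[Tot (m + 2 * i)] = \<zero>[Tot m]"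
 by (rule lin_zero[OF sh_linear module_Tot module_Tot])

lemma sh_cycle:
 assumes "x \<in> cycles Tot D (m + 2 * i)"
 shows "sh i m x \<in> cycles Tot D m"
proof -
 have "D l (sh i m x) = \<zero>[Tot l]" if m: "m = Suc l" for l
 proof -
  have "D (l + 2 * i) x = \<zero>[Tot (l + 2 * i)]" using assms m by (simp add: tot.cycles_iff)
  then show ?thesis unfolding m D_sh by (simp add: sh_zero)
 qed
 then show ?thesis using sh_closed assms by (simp add: tot.cycles_iff)
qed

lemma \<Psi>_cycle:
 assumes "x \<in> cycles Tot D n"
 shows "\<Psi> n x \<in> cycles C b n"
proof -
 have "b m (\<Psi> n x) = \<zero>[C m]" if n: "n = Suc m" for m
  using assms b_\<Psi>[of x m] lin_zero[OF \<Psi>_linear module_Tot module_obj, of m] n by (simp add: tot.cycles_iff)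
 then show ?thesis using assms by (simp add: tot.cycles_iff hoch.cycles_iff)
qed

lemma sh_sh: "sh i m (sh (Suc 0) (m + 2 * i) f) = sh (Suc i) m f"
 by (auto simp: sh_def intro!: restrict_ext)

lemma sh_0: "x :[Tot n] ==> sh 0 n x = x"
 by (auto simp: sh_def Tot_iff extensional_def fun_eq_iff)

text \<open>Induction two columns at a time. The shifted cycle is a boundary by induction; moving
  its bounding element back and subtracting its differential leaves a cycle in columns 0 and 1
  only.\<close>

lemma boundary_criterion:
 assumes "x \<in> cycles Tot D n"
  and "!!i m. n = m + 2 * i ==> \<Psi> m (sh i m x) \<in> b m ` carrier (C (Suc m))"
 shows "x \<in> D n ` carrier (Tot (Suc n))"
 using assms
proof (induction n arbitrary: x rule: less_induct)
 case (less n)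
 have xT: "x :[Tot n]" using less.prems(1) by (simp add: tot.cycles_iff)
 have b0: "\<Psi> n x \<in> b n ` carrier (C (Suc n))" using less.prems(2)[of n 0] sh_0[OF xT] by simp
 show ?case
 proof (cases "n < 2")
  case True
  show ?thesis by (rule two_columns_boundary[OF less.prems(1) _ b0]) (use True in auto)
 next
  case False
  then obtain m where n: "n = m + 2 * Suc 0" by (metis le_add_diff_inverse2 not_less mult_2_right One_nat_def mult.right_neutral)
  have "sh (Suc 0) m x \<in> D m ` carrier (Tot (Suc m))"
  proof (rule less.IH)
   show "sh (Suc 0) m x \<in> cycles Tot D m" using sh_cycle less.prems(1) n by simp
   show "\<Psi> l (sh i l (sh (Suc 0) m x)) \<in> b l ` carrier (C (Suc l))" if "m = l + 2 * i" for l i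
    using less.prems(2)[of l "Suc i"] n that by (simp add: sh_sh)
  qed (use n in simp)
  then obtain w where w: "w :[Tot (Suc m)]" "D m w = sh (Suc 0) m x" by force
  \<comment> \<open>The bounding element of the shifted cycle, moved back by two columns and
    extended by zero.\<close>
  define w' where "w' = (\<lambda>p\<in>{..Suc n}. if p < 2 then \<zero>[C (Suc n - p)] else w (p - 2))"
  have w': "w' :[Tot (Suc n)]"
   unfolding Tot_iff
  proof (intro conjI allI impI)
   fix p assume p: "p \<le> Suc n"
   show "w' p :[C (Suc n - p)]"
    using p Tot_comp[OF w(1), of "p - 2"] n by (auto simp: w'_def)
  qed (simp add: w'_def)
  have shw: "sh (Suc 0) (Suc m) w' = w"
   using w(1) n by (auto simp: sh_def w'_def Tot_iff extensional_def fun_eq_iff)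
  have shD: "sh (Suc 0) m (D n w') = sh (Suc 0) m x"
   using D_sh[of m "Suc 0" w'] shw w(2) n by simp
  interpret Tn: module R "Tot n" by (rule module_Tot)
  have Dw: "D n w' :[Tot n]" using lin_closed[OF D_linear w'] .
  define y where "y = x -[Tot n] D n w'"
  have yZ: "y \<in> cycles Tot D n"
   using module.submoduleE[OF module_Tot tot.cycles_submodule[of n]] less.prems(1) tot.boundary_cycle[OF w']
   by (simp add: y_def a_minus_def)
  have "y \<in> D n ` carrier (Tot (Suc n))"
  proof (rule two_columns_boundary[OF yZ])
   fix p assume p: "2 \<le> p" "p \<le> n"
   interpret Cp: module R "C (n - p)" by (rule module_obj)
   have "D n w' p = x p"
    using fun_cong[OF shD, of "p - 2"] p n by (auto simp: sh_def le_diff_conv numeral_2_eq_2 Suc_diff_le dest: le_Suc_ex)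
   then show "y p = \<zero>[C (n - p)]"
    using p xT Dw Tot_comp[OF xT p(2)] by (simp add: y_def Tot_ops Cp.diff_zero_iff)
  next
   have "\<Psi> n y = \<Psi> n x -[C n] b n (\<Psi> (Suc n) w')"
    using lin_diff[OF \<Psi>_linear module_Tot module_obj xT Dw] b_\<Psi>[OF w'] by (simp add: y_def)
   moreover obtain c where c: "c :[C (Suc n)]" "\<Psi> n x = b n c" using b0 by auto
   interpret CS: module R "C (Suc n)" by (rule module_obj)
   have "b n (c -[C (Suc n)] \<Psi> (Suc n) w') = b n c -[C n] b n (\<Psi> (Suc n) w')"
    using c w' by (intro lin_diff[OF b_linear module_obj module_obj]) auto
   ultimately have "\<Psi> n y = b n (c -[C (Suc n)] \<Psi> (Suc n) w')" using c by simp
   then show "\<Psi> n y \<in> b n ` carrier (C (Suc n))" using c w' by auto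
  qed
  then obtain u where u: "u :[Tot (Suc n)]" "y = D n u" by auto
  interpret TS: module R "Tot (Suc n)" by (rule module_Tot)
  have "D n (u +[Tot (Suc n)] w') = y +[Tot n] D n w'"
   using lin_add[OF D_linear u(1) w'] u(2) by simp
  also have "... = x"
   using xT Dw by (simp add: y_def Tn.minus_eq Tn.a_assoc Tn.l_neg)
  finally show ?thesis using u w' by (metis TS.a_closed imageI)
 qed
qed

text \<open>By induction a cycle \<open>z\<close> realises all prescribed values but the first. It
  is moved two columns to the right, column 1 is filled so that the differential vanishes from there
  on, and column 0 remains free to adjust the value of \<open>\<Psi>\<close>.\<close>

lemma lift_cycles:
 assumes "!!i m. n = m + 2 * i ==> c i \<in> cycles C b m"
 shows "\<exists>x\<in>cycles Tot D n. \<forall>i m. n = m + 2 * i \<longrightarrow> \<Psi> m (sh i m x) = c i"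
 using assms
proof (induction n arbitrary: c rule: less_induct)
 case (less n)
 interpret Cn: module R "C n" by (rule module_obj)
 interpret Tn: module R "Tot n" by (rule module_Tot)
 have c0: "c 0 \<in> cycles C b n" using less.prems[of n 0] by simp
 then have c0c: "c 0 :[C n]" by (simp add: hoch.cycles_iff)
 have "\<exists>x\<in>carrier (Tot n). (\<forall>i m. n = m + 2 * Suc i \<longrightarrow> \<Psi> m (sh (Suc i) m x) = c (Suc i)) \<and>
   (\<forall>l p. n = Suc l \<longrightarrow> 0 < p \<longrightarrow> p \<le> l \<longrightarrow> D l x p = \<zero>[C (l - p)])"
 proof (cases "n < 2")
  case True
  then show ?thesis by (intro bexI[of _ "\<zero>[Tot n]"]) auto
 next
  case False
  then obtain m where n: "n = m + 2 * Suc 0" by (metis le_add_diff_inverse2 not_less mult_2_right One_nat_def mult.right_neutral)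
  have "\<exists>z\<in>cycles Tot D m. \<forall>i l. m = l + 2 * i \<longrightarrow> \<Psi> l (sh i l z) = c (Suc i)"
   using n less.prems[of _ "Suc _"] by (intro less.IH) auto
  then obtain z where z: "z \<in> cycles Tot D m" "!!i l. m = l + 2 * i ==> \<Psi> l (sh i l z) = c (Suc i)" by blast
  have zT: "z :[Tot m]" using z(1) by (simp add: tot.cycles_iff)
  have z0: "z 0 :[C m]" using Tot_comp[OF zT, of 0] by simp
  \<comment> \<open>In column 1 the differential is \<open>- b'\<close> of this entry plus the norm
    of the entry in column 2. The contraction solves this equation because the norm of
    \<open>z 0\<close> is a cycle for \<open>b'\<close>.\<close>
  define x where "x = (\<lambda>p\<in>{..n}. if p = 0 then \<zero>[C n] else if p = Suc 0 then \<sigma> m (N m (z 0)) else z (p - 2))"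
  have \<sigma>c: "\<sigma> m (N m (z 0)) :[C (Suc m)]" using lin_closed[OF \<sigma>_linear] z0 by simp
  have x: "x :[Tot n]"
   unfolding Tot_iff
  proof (intro conjI allI impI)
   fix p assume p: "p \<le> n"
   show "x p :[C (n - p)]"
    using p \<sigma>c Tot_comp[OF zT, of "p - 2"] n by (auto simp: x_def)
  qed (simp add: x_def)
  have shx: "sh (Suc 0) m x = z"
   using zT n by (auto simp: sh_def x_def Tot_iff extensional_def fun_eq_iff)
  have "\<Psi> l (sh (Suc i) l x) = c (Suc i)" if "n = l + 2 * Suc i" for i l
   using z(2)[of l i] shx that n sh_sh[of i l x] by simp
  moreover have "D l x p = \<zero>[C (l - p)]" if l: "n = Suc l" and p: "0 < p" "p \<le> l" for l p
  proof -
   have lm: "l = Suc m" using n l by simp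
   interpret Cp: module R "C (l - p)" by (rule module_obj)
   interpret Cm: module R "C m" by (rule module_obj)
   \<comment> \<open>The first component of \<open>D z = 0\<close> expresses the boundary of
     \<open>z 0\<close> through \<open>1 - t\<close>. Applying \<open>N\<close> kills that term, and
     \<open>N b = b' N\<close> shows that \<open>N (z 0)\<close> is a cycle for
     \<open>b'\<close>.\<close>
   have N0: "b' m (\<sigma> m (N m (z 0))) = N m (z 0)"
   proof (cases m)
    case 0
    then show ?thesis using z0 b'_\<sigma>_0 by simp
   next
    case (Suc k)
    interpret Ck: module R "C k" by (rule module_obj)
    interpret CSk: module R "C (Suc k)" by (rule module_obj)
    have zk: "z 0 :[C (Suc k)]" "z (Suc 0) :[C k]"
     using z0 Tot_comp[OF zT, of "Suc 0"] Suc by auto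
    have "D k z 0 = \<zero>[Tot k] 0" using z(1) Suc by (simp add: tot.cycles_iff)
    then have e: "b k (z 0) +[C k] (z (Suc 0) -[C k] t k (z (Suc 0))) = \<zero>[C k]"
     by (simp add: D_apply Tot_ops vertical_def horizontal_def)
    have "N k (b k (z 0)) +[C k] N k (z (Suc 0) -[C k] t k (z (Suc 0))) = \<zero>[C k]"
     using zk lin_add[OF N_linear, of "b k (z 0)" k "z (Suc 0) -[C k] t k (z (Suc 0))"] e
      lin_zero[OF N_linear module_obj module_obj, of k] by simp
    then have "N k (b k (z 0)) = \<zero>[C k]" using zk by (simp add: N_one_minus_t)
    then have "b' k (N m (z 0)) = \<zero>[C k]" using b'_N[OF zk(1)] Suc by simp
    moreover have "\<sigma> m (N m (z 0)) :[C (Suc (Suc k))]" using \<sigma>c Suc by simp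
    ultimately show ?thesis
     using b'_\<sigma>_Suc[of "N m (z 0)" k] zk Suc lin_zero[OF \<sigma>_linear module_obj module_obj, of k] by simp
   qed
   show ?thesis
   proof (cases "p = Suc 0")
    case True
    have "x (Suc 0) = \<sigma> m (N m (z 0))" "x (Suc (Suc 0)) = z 0" using n by (simp_all add: x_def)
    then show ?thesis
     using True lm p N0 z0 by (simp add: D_apply vertical_def horizontal_def Cm.l_neg)
   next
    case False
    then obtain r where r: "p = Suc (Suc r)" using p by (cases p; cases "p - 1") auto
    then obtain k where k: "m = Suc k" using lm p by (cases m) auto
    have "sh (Suc 0) k (D l x) = \<zero>[Tot k]"
     using D_sh[of k "Suc 0" x] shx z(1) k lm by (simp add: tot.cycles_iff)
    from fun_cong[OF this, of r] show ?thesis using r p lm k by (simp add: sh_def Tot_ops)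
   qed
  qed
  ultimately show ?thesis using x by blast
 qed
 then obtain x where x: "x :[Tot n]"
  "!!i m. n = m + 2 * Suc i ==> \<Psi> m (sh (Suc i) m x) = c (Suc i)"
  "!!l p. [|n = Suc l; 0 < p; p \<le> l|] ==> D l x p = \<zero>[C (l - p)]" by blast
 \<comment> \<open>On elements of column 0 the map \<open>\<Psi>\<close> is the identity, so adding
   this difference there gives the value \<open>c 0\<close>; the shifts by at least two columns do
   not see it.\<close>
 define v where "v = c 0 -[C n] \<Psi> n x"
 have v: "v :[C n]" using c0c x(1) by (simp add: v_def)
 have iv: "inc n 0 v :[Tot n]" using inc_closed[of v n 0] v by simp
 have \<Psi>i: "\<Psi> n (inc n 0 v) = v" using \<Psi>_zero_tail[OF iv] by (simp add: inc_def)
 define y where "y = inc n 0 v +[Tot n] x"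
 have y: "y :[Tot n]" using iv x(1) by (simp add: y_def)
 have "\<Psi> n y = v +[C n] \<Psi> n x"
  using lin_add[OF \<Psi>_linear iv x(1)] \<Psi>i by (simp add: y_def)
 also have "... = c 0"
  using c0c x(1) by (simp add: v_def Cn.minus_eq Cn.a_assoc Cn.l_neg)
 finally have \<Psi>y: "\<Psi> n y = c 0" .
 have "sh (Suc i) m y = sh (Suc i) m x" if n: "n = m + 2 * Suc i" for i m
 proof (rule Tot_eqI)
  show "sh (Suc i) m y :[Tot m]" "sh (Suc i) m x :[Tot m]"
   using sh_closed y x(1) n by auto
  fix p assume p: "p \<le> m"
  interpret Cp: module R "C (m - p)" by (rule module_obj)
  have "x (p + 2 * Suc i) :[C (m - p)]" using Tot_comp[OF x(1), of "p + 2 * Suc i"] n p by simp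
  then show "sh (Suc i) m y p = sh (Suc i) m x p"
   using p n Tot_ops(1)[of "p + 2 * Suc i" n "inc n 0 v" x] by (simp add: sh_def y_def inc_def)
 qed
 then have "\<Psi> m (sh i m y) = c i" if "n = m + 2 * i" for i m
  using that x(2)[of m "i - 1"] \<Psi>y sh_0[OF y] by (cases i) auto
 moreover have "y \<in> cycles Tot D n"
  unfolding tot.cycles_iff
 proof (intro conjI allI impI y)
  fix l assume n: "n = Suc l"
  interpret Cl: module R "C l" by (rule module_obj)
  interpret Tl: module R "Tot l" by (rule module_Tot)
  have vl: "v :[C (Suc l)]" using v n by simp
  have "D l y = D l (inc n 0 v) +[Tot l] D l x"
   using lin_add[OF D_linear] iv x(1) n by (simp add: y_def)
  then have Dy: "D l y = inc l 0 (b l v) +[Tot l] D l x" using D_inc_0[OF vl] n by simp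
  have Dyc: "D l y :[Tot l]" using lin_closed[OF D_linear] y n by simp
  have tail: "D l y p = \<zero>[C (l - p)]" if p: "0 < p" "p \<le> l" for p
  proof -
   interpret Cp: module R "C (l - p)" by (rule module_obj)
   show ?thesis unfolding Dy using p x(3)[OF n p] by (simp add: Tot_ops inc_def)
  qed
  \<comment> \<open>The differential is already concentrated in column 0, where
    \<open>\<Psi>\<close> is the identity. The chain map property then expresses its last entry as
    the boundary of the cycle \<open>c 0\<close>.\<close>
  have "D l y 0 = \<Psi> l (D l y)" using \<Psi>_zero_tail[OF Dyc tail] by simp
  also have "... = b l (c 0)" using b_\<Psi>[of y l] y n \<Psi>y by simp
  also have "... = \<zero>[C l]" using c0 n by (simp add: hoch.cycles_iff)
  finally have D0: "D l y 0 = \<zero>[C l]" .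
  show "D l y = \<zero>[Tot l]"
  proof (rule Tot_eqI[OF Dyc])
   show "D l y p = \<zero>[Tot l] p" if "p \<le> l" for p
    using that D0 tail[of p] by (cases "p = 0") (simp_all add: Tot_ops)
  qed simp
 qed
 ultimately show ?case by blast
qed

text \<open>Component \<open>i\<close> of the isomorphism is the class of \<open>\<Psi>\<close>
  after \<open>i\<close> periodicity operators. Injectivity is \<open>boundary_criterion\<close> and
  surjectivity is \<open>lift_cycles\<close>.\<close>

theorem cyclic_homology_direct_sum:
 "isomorphic_modules R (cyclic_homology X n)
  (direct_sum UNIV (%i. chain_homology C b (int n - 2 * int i)))"
proof -
 let ?L = "%i. chain_homology C b (int n - 2 * int i)"
 let ?S = "direct_sum UNIV ?L"
 have mL: "module R (?L i)" for i
  by (rule module_chain_homology[OF hoch.chain_complex_axioms cring_R])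
 have mS: "module R ?S" by (intro module_direct_sum cring_R mL)
 have Lp: "?L i = chain_homology C b (int m)" if "n = m + 2 * i" for i m
  using that by simp
 have Ln: "?L i = zero_module" if "n < 2 * i" for i
  using that by (simp add: chain_homology_def)
 \<comment> \<open>For \<open>2 * i > n\<close> the summand is the zero module, whose only element
   is \<open>undefined\<close>.\<close>
 define g where "g x i = (if 2 * i \<le> n then hoch.cls (n - 2 * i) (\<Psi> (n - 2 * i) (sh i (n - 2 * i) x)) else undefined)" for x i
 have gl: "(%x. g x i) \<in> lin R (tot.Z n) (?L i)" for i
 proof (cases "2 * i \<le> n")
  case True
  then obtain m where m: "n = m + 2 * i" by (metis le_add_diff_inverse2)
  have "(%x. \<Psi> m (sh i m x)) \<in> lin R (tot.Z n) (hoch.Z m)"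
   using \<Psi>_cycle sh_cycle m sh_closed
   by (intro linear_mapsI)
    (auto simp: tot.cycles_iff lin_add[OF sh_linear] lin_smult[OF sh_linear]
     lin_add[OF \<Psi>_linear] lin_smult[OF \<Psi>_linear])
  from lin_comp[OF this hoch.cls_linear] show ?thesis using m by (simp add: g_def Lp[OF m])
 next
  case False
  then show ?thesis by (auto simp: g_def Ln zero_module_def linear_maps_def)
 qed
 have gz: "g x i = \<zero>[?L i]" if "n < 2 * i" for x i
  using that by (simp add: g_def Ln zero_module_def)
 have gS: "g x :[?S]" if x: "x :[tot.Z n]" for x
 proof -
  have "{i. g x i \<noteq> \<zero>[?L i]} \<subseteq> {..n}"
   using gz[of _ x] by (auto simp: not_le[symmetric])
  then have "finite {i. g x i \<noteq> \<zero>[?L i]}" by (rule finite_subset) simp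
  then show ?thesis using lin_closed[OF gl x] by (simp add: dsum_simps(1) PiE_iff)
 qed
 have iff: "g x = \<zero>[?S] \<longleftrightarrow> x \<in> D n ` carrier (Tot (Suc n))" if x: "x \<in> cycles Tot D n" for x
 proof
  assume g0: "g x = \<zero>[?S]"
  show "x \<in> D n ` carrier (Tot (Suc n))"
  proof (rule boundary_criterion[OF x])
   fix i m assume m: "n = m + 2 * i"
   have "hoch.cls m (\<Psi> m (sh i m x)) = \<zero>[chain_homology C b (int m)]"
    using fun_cong[OF g0, of i] m by (simp add: g_def dsum_simps(2))
   then show "\<Psi> m (sh i m x) \<in> b m ` carrier (C (Suc m))"
    using hoch.cls_zero_iff \<Psi>_cycle sh_cycle x m by blast
  qed
 next
  assume "x \<in> D n ` carrier (Tot (Suc n))"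
  then obtain w where w: "w :[Tot (Suc n)]" "x = D n w" by auto
  show "g x = \<zero>[?S]"
  proof
   fix i
   show "g x i = \<zero>[?S] i"
   proof (cases "2 * i \<le> n")
    case False
    then show ?thesis using gz[of i x] by (simp add: dsum_simps(2))
   next
    case True
    then obtain m where m: "n = m + 2 * i" by (metis le_add_diff_inverse2)
    have shw: "sh i (Suc m) w :[Tot (Suc m)]" using sh_closed[of w "Suc m" i] w m by simp
    have "\<Psi> m (sh i m x) = b m (\<Psi> (Suc m) (sh i (Suc m) w))"
     using D_sh[of m i w] b_\<Psi>[OF shw] w m by simp
    then have "\<Psi> m (sh i m x) \<in> b m ` carrier (C (Suc m))" using shw by auto
    then have "hoch.cls m (\<Psi> m (sh i m x)) = \<zero>[chain_homology C b (int m)]"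
     using hoch.cls_zero_iff \<Psi>_cycle sh_cycle x m by blast
    then show ?thesis using m by (simp add: g_def dsum_simps(2))
   qed
  qed
 qed
 have onto: "\<exists>x\<in>cycles Tot D n. g x = y" if y: "y :[?S]" for y
 proof -
  have "\<exists>c. n = m + 2 * i \<longrightarrow> c \<in> cycles C b m \<and> hoch.cls m c = y i" for i m
  proof (cases "n = m + 2 * i")
   case True
   have "y i :[?L i]" using y by (auto simp: dsum_simps(1))
   then have "y i \<in> hoch.cls m ` carrier (hoch.Z m)" unfolding Lp[OF True] hoch.cls_surj .
   then show ?thesis by auto
  qed simp
  then have "\<forall>i. \<exists>c. \<forall>m. n = m + 2 * i \<longrightarrow> c \<in> cycles C b m \<and> hoch.cls m c = y i"
   by (metis add_right_cancel)
  then obtain c where c: "!!i m. n = m + 2 * i ==> c i \<in> cycles C b m \<and> hoch.cls m (c i) = y i" by metis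
  obtain x where x: "x \<in> cycles Tot D n" "!!i m. n = m + 2 * i ==> \<Psi> m (sh i m x) = c i"
   using lift_cycles[of n c] c by blast
  have "g x i = y i" for i
  proof (cases "2 * i \<le> n")
   case True
   then obtain m where m: "n = m + 2 * i" by (metis le_add_diff_inverse2)
   then show ?thesis using x(2)[OF m] c[OF m] by (simp add: g_def)
  next
   case False
   have "y i :[?L i]" using y by (auto simp: dsum_simps(1))
   then show ?thesis using False Ln[of i] by (simp add: g_def zero_module_def)
  qed
  then show ?thesis using x(1) by auto
 qed
 have "isomorphic_modules R (chain_homology Tot D (int n)) ?S"
 \<comment> \<open>The relation is the graph of \<open>g\<close> on the cycles.\<close>
 proof (rule isomorphic_by_relation[OF tot.module_Z mS tot.module_homology mS tot.cls_linear tot.cls_surj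
    lin_id image_ident, of "%x y. x \<in> cycles Tot D n \<and> y = g x"])
  show "x :[tot.Z n] \<and> y :[?S]" if "x \<in> cycles Tot D n \<and> y = g x" for x y
   using that gS[of x] by simp
  show "\<exists>y. x \<in> cycles Tot D n \<and> y = g x" if "x :[tot.Z n]" for x using that by simp
  show "\<exists>x. x \<in> cycles Tot D n \<and> y = g x" if "y :[?S]" for y using onto[OF that] by blast
  show "x +[tot.Z n] x' \<in> cycles Tot D n \<and> y +[?S] y' = g (x +[tot.Z n] x')"
   if "x \<in> cycles Tot D n \<and> y = g x" "x' \<in> cycles Tot D n \<and> y' = g x'" for x y x' y'
  proof
   show "x +[tot.Z n] x' \<in> cycles Tot D n"
    using module.submoduleE(5)[OF module_Tot tot.cycles_submodule] that by simp
   have "g (x +[tot.Z n] x') i = g x i +[?L i] g x' i" for i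
    using lin_add[OF gl, of x x' i] that by simp
   then show "y +[?S] y' = g (x +[tot.Z n] x')"
    using that by (auto simp: dsum_simps(3) fun_eq_iff)
  qed
  show "r *[tot.Z n] x \<in> cycles Tot D n \<and> r *[?S] y = g (r *[tot.Z n] x)"
   if "r :[R]" "x \<in> cycles Tot D n \<and> y = g x" for r x y
  proof
   show "r *[tot.Z n] x \<in> cycles Tot D n"
    using module.submoduleE(4)[OF module_Tot tot.cycles_submodule] that by simp
   have "g (r *[tot.Z n] x) i = r *[?L i] g x i" for i
    using lin_smult[OF gl, of r x i] that by simp
   then show "r *[?S] y = g (r *[tot.Z n] x)"
    using that by (auto simp: dsum_simps(4) fun_eq_iff)
  qed
  show "tot.cls n x = \<zero>[chain_homology Tot D (int n)] \<longleftrightarrow> y = \<zero>[?S]" if "x \<in> cycles Tot D n \<and> y = g x" for x y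
   using that iff[of x] tot.cls_zero_iff[of x n] by simp
 qed
 then show ?thesis unfolding cyclic_homology_def .
qed

end

section \<open>Double complexes\<close>

lemma (in abelian_group) diff_eq_iff:
 "[|x :[G]; y :[G]; z :[G]|] ==> x \<ominus> y = z \<longleftrightarrow> x = y \<oplus> z"
 using r_neg1[of y z] r_neg1[of "\<ominus> y" x] by (auto simp: minus_eq a_comm[of _ "\<ominus> y"])

text \<open>For each \<open>p\<close> the complex \<open>A p\<close> with differential
  \<open>\<delta>\<close> resolves \<open>B p\<close> via \<open>\<alpha>\<close>. The two
  differentials commute rather than anticommute, so that transposing the double complex introduces
  no signs.\<close>

locale row_resolution =
 fixes R :: "('k, 'r) ring_scheme" and A :: "nat => nat => ('k, 'a, 'm) module_scheme"
  and \<eta> \<delta> :: "nat => nat => 'a => 'a"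
  and B :: "nat => ('k, 'b, 'n) module_scheme" and e :: "nat => 'b => 'b" and \<alpha> :: "nat => 'a => 'b"
 assumes module_A: "module R (A p q)" and module_B: "module R (B p)"
  and \<eta>_linear: "\<eta> p q \<in> lin R (A (Suc p) q) (A p q)"
  and \<delta>_linear: "\<delta> p q \<in> lin R (A p (Suc q)) (A p q)"
  and \<alpha>_linear: "\<alpha> p \<in> lin R (A p 0) (B p)"
  and \<eta>_\<eta>: "x :[A (Suc (Suc p)) q] ==> \<eta> p q (\<eta> (Suc p) q x) = \<zero>[A p q]"
  and \<eta>_\<delta>: "x :[A (Suc p) (Suc q)] ==> \<eta> p q (\<delta> (Suc p) q x) = \<delta> p q (\<eta> p (Suc q) x)"
  and \<alpha>_\<eta>: "x :[A (Suc p) 0] ==> \<alpha> p (\<eta> p 0 x) = e p (\<alpha> (Suc p) x)"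
  and \<alpha>_surj: "y :[B p] ==> \<exists>x\<in>carrier (A p 0). \<alpha> p x = y"
  and \<alpha>_\<delta>: "x :[A p (Suc 0)] ==> \<alpha> p (\<delta> p 0 x) = \<zero>[B p]"
  and exact_0: "[|x :[A p 0]; \<alpha> p x = \<zero>[B p]|] ==> \<exists>y\<in>carrier (A p (Suc 0)). x = \<delta> p 0 y"
  and exact_Suc: "[|x :[A p (Suc q)]; \<delta> p q x = \<zero>[A p q]|] ==>
   \<exists>y\<in>carrier (A p (Suc (Suc q))). x = \<delta> p (Suc q) y"

text \<open>Up to signs a cycle of the total complex: an antidiagonal whose neighbouring entries
  have the same image. Its two end entries map to cycles of the two augmentation complexes.\<close>

definition zigzag ::
 "(nat => nat => ('k, 'a, 'm) module_scheme) => (nat => nat => 'a => 'a) => (nat => nat => 'a => 'a) =>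
 nat => (nat => nat => 'a) => bool"
 where "zigzag A \<eta> \<delta> n z \<longleftrightarrow> (\<forall>p q. p + q = n \<longrightarrow> z p q :[A p q]) \<and>
  (\<forall>p q. Suc (p + q) = n \<longrightarrow> \<eta> p q (z (Suc p) q) = \<delta> p q (z p (Suc q)))"

lemma zigzag_transpose: "zigzag (%p q. A q p) (%p q. \<delta> q p) (%p q. \<eta> q p) n (%p q. z q p) \<longleftrightarrow> zigzag A \<eta> \<delta> n z"
 unfolding zigzag_def by (auto simp: add.commute)

context row_resolution
begin

text \<open>Dependent choice along the antidiagonal, from the augmented end \<open>q = 0\<close> to
  the end \<open>p = 0\<close>.\<close>

lemma zigzag_exists:
 assumes b: "b :[B n]" "!!m. n = Suc m ==> e m b = \<zero>[B m]"
 shows "\<exists>z. zigzag A \<eta> \<delta> n z \<and> \<alpha> n (z n 0) = b"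
proof -
 \<comment> \<open>The invariant includes that the next entry can be found. For \<open>q > n\<close>
   it is vacuous, so that the sequence continues formally beyond the antidiagonal.\<close>
 define P where "P q x \<longleftrightarrow> (\<forall>p. p + q = n \<longrightarrow> x :[A p q] \<and> (q = 0 \<longrightarrow> \<alpha> n x = b) \<and>
  (\<forall>p'. p = Suc p' \<longrightarrow> (\<exists>y\<in>carrier (A p' (Suc q)). \<eta> p' q x = \<delta> p' q y)))" for q x
 define Q where "Q q x y \<longleftrightarrow> (\<forall>p. Suc (p + q) = n \<longrightarrow> \<eta> p q x = \<delta> p q y)" for q x y
 have "\<exists>x. P 0 x"
 proof -
  obtain x where x: "x :[A n 0]" "\<alpha> n x = b" using \<alpha>_surj[OF b(1)] by blast
  have "\<exists>y\<in>carrier (A m (Suc 0)). \<eta> m 0 x = \<delta> m 0 y" if n: "n = Suc m" for m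
   using x b(2)[OF n] \<alpha>_\<eta>[of x m] lin_closed[OF \<eta>_linear, of x m 0] n by (intro exact_0) auto
  then show ?thesis using x unfolding P_def by auto
 qed
 moreover have "\<exists>y. P (Suc q) y \<and> Q q x y" if Px: "P q x" for q x
 proof (cases "\<exists>p. Suc (p + q) = n")
  case False
  then show ?thesis by (intro exI[of _ x]) (auto simp: P_def Q_def)
 next
  case True
  then obtain p where p: "Suc (p + q) = n" by blast
  obtain y where y: "y :[A p (Suc q)]" "\<eta> p q x = \<delta> p q y"
   using Px p unfolding P_def by force
  have "\<exists>v\<in>carrier (A m (Suc (Suc q))). \<eta> m (Suc q) y = \<delta> m (Suc q) v" if m: "p = Suc m" for m
  proof (rule exact_Suc)
   have y': "y :[A (Suc m) (Suc q)]" using y(1) m by simp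
   show "\<eta> m (Suc q) y :[A m (Suc q)]" by (rule lin_closed[OF \<eta>_linear y'])
   have "x :[A (Suc (Suc m)) q]" using Px p m by (simp add: P_def)
   then show "\<delta> m q (\<eta> m (Suc q) y) = \<zero>[A m q]"
    using \<eta>_\<delta>[OF y'] y(2) m \<eta>_\<eta>[of x m q] by simp
  qed
  then have "P (Suc q) y" using y(1) p unfolding P_def by auto
  moreover have "Q q x y" using y(2) p unfolding Q_def by auto
  ultimately show ?thesis by blast
 qed
 ultimately obtain f where f: "!!q. P q (f q) \<and> Q q (f q) (f (Suc q))"
  using dependent_nat_choice[of P Q] by blast
 have "zigzag A \<eta> \<delta> n (%p q. f q)" using f unfolding zigzag_def P_def Q_def by blast
 moreover have "\<alpha> n (f 0) = b" using f[of 0] unfolding P_def by auto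
 ultimately show ?thesis by (intro exI[of _ "%p q. f q"]) simp
qed

text \<open>If the class at one end is a boundary, the whole zigzag is, up to signs, a total
  boundary. Only what this says about the entry at the other end is recorded, because that is what
  the opposite augmentation sees.\<close>

lemma zigzag_boundary:
 assumes z: "zigzag A \<eta> \<delta> n z" and u: "u :[B (Suc n)]" "\<alpha> n (z n 0) = e n u"
 shows "\<exists>v\<in>carrier (A (Suc 0) n). \<exists>w\<in>carrier (A 0 (Suc n)). z 0 n = \<eta> 0 n v +[A 0 n] \<delta> 0 n w"
proof -
 \<comment> \<open>Here \<open>x\<close> and the existentially quantified \<open>y\<close> are
   consecutive entries of a bounding antidiagonal of degree \<open>n + 1\<close>; each step of the
   induction passes from \<open>x\<close> to \<open>y\<close>.\<close>
 define P where "P q x \<longleftrightarrow> (\<forall>p. p + q = n \<longrightarrow> x :[A (Suc p) q] \<and>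
  (\<exists>y\<in>carrier (A p (Suc q)). z p q = \<eta> p q x +[A p q] \<delta> p q y))" for q x
 have zc: "z p q :[A p q]" if "p + q = n" for p q using z that by (simp add: zigzag_def)
 have "\<exists>x. P q x" if "q \<le> n" for q
  using that
 proof (induction q)
  case 0
  interpret A: module R "A n 0" by (rule module_A)
  interpret B: module R "B n" by (rule module_B)
  obtain x where x: "x :[A (Suc n) 0]" "\<alpha> (Suc n) x = u" using \<alpha>_surj[OF u(1)] by blast
  have d: "\<eta> n 0 x :[A n 0]" by (rule lin_closed[OF \<eta>_linear x(1)])
  have "\<alpha> n (z n 0 -[A n 0] \<eta> n 0 x) = \<zero>[B n]"
   using lin_diff[OF \<alpha>_linear module_A module_B zc d] \<alpha>_\<eta>[OF x(1)] x u(2)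
    lin_closed[OF \<alpha>_linear zc, of n] by (simp add: B.diff_zero_iff)
  from exact_0[OF _ this] obtain y where y: "y :[A n (Suc 0)]" "z n 0 -[A n 0] \<eta> n 0 x = \<delta> n 0 y"
   using zc[of n 0] d by auto
  then have "z n 0 = \<eta> n 0 x +[A n 0] \<delta> n 0 y"
   using zc[of n 0] d lin_closed[OF \<delta>_linear y(1)] by (simp add: A.diff_eq_iff)
  then show ?case using x(1) y(1) unfolding P_def by auto
 next
  case (Suc q)
  then obtain x where Px: "P q x" by auto
  obtain p where p: "n = Suc p + q" using Suc.prems by (metis add_Suc_right add.commute le_Suc_ex)
  interpret A: module R "A p (Suc q)" by (rule module_A)
  interpret A': module R "A p q" by (rule module_A)
  obtain y where y: "y :[A (Suc p) (Suc q)]" "z (Suc p) q = \<eta> (Suc p) q x +[A (Suc p) q] \<delta> (Suc p) q y"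
   and x: "x :[A (Suc (Suc p)) q]" using Px p unfolding P_def by blast
  have d: "\<eta> p (Suc q) y :[A p (Suc q)]" by (rule lin_closed[OF \<eta>_linear y(1)])
  have zz: "z p (Suc q) :[A p (Suc q)]" using zc p by simp
  have "\<delta> p q (z p (Suc q)) = \<eta> p q (z (Suc p) q)" using z p by (simp add: zigzag_def)
  also have "... = \<delta> p q (\<eta> p (Suc q) y)"
   using lin_add[OF \<eta>_linear lin_closed[OF \<eta>_linear x] lin_closed[OF \<delta>_linear y(1)]]
    \<eta>_\<eta>[OF x] \<eta>_\<delta>[OF y(1)] lin_closed[OF \<delta>_linear d] by (simp add: y(2))
  finally have "\<delta> p q (z p (Suc q) -[A p (Suc q)] \<eta> p (Suc q) y) = \<zero>[A p q]"
   using lin_diff[OF \<delta>_linear module_A module_A zz d] lin_closed[OF \<delta>_linear d]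
   by (simp add: A'.diff_zero_iff)
  from exact_Suc[OF _ this] obtain v where v: "v :[A p (Suc (Suc q))]"
   "z p (Suc q) -[A p (Suc q)] \<eta> p (Suc q) y = \<delta> p (Suc q) v" using zz d by auto
  then have "z p (Suc q) = \<eta> p (Suc q) y +[A p (Suc q)] \<delta> p (Suc q) v"
   using zz d lin_closed[OF \<delta>_linear v(1)] by (simp add: A.diff_eq_iff)
  then show ?case using y(1) v(1) p unfolding P_def by auto
 qed
 from this[of n] obtain x where "P n x" by auto
 then show ?thesis unfolding P_def by auto
qed

end

text \<open>Both ways round a double complex with exact rows and columns: its zigzags are a linear relation
 between the cycles of the two augmentation complexes that matches the boundaries.\<close>

theorem double_complex_homology:
 assumes row: "row_resolution R A \<eta> \<delta> B e \<alpha>"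
  and col: "row_resolution R (%p q. A q p) (%p q. \<delta> q p) (%p q. \<eta> q p) C e' \<gamma>"
  and "chain_complex R B e" "chain_complex R C e'"
 shows "isomorphic_modules R (chain_homology B e (int n)) (chain_homology C e' (int n))"
proof -
 interpret r: row_resolution R A \<eta> \<delta> B e \<alpha> by fact
 interpret c: row_resolution R "%p q. A q p" "%p q. \<delta> q p" "%p q. \<eta> q p" C e' \<gamma> by fact
 interpret B: chain_complex R B e by fact
 interpret C: chain_complex R C e' by fact
 have cyc1: "\<alpha> n (z n 0) \<in> cycles B e n" if z: "zigzag A \<eta> \<delta> n z" for z
  unfolding B.cycles_iff
 proof (intro conjI allI impI)
  show "\<alpha> n (z n 0) :[B n]" using z by (intro lin_closed[OF r.\<alpha>_linear]) (simp add: zigzag_def)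
  fix m assume n: "n = Suc m"
  have zc: "z (Suc m) 0 :[A (Suc m) 0]" "z m (Suc 0) :[A m (Suc 0)]"
   "\<eta> m 0 (z (Suc m) 0) = \<delta> m 0 (z m (Suc 0))" using z n by (simp_all add: zigzag_def)
  show "e m (\<alpha> n (z n 0)) = \<zero>[B m]" using r.\<alpha>_\<eta>[OF zc(1)] r.\<alpha>_\<delta>[OF zc(2)] zc(3) n by simp
 qed
 have cyc2: "\<gamma> n (z 0 n) \<in> cycles C e' n" if z: "zigzag A \<eta> \<delta> n z" for z
  unfolding C.cycles_iff
 proof (intro conjI allI impI)
  show "\<gamma> n (z 0 n) :[C n]" using z by (intro lin_closed[OF c.\<alpha>_linear]) (simp add: zigzag_def)
  fix m assume n: "n = Suc m"
  have zc: "z 0 (Suc m) :[A 0 (Suc m)]" "z (Suc 0) m :[A (Suc 0) m]"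
   "\<eta> 0 m (z (Suc 0) m) = \<delta> 0 m (z 0 (Suc m))" using z n by (simp_all add: zigzag_def)
  show "e' m (\<gamma> n (z 0 n)) = \<zero>[C m]" using c.\<alpha>_\<eta>[OF zc(1)] c.\<alpha>_\<delta>[OF zc(2)] zc(3) n by simp
 qed
 have bd1: "\<gamma> n (z 0 n) \<in> e' n ` carrier (C (Suc n))"
  if z: "zigzag A \<eta> \<delta> n z" and bd: "\<alpha> n (z n 0) \<in> e n ` carrier (B (Suc n))" for z
 proof -
  interpret Cn: module R "C n" by (rule C.module_C)
  obtain v w where vw: "v :[A (Suc 0) n]" "w :[A 0 (Suc n)]"
   "z 0 n = \<eta> 0 n v +[A 0 n] \<delta> 0 n w" using r.zigzag_boundary[OF z] bd by blast
  have g: "\<gamma> (Suc n) w :[C (Suc n)]" by (rule lin_closed[OF c.\<alpha>_linear vw(2)])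
  have "\<gamma> n (z 0 n) = e' n (\<gamma> (Suc n) w)"
   using lin_add[OF c.\<alpha>_linear lin_closed[OF r.\<eta>_linear vw(1)] lin_closed[OF r.\<delta>_linear vw(2)]]
    c.\<alpha>_\<delta>[OF vw(1)] c.\<alpha>_\<eta>[OF vw(2)] lin_closed[OF c.\<alpha>_linear lin_closed[OF r.\<delta>_linear vw(2)]] vw(3)
   by simp
  then show ?thesis using g by auto
 qed
 have bd2: "\<alpha> n (z n 0) \<in> e n ` carrier (B (Suc n))"
  if z: "zigzag A \<eta> \<delta> n z" and bd: "\<gamma> n (z 0 n) \<in> e' n ` carrier (C (Suc n))" for z
 proof -
  interpret Bn: module R "B n" by (rule B.module_C)
  have z': "zigzag (%p q. A q p) (%p q. \<delta> q p) (%p q. \<eta> q p) n (%p q. z q p)"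
   using z by (subst zigzag_transpose)
  obtain v w where vw: "v :[A n (Suc 0)]" "w :[A (Suc n) 0]"
   "z n 0 = \<delta> n 0 v +[A n 0] \<eta> n 0 w" using c.zigzag_boundary[OF z'] bd by blast
  have g: "\<alpha> (Suc n) w :[B (Suc n)]" by (rule lin_closed[OF r.\<alpha>_linear vw(2)])
  have "\<alpha> n (z n 0) = e n (\<alpha> (Suc n) w)"
   using lin_add[OF r.\<alpha>_linear lin_closed[OF r.\<delta>_linear vw(1)] lin_closed[OF r.\<eta>_linear vw(2)]]
    r.\<alpha>_\<delta>[OF vw(1)] r.\<alpha>_\<eta>[OF vw(2)] lin_closed[OF r.\<alpha>_linear lin_closed[OF r.\<eta>_linear vw(2)]] vw(3)
   by simp
  then show ?thesis using g by auto
 qed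
 let ?G = "%x y. \<exists>z. zigzag A \<eta> \<delta> n z \<and> x = \<alpha> n (z n 0) \<and> y = \<gamma> n (z 0 n)"
 show ?thesis
 proof (rule isomorphic_by_relation[OF B.module_Z C.module_Z B.module_homology C.module_homology
    B.cls_linear B.cls_surj C.cls_linear C.cls_surj, where G = ?G])
  show "x :[B.Z n] \<and> y :[C.Z n]" if "?G x y" for x y using that cyc1 cyc2 by auto
  show "\<exists>y. ?G x y" if "x :[B.Z n]" for x
   using r.zigzag_exists[of x n] that by (auto simp: B.cycles_iff)
  show "\<exists>x. ?G x y" if "y :[C.Z n]" for y
  proof -
   have "y :[C n]" "!!m. n = Suc m ==> e' m y = \<zero>[C m]"
    using that by (auto simp: C.cycles_iff)
   then obtain z where z: "zigzag (%p q. A q p) (%p q. \<delta> q p) (%p q. \<eta> q p) n z" "\<gamma> n (z n 0) = y"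
    using c.zigzag_exists by blast
   have "zigzag A \<eta> \<delta> n (%p q. z q p)"
    using z(1) by (subst zigzag_transpose[symmetric])
   then show ?thesis using z(2) by blast
  qed
  show "?G (x +[B.Z n] x') (y +[C.Z n] y')" if G: "?G x y" and G': "?G x' y'" for x y x' y'
  proof -
   obtain z where z: "zigzag A \<eta> \<delta> n z" "x = \<alpha> n (z n 0)" "y = \<gamma> n (z 0 n)" using G by blast
   obtain z' where z': "zigzag A \<eta> \<delta> n z'" "x' = \<alpha> n (z' n 0)" "y' = \<gamma> n (z' 0 n)" using G' by blast
   define w where "w = (%p q. z p q +[A p q] z' p q)"
   have c: "z p q :[A p q]" "z' p q :[A p q]" if "p + q = n" for p q
    using z(1) z'(1) that by (simp_all add: zigzag_def)
   have "zigzag A \<eta> \<delta> n w"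
    unfolding zigzag_def
   proof (intro conjI allI impI)
    fix p q assume pq: "p + q = n"
    interpret Apq: module R "A p q" by (rule r.module_A)
    show "w p q :[A p q]" using c[OF pq] by (simp add: w_def)
   next
    fix p q assume pq: "Suc (p + q) = n"
    show "\<eta> p q (w (Suc p) q) = \<delta> p q (w p (Suc q))"
     using pq c[of "Suc p" q] c[of p "Suc q"] z(1) z'(1)
     by (simp add: w_def lin_add[OF r.\<eta>_linear] lin_add[OF r.\<delta>_linear] zigzag_def)
   qed
   moreover have "\<alpha> n (w n 0) = x +[B.Z n] x'" "\<gamma> n (w 0 n) = y +[C.Z n] y'"
    using c[of n 0] c[of 0 n] z z' by (simp_all add: w_def lin_add[OF r.\<alpha>_linear] lin_add[OF c.\<alpha>_linear])
   ultimately show ?thesis by (intro exI[of _ w]) simp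
  qed
  show "?G (s *[B.Z n] x) (s *[C.Z n] y)" if s: "s :[R]" and G: "?G x y" for s x y
  proof -
   obtain z where z: "zigzag A \<eta> \<delta> n z" "x = \<alpha> n (z n 0)" "y = \<gamma> n (z 0 n)" using G by blast
   define w where "w = (%p q. s *[A p q] z p q)"
   have c: "z p q :[A p q]" if "p + q = n" for p q
    using z(1) that by (simp add: zigzag_def)
   have "zigzag A \<eta> \<delta> n w"
    unfolding zigzag_def
   proof (intro conjI allI impI)
    fix p q assume pq: "p + q = n"
    interpret Apq: module R "A p q" by (rule r.module_A)
    show "w p q :[A p q]" using c[OF pq] s by (simp add: w_def)
   next
    fix p q assume pq: "Suc (p + q) = n"
    show "\<eta> p q (w (Suc p) q) = \<delta> p q (w p (Suc q))"
     using pq c[of "Suc p" q] c[of p "Suc q"] z(1) s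
     by (simp add: w_def lin_smult[OF r.\<eta>_linear] lin_smult[OF r.\<delta>_linear] zigzag_def)
   qed
   moreover have "\<alpha> n (w n 0) = s *[B.Z n] x" "\<gamma> n (w 0 n) = s *[C.Z n] y"
    using c[of n 0] c[of 0 n] z s by (simp_all add: w_def lin_smult[OF r.\<alpha>_linear] lin_smult[OF c.\<alpha>_linear])
   ultimately show ?thesis by (intro exI[of _ w]) simp
  qed
  show "B.cls n x = \<zero>[chain_homology B e (int n)] \<longleftrightarrow> C.cls n y = \<zero>[chain_homology C e' (int n)]"
   if G: "?G x y" for x y
  proof -
   obtain z where z: "zigzag A \<eta> \<delta> n z" "x = \<alpha> n (z n 0)" "y = \<gamma> n (z 0 n)" using G by blast
   show ?thesis
    unfolding z(2,3) B.cls_zero_iff[OF cyc1[OF z(1)]] C.cls_zero_iff[OF cyc2[OF z(1)]]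
    using bd1[OF z(1)] bd2[OF z(1)] by blast
  qed
 qed
qed

text \<open>An abstraction of the bar complex of \<open>H\<close> with coefficients in the left module \<open>V 0\<close>; \<open>V n\<close>
 plays the role of \<open>H\<^sup>\<otimes>\<^sup>n \<otimes> V 0\<close>, and the augmentation \<open>\<epsilon>\<close> is the right coefficient module.\<close>

locale bar_tower = hopf_algebra R H \<Delta> \<epsilon> S
 for R :: "('k, 'r) ring_scheme" and H :: "('k, 'h, 'm) module_scheme"
  and \<Delta> :: "'h => ('h list => 'k) set" and \<epsilon> :: "'h => 'k" and S :: "'h => 'h" +
 fixes V :: "nat => ('k, 'v) module" and c :: "nat => 'h => 'v => 'v" and a0 :: "'h => 'v => 'v"
 assumes V_tensor: "is_tensor R H (V n) (V (Suc n)) (c n)"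
  and V_0: "left_module R H (V 0) a0"
begin

section \<open>The bar complex of a tower\<close>

lemma module_V [simp]: "module R (V n)" using V_tensor by (simp add: is_tensor_def)

lemma c_bilinear: "bilinear R H (V n) (V (Suc n)) (c n)" using V_tensor by (simp add: is_tensor_def)

lemma c_closed [simp]: "[|h :[H]; v :[V n]|] ==> c n h v :[V (Suc n)]"
 by (rule bilinear_closed[OF c_bilinear])

abbreviation lift where "lift n L \<beta> \<equiv> tensor_lift R H (V n) (V (Suc n)) (c n) L \<beta>"

lemmas lift_linear = tensor_lift_linear[OF V_tensor]
lemmas lift_c = tensor_lift_cons[OF V_tensor]
lemmas c_lin = bilinear_comp_right[OF c_bilinear] bilinear_comp_left[OF c_bilinear]
lemmas c_diff = lin_diff[OF bilinear_right[OF c_bilinear] module_V module_V]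
lemmas c_neg = lin_neg[OF bilinear_right[OF c_bilinear] module_V module_V]
lemmas c_add = lin_add[OF bilinear_right[OF c_bilinear]]
lemmas c_zero = lin_zero[OF bilinear_right[OF c_bilinear] module_V module_V]

lemma V_eqI:
 assumes "x :[V (Suc n)]" "f \<in> lin R (V (Suc n)) (V m)" "g \<in> lin R (V (Suc n)) (V m)"
  "!!h v. [|h :[H]; v :[V n]|] ==> f (c n h v) = g (c n h v)"
 shows "f x = g x"
 by (rule is_tensor_eq[OF V_tensor module_V assms(2-4,1)])

lemma a0_bilinear: "bilinear R H (V 0) (V 0) a0"
 using left_module.act_linear[OF V_0] left_module.act_linear_left[OF V_0] by (intro bilinearI)

text \<open>At the bottom this is the given action on the coefficients; above it only the leading
  factor is multiplied, in contrast to the diagonal action \<open>act\<close>.\<close>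

primrec a :: "nat => 'h => 'v => 'v"
 where "a 0 = a0"
 | "a (Suc n) = (%h. lift n (V (Suc n)) (%g v. c n (h **[H] g) v))"

declare a.simps [simp del]

lemma a_bilinear: "bilinear R H (V n) (V n) (a n)"
proof (cases n)
 case 0
 then show ?thesis by (simp add: a.simps a0_bilinear)
next
 case (Suc m)
 show ?thesis
  unfolding Suc a.simps
  by (intro tensor_lift_bilinear[OF V_tensor] bilinearI c_lin mult_linear_left mult_linear_right lin_id) simp_all
qed

lemma a_closed [simp]: "[|h :[H]; v :[V n]|] ==> a n h v :[V n]"
 by (rule bilinear_closed[OF a_bilinear])

lemma a_c: "[|h :[H]; g :[H]; v :[V n]|] ==> a (Suc n) h (c n g v) = c n (h **[H] g) v"
 unfolding a.simps
 by (subst lift_c) (intro bilinearI c_lin mult_linear_right lin_id | simp)+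

lemmas a_lin = bilinear_comp_right[OF a_bilinear] bilinear_comp_left[OF a_bilinear]
lemmas a_diff = lin_diff[OF bilinear_right[OF a_bilinear] module_V module_V]
lemmas a_neg = lin_neg[OF bilinear_right[OF a_bilinear] module_V module_V]

lemma a_mult:
 assumes "g :[H]" "h :[H]" "v :[V n]"
 shows "a n g (a n h v) = a n (g **[H] h) v"
proof (cases n)
 case 0
 then show ?thesis using left_module.act_mult[OF V_0] assms by (simp add: a.simps)
next
 case (Suc m)
 show ?thesis
  unfolding Suc
  by (rule V_eqI[OF _ lin_comp[OF bilinear_right[OF a_bilinear] bilinear_right[OF a_bilinear]] bilinear_right[OF a_bilinear]])
   (use assms Suc in "simp_all add: a_c m_assoc")
qed

text \<open>The alternating sum of all bar faces except the one that applies the augmentation.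
  Unwinding the recursion multiplies neighbouring factors and finally lets the last factor act on
  the coefficients.\<close>

primrec \<beta> :: "nat => 'v => 'v"
 where "\<beta> 0 = lift 0 (V 0) a0"
 | "\<beta> (Suc n) = lift (Suc n) (V (Suc n)) (%h v. a (Suc n) h v -[V (Suc n)] c n h (\<beta> n v))"

declare \<beta>.simps [simp del]

lemma \<beta>_linear: "\<beta> n \<in> lin R (V (Suc n)) (V n)"
proof (induction n)
 case 0
 show ?case unfolding \<beta>.simps by (rule lift_linear[OF module_V a0_bilinear])
next
 case (Suc n)
 note [simp] = lin_closed[OF Suc]
 show ?case
  unfolding \<beta>.simps
  by (intro lift_linear module_V bilinearI lin_map_diff c_lin a_lin lin_id Suc) simp_all
qed

lemma \<beta>_closed [simp]: "v :[V (Suc n)] ==> \<beta> n v :[V n]"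
 by (rule lin_closed[OF \<beta>_linear])

lemma \<beta>_c_0: "[|h :[H]; v :[V 0]|] ==> \<beta> 0 (c 0 h v) = a 0 h v"
 by (simp add: a.simps \<beta>.simps lift_c[OF module_V a0_bilinear])

lemma \<beta>_c_Suc: "[|h :[H]; v :[V (Suc n)]|] ==>
 \<beta> (Suc n) (c (Suc n) h v) = a (Suc n) h v -[V (Suc n)] c n h (\<beta> n v)"
 unfolding \<beta>.simps
 by (subst lift_c) (intro bilinearI lin_map_diff c_lin a_lin lin_id \<beta>_linear module_V module_H | simp)+

definition \<theta> :: "nat => 'v => 'v" where "\<theta> n = lift n (V n) (%h v. \<epsilon> h *[V n] v)"

lemma \<epsilon>_bilinear: "bilinear R H (V n) (V n) (%h v. \<epsilon> h *[V n] v)"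
 by (intro bilinearI linear_map_smult smult_eps_linear lin_id) simp_all

lemma \<theta>_linear: "\<theta> n \<in> lin R (V (Suc n)) (V n)"
 unfolding \<theta>_def by (rule lift_linear[OF module_V \<epsilon>_bilinear])

lemma \<theta>_closed [simp]: "v :[V (Suc n)] ==> \<theta> n v :[V n]"
 by (rule lin_closed[OF \<theta>_linear])

lemma \<theta>_c [simp]: "[|h :[H]; v :[V n]|] ==> \<theta> n (c n h v) = \<epsilon> h *[V n] v"
 unfolding \<theta>_def by (rule lift_c[OF module_V \<epsilon>_bilinear])

lemmas \<beta>_ops = lin_diff[OF \<beta>_linear module_V module_V] lin_add[OF \<beta>_linear]
 lin_neg[OF \<beta>_linear module_V module_V] lin_smult[OF \<beta>_linear]
lemmas \<theta>_ops = lin_diff[OF \<theta>_linear module_V module_V] lin_add[OF \<theta>_linear]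
 lin_neg[OF \<theta>_linear module_V module_V] lin_smult[OF \<theta>_linear]

lemma \<beta>_a:
 assumes h: "h :[H]" and x: "x :[V (Suc n)]"
 shows "\<beta> n (a (Suc n) h x) = a n h (\<beta> n x)"
proof (rule V_eqI[OF x lin_comp[OF bilinear_right[OF a_bilinear h] \<beta>_linear] lin_comp[OF \<beta>_linear bilinear_right[OF a_bilinear h]]])
 fix g v assume gv: "g :[H]" "v :[V n]"
 show "\<beta> n (a (Suc n) h (c n g v)) = a n h (\<beta> n (c n g v))"
 proof (cases n)
  case 0
  then show ?thesis using gv h by (simp add: a_c \<beta>_c_0 a_mult)
 next
  case (Suc m)
  then show ?thesis using gv h by (simp add: a_c \<beta>_c_Suc a_mult a_diff)
 qed
qed

lemma \<theta>_a:
 assumes h: "h :[H]" and x: "x :[V (Suc n)]"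
 shows "\<theta> n (a (Suc n) h x) = \<epsilon> h *[V n] \<theta> n x"
proof -
 interpret Vn: module R "V n" by simp
 show ?thesis
  by (rule V_eqI[OF x lin_comp[OF bilinear_right[OF a_bilinear h] \<theta>_linear] linear_map_smult[OF \<theta>_linear module_V eps_closed[OF h]]])
   (use h in "simp add: a_c counit_mult Vn.smult_assoc1")
qed

lemma \<beta>_\<beta>: "x :[V (Suc (Suc n))] ==> \<beta> n (\<beta> (Suc n) x) = \<zero>[V n]"
proof (induction n arbitrary: x)
 case 0
 interpret V0: module R "V 0" by simp
 show ?case
 proof (rule V_eqI[OF 0 lin_comp[OF \<beta>_linear \<beta>_linear] lin_const_zero[OF module_V]])
  fix h v assume "h :[H]" "v :[V (Suc 0)]"
  then show "\<beta> 0 (\<beta> (Suc 0) (c (Suc 0) h v)) = \<zero>[V 0]"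
   by (simp add: \<beta>_c_Suc \<beta>_c_0 \<beta>_ops \<beta>_a V0.diff_zero_iff)
 qed
next
 case (Suc n)
 interpret VS: module R "V (Suc n)" by simp
 show ?case
 proof (rule V_eqI[OF Suc.prems lin_comp[OF \<beta>_linear \<beta>_linear] lin_const_zero[OF module_V]])
  fix h v assume "h :[H]" "v :[V (Suc (Suc n))]"
  then show "\<beta> (Suc n) (\<beta> (Suc (Suc n)) (c (Suc (Suc n)) h v)) = \<zero>[V (Suc n)]"
   by (simp add: \<beta>_c_Suc \<beta>_ops \<beta>_a Suc.IH c_zero VS.minus_eq VS.r_neg)
 qed
qed

text \<open>Combined with \<open>\<beta>_\<beta>\<close>, this is exactly what makes the square of
  \<open>\<theta> - \<beta>\<close> vanish.\<close>

lemma \<theta>_\<beta>: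
 assumes "x :[V (Suc (Suc n))]"
 shows "\<theta> n (\<beta> (Suc n) x) +[V n] \<beta> n (\<theta> (Suc n) x) = \<theta> n (\<theta> (Suc n) x)"
proof -
 interpret Vn: module R "V n" by simp
 show ?thesis
 proof (rule V_eqI[OF assms, where m = n and f = "%x. \<theta> n (\<beta> (Suc n) x) +[V n] \<beta> n (\<theta> (Suc n) x)"])
  fix h v assume "h :[H]" "v :[V (Suc n)]"
  then show "\<theta> n (\<beta> (Suc n) (c (Suc n) h v)) +[V n] \<beta> n (\<theta> (Suc n) (c (Suc n) h v)) = \<theta> n (\<theta> (Suc n) (c (Suc n) h v))"
   by (simp add: \<beta>_c_Suc \<theta>_ops \<beta>_ops \<theta>_a Vn.minus_eq Vn.a_assoc Vn.l_neg)
 qed (intro lin_map_add lin_comp[OF \<beta>_linear] lin_comp[OF \<theta>_linear] \<beta>_linear \<theta>_linear module_V)+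
qed

definition bd :: "nat => 'v => 'v" where "bd n x = \<theta> n x -[V n] \<beta> n x"

lemma bd_linear: "bd n \<in> lin R (V (Suc n)) (V n)"
 unfolding bd_def[abs_def] by (intro lin_map_diff \<theta>_linear \<beta>_linear module_V)

lemma bd_bd:
 assumes "x :[V (Suc (Suc n))]"
 shows "bd n (bd (Suc n) x) = \<zero>[V n]"
proof -
 interpret Vn: module R "V n" by simp
 interpret VS: module R "V (Suc n)" by simp
 show ?thesis
  using assms \<theta>_\<beta>[OF assms, symmetric]
  by (simp add: bd_def \<theta>_ops \<beta>_ops \<beta>_\<beta> Vn.minus_eq Vn.minus_add Vn.a_ac Vn.r_neg Vn.r_neg2)
qed

context
 fixes \<sigma> :: "'v => 'v"
 assumes \<sigma>_linear: "\<sigma> \<in> lin R (V 0) (V (Suc 0))"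
  and \<sigma>_a: "!!h v. [|h :[H]; v :[V 0]|] ==> \<sigma> (a0 h v) = a (Suc 0) h (\<sigma> v)"
  and \<beta>_\<sigma>: "!!v. v :[V 0] ==> \<beta> 0 (\<sigma> v) = v"
begin

text \<open>The section is applied behind all factors of \<open>H\<close>, which stay in place. The
  resulting contraction of \<open>\<beta>\<close> is therefore compatible with
  \<open>\<theta>\<close>, which touches only the leading factor; a unit put in front would contract
  \<open>\<beta>\<close> too, but would be destroyed by \<open>\<theta>\<close>.\<close>

primrec st :: "nat => 'v => 'v"
 where "st 0 = \<sigma>"
 | "st (Suc n) = lift n (V (Suc (Suc n))) (%h v. -[V (Suc (Suc n))] c (Suc n) h (st n v))"

declare st.simps [simp del]

lemma st_bilinear:
 "st n \<in> lin R (V n) (V (Suc n)) ==>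
  bilinear R H (V n) (V (Suc (Suc n))) (%h v. -[V (Suc (Suc n))] c (Suc n) h (st n v))"
 by (intro bilinearI lin_map_neg c_lin lin_id) (simp_all add: lin_closed[of "st n"])

lemma st_linear: "st n \<in> lin R (V n) (V (Suc n))"
proof (induction n)
 case 0
 show ?case by (simp add: st.simps \<sigma>_linear)
next
 case (Suc n)
 show ?case unfolding st.simps by (rule lift_linear[OF module_V st_bilinear[OF Suc]])
qed

lemma st_closed [simp]: "v :[V n] ==> st n v :[V (Suc n)]"
 by (rule lin_closed[OF st_linear])

lemma st_c: "[|h :[H]; v :[V n]|] ==> st (Suc n) (c n h v) = -[V (Suc (Suc n))] c (Suc n) h (st n v)"
 unfolding st.simps by (rule lift_c[OF module_V st_bilinear[OF st_linear]])

lemma st_a: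
 assumes "h :[H]" "v :[V n]"
 shows "st n (a n h v) = a (Suc n) h (st n v)"
proof (cases n)
 case 0
 then show ?thesis using assms \<sigma>_a by (simp add: a.simps(1) st.simps(1))
next
 case (Suc m)
 have x: "v :[V (Suc m)]" using assms Suc by simp
 show ?thesis
  unfolding Suc
  by (rule V_eqI[OF x lin_comp[OF bilinear_right[OF a_bilinear assms(1)] st_linear]
     lin_comp[OF st_linear bilinear_right[OF a_bilinear assms(1)]]])
   (use assms(1) in "simp add: a_c st_c a_neg")
qed

lemma \<theta>_st:
 assumes x: "x :[V (Suc n)]"
 shows "\<theta> (Suc n) (st (Suc n) x) = -[V (Suc n)] st n (\<theta> n x)"
proof -
 show ?thesis
  by (rule V_eqI[OF x lin_comp[OF st_linear \<theta>_linear] lin_map_neg[OF lin_comp[OF \<theta>_linear st_linear] module_V module_V]])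
   (simp add: st_c \<theta>_ops lin_smult[OF st_linear])
qed

lemma \<beta>_st: "x :[V (Suc n)] ==> \<beta> (Suc n) (st (Suc n) x) +[V (Suc n)] st n (\<beta> n x) = x"
proof (induction n arbitrary: x)
 case 0
 interpret V1: module R "V (Suc 0)" by simp
 show ?case
 proof (rule V_eqI[OF 0, where m = "Suc 0" and f = "%x. \<beta> (Suc 0) (st (Suc 0) x) +[V (Suc 0)] st 0 (\<beta> 0 x)" and g = "%x. x"])
  fix h v assume hv: "h :[H]" "v :[V 0]"
  have "\<beta> 0 (st 0 v) = v" using hv \<beta>_\<sigma> by (simp add: st.simps)
  then show "\<beta> (Suc 0) (st (Suc 0) (c 0 h v)) +[V (Suc 0)] st 0 (\<beta> 0 (c 0 h v)) = c 0 h v"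
   using hv by (simp add: st_c \<beta>_c_0 \<beta>_c_Suc \<beta>_ops st_a V1.minus_eq V1.minus_add V1.a_ac V1.r_neg1 V1.r_neg2 V1.l_neg V1.r_neg)
 qed (intro lin_map_add lin_comp[OF \<beta>_linear st_linear] lin_comp[OF st_linear \<beta>_linear] module_V lin_id)+
next
 case (Suc n)
 interpret V1: module R "V (Suc n)" by simp
 interpret V2: module R "V (Suc (Suc n))" by simp
 show ?case
 proof (rule V_eqI[OF Suc.prems, where m = "Suc (Suc n)" and f = "%x. \<beta> (Suc (Suc n)) (st (Suc (Suc n)) x) +[V (Suc (Suc n))] st (Suc n) (\<beta> (Suc n) x)" and g = "%x. x"])
  fix h v assume hv: "h :[H]" "v :[V (Suc n)]"
  let ?A = "a (Suc (Suc n)) h (st (Suc n) v)" and ?B = "c (Suc n) h (\<beta> (Suc n) (st (Suc n) v))"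
   and ?C = "c (Suc n) h (st n (\<beta> n v))"
  have "\<beta> (Suc (Suc n)) (st (Suc (Suc n)) (c (Suc n) h v)) = -[V (Suc (Suc n))] ?A +[V (Suc (Suc n))] ?B"
   using hv by (simp add: st_c \<beta>_c_Suc \<beta>_ops V2.minus_eq V2.minus_add)
  moreover have "st (Suc n) (\<beta> (Suc n) (c (Suc n) h v)) = ?A +[V (Suc (Suc n))] ?C"
   using hv by (simp add: \<beta>_c_Suc lin_diff[OF st_linear module_V module_V] st_a st_c V2.minus_eq)
  moreover have "?B +[V (Suc (Suc n))] ?C = c (Suc n) h v"
   using hv Suc.IH[OF hv(2)] c_add[of h "\<beta> (Suc n) (st (Suc n) v)" "Suc n" "st n (\<beta> n v)"] by (simp)
  moreover have "?A :[V (Suc (Suc n))]" "?B :[V (Suc (Suc n))]" "?C :[V (Suc (Suc n))]"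
   using hv by (simp_all)
  ultimately show "\<beta> (Suc (Suc n)) (st (Suc (Suc n)) (c (Suc n) h v)) +[V (Suc (Suc n))] st (Suc n) (\<beta> (Suc n) (c (Suc n) h v)) = c (Suc n) h v"
   by (metis V2.a_assoc V2.a_comm V2.a_inv_closed V2.r_neg1 V2.a_closed)
 qed (intro lin_map_add lin_comp[OF \<beta>_linear st_linear] lin_comp[OF st_linear \<beta>_linear] module_V lin_id)+
qed

text \<open>As \<open>st\<close> contracts \<open>\<beta>\<close> and anticommutes with
  \<open>\<theta>\<close>, its negative contracts \<open>\<theta> - \<beta>\<close>.\<close>

lemma bd_exact:
 assumes x: "x :[V (Suc n)]" and z: "bd n x = \<zero>[V n]"
 shows "\<exists>y\<in>carrier (V (Suc (Suc n))). x = bd (Suc n) y"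
proof -
 interpret Vn: module R "V n" by simp
 interpret V1: module R "V (Suc n)" by simp
 interpret V2: module R "V (Suc (Suc n))" by simp
 have e: "\<theta> n x = \<beta> n x" using z x by (simp add: bd_def Vn.diff_zero_iff)
 have m: "st (Suc n) x :[V (Suc (Suc n))]" "st n (\<beta> n x) :[V (Suc n)]"
  using x by (simp_all)
 have "bd (Suc n) (-[V (Suc (Suc n))] st (Suc n) x) = \<beta> (Suc n) (st (Suc n) x) +[V (Suc n)] st n (\<beta> n x)"
  using m \<theta>_st[OF x] e by (simp add: bd_def \<theta>_ops \<beta>_ops V1.minus_eq V1.a_comm)
 then show ?thesis using \<beta>_st[OF x] m(1) by (intro bexI[of _ "-[V (Suc (Suc n))] st (Suc n) x"]) auto
qed

end

end

text \<open>Naturality in the coefficients. The differential is determined by prepending and by the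
  action at the bottom, so compatibility with these two suffices; it is applied both to the
  differentials and to the augmentation of a resolution.\<close>

lemma bar_tower_map:
 assumes "bar_tower R H \<Delta> \<epsilon> S V c a0" "bar_tower R H \<Delta> \<epsilon> S V' c' a0'"
  and f: "!!n. f n \<in> lin R (V n) (V' n)"
  and fc: "!!n h v. [|h :[H]; v :[V n]|] ==> f (Suc n) (c n h v) = c' n h (f n v)"
  and f0: "!!h v. [|h :[H]; v :[V 0]|] ==> f 0 (a0 h v) = a0' h (f 0 v)"
  and x: "x :[V (Suc n)]"
 shows "f n (bar_tower.bd R H \<epsilon> V c a0 n x) = bar_tower.bd R H \<epsilon> V' c' a0' n (f (Suc n) x)"
proof -
 interpret V: bar_tower R H \<Delta> \<epsilon> S V c a0 by fact
 interpret V': bar_tower R H \<Delta> \<epsilon> S V' c' a0' by fact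
 note [simp] = lin_closed[OF f] fc
 note eqI = is_tensor_eq[OF V.V_tensor V'.module_V]
 have fa: "f n (V.a n h v) = V'.a n h (f n v)" if h: "h :[H]" and v: "v :[V n]" for n h v
 proof (cases n)
  case 0
  then show ?thesis using f0 h v by (simp add: V.a.simps V'.a.simps)
 next
  case (Suc m)
  have v': "v :[V (Suc m)]" using v Suc by simp
  show ?thesis
   unfolding Suc
   by (rule eqI[OF lin_comp[OF bilinear_right[OF V.a_bilinear h] f] lin_comp[OF f bilinear_right[OF V'.a_bilinear h]] _ v'])
    (use h in "simp add: V.a_c V'.a_c")
 qed
 have f\<beta>: "f n (V.\<beta> n x) = V'.\<beta> n (f (Suc n) x)" if "x :[V (Suc n)]" for n x
  using that
 proof (induction n arbitrary: x)
  case 0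
  show ?case
   by (rule eqI[OF lin_comp[OF V.\<beta>_linear f] lin_comp[OF f V'.\<beta>_linear] _ 0])
    (simp add: V.\<beta>_c_0 V'.\<beta>_c_0 fa)
 next
  case (Suc n)
  show ?case
   by (rule eqI[OF lin_comp[OF V.\<beta>_linear f] lin_comp[OF f V'.\<beta>_linear] _ Suc.prems])
    (simp add: V.\<beta>_c_Suc V'.\<beta>_c_Suc fa Suc.IH lin_diff[OF f V.module_V V'.module_V])
 qed
 have "f n (V.\<theta> n x) = V'.\<theta> n (f (Suc n) x)"
  by (rule eqI[OF lin_comp[OF V.\<theta>_linear f] lin_comp[OF f V'.\<theta>_linear] _ x])
   (simp add: lin_smult[OF f])
 then show ?thesis
  using x f\<beta>[OF x] by (simp add: V.bd_def V'.bd_def lin_diff[OF f V.module_V V'.module_V])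
qed

section \<open>The tensor powers as a bar complex with trivial coefficients\<close>

context hopf_algebra
begin

lemma T0_left_module: "left_module R H (T 0) (%h t. \<epsilon> h *[T 0] t)"
proof -
 interpret T0: module R "T 0" by simp
 interpret assoc_algebra R H by unfold_locales
 show ?thesis
  by unfold_locales
   (simp_all add: counit_mult counit_one T0.smult_assoc1 linear_map_smult lin_id smult_eps_linear)
qed

end

sublocale hopf_algebra \<subseteq> T: bar_tower R H \<Delta> \<epsilon> S "tensor_power R H" "tcons R H" "%h t. \<epsilon> h *[tensor_power R H 0] t"
 by (intro bar_tower.intro hopf_algebra_axioms bar_tower_axioms.intro T_tensor T0_left_module)

context hopf_algebra
begin

lemma lm_eq: "lm n = T.a (Suc n)"
 by (simp add: lm_def[abs_def] T.a.simps tl_def)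

lemma alternating_dd:
 "x :[T (Suc n)] ==> alternating_sum (T n) (%i. dd n i x) {..n} = T.\<beta> n x"
proof (induction n arbitrary: x)
 case 0
 interpret T0: module R "T 0" by simp
 have "dd 0 0 x = T.\<beta> 0 x"
  by (rule T_eqI[OF 0 module_T dd_linear T.\<beta>_linear])
   (simp add: T.\<beta>_c_0 T.a.simps del: dd.simps)
 moreover have "alternating_sum (T 0) (%i. dd 0 i x) {0} = dd 0 0 x"
  by (rule T0.alternating_sum_0) (rule dd_closed[OF 0])
 ultimately show ?case by simp
next
 case (Suc n)
 interpret TS: module R "T (Suc n)" by simp
 interpret Tn: module R "T n" by simp
 have lin: "(%x. alternating_sum (T (Suc n)) (%i. dd (Suc n) i x) {..Suc n}) \<in> lin R (T (Suc (Suc n))) (T (Suc n))"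
  by (rule TS.alternating_sum_linear_map[OF module_T dd_linear])
 show ?case
 proof (rule T_eqI[OF Suc.prems module_T lin T.\<beta>_linear])
  fix h t assume ht: "h :[H]" "t :[T (Suc n)]"
  have "alternating_sum (T (Suc n)) (%i. dd (Suc n) i (tc (Suc n) h t)) {..Suc n} =
    lm n h t -[T (Suc n)] alternating_sum (T (Suc n)) (%i. tc n h (dd n i t)) {..n}"
   by (subst TS.alternating_sum_Suc) (use ht in "simp_all add: dd_closed del: dd.simps")
  also have "alternating_sum (T (Suc n)) (%i. tc n h (dd n i t)) {..n} = tc n h (alternating_sum (T n) (%i. dd n i t) {..n})"
   by (rule Tn.alternating_sum_linear[OF module_T bilinear_right[OF tc_bilinear ht(1)], symmetric])
    (use ht in simp)
  also have "... = tc n h (T.\<beta> n t)" by (simp only: Suc.IH[OF ht(2)])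
  finally show "alternating_sum (T (Suc n)) (%i. dd (Suc n) i (tc (Suc n) h t)) {..Suc n} = T.\<beta> (Suc n) (tc (Suc n) h t)"
   using ht by (simp add: T.\<beta>_c_Suc lm_eq)
 qed
qed

lemma hochschild_b_CX:
 assumes x: "x :[T (Suc n)]"
 shows "hochschild_b CX n x = T.bd n x"
proof -
 interpret Tn: module R "T n" by simp
 have c: "face CX (Suc n) i x :[T n]" if "i \<le> Suc n" for i
  using that CX_face_0[OF x] CX_face_Suc[OF x] lin_closed[OF e0_linear x] dd_closed[OF x] by (cases i) auto
 have "hochschild_b CX n x = face CX (Suc n) 0 x -[T n] alternating_sum (T n) (%i. face CX (Suc n) (Suc i) x) {..n}"
  unfolding hochschild_b_def CX_obj by (rule Tn.alternating_sum_Suc[OF c])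
 also have "alternating_sum (T n) (%i. face CX (Suc n) (Suc i) x) {..n} = alternating_sum (T n) (%i. dd n i x) {..n}"
  by (rule Tn.alternating_sum_cong) (simp add: CX_face_Suc[OF x])
 also have "... = T.\<beta> n x" by (rule alternating_dd[OF x])
 finally show ?thesis by (simp add: CX_face_0[OF x] T.bd_def T.\<theta>_def e0_def tl_def)
qed

section \<open>Bar complexes with coefficients in a left module\<close>

abbreviation TQ where "TQ Q n \<equiv> tensor_k R (T n) Q"
abbreviation gen where "gen Q n t q \<equiv> tensor_k_gen R (T n) Q (t, q)"
abbreviation ext where "ext Q n \<equiv> tensor_lift R (T n) Q (TQ Q n) (%t q. tensor_k_gen R (T n) Q (t, q))"

definition cQ where "cQ Q n h = ext Q n (TQ Q (Suc n)) (%t q. gen Q (Suc n) (tc n h t) q)"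
definition aQ where "aQ Q ac h = ext Q 0 (TQ Q 0) (%t q. gen Q 0 t (ac h q))"

end

lemma is_tensor_k:
 assumes "module R M" "module R N"
 shows "is_tensor R M N (tensor_k R M N) (%x y. tensor_k_gen R M N (x, y))"
proof -
 interpret M: module R M by fact
 show ?thesis
  unfolding is_tensor_def
  using assms M.module_tensor_k[OF assms] M.tensor_k_gen_bilinear[OF assms] M.tensor_k_generates[OF assms] lin_id[of R "tensor_k R M N"]
  by (auto simp: case_prod_unfold intro!: bexI[of _ "%x. x"])
qed

context hopf_algebra
begin

context
 fixes Q :: "('k, 'q) module"
 assumes Q: "module R Q"
begin

lemma TQ_tensor: "is_tensor R (T n) Q (TQ Q n) (%t q. gen Q n t q)"
 by (rule is_tensor_k[OF module_T Q])

lemma module_TQ [simp]: "module R (TQ Q n)" by (rule module_tensor_k[OF module_T Q])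

lemma gen_bilinear: "bilinear R (T n) Q (TQ Q n) (gen Q n)" by (rule tensor_k_gen_bilinear[OF module_T Q])

lemma gen_closed [simp]: "[|t :[T n]; q :[Q]|] ==> gen Q n t q :[TQ Q n]"
 by (rule bilinear_closed[OF gen_bilinear])

lemmas gen_lin = lin_comp[OF _ bilinear_right[OF gen_bilinear]] lin_comp[OF _ bilinear_left[OF gen_bilinear]]
lemmas ext_linear = tensor_lift_linear[OF TQ_tensor]
lemmas ext_gen = tensor_lift_cons[OF TQ_tensor]
lemmas TQ_eqI = is_tensor_eq[OF TQ_tensor]

lemma cQ_inner: "h :[H] ==> bilinear R (T n) Q (TQ Q (Suc n)) (%t q. gen Q (Suc n) (tc n h t) q)"
 by (intro bilinearI gen_lin tc_linear lin_id) simp_all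

lemma cQ_gen: "[|h :[H]; t :[T n]; q :[Q]|] ==> cQ Q n h (gen Q n t q) = gen Q (Suc n) (tc n h t) q"
 unfolding cQ_def by (rule ext_gen[OF module_TQ cQ_inner])

lemma cQ_bilinear: "bilinear R H (TQ Q n) (TQ Q (Suc n)) (cQ Q n)"
 unfolding cQ_def[abs_def]
 by (intro tensor_lift_bilinear[OF TQ_tensor] cQ_inner gen_lin tc_linear lin_id) simp_all

text \<open>Associativity of the tensor product. The comparison map is built by currying: for a
  fixed element of \<open>Q\<close> it is a lift on \<open>T (Suc n)\<close>, and this lift depends
  linearly on that element.\<close>

lemma cQ_tensor: "is_tensor R H (TQ Q n) (TQ Q (Suc n)) (cQ Q n)"
proof -
 have gens: "generates R (TQ Q (Suc n)) ((%(h, v). cQ Q n h v) ` (carrier H \<times> carrier (TQ Q n)))"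
  unfolding generates_def
 proof (intro conjI allI impI subsetI)
  show "y :[TQ Q (Suc n)]" if "y \<in> (%(h, v). cQ Q n h v) ` (carrier H \<times> carrier (TQ Q n))" for y
   using that bilinear_closed[OF cQ_bilinear] by auto
  fix N x assume N: "submodule N R (TQ Q (Suc n))" "(%(h, v). cQ Q n h v) ` (carrier H \<times> carrier (TQ Q n)) \<subseteq> N"
   and x: "x :[TQ Q (Suc n)]"
  have inN: "gen Q (Suc n) t q \<in> N" if t: "t :[T (Suc n)]" and q: "q :[Q]" for t q
  proof -
   have "t \<in> {t \<in> carrier (T (Suc n)). gen Q (Suc n) t q \<in> N}"
   proof (rule generates_subset[of R "T (Suc n)"])
    show "generates R (T (Suc n)) ((%(h, t). tc n h t) ` (carrier H \<times> carrier (T n)))"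
     using T_tensor by (simp add: is_tensor_def)
    show "submodule {t \<in> carrier (T (Suc n)). gen Q (Suc n) t q \<in> N} R (T (Suc n))"
     by (rule linear_preimage_submodule[OF bilinear_left[OF gen_bilinear q] module_T module_TQ N(1)])
    fix s assume "s \<in> (%(h, t). tc n h t) ` (carrier H \<times> carrier (T n))"
    then obtain h u where s: "h :[H]" "u :[T n]" "s = tc n h u" by auto
    have "cQ Q n h (gen Q n u q) \<in> N" using N(2) s(1) gen_closed[OF s(2) q] by auto
    then show "s \<in> {t \<in> carrier (T (Suc n)). gen Q (Suc n) t q \<in> N}" using s q by (simp add: cQ_gen)
   qed (rule t)
   then show ?thesis by simp
  qed
  show "x \<in> N"
   by (rule generates_subset[OF tensor_k_generates[OF module_T Q] N(1) _ x]) (use inN in auto)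
 qed
 let ?K = "tensor_k R H (TQ Q n)" and ?k = "%h v. tensor_k_gen R H (TQ Q n) (h, v)"
 have mK: "module R ?K" by (rule module_tensor_k[OF module_H module_TQ])
 have kb: "bilinear R H (TQ Q n) ?K ?k" by (rule tensor_k_gen_bilinear[OF module_H module_TQ])
 note k_lin = bilinear_comp_right[OF kb] bilinear_comp_left[OF kb]
 have i: "bilinear R H (T n) ?K (%h t. ?k h (gen Q n t q))" if "q :[Q]" for q
  using that by (intro bilinearI k_lin gen_lin lin_id) simp_all
 have "bilinear R Q (T (Suc n)) ?K (%q. tl n ?K (%h t. ?k h (gen Q n t q)))"
  unfolding tl_def
  by (intro tensor_lift_bilinear[OF T_tensor mK Q] i k_lin gen_lin lin_id) simp_all
 note b = bilinear_flip[OF this]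
 let ?u = "ext Q (Suc n) ?K (%t q. tl n ?K (%h t. ?k h (gen Q n t q)) t)"
 have u: "?u \<in> lin R (TQ Q (Suc n)) ?K" by (rule ext_linear[OF mK b])
 have "?u (cQ Q n h v) = ?k h v" if h: "h :[H]" and v: "v :[TQ Q n]" for h v
 proof (rule TQ_eqI[OF mK lin_comp[OF bilinear_right[OF cQ_bilinear h] u] bilinear_right[OF kb h] _ v])
  fix t q assume "t :[T n]" "q :[Q]"
  then show "?u (cQ Q n h (gen Q n t q)) = ?k h (gen Q n t q)"
   using h by (simp add: cQ_gen ext_gen[OF mK b] tl_tc[OF mK i])
 qed
 then show ?thesis using gens u cQ_bilinear by (auto simp: is_tensor_def)
qed

end

context
 fixes Q :: "('k, 'q) module" and actQ :: "'h => 'q => 'q"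
 assumes lmQ: "left_module R H Q actQ"
begin

interpretation Q: left_module R H Q actQ by (rule lmQ)
lemma mQ: "module R Q" by unfold_locales

lemmas genQ_lin = gen_lin[OF mQ]
lemmas Q_eqI = TQ_eqI[OF mQ]

lemma actQ_closed [simp]: "[|h :[H]; q :[Q]|] ==> actQ h q :[Q]"
 by (rule lin_closed[OF Q.act_linear])

lemma aQ_inner: "h :[H] ==> bilinear R (T 0) Q (TQ Q 0) (%t q. gen Q 0 t (actQ h q))"
 by (intro bilinearI genQ_lin lin_id Q.act_linear) simp_all

lemma aQ_gen: "[|h :[H]; t :[T 0]; q :[Q]|] ==> aQ Q actQ h (gen Q 0 t q) = gen Q 0 t (actQ h q)"
 unfolding aQ_def by (rule ext_gen[OF mQ module_TQ[OF mQ] aQ_inner])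

lemma aQ_bilinear: "bilinear R H (TQ Q 0) (TQ Q 0) (aQ Q actQ)"
 unfolding aQ_def[abs_def]
 by (intro tensor_lift_bilinear[OF TQ_tensor[OF mQ]] module_TQ[OF mQ] module_H aQ_inner genQ_lin Q.act_linear_left)

lemma aQ_left_module: "left_module R H (TQ Q 0) (aQ Q actQ)"
proof -
 interpret V: module R "TQ Q 0" by (rule module_TQ[OF mQ])
 note r = bilinear_right[OF aQ_bilinear]
 show ?thesis
 proof (unfold_locales, goal_cases)
  case (3 g h x)
  show ?case
   by (rule Q_eqI[OF module_TQ[OF mQ] r lin_comp[OF r r] _ 3(3)])
    (use 3 gen_closed[OF mQ] in "simp_all add: aQ_gen Q.act_mult")
 next
  case (4 x)
  show ?case
   by (rule Q_eqI[OF module_TQ[OF mQ] r lin_id _ 4]) (simp_all add: aQ_gen Q.act_one)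
 qed (use aQ_bilinear in "auto simp: bilinear_def")
qed

lemma Q_tower: "bar_tower R H \<Delta> \<epsilon> S (TQ Q) (cQ Q) (aQ Q actQ)"
 by (intro bar_tower.intro hopf_algebra_axioms bar_tower_axioms.intro cQ_tensor[OF mQ] aQ_left_module)

end

text \<open>\<open>T 0\<close> is free of rank one on the empty tensor but is not the ground ring
  itself. This coordinate yields the isomorphism \<open>\<kappa>\<close> from
  \<open>T 0 \<otimes> Q\<close> to \<open>Q\<close>, with inverse \<open>\<iota>\<close>.\<close>

definition eT :: "('h list => 'k) set => 'k"
 where "eT = (SOME e. e \<in> lin R (T 0) (self_module R) \<and> e (pure_tensor R H []) = \<one>[R])"

lemma eT_linear: "eT \<in> lin R (T 0) (self_module R)"
 and eT_Nil: "eT (pure_tensor R H []) = \<one>[R]"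
proof -
 have "\<exists>e. e \<in> lin R (T 0) (self_module R) \<and> e (pure_tensor R H []) = \<one>[R]"
  by (rule tensor_power_lift[OF module_H module_self_module[OF is_cring], of 0 "%_. \<one>[R]"]) (auto simp: multilinear_0)
 from someI_ex[OF this] show "eT \<in> lin R (T 0) (self_module R)" "eT (pure_tensor R H []) = \<one>[R]"
  unfolding eT_def by blast+
qed

lemma eT_closed [simp]: "t :[T 0] ==> eT t :[R]"
 using lin_closed[OF eT_linear] by simp

abbreviation \<iota> where "\<iota> Q \<equiv> gen Q 0 (pure_tensor R H [])"
definition \<kappa> where "\<kappa> Q = ext Q 0 Q (%t q. eT t *[Q] q)"

context
 fixes Q :: "('k, 'q) module"
 assumes Q: "module R Q"
begin

interpretation Q: module R Q by (rule Q)

lemma \<kappa>_inner: "bilinear R (T 0) Q Q (%t q. eT t *[Q] q)"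
 using lin_add[OF eT_linear] lin_smult[OF eT_linear]
 by (intro bilinearI linear_mapsI) (auto simp: Q.smult_r_distr Q.smult_l_distr Q.smult_assoc1[symmetric] comm_monoid.m_comm[OF cring.axioms(2)[OF is_cring]])

lemma \<kappa>_linear: "\<kappa> Q \<in> lin R (TQ Q 0) Q"
 unfolding \<kappa>_def by (rule ext_linear[OF Q Q \<kappa>_inner])

lemma \<kappa>_gen: "[|t :[T 0]; q :[Q]|] ==> \<kappa> Q (gen Q 0 t q) = eT t *[Q] q"
 unfolding \<kappa>_def by (rule ext_gen[OF Q Q \<kappa>_inner])

lemma \<iota>_linear: "\<iota> Q \<in> lin R Q (TQ Q 0)"
 by (rule bilinear_right[OF gen_bilinear[OF Q]]) simp

lemma \<kappa>_\<iota>: "q :[Q] ==> \<kappa> Q (\<iota> Q q) = q"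
 by (simp add: \<kappa>_gen eT_Nil)

lemma \<iota>_\<kappa>:
 assumes "v :[TQ Q 0]"
 shows "\<iota> Q (\<kappa> Q v) = v"
proof (rule TQ_eqI[OF Q module_TQ[OF Q] lin_comp[OF \<kappa>_linear \<iota>_linear] lin_id _ assms])
 fix t q assume t: "t :[T 0]" and q: "q :[Q]"
 interpret V: module R "TQ Q 0" by (rule module_TQ[OF Q])
 note l = bilinear_left[OF gen_bilinear[OF Q] q]
 show "\<iota> Q (\<kappa> Q (gen Q 0 t q)) = gen Q 0 t q"
 proof (rule T0_eqI[OF t module_TQ[OF Q] _ l])
  show "(%t. \<iota> Q (\<kappa> Q (gen Q 0 t q))) \<in> lin R (T 0) (TQ Q 0)"
   by (rule lin_comp[OF lin_comp[OF l \<kappa>_linear] \<iota>_linear])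
 qed (use q in "simp add: \<kappa>_\<iota>")
qed

end

end

section \<open>Equivariant sections from projectivity\<close>

definition direct_sum_ext ::
 "('k, 'b, 'n) module_scheme => 'i set => ('i => ('k, 'a, 'm) module_scheme) => ('i => 'a => 'b) => ('i => 'a) => 'b"
 where "direct_sum_ext N I M g f = (\<Oplus>\<^bsub>N\<^esub>i\<in>{i\<in>I. f i \<noteq> \<zero>[M i]}. g i (f i))"

context
 fixes R :: "('k, 'r) ring_scheme" and N :: "('k, 'b, 'n) module_scheme"
  and I :: "'i set" and M :: "'i => ('k, 'a, 'm) module_scheme" and g :: "'i => 'a => 'b"
 assumes N: "module R N" and M: "!!i. i \<in> I ==> module R (M i)"
  and g: "!!i. i \<in> I ==> g i \<in> lin R (M i) N"
begin

interpretation N: module R N by (rule N)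

lemma direct_sum_ext_superset:
 assumes "finite A" "{i\<in>I. f i \<noteq> \<zero>[M i]} \<subseteq> A" "A \<subseteq> I" "!!i. i \<in> I ==> f i :[M i]"
 shows "direct_sum_ext N I M g f = (\<Oplus>\<^bsub>N\<^esub>i\<in>A. g i (f i))"
 unfolding direct_sum_ext_def
proof (rule N.add.finprod_mono_neutral_cong_left[OF assms(1,2)])
 show "g i (f i) = \<zero>[N]" if "i \<in> A - {i \<in> I. f i \<noteq> \<zero>[M i]}" for i
  using that assms(3) lin_zero[OF g M N, of i] by auto
 show "(%i. g i (f i)) \<in> A \<rightarrow> carrier N"
  using assms(3,4) lin_closed[OF g] by blast
qed auto

lemma direct_sum_ext_linear: "direct_sum_ext N I M g \<in> lin R (direct_sum I M) N"
proof (intro linear_mapsI)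
 let ?s = "%f. {i\<in>I. f i \<noteq> \<zero>[M i]}"
 have s: "finite (?s f)" and c: "!!i. i \<in> I ==> f i :[M i]" if "f :[direct_sum I M]" for f
  using that by (auto simp: dsum_simps)
 have gc: "g i (f i) :[N]" if "f :[direct_sum I M]" "i \<in> I" for f i
  by (rule lin_closed[OF g c]) (use that in auto)
 show "direct_sum_ext N I M g f :[N]" if "f :[direct_sum I M]" for f
  unfolding direct_sum_ext_def using gc[OF that] by (intro N.finsum_closed) auto
 show "direct_sum_ext N I M g (f +[direct_sum I M] f') = direct_sum_ext N I M g f +[N] direct_sum_ext N I M g f'"
  if f: "f :[direct_sum I M]" "f' :[direct_sum I M]" for f f'
 proof -
  let ?A = "?s f \<union> ?s f'"
  have A: "finite ?A" using s f by auto
  have z: "x +[M i] y = \<zero>[M i]" if "i \<in> I" "x = \<zero>[M i]" "y = \<zero>[M i]" for i x y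
  proof -
   interpret Mi: module R "M i" by (rule M[OF that(1)])
   show ?thesis using that by simp
  qed
  have cl: "f i +[M i] f' i :[M i]" if "i \<in> I" for i
  proof -
   interpret Mi: module R "M i" by (rule M[OF that(1)])
   show ?thesis using c f that by simp
  qed
  have "direct_sum_ext N I M g (f +[direct_sum I M] f') = (\<Oplus>\<^bsub>N\<^esub>i\<in>?A. g i ((f +[direct_sum I M] f') i))"
   using A cl z by (intro direct_sum_ext_superset) (auto simp: dsum_simps)
  also have "... = (\<Oplus>\<^bsub>N\<^esub>i\<in>?A. g i (f i) +[N] g i (f' i))"
   using c f by (intro finsum_strong_cong) (auto simp: dsum_simps(3) lin_add[OF g])
  also have "... = (\<Oplus>\<^bsub>N\<^esub>i\<in>?A. g i (f i)) +[N] (\<Oplus>\<^bsub>N\<^esub>i\<in>?A. g i (f' i))"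
   using gc f by (intro N.finsum_addf) auto
  finally show ?thesis
   using A c f by (simp add: direct_sum_ext_superset[of ?A f] direct_sum_ext_superset[of ?A f'])
 qed
 show "direct_sum_ext N I M g (r *[direct_sum I M] f) = r *[N] direct_sum_ext N I M g f"
  if r: "r :[R]" and f: "f :[direct_sum I M]" for r f
 proof -
  have z: "x :[M i] ==> r *[M i] x :[M i]" "r *[M i] \<zero>[M i] = \<zero>[M i]" if "i \<in> I" for i x
  proof -
   interpret Mi: module R "M i" by (rule M[OF that])
   show "x :[M i] ==> r *[M i] x :[M i]" "r *[M i] \<zero>[M i] = \<zero>[M i]"
    using r by simp_all
  qed
  have "direct_sum_ext N I M g (r *[direct_sum I M] f) = (\<Oplus>\<^bsub>N\<^esub>i\<in>?s f. g i ((r *[direct_sum I M] f) i))"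
   using s[OF f] c[OF f] z by (intro direct_sum_ext_superset) (auto simp: dsum_simps)
  also have "... = (\<Oplus>\<^bsub>N\<^esub>i\<in>?s f. r *[N] g i (f i))"
   using c[OF f] r by (intro finsum_strong_cong) (auto simp: dsum_simps(4) lin_smult[OF g])
  also have "... = r *[N] direct_sum_ext N I M g f"
   unfolding direct_sum_ext_def using s[OF f] gc[OF f] r by (intro N.finsum_smult_ldistr[symmetric]) auto
  finally show ?thesis .
 qed
qed

end

text \<open>An equivariant section of the action map \<open>H \<otimes> Q \<rightarrow> Q\<close>,
  expressed with \<open>tensor_lift\<close>. Both notions of projectivity are reduced to it, and it
  is all that the exactness of the bar direction requires.\<close>

definition (in hopf_algebra) bar_section :: "('k, 'q) module => ('h => 'q => 'q) => ('q => ('h \<times> 'q => 'k) set) => bool"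
 where "bar_section Q ac \<sigma> \<longleftrightarrow> (let L = tensor_k R H Q; t = (%h q. tensor_k_gen R H Q (h, q)) in
  \<sigma> \<in> lin R Q L \<and>
  (\<forall>h\<in>carrier H. \<forall>q\<in>carrier Q. \<sigma> (ac h q) = tensor_lift R H Q L t L (%g x. t (h **[H] g) x) (\<sigma> q)) \<and>
  (\<forall>q\<in>carrier Q. tensor_lift R H Q L t Q ac (\<sigma> q) = q))"

context hopf_algebra
begin

context
 fixes Q :: "('k, 'q) module" and ac :: "'h => 'q => 'q"
 assumes lmQ: "left_module R H Q ac"
begin

interpretation Q: left_module R H Q ac by (rule lmQ)
lemmas mQ' = mQ[OF lmQ]
interpretation V: bar_tower R H \<Delta> \<epsilon> S "TQ Q" "cQ Q" "aQ Q ac" by (rule Q_tower[OF lmQ])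

abbreviation LQ where "LQ \<equiv> tensor_k R H Q"
abbreviation tQ where "tQ h q \<equiv> tensor_k_gen R H Q (h, q)"
abbreviation lQ where "lQ \<equiv> tensor_lift R H Q LQ (%h q. tensor_k_gen R H Q (h, q))"

lemma LQ_tensor: "is_tensor R H Q LQ tQ" by (rule is_tensor_k[OF module_H mQ'])
lemma module_LQ: "module R LQ" using LQ_tensor by (simp add: is_tensor_def)
lemma tQ_bilinear: "bilinear R H Q LQ tQ" using LQ_tensor by (simp add: is_tensor_def)
lemma ac_bilinear: "bilinear R H Q Q ac" by (intro bilinearI Q.act_linear Q.act_linear_left)
lemma tQm_bilinear: "h :[H] ==> bilinear R H Q LQ (%g x. tQ (h **[H] g) x)"
 by (rule bilinear_precomp[OF tQ_bilinear mult_linear_right[OF _ lin_id] lin_id])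

text \<open>In the tower the modules \<open>Q\<close> and \<open>H \<otimes> Q\<close> appear as
  \<open>T 0 \<otimes> Q\<close> and \<open>T 1 \<otimes> Q\<close>; the section is carried over by
  \<open>\<kappa>\<close> and by the map \<open>?j\<close>.\<close>

lemma tower_section:
 assumes "bar_section Q ac \<sigma>0"
 shows "\<exists>\<sigma>. \<sigma> \<in> lin R (TQ Q 0) (TQ Q (Suc 0)) \<and>
  (\<forall>h\<in>carrier H. \<forall>v\<in>carrier (TQ Q 0). \<sigma> (aQ Q ac h v) = V.a (Suc 0) h (\<sigma> v)) \<and>
  (\<forall>v\<in>carrier (TQ Q 0). V.\<beta> 0 (\<sigma> v) = v)"
proof -
 note s = assms[unfolded bar_section_def Let_def]
 have s1: "\<sigma>0 \<in> lin R Q LQ" using s by blast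
 have s2: "\<sigma>0 (ac h q) = lQ LQ (%g x. tQ (h **[H] g) x) (\<sigma>0 q)" if "h :[H]" "q :[Q]" for h q
  using s that by blast
 have s3: "lQ Q ac (\<sigma>0 q) = q" if "q :[Q]" for q using s that by blast
 let ?j = "lQ (TQ Q (Suc 0)) (%h q. cQ Q 0 h (\<iota> Q q))"
 have jb: "bilinear R H Q (TQ Q (Suc 0)) (%h q. cQ Q 0 h (\<iota> Q q))"
  by (rule bilinear_precomp[OF V.c_bilinear lin_id \<iota>_linear[OF mQ']])
 have j: "?j \<in> lin R LQ (TQ Q (Suc 0))" by (rule tensor_lift_linear[OF LQ_tensor V.module_V jb])
 note jt = tensor_lift_cons[OF LQ_tensor V.module_V jb]
 note \<kappa> = \<kappa>_linear[OF mQ'] and \<iota> = \<iota>_linear[OF mQ']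
 have \<iota>c: "\<iota> Q q :[TQ Q 0]" if "q :[Q]" for q by (rule lin_closed[OF \<iota> that])
 have \<kappa>c: "\<kappa> Q q :[Q]" if "q :[TQ Q 0]" for q by (rule lin_closed[OF \<kappa> that])
 have \<kappa>a: "\<kappa> Q (aQ Q ac h v) = ac h (\<kappa> Q v)" if h: "h :[H]" and v: "v :[TQ Q 0]" for h v
  by (rule is_tensor_eq[OF TQ_tensor[OF mQ'] mQ' lin_comp[OF bilinear_right[OF aQ_bilinear[OF lmQ] h] \<kappa>] lin_comp[OF \<kappa> Q.act_linear[OF h]] _ v])
   (use h actQ_closed[OF lmQ] in "simp add: aQ_gen[OF lmQ] \<kappa>_gen[OF mQ'] lin_smult[OF Q.act_linear[OF h]]")
 have ja: "?j (lQ LQ (%g x. tQ (h **[H] g) x) y) = V.a (Suc 0) h (?j y)" if h: "h :[H]" and y: "y :[LQ]" for h y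
  by (rule is_tensor_eq[OF LQ_tensor V.module_V
     lin_comp[OF tensor_lift_linear[OF LQ_tensor module_LQ tQm_bilinear[OF h]] j] lin_comp[OF j bilinear_right[OF V.a_bilinear h]] _ y])
   (use h \<iota>c in "simp add: tensor_lift_cons[OF LQ_tensor module_LQ tQm_bilinear] jt V.a_c")
 have j\<beta>: "V.\<beta> 0 (?j y) = \<iota> Q (lQ Q ac y)" if y: "y :[LQ]" for y
  by (rule is_tensor_eq[OF LQ_tensor V.module_V lin_comp[OF j V.\<beta>_linear]
     lin_comp[OF tensor_lift_linear[OF LQ_tensor mQ' ac_bilinear] \<iota>] _ y])
   (use \<iota>c in "simp add: tensor_lift_cons[OF LQ_tensor mQ' ac_bilinear] jt V.\<beta>_c_0 V.a.simps aQ_gen[OF lmQ]")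
 show ?thesis
 proof (intro exI[of _ "%v. ?j (\<sigma>0 (\<kappa> Q v))"] conjI ballI)
  show "(%v. ?j (\<sigma>0 (\<kappa> Q v))) \<in> lin R (TQ Q 0) (TQ Q (Suc 0))"
   by (rule lin_comp[OF lin_comp[OF \<kappa> s1] j])
  show "?j (\<sigma>0 (\<kappa> Q (aQ Q ac h v))) = V.a (Suc 0) h (?j (\<sigma>0 (\<kappa> Q v)))"
   if "h :[H]" "v :[TQ Q 0]" for h v
   using that by (simp add: \<kappa>a s2 \<kappa>c ja lin_closed[OF s1])
  show "V.\<beta> 0 (?j (\<sigma>0 (\<kappa> Q v))) = v" if "v :[TQ Q 0]" for v
   using that by (simp add: j\<beta> lin_closed[OF s1] \<kappa>c s3 \<iota>_\<kappa>[OF mQ'])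
 qed
qed

lemma relatively_projective_section:
 assumes "relatively_projective R H Q ac"
 shows "\<exists>\<sigma>. bar_section Q ac \<sigma>"
proof -
 have gens: "generates R LQ (tensor_k_gen R H Q ` (carrier H \<times> carrier Q))"
  by (rule tensor_k_generates[OF module_H mQ'])
 have 1: "linear_extension R LQ LQ (carrier H \<times> carrier Q) (tensor_k_gen R H Q) (%(g, x). tQ (h **[H] g) x) =
   restrict (lQ LQ (%g x. tQ (h **[H] g) x)) (carrier LQ)" if h: "h :[H]" for h
  by (rule linear_extension_eq[OF module_LQ module_LQ gens tensor_lift_linear[OF LQ_tensor module_LQ tQm_bilinear[OF h]]])
   (auto simp: tensor_lift_cons[OF LQ_tensor module_LQ tQm_bilinear[OF h]])
 have 2: "linear_extension R LQ Q (carrier H \<times> carrier Q) (tensor_k_gen R H Q) (%(g, x). ac g x) =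
   restrict (lQ Q ac) (carrier LQ)"
  by (rule linear_extension_eq[OF module_LQ mQ' gens tensor_lift_linear[OF LQ_tensor mQ' ac_bilinear]])
   (auto simp: tensor_lift_cons[OF LQ_tensor mQ' ac_bilinear])
 obtain \<sigma> where \<sigma>: "\<sigma> \<in> lin R Q LQ"
  "\<forall>h\<in>carrier H. \<forall>x\<in>carrier Q. \<sigma> (ac h x) = linear_extension R LQ LQ (carrier H \<times> carrier Q) (tensor_k_gen R H Q) (%(g, x). tQ (h **[H] g) x) (\<sigma> x)"
  "\<forall>x\<in>carrier Q. linear_extension R LQ Q (carrier H \<times> carrier Q) (tensor_k_gen R H Q) (%(g, x). ac g x) (\<sigma> x) = x"
  using assms unfolding relatively_projective_def Let_def H_linear_maps_def by blast
 show ?thesis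
  unfolding bar_section_def Let_def
  using \<sigma>(1) \<sigma>(2,3)[unfolded 2] lin_closed[OF \<sigma>(1)] by (intro exI[of _ \<sigma>]) (auto simp: 1)
qed

text \<open>The section sends \<open>q\<close> to the sum over the basis of
  \<open>i q x \<otimes> p (e x)\<close>: the coordinates of \<open>q\<close> in the free module,
  paired with the images of the basis elements. It is equivariant because the coordinates
  are.\<close>

lemma projective_section:
 assumes "projective_left_module R H Q ac"
 shows "\<exists>\<sigma>. bar_section Q ac \<sigma>"
proof -
 interpret H: module R H by (rule module_H)
 obtain X :: "'q set" and i p where i: "i \<in> lin R Q (direct_sum X (%_. H))"
  and ih: "\<forall>h\<in>carrier H. \<forall>x\<in>carrier Q. i (ac h x) = (\<lambda>z\<in>X. h **[H] i x z)"
  and p: "p \<in> lin R (direct_sum X (%_. H)) Q"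
  and ph: "\<forall>h\<in>carrier H. \<forall>f\<in>carrier (direct_sum X (%_. H)). p (\<lambda>z\<in>X. h **[H] f z) = ac h (p f)"
  and pi: "\<forall>x\<in>carrier Q. p (i x) = x"
  using assms unfolding projective_left_module_def Let_def H_linear_maps_def by blast
 let ?W = "direct_sum X (%_. H)"
 define e where "e x = (\<lambda>y\<in>X. if y = x then \<one>[H] else \<zero>[H])" for x
 have mW: "module R ?W" by (rule module_direct_sum[OF is_cring module_H])
 interpret W: module R ?W by (rule mW)
 have ec: "e x :[?W]" if "x \<in> X" for x
 proof -
  have "{y \<in> X. (if y = x then \<one>[H] else \<zero>[H]) \<noteq> \<zero>[H]} \<subseteq> {x}" by auto
  from finite_subset[OF this] show ?thesis by (auto simp: dsum_simps e_def cong: conj_cong)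
 qed
 have pe: "p (e x) :[Q]" if "x \<in> X" for x by (rule lin_closed[OF p ec[OF that]])
 have hW: "(\<lambda>z\<in>X. h **[H] f z) :[?W]" if h: "h :[H]" and f: "f :[?W]" for h f
 proof -
  have "{z \<in> X. h **[H] f z \<noteq> \<zero>[H]} \<subseteq> {z \<in> X. f z \<noteq> \<zero>[H]}" using h by auto
  from finite_subset[OF this] show ?thesis using f h by (auto simp: dsum_simps PiE_iff cong: conj_cong)
 qed
 have g: "(%h. tQ h (p (e x))) \<in> lin R H LQ" if "x \<in> X" for x
  by (rule bilinear_left[OF tQ_bilinear pe[OF that]])
 define \<Phi> where "\<Phi> = direct_sum_ext LQ X (%_. H) (%x h. tQ h (p (e x)))"
 have \<Phi>: "\<Phi> \<in> lin R ?W LQ" unfolding \<Phi>_def by (rule direct_sum_ext_linear[OF module_LQ module_H g])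
 have supp: "finite {x\<in>X. f x \<noteq> \<zero>[H]}" "!!x. x \<in> X ==> f x :[H]" if "f :[?W]" for f
  using that by (auto simp: dsum_simps)
 have gc: "(%x. tQ (f x) (p (e x))) \<in> {x\<in>X. f x \<noteq> \<zero>[H]} \<rightarrow> carrier LQ" if "f :[?W]" for f
  using supp(2)[OF that] lin_closed[OF g] by auto
 have \<Phi>h: "\<Phi> (\<lambda>z\<in>X. h **[H] f z) = lQ LQ (%g x. tQ (h **[H] g) x) (\<Phi> f)" if h: "h :[H]" and f: "f :[?W]" for h f
 proof -
  have "\<Phi> (\<lambda>z\<in>X. h **[H] f z) = (\<Oplus>\<^bsub>LQ\<^esub>x\<in>{x\<in>X. f x \<noteq> \<zero>[H]}. tQ ((\<lambda>z\<in>X. h **[H] f z) x) (p (e x)))"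
   unfolding \<Phi>_def
   by (rule direct_sum_ext_superset[OF module_LQ module_H g]) (use supp[OF f] h in auto)
  also have "... = (\<Oplus>\<^bsub>LQ\<^esub>x\<in>{x\<in>X. f x \<noteq> \<zero>[H]}. lQ LQ (%g x. tQ (h **[H] g) x) (tQ (f x) (p (e x))))"
   using supp(2)[OF f] pe
   by (intro finsum_strong_cong) (simp add: tensor_lift_cons[OF LQ_tensor module_LQ tQm_bilinear[OF h]])
  also have "... = lQ LQ (%g x. tQ (h **[H] g) x) (\<Phi> f)"
   unfolding \<Phi>_def direct_sum_ext_def
   by (rule lin_finsum[OF tensor_lift_linear[OF LQ_tensor module_LQ tQm_bilinear[OF h]] module_LQ module_LQ gc[OF f], symmetric])
  finally show ?thesis .
 qed
 \<comment> \<open>The expansion in the basis with coefficients in \<open>H\<close>;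
   \<open>free_generates\<close> covers only coefficients in the ground ring.\<close>
 have dec: "(\<Oplus>\<^bsub>?W\<^esub>x\<in>{x\<in>X. f x \<noteq> \<zero>[H]}. (\<lambda>z\<in>X. f x **[H] e x z)) = f" (is "?l = f") if f: "f :[?W]" for f
 proof (rule extensionalityI[of _ X])
  have c: "(%x. \<lambda>z\<in>X. f x **[H] e x z) \<in> {x\<in>X. f x \<noteq> \<zero>[H]} \<rightarrow> carrier ?W"
   using hW[OF supp(2)[OF f] ec] by auto
  have "?l :[?W]" by (rule W.finsum_closed[OF c])
  then show "?l \<in> extensional X" by (auto simp: dsum_simps PiE_iff)
  show "f \<in> extensional X" using f by (auto simp: dsum_simps PiE_iff)
  fix y assume y: "y \<in> X"
  have ev: "(%f. f y) \<in> lin R ?W H" using y by (intro linear_mapsI) (auto simp: dsum_simps)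
  have "?l y = (\<Oplus>\<^bsub>H\<^esub>x\<in>{x\<in>X. f x \<noteq> \<zero>[H]}. (\<lambda>z\<in>X. f x **[H] e x z) y)"
   by (rule lin_finsum[OF ev mW module_H c])
  also have "... = (\<Oplus>\<^bsub>H\<^esub>x\<in>{x\<in>X. f x \<noteq> \<zero>[H]}. if y = x then f y else \<zero>[H])"
   using y supp(2)[OF f] by (intro finsum_strong_cong) (auto simp: e_def)
  also have "... = f y"
  proof (cases "f y = \<zero>[H]")
   case True
   have "(\<Oplus>\<^bsub>H\<^esub>x\<in>{x\<in>X. f x \<noteq> \<zero>[H]}. if y = x then f y else \<zero>[H]) = (\<Oplus>\<^bsub>H\<^esub>x\<in>{x\<in>X. f x \<noteq> \<zero>[H]}. \<zero>[H])"
    by (intro finsum_strong_cong) (use True in auto)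
   then show ?thesis using True by simp
  next
   case False
   show ?thesis by (rule abelian_monoid.finsum_singleton[OF abelian_group.axioms(1)[OF module.axioms(2)[OF module_H]], where f = "%_. f y"]) (use False y supp[OF f] in auto)
  qed
  finally show "?l y = f y" .
 qed
 have \<Phi>p: "lQ Q ac (\<Phi> f) = p f" if f: "f :[?W]" for f
 proof -
  have "lQ Q ac (\<Phi> f) = (\<Oplus>\<^bsub>Q\<^esub>x\<in>{x\<in>X. f x \<noteq> \<zero>[H]}. lQ Q ac (tQ (f x) (p (e x))))"
   unfolding \<Phi>_def direct_sum_ext_def
   by (rule lin_finsum[OF tensor_lift_linear[OF LQ_tensor mQ' ac_bilinear] module_LQ mQ' gc[OF f]])
  also have "... = (\<Oplus>\<^bsub>Q\<^esub>x\<in>{x\<in>X. f x \<noteq> \<zero>[H]}. p (\<lambda>z\<in>X. f x **[H] e x z))"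
   using supp(2)[OF f] pe ec ph
   by (intro finsum_strong_cong) (simp add: tensor_lift_cons[OF LQ_tensor mQ' ac_bilinear])
  also have "... = p (\<Oplus>\<^bsub>?W\<^esub>x\<in>{x\<in>X. f x \<noteq> \<zero>[H]}. (\<lambda>z\<in>X. f x **[H] e x z))"
   by (rule lin_finsum[OF p mW mQ', symmetric]) (use hW[OF supp(2)[OF f] ec] in auto)
  finally show ?thesis by (simp add: dec[OF f])
 qed
 show ?thesis
  unfolding bar_section_def Let_def
 proof (intro exI[of _ "%q. \<Phi> (i q)"] conjI ballI)
  show "(%q. \<Phi> (i q)) \<in> lin R Q LQ" by (rule lin_comp[OF i \<Phi>])
  show "\<Phi> (i (ac h q)) = lQ LQ (%g x. tQ (h **[H] g) x) (\<Phi> (i q))" if "h :[H]" "q :[Q]" for h q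
   using \<Phi>h[OF that(1) lin_closed[OF i that(2)]] bspec[OF bspec[OF ih that(1)] that(2)] by simp
  show "lQ Q ac (\<Phi> (i q)) = q" if "q :[Q]" for q
   using \<Phi>p[OF lin_closed[OF i that]] bspec[OF pi that] by simp
 qed
qed

lemma Q_exact:
 assumes "bar_section Q ac \<sigma>" "x :[TQ Q (Suc n)]" "V.bd n x = \<zero>[TQ Q n]"
 shows "\<exists>y\<in>carrier (TQ Q (Suc (Suc n))). x = V.bd (Suc n) y"
proof -
 from tower_section[OF assms(1)] obtain \<sigma> where \<sigma>: "\<sigma> \<in> lin R (TQ Q 0) (TQ Q (Suc 0))"
  "!!h v. [|h :[H]; v :[TQ Q 0]|] ==> \<sigma> (aQ Q ac h v) = V.a (Suc 0) h (\<sigma> v)"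
  "!!v. v :[TQ Q 0] ==> V.\<beta> 0 (\<sigma> v) = v"
  by (elim exE conjE) metis
 show ?thesis by (rule V.bd_exact[OF \<sigma> assms(2,3)])
qed

end

end

section \<open>Flatness: vanishing certificates and exactness\<close>

context module
begin

lemma finsum_swap:
 assumes "finite A" "finite B" "!!i j. [|i \<in> A; j \<in> B|] ==> f i j :[M]"
 shows "(\<Oplus>\<^bsub>M\<^esub>i\<in>A. \<Oplus>\<^bsub>M\<^esub>j\<in>B. f i j) = (\<Oplus>\<^bsub>M\<^esub>j\<in>B. \<Oplus>\<^bsub>M\<^esub>i\<in>A. f i j)"
 using assms(1,3)
proof (induction A rule: finite_induct)
 case (insert a A)
 have c: "(%i. \<Oplus>\<^bsub>M\<^esub>j\<in>B. f i j) \<in> A \<rightarrow> carrier M" "(\<Oplus>\<^bsub>M\<^esub>j\<in>B. f a j) :[M]"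
  "f a \<in> B \<rightarrow> carrier M" "(%j. \<Oplus>\<^bsub>M\<^esub>i\<in>A. f i j) \<in> B \<rightarrow> carrier M"
  using insert.prems by (auto intro!: M.finsum_closed)
 have "(\<Oplus>\<^bsub>M\<^esub>i\<in>insert a A. \<Oplus>\<^bsub>M\<^esub>j\<in>B. f i j) = (\<Oplus>\<^bsub>M\<^esub>j\<in>B. f a j) +[M] (\<Oplus>\<^bsub>M\<^esub>i\<in>A. \<Oplus>\<^bsub>M\<^esub>j\<in>B. f i j)"
  using insert.hyps c by (simp add: M.finsum_insert)
 also have "(\<Oplus>\<^bsub>M\<^esub>i\<in>A. \<Oplus>\<^bsub>M\<^esub>j\<in>B. f i j) = (\<Oplus>\<^bsub>M\<^esub>j\<in>B. \<Oplus>\<^bsub>M\<^esub>i\<in>A. f i j)"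
  using insert.prems by (intro insert.IH) auto
 also have "(\<Oplus>\<^bsub>M\<^esub>j\<in>B. f a j) +[M] ... = (\<Oplus>\<^bsub>M\<^esub>j\<in>B. f a j +[M] (\<Oplus>\<^bsub>M\<^esub>i\<in>A. f i j))"
  using c by (intro M.finsum_addf[symmetric]) auto
 also have "... = (\<Oplus>\<^bsub>M\<^esub>j\<in>B. \<Oplus>\<^bsub>M\<^esub>i\<in>insert a A. f i j)"
  using insert.hyps insert.prems by (intro finsum_strong_cong M.finsum_insert[symmetric]) auto
 finally show ?case .
qed simp

lemma list_sum_finsum:
 assumes "!!x p. [|x \<in> set L; p \<in> P|] ==> f x p :[M]" "finite P"
 shows "(\<Oplus>\<^bsub>M\<^esub>p\<in>P. list_sum M (%x. f x p) L) = list_sum M (%x. \<Oplus>\<^bsub>M\<^esub>p\<in>P. f x p) L"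
 unfolding list_sum_def using assms by (intro finsum_swap) auto

end

lemma (in cring) free_eval_linear: "p \<in> X ==> (%w. w p) \<in> lin R (free_module R X) (self_module R)"
 by (intro linear_mapsI) (auto simp: free_module_simps)

text \<open>\<open>L\<close> certifies that \<open>w\<close> vanishes in \<open>H \<otimes> C\<close>: after the expansion \<open>w(x, m) x = \<Sum> c(x, m) y\<close> over
 the pairs \<open>(y, c)\<close> of \<open>L\<close>, the elements \<open>\<Sum> c(x, m) m\<close> of \<open>C\<close> are 0.\<close>

definition certificate ::
 "('k, 'r) ring_scheme => ('k, 'h, 'm) module_scheme => ('k, 'c, 'n) module_scheme =>
 ('h \<times> 'c => 'k) => ('h \<times> ('h \<times> 'c => 'k)) list => bool"
 where "certificate R H C w L \<longleftrightarrow> (let X = carrier H \<times> carrier C in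
  (\<forall>z\<in>set L. fst z :[H] \<and> snd z :[free_module R X] \<and> free_ext R C X snd (snd z) = \<zero>[C]) \<and>
  (\<forall>p\<in>X. w p *[H] fst p = list_sum H (%z. snd z p *[H] fst z) L))"

context
 fixes R :: "('k, 'r) ring_scheme" and H :: "('k, 'h, 'm) module_scheme" and C :: "('k, 'c, 'n) module_scheme"
 assumes H: "module R H" and C: "module R C"
begin

interpretation H: module R H by (rule H)
interpretation C: module R C by (rule C)

abbreviation XX where "XX \<equiv> carrier H \<times> carrier C"
abbreviation FF where "FF \<equiv> free_module R XX"
abbreviation ev where "ev \<equiv> free_ext R C XX snd"
abbreviation \<delta> where "\<delta> \<equiv> free_gen R XX"
abbreviation cert where "cert \<equiv> certificate R H C"

lemma module_FF: "module R FF" by (rule H.module_free_module)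
interpretation FF: module R FF by (rule module_FF)

lemma snd_XX: "snd \<in> XX \<rightarrow> carrier C" by auto
lemmas ev_linear = C.free_ext_linear[OF snd_XX]
lemmas FF_eval = H.free_eval_linear[of _ XX]
lemmas \<delta>_closed = H.free_gen_closed[of _ XX]

lemma FF_closed: "[|w :[FF]; p \<in> XX|] ==> w p :[R]"
 using lin_closed[OF FF_eval] by simp

lemma \<delta>_smult: "[|p \<in> XX; a \<in> XX|] ==> \<delta> a p *[H] fst p = \<delta> a p *[H] fst a"
 by (auto simp: free_gen_def)

lemma cert_term_closed: "[|cert w L; p \<in> XX; z \<in> set L|] ==> snd z p *[H] fst z :[H]"
 unfolding certificate_def Let_def by (intro H.smult_closed FF_closed) blast+

lemma cert_submodule: "submodule {w \<in> carrier FF. \<exists>L. cert w L} R FF"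
proof -
 have s: "\<exists>L. cert (r *[FF] w) L" if r: "r :[R]" and w: "w :[FF]" and L: "cert w L" for r w L
 proof (intro exI[of _ "map (%z. (r *[H] fst z, snd z)) L"])
  have "(r *[FF] w) p *[H] fst p =
    list_sum H (%z. snd z p *[H] fst z) (map (%z. (r *[H] fst z, snd z)) L)" if p: "p \<in> XX" for p
  proof -
   have c: "snd z p :[R]" "fst z :[H]" if "z \<in> set L" for z
    using L p that FF_closed by (auto simp: certificate_def Let_def)
   have "(r *[FF] w) p *[H] fst p = r *[H] list_sum H (%z. snd z p *[H] fst z) L"
    using L p r FF_closed[OF w p] by (auto simp: certificate_def Let_def free_module_simps H.smult_assoc1)
   also have "... = list_sum H (%z. r *[H] (snd z p *[H] fst z)) L"
    by (rule H.list_sum_linear_map[OF H linear_map_smult[OF lin_id H r] cert_term_closed[OF L p]])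
   also have "... = list_sum H (%z. snd z p *[H] (r *[H] fst z)) L"
    using c r by (intro H.list_sum_cong) (simp_all add: H.smult_assoc1[symmetric] H.m_comm)
   also have "... = list_sum H (%z. snd z p *[H] fst z) (map (%z. (r *[H] fst z, snd z)) L)"
    using c r by (subst H.list_sum_map) simp_all
   finally show ?thesis .
  qed
  then show "cert (r *[FF] w) (map (%z. (r *[H] fst z, snd z)) L)"
   using L r unfolding certificate_def Let_def by auto
 qed
 show ?thesis
 proof (intro FF.submoduleI)
  have "cert \<zero>[FF] []" by (auto simp: certificate_def free_module_simps)
  then show "\<zero>[FF] \<in> {w \<in> carrier FF. \<exists>L. cert w L}" by auto
  fix v assume v: "v \<in> {w \<in> carrier FF. \<exists>L. cert w L}"
  then show "-[FF] v \<in> {w \<in> carrier FF. \<exists>L. cert w L}"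
   using s[of "-[R] \<one>[R]" v] by (auto simp: module_minus_eq[OF module_FF])
  show "r *[FF] v \<in> {w \<in> carrier FF. \<exists>L. cert w L}" if "r :[R]" for r
   using s[OF that] v that by auto
  fix w assume w: "w \<in> {w \<in> carrier FF. \<exists>L. cert w L}"
  from v obtain L where L: "cert v L" by blast
  from w obtain L' where L': "cert w L'" by blast
  have vw: "v :[FF]" "w :[FF]" using v w by auto
  have "cert (v +[FF] w) (L @ L')"
   unfolding certificate_def Let_def
  proof (intro conjI ballI)
   fix p assume p: "p \<in> XX"
   have "(v +[FF] w) p *[H] fst p = v p *[H] fst p +[H] w p *[H] fst p"
    using p FF_closed[OF vw(1) p] FF_closed[OF vw(2) p] by (auto simp: free_module_simps H.smult_l_distr)
   also have "... = list_sum H (%z. snd z p *[H] fst z) (L @ L')"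
    using L L' p H.list_sum_append[where f = "%z. snd z p *[H] fst z" and xs = L and ys = L'] cert_term_closed[OF L p] cert_term_closed[OF L' p]
    by (auto simp: certificate_def Let_def)
   finally show "(v +[FF] w) p *[H] fst p = list_sum H (%z. snd z p *[H] fst z) (L @ L')" .
  qed (use L L' in "auto simp: certificate_def Let_def")
  then show "v +[FF] w \<in> {w \<in> carrier FF. \<exists>L. cert w L}" using vw by auto
 qed auto
qed

lemma FF_rel_eval:
 assumes "a \<in> XX" "b \<in> XX" "p \<in> XX"
 shows "c \<in> XX ==> (\<delta> a -[FF] (\<delta> b +[FF] \<delta> c)) p = \<delta> a p -[R] (\<delta> b p +[R] \<delta> c p)"
  and "r :[R] ==> (\<delta> a -[FF] r *[FF] \<delta> b) p = \<delta> a p -[R] r **[R] \<delta> b p"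
  and "(\<delta> a -[FF] \<delta> b) p = \<delta> a p -[R] \<delta> b p"
proof -
 have D: "(x -[FF] y) p = x p -[R] y p" if "x :[FF]" "y :[FF]" for x y
  using lin_diff[OF FF_eval[OF assms(3)] module_FF module_self_module[OF H.is_cring] that]
  by (simp add: a_minus_def a_inv_def m_inv_def self_module_def)
 note [simp] = D lin_add[OF FF_eval[OF assms(3)]] lin_smult[OF FF_eval[OF assms(3)]] \<delta>_closed
 show "c \<in> XX ==> (\<delta> a -[FF] (\<delta> b +[FF] \<delta> c)) p = \<delta> a p -[R] (\<delta> b p +[R] \<delta> c p)"
  "r :[R] ==> (\<delta> a -[FF] r *[FF] \<delta> b) p = \<delta> a p -[R] r **[R] \<delta> b p"
  "(\<delta> a -[FF] \<delta> b) p = \<delta> a p -[R] \<delta> b p"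
  using assms(1,2) by (simp_all del: mem_Sigma_iff)
qed

text \<open>The elements that possess a certificate form a submodule, so it is enough to certify the
  four kinds of bilinear relations.\<close>

lemma cert_span:
 assumes "w \<in> span_module R FF (bilinear_relations R H C)"
 shows "\<exists>L. cert w L"
proof -
 note dc = FF_closed[OF \<delta>_closed]
 note ev_rel = C.free_ext_relations[OF snd_XX]
 have sm: "(\<alpha> -[R] \<beta>) *[H] x = \<alpha> *[H] x -[H] \<beta> *[H] x" if "\<alpha> :[R]" "\<beta> :[R]" "x :[H]" for \<alpha> \<beta> x
  using that by (simp add: a_minus_def H.smult_l_distr H.smult_l_minus)
 have alg: "\<alpha> *[H] (x +[H] x') -[H] (\<beta> *[H] x +[H] \<gamma> *[H] x') = (\<alpha> -[R] \<beta>) *[H] x +[H] (\<alpha> -[R] \<gamma>) *[H] x'"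
  if "\<alpha> :[R]" "\<beta> :[R]" "\<gamma> :[R]" "x :[H]" "x' :[H]" for \<alpha> \<beta> \<gamma> x x'
  using that by (simp add: sm H.smult_r_distr) (simp add: a_minus_def H.minus_add H.a_ac)
 \<comment> \<open>Relations in the second slot involve a single element of \<open>H\<close>. Their
   certificate has one entry, with the relation itself as its coefficient function.\<close>
 have one: "\<exists>L. cert w L" if "w :[FF]" "ev w = \<zero>[C]" "y :[H]" "!!p. p \<in> XX ==> w p *[H] fst p = w p *[H] y" for w y
 proof (intro exI[of _ "[(y, w)]"])
  have "list_sum H (%z. snd z p *[H] fst z) [(y, w)] = w p *[H] y" if "p \<in> XX" for p
  proof -
   have "w p *[H] y :[H]" by (rule H.smult_closed[OF FF_closed[OF \<open>w :[FF]\<close> that] \<open>y :[H]\<close>])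
   then show ?thesis
    using H.list_sum_Cons[of "%z. snd z p *[H] fst z" "(y, w)" "[]"] by simp
  qed
  then show "cert w [(y, w)]" using that by (simp add: certificate_def)
 qed
 have "bilinear_relations R H C \<subseteq> {w \<in> carrier FF. \<exists>L. cert w L}"
 proof
  fix w assume w: "w \<in> bilinear_relations R H C"
  have wc: "w :[FF]" using w H.bilinear_relations_closed[OF H C] by blast
  from w consider
   (1) x x' m where "w = \<delta> (x +[H] x', m) -[FF] (\<delta> (x, m) +[FF] \<delta> (x', m))" "x :[H]" "x' :[H]" "m :[C]"
   | (2) x m m' where "w = \<delta> (x, m +[C] m') -[FF] (\<delta> (x, m) +[FF] \<delta> (x, m'))" "x :[H]" "m :[C]" "m' :[C]"
   | (3) r x m where "w = \<delta> (r *[H] x, m) -[FF] r *[FF] \<delta> (x, m)" "r :[R]" "x :[H]" "m :[C]"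
   | (4) r x m where "w = \<delta> (x, r *[C] m) -[FF] r *[FF] \<delta> (x, m)" "r :[R]" "x :[H]" "m :[C]"
   unfolding bilinear_relations_def Let_def by blast
  then have "\<exists>L. cert w L"
  proof cases
   case 1
   let ?a = "(x +[H] x', m)" and ?b = "(x, m)" and ?c = "(x', m)"
   have X: "?a \<in> XX" "?b \<in> XX" "?c \<in> XX" using 1 by auto
   \<comment> \<open>Expanding \<open>x + x'\<close> and collecting the multiples of
     \<open>x\<close> and of \<open>x'\<close> leaves two differences of basis elements; both
     evaluate to \<open>m - m\<close> in \<open>C\<close>.\<close>
   have "cert w [(x, \<delta> ?a -[FF] \<delta> ?b), (x', \<delta> ?a -[FF] \<delta> ?c)]"
    unfolding certificate_def Let_def
   proof (intro conjI ballI)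
    fix p assume p: "p \<in> XX"
    then have fp: "fst p :[H]" by auto
    note d = dc[OF X(1) p] dc[OF X(2) p] dc[OF X(3) p]
    have "w p *[H] fst p = \<delta> ?a p *[H] fst p -[H] (\<delta> ?b p *[H] fst p +[H] \<delta> ?c p *[H] fst p)"
     unfolding 1(1) FF_rel_eval(1)[OF X(1,2) p X(3)] using d fp by (simp add: sm H.smult_l_distr)
    also have "... = \<delta> ?a p *[H] (x +[H] x') -[H] (\<delta> ?b p *[H] x +[H] \<delta> ?c p *[H] x')"
     unfolding \<delta>_smult[OF p X(1)] \<delta>_smult[OF p X(2)] \<delta>_smult[OF p X(3)] by simp
    also have "... = (\<delta> ?a p -[R] \<delta> ?b p) *[H] x +[H] (\<delta> ?a p -[R] \<delta> ?c p) *[H] x'"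
     by (rule alg[OF d 1(2,3)])
    also have "... = list_sum H (%z. snd z p *[H] fst z) [(x, \<delta> ?a -[FF] \<delta> ?b), (x', \<delta> ?a -[FF] \<delta> ?c)]"
    proof -
     have "(\<delta> ?a p -[R] \<delta> ?b p) *[H] x :[H]" "(\<delta> ?a p -[R] \<delta> ?c p) *[H] x' :[H]"
      using d 1(2,3) by simp_all
     then show ?thesis
      using FF_rel_eval(3)[OF X(1,2) p] FF_rel_eval(3)[OF X(1,3) p]
      by (subst H.list_sum_Cons, (auto)[2], subst H.list_sum_Cons, auto)
    qed
    finally show "w p *[H] fst p = list_sum H (%z. snd z p *[H] fst z) [(x, \<delta> ?a -[FF] \<delta> ?b), (x', \<delta> ?a -[FF] \<delta> ?c)]" .
   qed (use 1 X \<delta>_closed ev_rel(3)[OF X(1,2)] ev_rel(3)[OF X(1,3)] in "auto simp: C.M.r_neg C.M.minus_eq")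
   then show ?thesis by blast
  next
   case 2
   have X: "(x, m +[C] m') \<in> XX" "(x, m) \<in> XX" "(x, m') \<in> XX" using 2 by auto
   show ?thesis
   proof (rule one[OF wc _ 2(2)])
    show "ev w = \<zero>[C]" unfolding 2(1) ev_rel(1)[OF X(1-3)] using 2 by (simp add: C.M.r_neg C.M.minus_eq)
    show "w p *[H] fst p = w p *[H] x" if p: "p \<in> XX" for p
    proof -
     have fp: "fst p :[H]" using p by auto
     note d = dc[OF X(1) p] dc[OF X(2) p] dc[OF X(3) p]
     show ?thesis
      unfolding 2(1) FF_rel_eval(1)[OF X(1,2) p X(3)] using d fp 2(2) \<delta>_smult[OF p X(1)] \<delta>_smult[OF p X(2)] \<delta>_smult[OF p X(3)]
      by (simp add: sm H.smult_l_distr)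
    qed
   qed
  next
   case 3
   have X: "(r *[H] x, m) \<in> XX" "(x, m) \<in> XX" using 3 by auto
   \<comment> \<open>Both terms of the relation are multiples of \<open>x\<close>: the first through
     its entry \<open>r x\<close>, the second through its coefficient \<open>r\<close>. This
     accounts for the common factor.\<close>
   let ?c = "r *[FF] (\<delta> (r *[H] x, m) -[FF] \<delta> (x, m))"
   have "cert w [(x, ?c)]"
    unfolding certificate_def Let_def
   proof (intro conjI ballI)
    fix p assume p: "p \<in> XX"
    then have fp: "fst p :[H]" by auto
    note d = dc[OF X(1) p] dc[OF X(2) p]
    have cp: "?c p = r **[R] (\<delta> (r *[H] x, m) p -[R] \<delta> (x, m) p)"
     using p FF_rel_eval(3)[OF X p] by (simp add: free_module_simps(4))
    have "w p *[H] fst p = \<delta> (r *[H] x, m) p *[H] (r *[H] x) -[H] r *[H] (\<delta> (x, m) p *[H] x)"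
     unfolding 3(1) FF_rel_eval(2)[OF X p 3(2)] using d fp 3(2,3) \<delta>_smult[OF p X(1)] \<delta>_smult[OF p X(2)]
     by (simp add: sm H.smult_assoc1)
    also have "... = ?c p *[H] x"
     using d 3(2,3) unfolding cp
     by (simp add: H.smult_assoc1 sm lin_diff[OF linear_map_smult[OF lin_id H 3(2)] H H])
      (simp add: H.smult_assoc1[symmetric] H.m_comm)
    finally show "w p *[H] fst p = list_sum H (%z. snd z p *[H] fst z) [(x, ?c)]"
     using d 3(2,3) H.list_sum_Cons[of "%z. snd z p *[H] fst z" "(x, ?c)" "[]"] by (simp add: cp)
   qed (use 3 X \<delta>_closed ev_rel(3)[OF X] lin_smult[OF ev_linear] in "auto simp: C.M.r_neg C.M.minus_eq")
   then show ?thesis by blast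
  next
   case 4
   have X: "(x, r *[C] m) \<in> XX" "(x, m) \<in> XX" using 4 by auto
   show ?thesis
   proof (rule one[OF wc _ 4(3)])
    show "ev w = \<zero>[C]" unfolding 4(1) ev_rel(2)[OF X 4(2)] using 4 by (simp add: C.M.r_neg C.M.minus_eq)
    show "w p *[H] fst p = w p *[H] x" if p: "p \<in> XX" for p
    proof -
     have fp: "fst p :[H]" using p by auto
     note d = dc[OF X(1) p] dc[OF X(2) p]
     show ?thesis
      unfolding 4(1) FF_rel_eval(2)[OF X p 4(2)] using d fp 4(2,3) \<delta>_smult[OF p X(1)] \<delta>_smult[OF p X(2)]
      by (simp add: sm H.smult_assoc1)
    qed
   qed
  qed
  then show "w \<in> {w \<in> carrier FF. \<exists>L. cert w L}" using wc by blast
 qed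
 from span_subset[OF cert_submodule this assms] show ?thesis by blast
qed

context
 assumes flat: "flat_module R H"
begin

text \<open>At a pair \<open>q\<close> with \<open>w q = 0\<close> the certificate is a linear
  relation among its elements of \<open>H\<close>. By flatness these are combinations of elements
  \<open>u j\<close> whose coefficient matrix annihilates the relation; passing to the
  \<open>u j\<close> makes all coefficients at \<open>q\<close> vanish. The new coefficient
  functions are combinations of the old ones, so no other pair is spoiled.\<close>

lemma cert_refine:
 assumes L: "cert w L" and q: "q \<in> XX" "w q = \<zero>[R]"
 shows "\<exists>L'. cert w L' \<and> (\<forall>z\<in>set L'. snd z q = \<zero>[R]) \<and>
  (\<forall>p\<in>XX. (\<forall>z\<in>set L. snd z p = \<zero>[R]) \<longrightarrow> (\<forall>z\<in>set L'. snd z p = \<zero>[R]))"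
proof -
 define n where "n = length L"
 define y where "y i = fst (L ! i)" for i
 define c where "c i = snd (L ! i)" for i
 have yc: "y i :[H]" "c i :[FF]" "ev (c i) = \<zero>[C]" if "i < n" for i
  using L that by (auto simp: certificate_def Let_def y_def c_def n_def)
 have cR: "c i p :[R]" if "i < n" "p \<in> XX" for i p using FF_closed[OF yc(2)] that by blast
 have wL: "w p *[H] fst p = (\<Oplus>\<^bsub>H\<^esub>i\<in>{..<n}. c i p *[H] y i)" if "p \<in> XX" for p
  using L that by (auto simp: certificate_def Let_def list_sum_def n_def y_def c_def)
 have "(\<Oplus>\<^bsub>H\<^esub>i\<in>{..<n}. c i q *[H] y i) = \<zero>[H]" using wL[OF q(1)] q by auto
 then obtain l a u where a: "\<forall>i<n. a i \<in> {..<l::nat} \<rightarrow> carrier R" and u: "u \<in> {..<l} \<rightarrow> carrier H"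
  and yu: "\<forall>i<n. y i = (\<Oplus>\<^bsub>H\<^esub>j\<in>{..<l}. a i j *[H] u j)"
  and ca: "\<forall>j<l. (\<Oplus>\<^bsub>R\<^esub>i\<in>{..<n}. c i q **[R] a i j) = \<zero>[R]"
  using flat[unfolded flat_module_def, rule_format, of "%i. c i q" n y] yc(1) cR[OF _ q(1)] by auto
 have aR: "a i j :[R]" if "i < n" "j < l" for i j using a that by auto
 have uH: "u j :[H]" if "j < l" for j using u that by auto
 define d where "d j = (\<Oplus>\<^bsub>FF\<^esub>i\<in>{..<n}. a i j *[FF] c i)" for j
 have dc: "(%i. a i j *[FF] c i) \<in> {..<n} \<rightarrow> carrier FF" if "j < l" for j using aR yc(2) that by auto
 have dF: "d j :[FF]" if "j < l" for j unfolding d_def by (rule FF.finsum_closed[OF dc[OF that]])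
 have dp: "d j p = (\<Oplus>\<^bsub>R\<^esub>i\<in>{..<n}. a i j **[R] c i p)" if j: "j < l" and p: "p \<in> XX" for j p
 proof -
  have "d j p = (\<Oplus>\<^bsub>self_module R\<^esub>i\<in>{..<n}. (a i j *[FF] c i) p)"
   unfolding d_def by (rule lin_finsum[OF FF_eval[OF p] module_FF module_self_module[OF H.is_cring] dc[OF j]])
  also have "... = (\<Oplus>\<^bsub>self_module R\<^esub>i\<in>{..<n}. a i j **[R] c i p)"
   using p by (intro finsum_strong_cong) (auto simp: free_module_simps(4))
  also have "... = (\<Oplus>\<^bsub>R\<^esub>i\<in>{..<n}. a i j **[R] c i p)"
   by (simp add: finsum_def finprod_def self_module_def)
  finally show ?thesis .
 qed
 define L' where "L' = map (%j. (u j, d j)) [0..<l]"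
 have "cert w L'"
  unfolding certificate_def Let_def
 proof (intro conjI ballI)
  fix z assume "z \<in> set L'"
  then obtain j where j: "j < l" "z = (u j, d j)" by (auto simp: L'_def)
  show "fst z :[H]" "snd z :[FF]" using j uH dF by auto
  have "ev (d j) = (\<Oplus>\<^bsub>C\<^esub>i\<in>{..<n}. ev (a i j *[FF] c i))"
   unfolding d_def by (rule lin_finsum[OF ev_linear module_FF C dc[OF j(1)]])
  also have "... = (\<Oplus>\<^bsub>C\<^esub>i\<in>{..<n}. \<zero>[C])"
   using aR yc j by (intro finsum_strong_cong) (auto simp: lin_smult[OF ev_linear])
  finally show "ev (snd z) = \<zero>[C]" using j by simp
 next
  fix p assume p: "p \<in> XX"
  have "w p *[H] fst p = (\<Oplus>\<^bsub>H\<^esub>i\<in>{..<n}. \<Oplus>\<^bsub>H\<^esub>j\<in>{..<l}. (a i j **[R] c i p) *[H] u j)"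
   unfolding wL[OF p]
  proof (intro finsum_strong_cong)
   fix i assume "i \<in> {..<n}"
   then have i: "i < n" by simp
   have "c i p *[H] y i = (\<Oplus>\<^bsub>H\<^esub>j\<in>{..<l}. c i p *[H] (a i j *[H] u j))"
    using yu i aR[OF i] uH by (auto intro!: lin_finsum[OF linear_map_smult[OF lin_id H cR[OF i p]] H H])
   also have "... = (\<Oplus>\<^bsub>H\<^esub>j\<in>{..<l}. (a i j **[R] c i p) *[H] u j)"
    using aR[OF i] uH cR[OF i p] by (intro finsum_strong_cong) (simp add: H.smult_assoc1[symmetric] H.m_comm)
   finally show "c i p *[H] y i = (\<Oplus>\<^bsub>H\<^esub>j\<in>{..<l}. (a i j **[R] c i p) *[H] u j)" .
  qed
  also have "... = (\<Oplus>\<^bsub>H\<^esub>j\<in>{..<l}. \<Oplus>\<^bsub>H\<^esub>i\<in>{..<n}. (a i j **[R] c i p) *[H] u j)"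
   using aR uH cR[OF _ p] by (intro H.finsum_swap) auto
  also have "... = (\<Oplus>\<^bsub>H\<^esub>j\<in>{..<l}. d j p *[H] u j)"
  proof (intro finsum_strong_cong)
   fix j assume "j \<in> {..<l}"
   then have j: "j < l" by simp
   have "(%r. r *[H] u j) \<in> lin R (self_module R) H"
    using uH[OF j] by (intro linear_mapsI) (auto simp: H.smult_l_distr H.smult_assoc1)
   from lin_finsum[OF this module_self_module[OF H.is_cring] H, of "%i. a i j **[R] c i p" "{..<n}"]
   have "(\<Oplus>\<^bsub>self_module R\<^esub>i\<in>{..<n}. a i j **[R] c i p) *[H] u j = (\<Oplus>\<^bsub>H\<^esub>i\<in>{..<n}. (a i j **[R] c i p) *[H] u j)"
    using aR j cR[OF _ p] by auto
   then show "(\<Oplus>\<^bsub>H\<^esub>i\<in>{..<n}. (a i j **[R] c i p) *[H] u j) = d j p *[H] u j"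
    unfolding dp[OF j p] by (simp add: finsum_def finprod_def self_module_def)
  qed
  also have "... = list_sum H (%z. snd z p *[H] fst z) L'"
   by (auto simp: list_sum_def L'_def intro!: finsum_strong_cong)
  finally show "w p *[H] fst p = list_sum H (%z. snd z p *[H] fst z) L'"
   by (simp add: L'_def)
 qed
 moreover have "\<forall>z\<in>set L'. snd z q = \<zero>[R]"
 proof -
  have "d j q = \<zero>[R]" if j: "j < l" for j
  proof -
   have "d j q = (\<Oplus>\<^bsub>R\<^esub>i\<in>{..<n}. c i q **[R] a i j)"
    unfolding dp[OF j q(1)] using aR[OF _ j] cR[OF _ q(1)] by (intro finsum_strong_cong) (simp add: H.m_comm)
   then show ?thesis using ca j by simp
  qed
  then show ?thesis by (auto simp: L'_def)
 qed
 moreover have "\<forall>z\<in>set L'. snd z p = \<zero>[R]" if p: "p \<in> XX" and z: "\<forall>z\<in>set L. snd z p = \<zero>[R]" for p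
 proof -
  have "d j p = \<zero>[R]" if j: "j < l" for j
  proof -
   have "d j p = (\<Oplus>\<^bsub>R\<^esub>i\<in>{..<n}. \<zero>[R])"
    unfolding dp[OF j p] using aR[OF _ j] z by (intro finsum_strong_cong) (simp add: c_def n_def)
   then show ?thesis by simp
  qed
  then show ?thesis by (auto simp: L'_def)
 qed
 ultimately show ?thesis by blast
qed

lemma cert_support:
 assumes "cert w L"
 shows "\<exists>L. cert w L \<and> (\<forall>p\<in>XX. w p = \<zero>[R] \<longrightarrow> (\<forall>z\<in>set L. snd z p = \<zero>[R]))"
 using assms
proof (induction "card {p \<in> XX. w p = \<zero>[R] \<and> (\<exists>z\<in>set L. snd z p \<noteq> \<zero>[R])}" arbitrary: L rule: less_induct)
 case less
 let ?B = "%L. {p \<in> XX. w p = \<zero>[R] \<and> (\<exists>z\<in>set L. snd z p \<noteq> \<zero>[R])}"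
 show ?case
 proof (cases "?B L = {}")
  case True
  then show ?thesis using less.prems by blast
 next
  case False
  then obtain q where q: "q \<in> ?B L" by blast
  have "?B L \<subseteq> (\<Union>z\<in>set L. {p \<in> XX. snd z p \<noteq> \<zero>[R]})" by blast
  moreover have "finite (\<Union>z\<in>set L. {p \<in> XX. snd z p \<noteq> \<zero>[R]})"
   using less.prems by (auto simp: certificate_def Let_def free_module_simps)
  ultimately have fin: "finite (?B L)" by (rule finite_subset)
  obtain L' where L': "cert w L'" "\<forall>z\<in>set L'. snd z q = \<zero>[R]"
   "\<forall>p\<in>XX. (\<forall>z\<in>set L. snd z p = \<zero>[R]) \<longrightarrow> (\<forall>z\<in>set L'. snd z p = \<zero>[R])"
   using cert_refine[OF less.prems, of q] q by blast
  have "?B L' \<subset> ?B L" using L'(2,3) q by blast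
  from less.hyps[OF psubset_card_mono[OF fin this] L'(1)] show ?thesis .
 qed
qed

end

end

text \<open>Modulo the image of \<open>F\<close>, an element of \<open>TB\<close> is a combination
  of tensors \<open>h \<otimes> s m\<close> with \<open>s\<close> a section of \<open>g\<close> as a
  map of sets. That \<open>G\<close> kills it certifies the vanishing of the corresponding
  combination of \<open>h \<otimes> m\<close>; regrouping along the certificate leaves elements of
  \<open>B\<close> that \<open>g\<close> kills, to which exactness applies.\<close>

theorem flat_exact:
 assumes flat: "flat_module R H"
  and tA: "is_tensor R H A TA cA" and tB: "is_tensor R H B TB cB" and tC: "is_tensor R H C TC cC"
  and f: "f \<in> lin R A B" and g: "g \<in> lin R B C"
  and ex: "!!b. [|b :[B]; g b = \<zero>[C]|] ==> b \<in> f ` carrier A"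
  and F: "F \<in> lin R TA TB" "!!h a. [|h :[H]; a :[A]|] ==> F (cA h a) = cB h (f a)"
  and G: "G \<in> lin R TB TC" "!!h b. [|h :[H]; b :[B]|] ==> G (cB h b) = cC h (g b)"
  and x: "x :[TB]" "G x = \<zero>[TC]"
 shows "x \<in> F ` carrier TA"
proof -
 have m: "module R H" "module R A" "module R B" "module R C" "module R TA" "module R TB" "module R TC"
  and bA: "bilinear R H A TA cA" and bB: "bilinear R H B TB cB" and bC: "bilinear R H C TC cC"
  using tA tB tC by (simp_all add: is_tensor_def)
 interpret B: module R B by (rule m)
 interpret C: module R C by (rule m)
 interpret TA: module R TA by (rule m)
 interpret TB: module R TB by (rule m)
 interpret TC: module R TC by (rule m)
 let ?X = "carrier H \<times> carrier C"
 let ?F = "free_module R ?X"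
 have mF: "module R ?F" by (rule B.module_free_module)
 interpret FF: module R ?F by (rule mF)
 \<comment> \<open>A set-theoretic section of \<open>g\<close> over its image, with zero as default
   value elsewhere. It is not linear, whence the detour through the free module on pairs.\<close>
 define s where "s m = (if m \<in> g ` carrier B then (SOME b. b :[B] \<and> g b = m) else \<zero>[B])" for m
 have s: "s m :[B] \<and> (m \<in> g ` carrier B \<longrightarrow> g (s m) = m)" for m
  using someI_ex[of "%b. b :[B] \<and> g b = m"] by (auto simp: s_def)
 let ?eC = "%p. cC (fst p) (snd p)" and ?eB = "%p. cB (fst p) (s (snd p))"
 have eC: "?eC \<in> ?X \<rightarrow> carrier TC" using bilinear_closed[OF bC] by auto
 have eB: "?eB \<in> ?X \<rightarrow> carrier TB" using bilinear_closed[OF bB] s by auto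
 let ?EC = "free_ext R TC ?X ?eC" and ?EB = "free_ext R TB ?X ?eB"
 note EC = TC.free_ext_linear[OF eC] and EB = TB.free_ext_linear[OF eB]
 define N where "N = {x \<in> carrier TB. \<exists>w\<in>carrier ?F. \<exists>a\<in>carrier TA. (\<forall>p\<in>?X. w p \<noteq> \<zero>[R] \<longrightarrow> snd p \<in> g ` carrier B) \<and>
  G x = ?EC w \<and> x = ?EB w +[TB] F a}"
 have N_I: "x \<in> N" if "x :[TB]" "w :[?F]" "a :[TA]" "\<forall>p\<in>?X. w p \<noteq> \<zero>[R] \<longrightarrow> snd p \<in> g ` carrier B"
  "G x = ?EC w" "x = ?EB w +[TB] F a" for x w a
  using that unfolding N_def by blast
 have N_smult: "r *[TB] x \<in> N" if r: "r :[R]" and x: "x \<in> N" for r x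
 proof -
  from x obtain w a where wa: "x :[TB]" "w :[?F]" "a :[TA]" "\<forall>p\<in>?X. w p \<noteq> \<zero>[R] \<longrightarrow> snd p \<in> g ` carrier B"
   "G x = ?EC w" "x = ?EB w +[TB] F a" unfolding N_def by blast
  have e: "r *[TB] x = ?EB (r *[?F] w) +[TB] F (r *[TA] a)"
   using wa(2,3) r lin_closed[OF EB wa(2)] lin_closed[OF F(1) wa(3)] unfolding wa(6)
   by (simp add: lin_smult[OF EB] lin_smult[OF F(1)] TB.smult_r_distr)
  show ?thesis
  proof (rule N_I[OF _ _ _ _ _ e])
   show "\<forall>p\<in>?X. (r *[?F] w) p \<noteq> \<zero>[R] \<longrightarrow> snd p \<in> g ` carrier B"
   proof (intro ballI impI)
    fix p assume p: "p \<in> ?X" "(r *[?F] w) p \<noteq> \<zero>[R]"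
    then have "w p \<noteq> \<zero>[R]" using r by (auto simp: free_module_simps(4))
    then show "snd p \<in> g ` carrier B" using wa(4) p(1) by blast
   qed
   show "G (r *[TB] x) = ?EC (r *[?F] w)" using wa(1,2,5) r by (simp add: lin_smult[OF G(1)] lin_smult[OF EC])
  qed (use wa(1-3) r in simp_all)
 qed
 have sub: "submodule N R TB"
 proof (intro TB.submoduleI N_smult)
  show "N \<subseteq> carrier TB" by (auto simp: N_def)
  show "\<zero>[TB] \<in> N"
  proof (rule N_I[of _ "\<zero>[?F]" "\<zero>[TA]"])
   show "\<forall>p\<in>?X. \<zero>[?F] p \<noteq> \<zero>[R] \<longrightarrow> snd p \<in> g ` carrier B" by (simp add: free_module_simps(2))
  qed (simp_all add: lin_zero[OF EC mF m(7)] lin_zero[OF EB mF m(6)] lin_zero[OF F(1) m(5,6)] lin_zero[OF G(1) m(6,7)])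
  show "-[TB] x \<in> N" if "x \<in> N" for x
   using N_smult[of "-[R] \<one>[R]" x] that module_minus_eq[OF m(6), of x] by (auto simp: N_def)
  fix x y assume "x \<in> N" "y \<in> N"
  then obtain w a v b where wa: "x :[TB]" "w :[?F]" "a :[TA]" "\<forall>p\<in>?X. w p \<noteq> \<zero>[R] \<longrightarrow> snd p \<in> g ` carrier B"
   "G x = ?EC w" "x = ?EB w +[TB] F a"
   and vb: "y :[TB]" "v :[?F]" "b :[TA]" "\<forall>p\<in>?X. v p \<noteq> \<zero>[R] \<longrightarrow> snd p \<in> g ` carrier B"
   "G y = ?EC v" "y = ?EB v +[TB] F b" unfolding N_def by blast
  have e: "x +[TB] y = ?EB (w +[?F] v) +[TB] F (a +[TA] b)"
   using lin_closed[OF EB wa(2)] lin_closed[OF F(1) wa(3)] lin_closed[OF EB vb(2)] lin_closed[OF F(1) vb(3)]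
   unfolding wa(6) vb(6) lin_add[OF EB wa(2) vb(2)] lin_add[OF F(1) wa(3) vb(3)] by (simp add: TB.a_ac)
  show "x +[TB] y \<in> N"
  proof (rule N_I[OF _ _ _ _ _ e])
   show "\<forall>p\<in>?X. (w +[?F] v) p \<noteq> \<zero>[R] \<longrightarrow> snd p \<in> g ` carrier B"
   proof (intro ballI impI)
    fix p assume p: "p \<in> ?X" "(w +[?F] v) p \<noteq> \<zero>[R]"
    then have "w p \<noteq> \<zero>[R] \<or> v p \<noteq> \<zero>[R]" by (auto simp: free_module_simps(3))
    then show "snd p \<in> g ` carrier B" using wa(4) vb(4) p(1) by blast
   qed
   show "G (x +[TB] y) = ?EC (w +[?F] v)" using wa(1,2,5) vb(1,2,5) by (simp add: lin_add[OF G(1)] lin_add[OF EC])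
  qed (use wa(1-3) vb(1-3) in simp_all)
 qed
 have inN: "cB h b \<in> N" if h: "h :[H]" and b: "b :[B]" for h b
 proof -
  have gb: "g b :[C]" by (rule lin_closed[OF g b])
  have p: "(h, g b) \<in> ?X" using h gb by simp
  have sb: "s (g b) :[B]" "g (s (g b)) = g b" using s[of "g b"] b by auto
  have "g (b -[B] s (g b)) = \<zero>[C]"
   unfolding lin_diff[OF g m(3,4) b sb(1)] sb(2) using gb by (simp add: C.diff_zero_iff)
  then obtain a where a: "a :[A]" "b -[B] s (g b) = f a" using ex[of "b -[B] s (g b)"] b sb(1) by auto
  have fa: "f a :[B]" by (rule lin_closed[OF f a(1)])
  have "b = s (g b) +[B] f a" using a(2) b sb(1) fa by (simp add: B.diff_eq_iff)
  then have "cB h b = cB h (s (g b)) +[TB] F (cA h a)"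
   using lin_add[OF bilinear_right[OF bB h] sb(1) fa] F(2)[OF h a(1)] by simp
  then have e: "cB h b = ?EB (free_gen R ?X (h, g b)) +[TB] F (cA h a)"
   using TB.free_ext_gen[OF eB p] by simp
  show ?thesis
  proof (rule N_I[OF _ _ _ _ _ e])
   show "\<forall>q\<in>?X. free_gen R ?X (h, g b) q \<noteq> \<zero>[R] \<longrightarrow> snd q \<in> g ` carrier B" using b by (auto simp: free_gen_def)
   show "G (cB h b) = ?EC (free_gen R ?X (h, g b))" using G(2)[OF h b] TC.free_ext_gen[OF eC p] by simp
  qed (use bilinear_closed[OF bA h a(1)] bilinear_closed[OF bB h b] B.free_gen_closed[OF p] in simp_all)
 qed
 have "generates R TB ((%(h, b). cB h b) ` (carrier H \<times> carrier B))" using tB by (simp add: is_tensor_def)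
 then have "x \<in> N" by (rule generates_subset[OF _ sub _ x(1)]) (use inN in auto)
 then obtain w a where wa: "w :[?F]" "a :[TA]" "\<forall>p\<in>?X. w p \<noteq> \<zero>[R] \<longrightarrow> snd p \<in> g ` carrier B"
  "G x = ?EC w" "x = ?EB w +[TB] F a" unfolding N_def by blast
 let ?B = "bilinear_relations R H C"
 have relc: "?B \<subseteq> carrier ?F" by (rule B.bilinear_relations_closed[OF m(1,4)])
 obtain u where u: "u \<in> lin R TC (tensor_k R H C)"
  "!!h c. [|h :[H]; c :[C]|] ==> u (cC h c) = tensor_k_gen R H C (h, c)"
  using tC by (auto simp: is_tensor_def)
 have mK: "module R (tensor_k R H C)" by (rule B.module_tensor_k[OF m(1,4)])
 \<comment> \<open>The comparison with the presented tensor product turns the vanishing in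
   \<open>TC\<close> into membership in the span of the bilinear relations, the form in which a
   certificate is available.\<close>
 have "u (?EC w) = span_module R ?F ?B +>\<^bsub>?F\<^esub> w"
 proof (rule generates_linear_eq[OF B.free_generates lin_comp[OF EC u(1)] _ mF mK _ wa(1)])
  show "(%w. span_module R ?F ?B +>\<^bsub>?F\<^esub> w) \<in> lin R ?F (tensor_k R H C)"
   unfolding tensor_k_def by (rule B.presented_proj_linear[OF relc])
  fix y assume "y \<in> free_gen R ?X ` ?X"
  then obtain p where p: "p \<in> ?X" "y = free_gen R ?X p" by blast
  show "u (?EC y) = span_module R ?F ?B +>\<^bsub>?F\<^esub> y"
   using p(1) u(2)[of "fst p" "snd p"] TC.free_ext_gen[OF eC p(1)] unfolding p(2)
   by (auto simp: tensor_k_gen_def presented_gen_def)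
 qed
 then have "span_module R ?F ?B +>\<^bsub>?F\<^esub> w = \<zero>[tensor_k R H C]"
  using wa(4) x(2) lin_zero[OF u(1) m(7) mK] by simp
 then have "w \<in> span_module R ?F ?B"
  using B.presented_proj_zero_iff[OF relc wa(1)] by (simp add: tensor_k_def)
 then obtain L0 where "certificate R H C w L0" using cert_span[OF m(1,4)] by blast
 then obtain L where L: "certificate R H C w L" "\<forall>p\<in>?X. w p = \<zero>[R] \<longrightarrow> (\<forall>z\<in>set L. snd z p = \<zero>[R])"
  using cert_support[OF m(1,4) flat] by blast
 have Lc: "fst z :[H]" "snd z :[?F]" "free_ext R C ?X snd (snd z) = \<zero>[C]" if "z \<in> set L" for z
  using L(1) that by (auto simp: certificate_def Let_def)
 define P where "P = {p \<in> ?X. w p \<noteq> \<zero>[R]}"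
 have P: "finite P" "P \<subseteq> ?X" using wa(1) by (auto simp: P_def free_module_simps(1))
 have wc: "w p :[R]" if "p \<in> ?X" for p using wa(1) that by (auto simp: free_module_simps(1))
 have zc: "snd z p :[R]" if "z \<in> set L" "p \<in> ?X" for z p using Lc(2)[OF that(1)] that(2) by (auto simp: free_module_simps(1))
 have zs: "{p \<in> ?X. snd z p \<noteq> \<zero>[R]} \<subseteq> P" if "z \<in> set L" for z using L(2) that by (auto simp: P_def)
 have sX: "(%p. s (snd p)) \<in> ?X \<rightarrow> carrier B" using s by auto
 let ?b = "%z. free_ext R B ?X (%p. s (snd p)) (snd z)"
 have bP: "?b z = (\<Oplus>\<^bsub>B\<^esub>p\<in>P. snd z p *[B] s (snd p))" if z: "z \<in> set L" for z
  by (rule B.free_ext_superset[OF P(1) zs[OF z] P(2) sX]) (use zc z in auto)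
 have tc: "cB (fst z) (snd z p *[B] s (snd p)) :[TB]" if "z \<in> set L" "p \<in> P" for z p
  using Lc(1)[OF that(1)] zc[OF that(1), of p] that(2) P(2) s by (intro bilinear_closed[OF bB] B.smult_closed) auto
 have "?EB w = (\<Oplus>\<^bsub>TB\<^esub>p\<in>P. w p *[TB] ?eB p)"
  by (rule TB.free_ext_superset[OF P(1) _ P(2) eB]) (use wc in "auto simp: P_def")
 \<comment> \<open>The first entries are expanded according to the certificate, and the scalars are
   moved across the tensor sign to the second entries. Interchanging the two sums then collects, for
   each entry \<open>z\<close>, one element of \<open>B\<close>.\<close>
 also have "... = (\<Oplus>\<^bsub>TB\<^esub>p\<in>P. list_sum TB (%z. cB (fst z) (snd z p *[B] s (snd p))) L)"
 proof (intro finsum_strong_cong)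
  fix p assume "p \<in> P"
  then have p: "p \<in> ?X" using P(2) by blast
  then have fp: "fst p :[H]" by auto
  have sp: "s (snd p) :[B]" using s by blast
  note l = bilinear_left[OF bB sp]
  have tH: "snd z p *[H] fst z :[H]" if "z \<in> set L" for z
   by (rule module.smult_closed[OF m(1) zc[OF that p] Lc(1)[OF that]])
  have "w p *[TB] ?eB p = cB (w p *[H] fst p) (s (snd p))"
   by (rule lin_smult[OF l wc[OF p] fp, symmetric])
  also have "w p *[H] fst p = list_sum H (%z. snd z p *[H] fst z) L"
   using L(1) p by (auto simp: certificate_def Let_def)
  also have "cB ... (s (snd p)) = list_sum TB (%z. cB (snd z p *[H] fst z) (s (snd p))) L"
   by (rule module.list_sum_linear_map[OF m(1) m(6) l tH])
  also have "... = list_sum TB (%z. cB (fst z) (snd z p *[B] s (snd p))) L"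
  proof (rule TB.list_sum_cong)
   fix z assume z: "z \<in> set L"
   show "cB (snd z p *[H] fst z) (s (snd p)) :[TB]" by (rule lin_closed[OF l tH[OF z]])
   show "cB (snd z p *[H] fst z) (s (snd p)) = cB (fst z) (snd z p *[B] s (snd p))"
    using lin_smult[OF l zc[OF z p] Lc(1)[OF z]] lin_smult[OF bilinear_right[OF bB Lc(1)[OF z]] zc[OF z p] sp] by simp
  qed
  finally show "w p *[TB] ?eB p = list_sum TB (%z. cB (fst z) (snd z p *[B] s (snd p))) L" .
 qed
 also have "... = list_sum TB (%z. \<Oplus>\<^bsub>TB\<^esub>p\<in>P. cB (fst z) (snd z p *[B] s (snd p))) L"
  by (rule TB.list_sum_finsum[OF tc P(1)])
 also have "... = list_sum TB (%z. cB (fst z) (?b z)) L"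
 proof (rule TB.list_sum_cong)
  fix z assume z: "z \<in> set L"
  show "(\<Oplus>\<^bsub>TB\<^esub>p\<in>P. cB (fst z) (snd z p *[B] s (snd p))) :[TB]" using tc z by (intro TB.finsum_closed) auto
  show "(\<Oplus>\<^bsub>TB\<^esub>p\<in>P. cB (fst z) (snd z p *[B] s (snd p))) = cB (fst z) (?b z)"
   unfolding bP[OF z]
   by (rule lin_finsum[OF bilinear_right[OF bB Lc(1)[OF z]] m(3) m(6), symmetric]) (use zc[OF z] P(2) s in auto)
 qed
 finally have EBw: "?EB w = list_sum TB (%z. cB (fst z) (?b z)) L" .
 \<comment> \<open>The coefficients of \<open>z\<close> are supported where \<open>s\<close> is a
   section, so applying \<open>g\<close> gives the combination in \<open>C\<close> that the
   certificate declares to be zero.\<close>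
 have "\<exists>t. t :[TA] \<and> cB (fst z) (?b z) = F t" if z: "z \<in> set L" for z
 proof -
  have "g (?b z) = (\<Oplus>\<^bsub>C\<^esub>p\<in>P. g (snd z p *[B] s (snd p)))"
   unfolding bP[OF z] by (rule lin_finsum[OF g m(3,4)]) (use zc[OF z] P(2) s in auto)
  also have "... = (\<Oplus>\<^bsub>C\<^esub>p\<in>P. snd z p *[C] snd p)"
  proof (intro finsum_strong_cong)
   fix p assume p: "p \<in> P"
   have "snd p \<in> g ` carrier B" using wa(3) p by (auto simp: P_def)
   then show "g (snd z p *[B] s (snd p)) = snd z p *[C] snd p"
    using lin_smult[OF g zc[OF z], of p "s (snd p)"] s[of "snd p"] p P(2) by auto
  qed
  also have "... = free_ext R C ?X snd (snd z)"
   by (rule C.free_ext_superset[OF P(1) zs[OF z] P(2), symmetric]) (use zc[OF z] in auto)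
  finally have "g (?b z) = \<zero>[C]" using Lc(3)[OF z] by simp
  then obtain a where "a :[A]" "?b z = f a"
   using ex[OF lin_closed[OF B.free_ext_linear[OF sX] Lc(2)[OF z]]] by auto
  then show ?thesis using F(2)[OF Lc(1)[OF z]] bilinear_closed[OF bA Lc(1)[OF z]] by (intro exI[of _ "cA (fst z) a"]) auto
 qed
 then obtain t where t: "!!z. z \<in> set L ==> t z :[TA]" "!!z. z \<in> set L ==> cB (fst z) (?b z) = F (t z)" by metis
 have tL: "list_sum TA t L :[TA]" by (rule TA.list_sum_closed[OF t(1)])
 have "?EB w = list_sum TB (%z. F (t z)) L"
  unfolding EBw using t lin_closed[OF F(1)] by (intro TB.list_sum_cong) auto
 also have "... = F (list_sum TA t L)" by (rule TA.list_sum_linear_map[OF m(6) F(1) t(1), symmetric])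
 finally have "x = F (list_sum TA t L +[TA] a)"
  unfolding wa(5) using lin_add[OF F(1) tL wa(2)] by simp
 then show ?thesis using tL wa(2) by auto
qed

section \<open>Exactness after tensoring with tensor powers\<close>

definition (in hopf_algebra) qm :: "('k, 'q) module => ('k, 'p) module => nat => ('q => 'p) =>
  (('h list => 'k) set \<times> 'q => 'k) set => (('h list => 'k) set \<times> 'p => 'k) set"
 where "qm Q Q' n f = ext Q n (TQ Q' n) (%t q. gen Q' n t (f q))"

context hopf_algebra
begin

context
 fixes Q :: "('k, 'q) module" and Q' :: "('k, 'p) module" and f :: "'q => 'p"
 assumes Q: "module R Q" and Q': "module R Q'" and f: "f \<in> lin R Q Q'"
begin

lemma qm_inner: "bilinear R (T n) Q (TQ Q' n) (%t q. gen Q' n t (f q))"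
 by (rule bilinear_precomp[OF gen_bilinear[OF Q'] lin_id f])

lemma qm_linear: "qm Q Q' n f \<in> lin R (TQ Q n) (TQ Q' n)"
 unfolding qm_def by (rule ext_linear[OF Q module_TQ[OF Q'] qm_inner])

lemma qm_gen: "[|t :[T n]; q :[Q]|] ==> qm Q Q' n f (gen Q n t q) = gen Q' n t (f q)"
 unfolding qm_def by (rule ext_gen[OF Q module_TQ[OF Q'] qm_inner])

lemma qm_cQ:
 assumes h: "h :[H]" and v: "v :[TQ Q n]"
 shows "qm Q Q' (Suc n) f (cQ Q n h v) = cQ Q' n h (qm Q Q' n f v)"
 by (rule TQ_eqI[OF Q module_TQ[OF Q'] lin_comp[OF bilinear_right[OF cQ_bilinear[OF Q] h] qm_linear]
    lin_comp[OF qm_linear bilinear_right[OF cQ_bilinear[OF Q'] h]] _ v])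
  (use h lin_closed[OF f] in "simp add: cQ_gen[OF Q] cQ_gen[OF Q'] qm_gen")

end

definition tensor_exact :: "('k, 'a) module => ('a => 'b) => ('k, 'b) module => ('b => 'c) => ('k, 'c) module => bool"
 where "tensor_exact A f B g C \<longleftrightarrow> (\<forall>n x. x :[TQ B n] \<longrightarrow> qm B C n g x = \<zero>[TQ C n] \<longrightarrow>
  (\<exists>y\<in>carrier (TQ A n). x = qm A B n f y))"

context
 fixes A :: "('k, 'a) module" and B :: "('k, 'b) module" and C :: "('k, 'c) module" and f g
 assumes m: "module R A" "module R B" "module R C"
  and f: "f \<in> lin R A B" and g: "g \<in> lin R B C"
begin

text \<open>As \<open>T (Suc n) \<otimes> A\<close> is the tensor product of \<open>H\<close> with
  \<open>T n \<otimes> A\<close>, flatness of \<open>H\<close> is applied once for each factor. In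
  degree 0 the exactness is that of the given sequence, up to \<open>\<iota>\<close> and
  \<open>\<kappa>\<close>.\<close>

lemma flat_tensor_exact:
 assumes flat: "flat_module R H" and ex: "!!b. [|b :[B]; g b = \<zero>[C]|] ==> b \<in> f ` carrier A"
 shows "tensor_exact A f B g C"
proof -
 note F = qm_linear[OF m(1,2) f] and G = qm_linear[OF m(2,3) g]
 have "x \<in> qm A B n f ` carrier (TQ A n)" if "x :[TQ B n]" "qm B C n g x = \<zero>[TQ C n]" for n x
  using that
 proof (induction n arbitrary: x)
  case 0
  let ?k = "\<kappa> B x"
  have k: "?k :[B]" "\<iota> B ?k = x" using lin_closed[OF \<kappa>_linear[OF m(2)] 0(1)] \<iota>_\<kappa>[OF m(2) 0(1)] by auto
  have "g ?k = \<kappa> C (\<iota> C (g ?k))" by (rule \<kappa>_\<iota>[OF m(3) lin_closed[OF g k(1)], symmetric])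
  also have "\<iota> C (g ?k) = qm B C 0 g x" using qm_gen[OF m(2,3) g pure_Nil_closed k(1)] k(2) by simp
  also have "\<kappa> C ... = \<zero>[C]" unfolding 0(2) by (rule lin_zero[OF \<kappa>_linear[OF m(3)] module_TQ[OF m(3)] m(3)])
  finally obtain a where a: "a :[A]" "?k = f a" using ex[OF k(1)] by auto
  have "x = qm A B 0 f (\<iota> A a)" using qm_gen[OF m(1,2) f pure_Nil_closed a(1)] a(2) k(2) by simp
  then show ?case using lin_closed[OF \<iota>_linear[OF m(1)] a(1)] by auto
 next
  case (Suc n)
  show ?case
   by (rule flat_exact[OF flat cQ_tensor[OF m(1)] cQ_tensor[OF m(2)] cQ_tensor[OF m(3)] F G Suc.IH F qm_cQ[OF m(1,2) f] G qm_cQ[OF m(2,3) g] Suc.prems])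
 qed
 then show ?thesis unfolding tensor_exact_def by blast
qed

text \<open>A contraction is an identity between linear maps, and tensoring with \<open>T n\<close>
  preserves it.\<close>

lemma split_tensor_exact:
 assumes s: "s \<in> lin R B A" and s': "s' \<in> lin R C B"
  and e: "!!b. b :[B] ==> f (s b) +[B] s' (g b) = b"
 shows "tensor_exact A f B g C"
 unfolding tensor_exact_def
proof (intro allI impI)
 fix n x assume x: "x :[TQ B n]" "qm B C n g x = \<zero>[TQ C n]"
 interpret V: module R "TQ B n" by (rule module_TQ[OF m(2)])
 note l = qm_linear[OF m(1,2) f] qm_linear[OF m(2,3) g] qm_linear[OF m(2,1) s] qm_linear[OF m(3,2) s']
 note lg = qm_gen[OF m(1,2) f] qm_gen[OF m(2,3) g] qm_gen[OF m(2,1) s] qm_gen[OF m(3,2) s']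
 have "qm A B n f (qm B A n s x) +[TQ B n] qm C B n s' (qm B C n g x) = x"
 proof (rule TQ_eqI[OF m(2) module_TQ[OF m(2)] lin_map_add[OF lin_comp[OF l(3,1)] lin_comp[OF l(2,4)] module_TQ[OF m(2)]] lin_id _ x(1)])
  fix t q assume t: "t :[T n]" and q: "q :[B]"
  have c: "s q :[A]" "g q :[C]" "f (s q) :[B]" "s' (g q) :[B]"
   using q by (simp_all add: lin_closed[OF s] lin_closed[OF g] lin_closed[OF f] lin_closed[OF s'])
  show "qm A B n f (qm B A n s (gen B n t q)) +[TQ B n] qm C B n s' (qm B C n g (gen B n t q)) = gen B n t q"
   using lin_add[OF bilinear_right[OF gen_bilinear[OF m(2)] t] c(3,4), unfolded e[OF q], symmetric] t q c by (simp add: lg)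
 qed
 then have "x = qm A B n f (qm B A n s x)"
  using lin_zero[OF l(4) module_TQ[OF m(3)] module_TQ[OF m(2)]] lin_closed[OF l(1) lin_closed[OF l(3) x(1)]] x(2) by simp
 then show "\<exists>y\<in>carrier (TQ A n). x = qm A B n f y" using lin_closed[OF l(3) x(1)] by auto
qed

end

end

section \<open>Comparison with Tor\<close>

context hopf_algebra
begin

abbreviation k where "k \<equiv> self_module R"
abbreviation tH where "tH Q ac \<equiv> tensor_H R H (self_module R) (trivial_right_action R \<epsilon>) Q ac"
abbreviation gH where "gH Q ac r q \<equiv> tensor_H_gen R H (self_module R) (trivial_right_action R \<epsilon>) Q ac (r, q)"
abbreviation bdQ where "bdQ Q ac \<equiv> bar_tower.bd R H \<epsilon> (TQ Q) (cQ Q) (aQ Q ac)"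

lemma module_k: "module R k" by (rule module_self_module[OF is_cring])

text \<open>The augmentation of the bar complex with coefficients in \<open>Q\<close>, with values
  in the term of the Tor complex that belongs to \<open>Q\<close>.\<close>

definition \<gamma> where "\<gamma> Q ac = ext Q 0 (tH Q ac) (%t q. gH Q ac (eT t) q)"

context
 fixes Q :: "('k, 'q) module" and ac :: "'h => 'q => 'q"
 assumes lmQ: "left_module R H Q ac"
begin

interpretation Q: left_module R H Q ac by (rule lmQ)
interpretation V: bar_tower R H \<Delta> \<epsilon> S "TQ Q" "cQ Q" "aQ Q ac" by (rule Q_tower[OF lmQ])
lemmas mQ2 = mQ[OF lmQ]

abbreviation XH where "XH \<equiv> carrier k \<times> carrier Q"
abbreviation rels where "rels \<equiv> bilinear_relations R k Q \<union> balanced_relations R H k (trivial_right_action R \<epsilon>) Q ac"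

lemma ac_closed [simp]: "[|h :[H]; q :[Q]|] ==> ac h q :[Q]"
 by (rule lin_closed[OF Q.act_linear])

lemma rels_closed: "rels \<subseteq> carrier (free_module R XH)"
proof -
 interpret F: module R "free_module R XH" by (rule module_free_module)
 have "balanced_relations R H k (trivial_right_action R \<epsilon>) Q ac \<subseteq> carrier (free_module R XH)"
 proof
  fix w assume "w \<in> balanced_relations R H k (trivial_right_action R \<epsilon>) Q ac"
  then obtain r h q where w: "w = free_gen R XH (r **[R] \<epsilon> h, q) -[free_module R XH] free_gen R XH (r, ac h q)"
   and rhq: "r :[R]" "h :[H]" "q :[Q]"
   unfolding balanced_relations_def Let_def trivial_right_action_def by auto
  show "w :[free_module R XH]"
   unfolding w by (rule F.minus_closed[OF free_gen_closed free_gen_closed]) (use rhq in auto)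
 qed
 then show ?thesis using bilinear_relations_closed[OF module_k mQ2] by blast
qed

lemma module_tH: "module R (tH Q ac)"
 unfolding tensor_H_def by (rule module_presented[OF rels_closed])

lemma tH_generates: "generates R (tH Q ac) (tensor_H_gen R H k (trivial_right_action R \<epsilon>) Q ac ` XH)"
 unfolding tensor_H_def tensor_H_gen_def by (rule presented_generates[OF rels_closed])

lemma gH_bilinear: "bilinear R k Q (tH Q ac) (gH Q ac)"
 unfolding tensor_H_def tensor_H_gen_def by (rule presented_gen_bilinear[OF module_k mQ2 rels_closed]) simp

lemma gH_balanced:
 assumes "r :[R]" "h :[H]" "q :[Q]"
 shows "gH Q ac (r **[R] \<epsilon> h) q = gH Q ac r (ac h q)"
 unfolding tensor_H_gen_def
proof (rule presented_relations(3)[OF rels_closed])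
 show "free_gen R XH (r **[R] \<epsilon> h, q) -[free_module R XH] free_gen R XH (r, ac h q) \<in> rels"
  using assms by (intro UnI2) (force simp: balanced_relations_def Let_def trivial_right_action_def)
qed (use assms in auto)

lemma tH_lift:
 assumes L: "module R L" and b: "bilinear R k Q L \<beta>"
  and bal: "!!r h q. [|r :[R]; h :[H]; q :[Q]|] ==> \<beta> (r **[R] \<epsilon> h) q = \<beta> r (ac h q)"
 shows "\<exists>g. g \<in> lin R (tH Q ac) L \<and> (\<forall>r\<in>carrier R. \<forall>q\<in>carrier Q. g (gH Q ac r q) = \<beta> r q)"
proof -
 interpret L: module R L by (rule L)
 have c: "(%(r, q). \<beta> r q) \<in> XH \<rightarrow> carrier L" using bilinear_closed[OF b] by auto
 have z: "free_ext R L XH (%(r, q). \<beta> r q) w = \<zero>[L]" if "w \<in> rels" for w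
  using that
 proof
  assume "w \<in> bilinear_relations R k Q"
  then show ?thesis by (rule bilinear_relations_zero[OF module_k mQ2 L b])
 next
  assume "w \<in> balanced_relations R H k (trivial_right_action R \<epsilon>) Q ac"
  then obtain r h q where w: "w = free_gen R XH (r **[R] \<epsilon> h, q) -[free_module R XH] free_gen R XH (r, ac h q)"
   and rhq: "r :[R]" "h :[H]" "q :[Q]"
   unfolding balanced_relations_def Let_def trivial_right_action_def by auto
  have X: "(r **[R] \<epsilon> h, q) \<in> XH" "(r, ac h q) \<in> XH" using rhq by auto
  have "\<beta> r (ac h q) :[L]" by (rule bilinear_closed[OF b]) (use rhq in auto)
  then show ?thesis unfolding w L.free_ext_relations(3)[OF c X] using bal[OF rhq] by (simp add: L.diff_zero_iff)
 qed
 from presented_lift[OF rels_closed L c z]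
 obtain g where g: "g \<in> lin R (tH Q ac) L"
  "!!x. x \<in> XH ==> g (tensor_H_gen R H k (trivial_right_action R \<epsilon>) Q ac x) = (%(r, q). \<beta> r q) x"
  unfolding tensor_H_def tensor_H_gen_def by blast
 then show ?thesis by (intro exI[of _ g]) auto
qed

lemma \<gamma>_inner: "bilinear R (T 0) Q (tH Q ac) (%t q. gH Q ac (eT t) q)"
 by (rule bilinear_precomp[OF gH_bilinear eT_linear lin_id])

lemma \<gamma>_linear: "\<gamma> Q ac \<in> lin R (TQ Q 0) (tH Q ac)"
 unfolding \<gamma>_def by (rule ext_linear[OF mQ2 module_tH \<gamma>_inner])

lemma \<gamma>_gen: "[|t :[T 0]; q :[Q]|] ==> \<gamma> Q ac (gen Q 0 t q) = gH Q ac (eT t) q"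
 unfolding \<gamma>_def by (rule ext_gen[OF mQ2 module_tH \<gamma>_inner])

lemma \<gamma>_smult_\<iota>: "[|r :[R]; q :[Q]|] ==> \<gamma> Q ac (r *[TQ Q 0] \<iota> Q q) = gH Q ac r q"
 using lin_smult[OF bilinear_left[OF gH_bilinear], of q r "\<one>[R]"] lin_closed[OF \<iota>_linear[OF mQ2], of q]
 by (simp add: lin_smult[OF \<gamma>_linear] \<gamma>_gen eT_Nil)

lemma \<gamma>_surj:
 assumes "y :[tH Q ac]"
 shows "\<exists>x\<in>carrier (TQ Q 0). \<gamma> Q ac x = y"
proof -
 interpret V0: module R "TQ Q 0" by simp
 have "y \<in> \<gamma> Q ac ` carrier (TQ Q 0)"
 proof (rule generates_subset[OF tH_generates linear_image_submodule[OF \<gamma>_linear V.module_V module_tH] _ assms])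
  fix x assume "x \<in> tensor_H_gen R H k (trivial_right_action R \<epsilon>) Q ac ` XH"
  then obtain r q where rq: "r :[R]" "q :[Q]" "x = gH Q ac r q" by auto
  show "x \<in> \<gamma> Q ac ` carrier (TQ Q 0)"
   using \<gamma>_smult_\<iota>[OF rq(1,2)] rq lin_closed[OF \<iota>_linear[OF mQ2] rq(2)] by (intro image_eqI[of _ _ "r *[TQ Q 0] \<iota> Q q"]) auto
 qed
 then show ?thesis by auto
qed

lemma \<gamma>_bd:
 assumes "x :[TQ Q (Suc 0)]"
 shows "\<gamma> Q ac (V.bd 0 x) = \<zero>[tH Q ac]"
proof -
 interpret K: module R "tH Q ac" by (rule module_tH)
 interpret V0: module R "TQ Q 0" by simp
 show ?thesis
 proof (rule is_tensor_eq[OF V.V_tensor module_tH lin_comp[OF V.bd_linear \<gamma>_linear] lin_const_zero[OF module_tH] _ assms])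
  fix h v assume h: "h :[H]" and v: "v :[TQ Q 0]"
  have e: "V.bd 0 (cQ Q 0 h v) = \<epsilon> h *[TQ Q 0] v -[TQ Q 0] aQ Q ac h v"
   using h v by (simp add: V.bd_def V.\<beta>_c_0 V.a.simps)
  have ac: "aQ Q ac h \<in> lin R (TQ Q 0) (TQ Q 0)" by (rule bilinear_right[OF aQ_bilinear[OF lmQ] h])
  have "\<epsilon> h *[tH Q ac] \<gamma> Q ac v = \<gamma> Q ac (aQ Q ac h v)"
  proof (rule TQ_eqI[OF mQ2 module_tH linear_map_smult[OF \<gamma>_linear module_tH eps_closed[OF h]] lin_comp[OF ac \<gamma>_linear] _ v])
   fix t q assume tq: "t :[T 0]" "q :[Q]"
   have "\<epsilon> h *[tH Q ac] gH Q ac (eT t) q = gH Q ac (eT t **[R] \<epsilon> h) q"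
    using lin_smult[OF bilinear_left[OF gH_bilinear tq(2)], of "\<epsilon> h" "eT t"] h tq(1)
    by (simp add: comm_monoid.m_comm[OF cring.axioms(2)[OF is_cring]])
   then show "\<epsilon> h *[tH Q ac] \<gamma> Q ac (gen Q 0 t q) = \<gamma> Q ac (aQ Q ac h (gen Q 0 t q))"
    using h tq by (simp add: \<gamma>_gen aQ_gen[OF lmQ] gH_balanced)
  qed
  then show "\<gamma> Q ac (V.bd 0 (cQ Q 0 h v)) = \<zero>[tH Q ac]"
   unfolding e using h v lin_closed[OF ac v] lin_closed[OF \<gamma>_linear]
   by (simp add: lin_diff[OF \<gamma>_linear V.module_V module_tH] lin_smult[OF \<gamma>_linear] K.diff_zero_iff)
 qed
qed

text \<open>The target of \<open>\<gamma>\<close> has the universal property of the cokernel of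
  \<open>bd 0\<close>. It yields a map back to the quotient by the image of \<open>bd 0\<close>, and
  that quotient detects membership in the image.\<close>

lemma \<gamma>_exact:
 assumes x: "x :[TQ Q 0]" "\<gamma> Q ac x = \<zero>[tH Q ac]"
 shows "\<exists>y\<in>carrier (TQ Q (Suc 0)). x = V.bd 0 y"
proof -
 interpret V0: module R "TQ Q 0" by simp
 let ?I = "V.bd 0 ` carrier (TQ Q (Suc 0))"
 have I: "submodule ?I R (TQ Q 0)" by (rule linear_image_submodule[OF V.bd_linear V.module_V V.module_V])
 define L where "L = quotient_module (TQ Q 0) ?I"
 define p where "p v = ?I +>\<^bsub>TQ Q 0\<^esub> v" for v
 have L: "module R L" unfolding L_def by (rule quotient_module_module[OF V.module_V I])
 have p: "p \<in> lin R (TQ Q 0) L" unfolding p_def[abs_def] L_def by (rule quotient_proj_linear[OF V.module_V I])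
 interpret L: module R L by (rule L)
 have pz: "p v = \<zero>[L] \<longleftrightarrow> v \<in> ?I" if "v :[TQ Q 0]" for v
  unfolding p_def L_def by (rule quotient_proj_zero[OF V.module_V I that])
 have \<iota>c: "\<iota> Q q :[TQ Q 0]" if "q :[Q]" for q by (rule lin_closed[OF \<iota>_linear[OF mQ2] that])
 have pa: "p (aQ Q ac h v) = \<epsilon> h *[L] p v" if h: "h :[H]" and v: "v :[TQ Q 0]" for h v
 proof -
  have a: "aQ Q ac h v :[TQ Q 0]" by (rule bilinear_closed[OF aQ_bilinear[OF lmQ] h v])
  have "V.bd 0 (cQ Q 0 h v) = \<epsilon> h *[TQ Q 0] v -[TQ Q 0] aQ Q ac h v"
   using h v by (simp add: V.bd_def V.\<beta>_c_0 V.a.simps)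
  then have e: "\<epsilon> h *[TQ Q 0] v -[TQ Q 0] aQ Q ac h v \<in> ?I" by (rule image_eqI[OF sym]) (rule V.c_closed[OF h v])
  have ev: "\<epsilon> h *[TQ Q 0] v :[TQ Q 0]" by (rule V0.smult_closed[OF eps_closed[OF h] v])
  have "p (\<epsilon> h *[TQ Q 0] v) -[L] p (aQ Q ac h v) = \<zero>[L]"
   using e unfolding pz[OF V0.minus_closed[OF ev a], symmetric] lin_diff[OF p V.module_V L ev a] .
  then have "p (\<epsilon> h *[TQ Q 0] v) = p (aQ Q ac h v)"
   by (simp only: L.diff_zero_iff[OF lin_closed[OF p ev] lin_closed[OF p a]])
  then show ?thesis using lin_smult[OF p eps_closed[OF h] v] by simp
 qed
 have pb: "bilinear R k Q L (%r q. r *[L] p (\<iota> Q q))"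
 proof (rule bilinearI)
  show "(%q. r *[L] p (\<iota> Q q)) \<in> lin R Q L" if "r :[k]" for r
   by (rule linear_map_smult[OF lin_comp[OF \<iota>_linear[OF mQ2] p] L]) (use that in simp)
  show "(%r. r *[L] p (\<iota> Q q)) \<in> lin R k L" if "q :[Q]" for q
   using lin_closed[OF p \<iota>c[OF that]] by (intro linear_mapsI) (auto simp: L.smult_l_distr L.smult_assoc1)
 qed
 have "\<exists>g. g \<in> lin R (tH Q ac) L \<and> (\<forall>r\<in>carrier R. \<forall>q\<in>carrier Q. g (gH Q ac r q) = r *[L] p (\<iota> Q q))"
 proof (rule tH_lift[OF L pb])
  fix r h q assume rhq: "r :[R]" "h :[H]" "q :[Q]"
  have "p (\<iota> Q (ac h q)) = \<epsilon> h *[L] p (\<iota> Q q)"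
   using pa[OF rhq(2) \<iota>c[OF rhq(3)]] rhq by (simp add: aQ_gen[OF lmQ])
  then show "(r **[R] \<epsilon> h) *[L] p (\<iota> Q q) = r *[L] p (\<iota> Q (ac h q))"
   using L.smult_assoc1[OF rhq(1) eps_closed[OF rhq(2)] lin_closed[OF p \<iota>c[OF rhq(3)]]] by simp
 qed
 then obtain g where g: "g \<in> lin R (tH Q ac) L" "\<forall>r\<in>carrier R. \<forall>q\<in>carrier Q. g (gH Q ac r q) = r *[L] p (\<iota> Q q)"
  by blast
 let ?q = "\<kappa> Q x"
 have q: "?q :[Q]" "\<iota> Q ?q = x" using lin_closed[OF \<kappa>_linear[OF mQ2] x(1)] \<iota>_\<kappa>[OF mQ2 x(1)] by auto
 have "\<gamma> Q ac x = gH Q ac \<one>[R] ?q" using \<gamma>_gen[OF pure_Nil_closed q(1)] unfolding q(2) eT_Nil .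
 then have "g \<zero>[tH Q ac] = \<one>[R] *[L] p x" using g(2) q x(2) by simp
 then have "p x = \<zero>[L]" using lin_zero[OF g(1) module_tH L] lin_closed[OF p x(1)] by simp
 then show ?thesis using pz[OF x(1)] by blast
qed

end

lemma chain_complex_bar: "chain_complex R T T.bd"
 by (intro chain_complex.intro module_T T.bd_linear T.bd_bd)

text \<open>The hypotheses are what both kinds of admissible resolutions provide. The second
  conclusion is used when the degreewise isomorphisms are assembled to one of direct sums.\<close>

lemma tensor_resolution_homology:
 assumes res: "left_resolution R H k (trivial_left_action R \<epsilon>) Q ac d aug"
  and sec: "!!q. \<exists>\<sigma>. bar_section (Q q) (ac q) \<sigma>"
  and ex0: "tensor_exact (Q (Suc 0)) (d 0) (Q 0) aug k"
  and exS: "!!q. tensor_exact (Q (Suc (Suc q))) (d (Suc q)) (Q (Suc q)) (d q) (Q q)"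
 shows "isomorphic_modules R (chain_homology T T.bd i) (hopf_homology R H \<epsilon> Q ac d i)"
  and "module R (hopf_homology R H \<epsilon> Q ac d i)"
proof -
 interpret res: left_resolution R H k "trivial_left_action R \<epsilon>" Q ac d aug by (rule res)
 have lm: "left_module R H (Q q) (ac q)" for q by (rule res.left_modules)
 note mq = mQ[OF lm]
 have dl: "d q \<in> lin R (Q (Suc q)) (Q q)" for q using res.diff_linear[of q] by (simp add: H_linear_maps_def)
 have da: "d q (ac (Suc q) h x) = ac q h (d q x)" if "h :[H]" "x :[Q (Suc q)]" for q h x
  using res.diff_linear[of q] that by (simp add: H_linear_maps_def)
 have al: "aug \<in> lin R (Q 0) k" using res.aug_linear by (simp add: H_linear_maps_def)
 have aa: "aug (ac 0 h x) = \<epsilon> h **[R] aug x" if "h :[H]" "x :[Q 0]" for h x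
  using res.aug_linear that by (simp add: H_linear_maps_def trivial_left_action_def)
 have augc: "aug x :[R]" if "x :[Q 0]" for x using lin_closed[OF al that] by simp
 have dc: "d q x :[Q q]" if "x :[Q (Suc q)]" for q x by (rule lin_closed[OF dl that])
 have dd0: "d q (d (Suc q) x) = \<zero>[Q q]" if "x :[Q (Suc (Suc q))]" for q x
  using res.exact_Suc[of q] that by (auto simp: a_kernel_def' set_eq_iff)
 have ad0: "aug (d 0 x) = \<zero>[k]" if "x :[Q (Suc 0)]" for x
  using res.exact_zero that by (auto simp: a_kernel_def' set_eq_iff)
 let ?A = "%p q. TQ (Q q) p" and ?\<eta> = "%p q. bdQ (Q q) (ac q) p" and ?\<delta> = "%p q. qm (Q (Suc q)) (Q q) p (d q)"
 note tow = Q_tower[OF lm]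
 note bdl = bar_tower.bd_linear[OF tow] and bd0 = bar_tower.bd_bd[OF tow]
 note ql = qm_linear[OF mq mq dl] and qg = qm_gen[OF mq mq dl]
 have comm: "?\<delta> p q (?\<eta> p (Suc q) x) = ?\<eta> p q (?\<delta> (Suc p) q x)" if x: "x :[?A (Suc p) (Suc q)]" for p q x
 proof (rule bar_tower_map[where f = "%p. ?\<delta> p q" and V = "TQ (Q (Suc q))" and V' = "TQ (Q q)" and c = "cQ (Q (Suc q))"
    and c' = "cQ (Q q)" and n = p, OF tow tow ql qm_cQ[OF mq mq dl] _ x])
  fix h v assume h: "h :[H]" and v: "v :[TQ (Q (Suc q)) 0]"
  show "?\<delta> 0 q (aQ (Q (Suc q)) (ac (Suc q)) h v) = aQ (Q q) (ac q) h (?\<delta> 0 q v)"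
   by (rule TQ_eqI[OF mq module_TQ[OF mq] lin_comp[OF bilinear_right[OF aQ_bilinear[OF lm] h] ql] lin_comp[OF ql bilinear_right[OF aQ_bilinear[OF lm] h]] _ v])
    (use h dc actQ_closed[OF lm] in "simp add: aQ_gen[OF lm] qg da")
 qed
 have dd: "?\<delta> p q (?\<delta> p (Suc q) x) = \<zero>[?A p q]" if x: "x :[?A p (Suc (Suc q))]" for p q x
 proof (rule TQ_eqI[OF mq module_TQ[OF mq] lin_comp[OF ql ql] lin_const_zero[OF module_TQ[OF mq]] _ x])
  fix t y assume ty: "t :[T p]" "y :[Q (Suc (Suc q))]"
  show "?\<delta> p q (?\<delta> p (Suc q) (gen (Q (Suc (Suc q))) p t y)) = \<zero>[?A p q]"
   using ty dc[OF ty(2)] lin_zero[OF bilinear_right[OF gen_bilinear[OF mq] ty(1)] mq module_TQ[OF mq]] by (simp add: qg dd0)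
 qed
 define \<alpha> where "\<alpha> p = ext (Q 0) p (T p) (%t q. aug q *[T p] t)" for p
 have \<alpha>i: "bilinear R (T p) (Q 0) (T p) (%t q. aug q *[T p] t)" for p
 proof (rule bilinearI)
  interpret Tp: module R "T p" by simp
  show "(%q. aug q *[T p] t) \<in> lin R (Q 0) (T p)" if "t :[T p]" for t
   using that augc lin_add[OF al] lin_smult[OF al] by (intro linear_mapsI) (auto simp: Tp.smult_l_distr Tp.smult_assoc1)
  show "(%t. aug q *[T p] t) \<in> lin R (T p) (T p)" if "q :[Q 0]" for q
   by (rule linear_map_smult[OF lin_id module_T augc[OF that]])
 qed
 have \<alpha>l: "\<alpha> p \<in> lin R (TQ (Q 0) p) (T p)" for p unfolding \<alpha>_def by (rule ext_linear[OF mq module_T \<alpha>i])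
 have \<alpha>g: "\<alpha> p (gen (Q 0) p t q) = aug q *[T p] t" if "t :[T p]" "q :[Q 0]" for p t q
  unfolding \<alpha>_def by (rule ext_gen[OF mq module_T \<alpha>i that])
 \<comment> \<open>An element of augmentation 1; tensoring with it shows that
   \<open>\<alpha>\<close> is surjective.\<close>
 have "\<one>[R] \<in> aug ` carrier (Q 0)" unfolding res.aug_surj by simp
 then obtain q1 where q1': "\<one>[R] = aug q1" "q1 :[Q 0]" by (rule imageE)
 note q1 = q1'(2) q1'(1)[symmetric]
 have \<alpha>bd: "\<alpha> p (?\<eta> p 0 x) = T.bd p (\<alpha> (Suc p) x)" if x: "x :[TQ (Q 0) (Suc p)]" for p x
 proof (rule bar_tower_map[where f = \<alpha> and V = "TQ (Q 0)" and V' = T and c = "cQ (Q 0)" and c' = tc and n = p, OF tow T.bar_tower_axioms \<alpha>l _ _ x])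
  fix n h v assume h: "h :[H]" and v: "v :[TQ (Q 0) n]"
  show "\<alpha> (Suc n) (cQ (Q 0) n h v) = tc n h (\<alpha> n v)"
   by (rule TQ_eqI[OF mq module_T lin_comp[OF bilinear_right[OF cQ_bilinear[OF mq] h] \<alpha>l] lin_comp[OF \<alpha>l bilinear_right[OF tc_bilinear h]] _ v])
    (use h in "simp add: cQ_gen[OF mq] \<alpha>g augc lin_smult[OF bilinear_right[OF tc_bilinear h]]")
 next
  fix h v assume h: "h :[H]" and v: "v :[TQ (Q 0) 0]"
  interpret T0: module R "T 0" by simp
  show "\<alpha> 0 (aQ (Q 0) (ac 0) h v) = \<epsilon> h *[T 0] \<alpha> 0 v"
   by (rule TQ_eqI[OF mq module_T lin_comp[OF bilinear_right[OF aQ_bilinear[OF lm] h] \<alpha>l] linear_map_smult[OF \<alpha>l module_T eps_closed[OF h]] _ v])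
    (use h actQ_closed[OF lm] in "simp add: aQ_gen[OF lm] \<alpha>g augc aa T0.smult_assoc1")
 qed
 \<comment> \<open>The hypothesis \<open>ex0\<close> concerns \<open>T p \<otimes> k\<close>,
   whereas \<open>\<alpha>\<close> takes values in \<open>T p\<close>. The map from the latter to
   the former given by tensoring with 1 transfers the vanishing.\<close>
 have aug_qm: "qm (Q 0) k p aug x = gen k p (\<alpha> p x) \<one>[R]" if x: "x :[TQ (Q 0) p]" for p x
 proof -
  have one: "\<one>[R] :[k]" by simp
  show ?thesis
  proof (rule TQ_eqI[OF mq module_TQ[OF module_k] qm_linear[OF mq module_k al] lin_comp[OF \<alpha>l bilinear_left[OF gen_bilinear[OF module_k] one]] _ x])
   fix t q assume t: "t :[T p]" and q: "q :[Q 0]"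
   show "qm (Q 0) k p aug (gen (Q 0) p t q) = gen k p (\<alpha> p (gen (Q 0) p t q)) \<one>[R]"
    using lin_smult[OF bilinear_left[OF gen_bilinear[OF module_k] one] augc[OF q] t]
     lin_smult[OF bilinear_right[OF gen_bilinear[OF module_k] t] augc[OF q] one] augc[OF q]
    by (simp add: qm_gen[OF mq module_k al t q] \<alpha>g[OF t q])
  qed
 qed
 have row: "row_resolution R ?A ?\<eta> ?\<delta> T T.bd \<alpha>"
 proof (intro row_resolution.intro module_TQ mq module_T bdl ql \<alpha>l bd0 \<alpha>bd)
  show "?\<eta> p q (?\<delta> (Suc p) q x) = ?\<delta> p q (?\<eta> p (Suc q) x)" if "x :[?A (Suc p) (Suc q)]" for p q x
   using comm[OF that] by simp
  show "\<exists>x\<in>carrier (?A p 0). \<alpha> p x = y" if y: "y :[T p]" for p y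
  proof -
   interpret Tp: module R "T p" by simp
   show ?thesis using \<alpha>g[OF y q1(1)] q1 y gen_closed[OF mq y q1(1)] by (intro bexI[of _ "gen (Q 0) p y q1"]) auto
  qed
  show "\<alpha> p (?\<delta> p 0 x) = \<zero>[T p]" if x: "x :[?A p (Suc 0)]" for p x
  proof (rule TQ_eqI[OF mq module_T lin_comp[OF ql \<alpha>l] lin_const_zero[OF module_T] _ x])
   interpret Tp: module R "T p" by simp
   show "\<alpha> p (?\<delta> p 0 (gen (Q (Suc 0)) p t q)) = \<zero>[T p]" if "t :[T p]" "q :[Q (Suc 0)]" for t q
    using that dc[OF that(2)] ad0[OF that(2)] by (simp add: qg \<alpha>g)
  qed
  show "\<exists>y\<in>carrier (?A p (Suc 0)). x = ?\<delta> p 0 y" if x: "x :[?A p 0]" "\<alpha> p x = \<zero>[T p]" for p x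
  proof -
   have "qm (Q 0) k p aug x = \<zero>[TQ k p]"
    unfolding aug_qm[OF x(1)] x(2)
    by (rule lin_zero[OF bilinear_left[OF gen_bilinear[OF module_k]] module_T module_TQ[OF module_k]]) simp
   then show ?thesis using ex0 x(1) unfolding tensor_exact_def by blast
  qed
  show "\<exists>y\<in>carrier (?A p (Suc (Suc q))). x = ?\<delta> p (Suc q) y" if "x :[?A p (Suc q)]" "?\<delta> p q x = \<zero>[?A p q]" for p q x
   using exS[of q] that unfolding tensor_exact_def by blast
 qed
 let ?C = "%q. tH (Q q) (ac q)"
 \<comment> \<open>Literally the differential that occurs in \<open>tor\<close>, so that the
   conclusions follow by unfolding definitions.\<close>
 define e where "e q = linear_extension R (?C (Suc q)) (?C q) (carrier k \<times> carrier (Q (Suc q)))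
  (tensor_H_gen R H k (trivial_right_action R \<epsilon>) (Q (Suc q)) (ac (Suc q))) (%(a, x). gH (Q q) (ac q) a (d q x))" for q
 have e: "e q \<in> lin R (?C (Suc q)) (?C q) \<and>
   (\<forall>r\<in>carrier R. \<forall>x\<in>carrier (Q (Suc q)). e q (gH (Q (Suc q)) (ac (Suc q)) r x) = gH (Q q) (ac q) r (d q x))" for q
 proof -
  have "\<exists>g. g \<in> lin R (?C (Suc q)) (?C q) \<and>
    (\<forall>r\<in>carrier R. \<forall>x\<in>carrier (Q (Suc q)). g (gH (Q (Suc q)) (ac (Suc q)) r x) = gH (Q q) (ac q) r (d q x))"
   by (rule tH_lift[OF lm module_tH[OF lm] bilinear_precomp[OF gH_bilinear[OF lm] lin_id dl]])
    (simp add: da gH_balanced[OF lm] dc)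
  then obtain g where g: "g \<in> lin R (?C (Suc q)) (?C q)"
   "\<forall>r\<in>carrier R. \<forall>x\<in>carrier (Q (Suc q)). g (gH (Q (Suc q)) (ac (Suc q)) r x) = gH (Q q) (ac q) r (d q x)" by blast
  have eg: "e q = restrict g (carrier (?C (Suc q)))"
   unfolding e_def by (rule linear_extension_eq[OF module_tH[OF lm] module_tH[OF lm] tH_generates[OF lm] g(1)]) (use g(2) in auto)
  have gc: "gH (Q (Suc q)) (ac (Suc q)) r x :[?C (Suc q)]" if "r :[R]" "x :[Q (Suc q)]" for r x
   by (rule bilinear_closed[OF gH_bilinear[OF lm]]) (use that in auto)
  have "e q \<in> lin R (?C (Suc q)) (?C q)" by (rule lin_cong[OF g(1) module_tH[OF lm]]) (simp add: eg)
  then show ?thesis using g(2) gc by (simp add: eg)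
 qed
 have el: "e q \<in> lin R (?C (Suc q)) (?C q)" for q using e by blast
 have \<gamma>e: "\<gamma> (Q q) (ac q) (?\<delta> 0 q x) = e q (\<gamma> (Q (Suc q)) (ac (Suc q)) x)" if x: "x :[?A 0 (Suc q)]" for q x
  by (rule TQ_eqI[OF mq module_tH[OF lm] lin_comp[OF ql \<gamma>_linear[OF lm]] lin_comp[OF \<gamma>_linear[OF lm] el] _ x])
   (use e in "simp add: qg \<gamma>_gen[OF lm] dc")
 have col: "row_resolution R (%p q. ?A q p) (%p q. ?\<delta> q p) (%p q. ?\<eta> q p) ?C e (%q. \<gamma> (Q q) (ac q))"
 proof (intro row_resolution.intro module_TQ mq module_tH lm bdl ql \<gamma>_linear dd comm \<gamma>e \<gamma>_surj \<gamma>_bd)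
  show "\<exists>y\<in>carrier (?A (Suc 0) p). x = ?\<eta> 0 p y" if "x :[?A 0 p]" "\<gamma> (Q p) (ac p) x = \<zero>[?C p]" for p x
   by (rule \<gamma>_exact[OF lm that])
  show "\<exists>y\<in>carrier (?A (Suc (Suc q)) p). x = ?\<eta> (Suc q) p y" if "x :[?A (Suc q) p]" "?\<eta> q p x = \<zero>[?A q p]" for p q x
  proof -
   obtain \<sigma> where "bar_section (Q p) (ac p) \<sigma>" using sec by blast
   then show ?thesis by (rule Q_exact[OF lm _ that])
  qed
 qed
 have C: "chain_complex R ?C e"
 proof (intro chain_complex.intro module_tH lm el)
  fix q x assume "x :[?C (Suc (Suc q))]"
  then obtain y where y: "y :[?A 0 (Suc (Suc q))]" "\<gamma> (Q (Suc (Suc q))) (ac (Suc (Suc q))) y = x" using \<gamma>_surj[OF lm] by blast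
  show "e q (e (Suc q) x) = \<zero>[?C q]"
   using \<gamma>e[OF y(1)] \<gamma>e[OF lin_closed[OF ql y(1)]] dd[OF y(1)] y(2) lin_zero[OF \<gamma>_linear[OF lm] module_TQ[OF mq] module_tH[OF lm]] by simp
 qed
 show "module R (hopf_homology R H \<epsilon> Q ac d i)"
  using module_chain_homology[OF C is_cring, of i] unfolding hopf_homology_def tor_def e_def .
 have "isomorphic_modules R (chain_homology T T.bd i) (chain_homology ?C e i)"
 proof (cases "i < 0")
  case True
  then show ?thesis by (rule isomorphic_chain_homology_negative)
 next
  case False
  then show ?thesis using double_complex_homology[where A = ?A and \<eta> = ?\<eta> and \<delta> = ?\<delta> and B = T and e = T.bd and \<alpha> = \<alpha> and C = ?C and e' = e
    and \<gamma> = "%q. \<gamma> (Q q) (ac q)" and n = "nat i", OF row col chain_complex_bar C] by simp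
 qed
 then show "isomorphic_modules R (chain_homology T T.bd i) (hopf_homology R H \<epsilon> Q ac d i)"
  unfolding hopf_homology_def tor_def e_def .
qed

end

section \<open>Conclusion\<close>

theorem (in cocommutative_hopf_algebra) hopf_cyclic_homology_direct_sum:
 "isomorphic_modules R (cyclic_homology CX n) (direct_sum UNIV (%i. chain_homology T T.bd (int n - 2 * int i)))"
proof -
 have X: "split_precyclic R CX phibar sg"
 proof (rule split_precyclic.intro[OF precyclic_CX], rule split_precyclic_axioms.intro, unfold CX_obj)
  show "phibar p q \<in> lin R (T q) (T (q + p))" for p q by (rule phibar_linear)
  show "sg n \<in> lin R (T n) (T (Suc n))" for n by (rule sg_linear)
  show "phibar 0 q x = x" if "x :[T q]" for x q by (rule phibar_0[OF that])
  show "hochschild_b CX p (phibar (Suc p) 0 x) = phibar p 0 (horizontal CX p 0 x)" if "x :[T 0]" for x p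
   by (rule b_phibar_0[OF that])
  show "hochschild_b CX (Suc (q + p)) (phibar (Suc p) (Suc q) x) =
    phibar (Suc p) q (vertical CX (Suc p) q x) +[T (Suc (q + p))] phibar p (Suc q) (horizontal CX p (Suc q) x)"
   if "x :[T (Suc q)]" for x p q
   by (rule b_phibar_Suc[OF that])
  show "hochschild_b' CX 0 (sg 0 x) = x" if "x :[T 0]" for x by (rule b'_sg_0[OF that])
  show "hochschild_b' CX (Suc n) (sg (Suc n) x) +[T (Suc n)] sg n (hochschild_b' CX n x) = x"
   if "x :[T (Suc n)]" for x n by (rule b'_sg_Suc[OF that])
 qed
 \<comment> \<open>The two differentials agree on the carriers only, but cycles and boundaries see
   nothing else.\<close>
 have b: "chain_homology T (hochschild_b CX) i = chain_homology T T.bd i" for i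
 proof -
  have "cycles T (hochschild_b CX) n = cycles T T.bd n" for n
   by (cases n) (auto simp: cycles_def a_kernel_def' hochschild_b_CX)
  moreover have "hochschild_b CX n ` carrier (T (Suc n)) = T.bd n ` carrier (T (Suc n))" for n
   by (rule image_cong) (simp_all add: hochschild_b_CX)
  ultimately show ?thesis by (simp add: chain_homology_def)
 qed
 show ?thesis using split_precyclic.cyclic_homology_direct_sum[OF X, of n] unfolding CX_obj b .
qed

theorem theorem4p1:
  fixes R :: "('k, 'r) ring_scheme" and H :: "('k, 'h, 'm) module_scheme"
    and \<Delta> :: "'h \<Rightarrow> ('h list \<Rightarrow> 'k) set" and \<epsilon> :: "'h \<Rightarrow> 'k" and S :: "'h \<Rightarrow> 'h"
    and Q :: "nat \<Rightarrow> ('k, 'q) module" and act :: "nat \<Rightarrow> 'h \<Rightarrow> 'q \<Rightarrow> 'q"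
    and d :: "nat \<Rightarrow> 'q \<Rightarrow> 'q" and aug :: "'q \<Rightarrow> 'k" and n :: nat
  assumes "hopf_algebra R H \<Delta> \<epsilon> S"
    and "cocommutative R H \<Delta>"
    and "tor_resolution R H (self_module R) (trivial_left_action R \<epsilon>) Q act d aug"
  shows "isomorphic_modules R
    (cyclic_homology (hopf_cyclic_module R H \<Delta> \<epsilon> S) n)
    (direct_sum (UNIV :: nat set) (\<lambda>i. hopf_homology R H \<epsilon> Q act d (int n - 2 * int i)))"
proof -
 interpret cocommutative_hopf_algebra R H \<Delta> \<epsilon> S
  using assms(1,2) by (simp add: cocommutative_hopf_algebra_def cocommutative_hopf_algebra_axioms_def)
 have res: "left_resolution R H k (trivial_left_action R \<epsilon>) Q act d aug"
  and alt: "flat_module R H \<and> (\<forall>n. projective_left_module R H (Q n) (act n)) \<or>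
   k_split R k Q d aug \<and> (\<forall>n. relatively_projective R H (Q n) (act n))"
  using assms(3) by (simp_all add: tor_resolution_def)
 interpret res: left_resolution R H k "trivial_left_action R \<epsilon>" Q act d aug by (rule res)
 have lm: "left_module R H (Q q) (act q)" for q by (rule res.left_modules)
 note mq = mQ[OF lm]
 have dl: "d q \<in> lin R (Q (Suc q)) (Q q)" for q using res.diff_linear[of q] by (simp add: H_linear_maps_def)
 have al: "aug \<in> lin R (Q 0) k" using res.aug_linear by (simp add: H_linear_maps_def)
 have sec: "\<exists>\<sigma>. bar_section (Q q) (act q) \<sigma>" for q
  using alt projective_section[OF lm] relatively_projective_section[OF lm] by blast
 \<comment> \<open>Exactness survives tensoring with the tensor powers for two different reasons:
   flatness of \<open>H\<close> in the first case, the linear contraction in the second.\<close>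
 have "tensor_exact (Q (Suc 0)) (d 0) (Q 0) aug k \<and> (\<forall>q. tensor_exact (Q (Suc (Suc q))) (d (Suc q)) (Q (Suc q)) (d q) (Q q))"
  using alt
 proof
  assume "flat_module R H \<and> (\<forall>n. projective_left_module R H (Q n) (act n))"
  then have flat: "flat_module R H" by simp
  have "tensor_exact (Q (Suc 0)) (d 0) (Q 0) aug k"
   by (rule flat_tensor_exact[OF mq mq module_k dl al flat]) (use res.exact_zero in "simp add: a_kernel_def'")
  moreover have "tensor_exact (Q (Suc (Suc q))) (d (Suc q)) (Q (Suc q)) (d q) (Q q)" for q
   by (rule flat_tensor_exact[OF mq mq mq dl dl flat]) (use res.exact_Suc[of q] in "simp add: a_kernel_def'")
  ultimately show ?thesis by blast
 next
  assume "k_split R k Q d aug \<and> (\<forall>n. relatively_projective R H (Q n) (act n))"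
  then obtain s' s where s': "s' \<in> lin R k (Q 0)" and s: "(\<forall>n. s n \<in> lin R (Q n) (Q (Suc n))) \<and>
    (\<forall>x\<in>carrier k. aug (s' x) = x) \<and> (\<forall>x\<in>carrier (Q 0). d 0 (s 0 x) +[Q 0] s' (aug x) = x) \<and>
    (\<forall>n. \<forall>x\<in>carrier (Q (Suc n)). d (Suc n) (s (Suc n) x) +[Q (Suc n)] s n (d n x) = x)"
   unfolding k_split_def by blast
  have sl: "s n \<in> lin R (Q n) (Q (Suc n))" for n using s by simp
  have "tensor_exact (Q (Suc 0)) (d 0) (Q 0) aug k"
   by (rule split_tensor_exact[OF mq mq module_k dl al sl s']) (use s in simp)
  moreover have "tensor_exact (Q (Suc (Suc q))) (d (Suc q)) (Q (Suc q)) (d q) (Q q)" for q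
   by (rule split_tensor_exact[OF mq mq mq dl dl sl sl]) (use s in simp)
  ultimately show ?thesis by blast
 qed
 then have "isomorphic_modules R (chain_homology T T.bd i) (hopf_homology R H \<epsilon> Q act d i) \<and> module R (hopf_homology R H \<epsilon> Q act d i)" for i
  using tensor_resolution_homology[OF res sec] by blast
 then have "isomorphic_modules R (direct_sum UNIV (%i. chain_homology T T.bd (int n - 2 * int i)))
   (direct_sum UNIV (%i. hopf_homology R H \<epsilon> Q act d (int n - 2 * int i)))"
  by (intro direct_sum_isomorphic module_chain_homology[OF chain_complex_bar is_cring]) auto
 then show ?thesis by (rule isomorphic_modules_trans[OF hopf_cyclic_homology_direct_sum])
qed

end
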